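(* Under the assumptions of the context, one has $\mathscr{D}(\mathcal{Z})\subset\mathscr{D}(\mathcal{G})$. Let $\widehat{\mathfrak{B}}$, with domain $\mathscr{D}(\widehat{\mathfrak{B}})=\mathscr{D}(\mathcal{Z})$, be defined by $$\widehat{\mathfrak{B}}f=\mathcal{G}f-\mathcal{Z}f\qquad\forall f\in\mathscr{D}(\mathcal{Z}).$$ Then $\widehat{\mathfrak{B}}$ is $\mathcal{Z}$-bounded and, for any $f\in\mathscr{D}(\mathcal{Z})$, $$\widehat{\mathfrak{B}}f=\lim_{\lambda\to\infty}\lambda\,\mathfrak{B}_\lambda f\quad\text{in }\mathfrak{X}.$$ In particular, $\widehat{\mathfrak{B}}f\in\mathfrak{X}_+$ for any $f\in\mathscr{D}(\mathcal{Z})\cap\mathfrak{X}_+$, and $$\langle\mathbf{\Psi},(\mathcal{Z}+\widehat{\mathfrak{B}})f\rangle_{\mathfrak{X}}\le 0\qquad\forall f\in\mathscr{D}(\mathcal{Z})\cap\mathfrak{X}_+.$$ Finally, the following Duhamel identity holds: $$\mathcal{T}(t)f=\mathcal{T}_0(t)f+\int_0^t\mathcal{T}(t-s)\widehat{\mathfrak{B}}\mathcal{T}_0(s)f\,\mathrm{d}s\qquad\forall f\in\mathscr{D}(\mathcal{Z}),\ t\ge 0.$$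
   Context: $\mathcal{E}$ is a real ordered Banach space with (closed) positive cone $\mathcal{E}_+$ that is generating, $\mathcal{E}=\mathcal{E}_+-\mathcal{E}_+$, and on which the norm is additive: $\|u+v\|=\|u\|+\|v\|$ for $u,v\in\mathcal{E}_+$. An evolution family in $\mathcal{E}$ is a family $(\mathbf{U}(t,s))_{t\ge s\ge 0}$ of bounded linear operators on $\mathcal{E}$ such that (a) for each $u\in\mathcal{E}$ the map $(t,s)\mapsto\mathbf{U}(t,s)u$ is continuous on $t\ge s\ge 0$; (b) $\mathbf{U}(t,s)=\mathbf{U}(t,r)\mathbf{U}(r,s)$ and $\mathbf{U}(t,t)=\mathbf{I}$ for $t\ge r\ge s$; (c) $\|\mathbf{U}(t,s)\|\le Ce^{\beta(t-s)}$ for $t\ge s$, for some constants $C,\beta>0$. Standing assumptions: $(\mathbf{U}(t,s))_{t\ge s\ge0}$ is a given evolution family in $\mathcal{E}$ and $(\mathbf{B}(t))_{t\ge 0}$ is a family of (possibly unbounded) linear operators $\mathbf{B}(t):\mathscr{D}(\mathbf{B}(t))\subset\mathcal{E}\to\mathcal{E}$ such that: (i) $\mathbf{U}(t,s)u\in\mathcal{E}_+$ for $u\in\mathcal{E}_+$, $t\ge s\ge 0$; (ii) $\|\mathbf{U}(t,s)u\|_{\mathcal{E}}\le\|u\|_{\mathcal{E}}$ for $u\in\mathcal{E}_+$, $t\ge s\ge 0$; (iii) $\mathbf{B}(t)u\in\mathcal{E}_+$ for $u\in\mathscr{D}(\mathbf{B}(t))\cap\mathcal{E}_+$, $t\ge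 0$; (iv) for any $u\in\mathcal{E}$ and $s\ge 0$, $\mathbf{U}(t,s)u\in\mathscr{D}(\mathbf{B}(t))$ for a.e. $t\ge s$ and the mapping $t\in[s,\infty)\mapsto\mathbf{B}(t)\mathbf{U}(t,s)u$ is measurable; moreover, for any $t\ge s\ge 0$ and $u\in\mathcal{E}_+$, $\int_s^t\|\mathbf{B}(\tau)\mathbf{U}(\tau,s)u\|_{\mathcal{E}}\,\mathrm{d}\tau\le\|u\|_{\mathcal{E}}-\|\mathbf{U}(t,s)u\|_{\mathcal{E}}$. Let $\Delta=\{(t,s):0\le s\le t<\infty\}$ and $\mathfrak{X}=L^1(\mathbb{R}_+,\mathcal{E})$ with norm $\|f\|_{\mathfrak{X}}=\int_0^\infty\|f(s)\|_{\mathcal{E}}\,\mathrm{d}s$ and positive cone $\mathfrak{X}_+=\{f\in\mathfrak{X}: f(s)\in\mathcal{E}_+\text{ for a.e. }s\}$. It is further assumed that: (v) for any $f\in\mathfrak{X}$ the mapping $(t,s)\in\Delta\mapsto\mathbf{B}(t)\mathbf{U}(t,s)f(s)\in\mathcal{E}$ is well-defined for almost every $(t,s)\in\Delta$ and is measurable. Set $\mathbf{V}_0(t,s)=\mathbf{U}(t,s)$, $\mathbf{V}_{n+1}(t,s)u=\int_s^t\mathbf{V}_n(t,r)\mathbf{B}(r)\mathbf{U}(r,s)u\,\mathrm{d}r$, and $\mathbf{V}(t,s)u=\sum_{n=0}^\infty\mathbf{V}_n(t,s)u$ for $t\ge s\ge 0$, $u\in\mathcal{E}$. Under (i)–(iv)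 the $\mathbf{V}_n(t,s)$ are bounded positive operators, the series converges, and $(\mathbf{V}(t,s))_{t\ge s\ge 0}$ is an evolution family with $\|\mathbf{V}(t,s)u\|\le\|u\|$ for $u\in\mathcal{E}_+$. $\mathbf{\Psi}$ is the positive bounded linear functional on $\mathfrak{X}$ with $\langle\mathbf{\Psi},f\rangle_{\mathfrak{X}}=\|f\|_{\mathfrak{X}}$ for $f\in\mathfrak{X}_+$. $(\mathcal{T}_0(t))_{t\ge0}$ is the $C_0$-semigroup on $\mathfrak{X}$ given by $[\mathcal{T}_0(t)f](s)=\mathbf{U}(s,s-t)f(s-t)$ if $s\ge t$ and $0$ if $0\le s<t$; its generator is $(\mathcal{Z},\mathscr{D}(\mathcal{Z}))$. $(\mathcal{T}(t))_{t\ge0}$ is the $C_0$-semigroup on $\mathfrak{X}$ given by $[\mathcal{T}(t)f](s)=\mathbf{V}(s,s-t)f(s-t)$ if $s\ge t$ and $0$ if $0\le s<t$; its generator is $(\mathcal{G},\mathscr{D}(\mathcal{G}))$. For $\lambda>0$ and $f\in\mathfrak{X}$, $[\mathfrak{B}_\lambda f](s)=\int_0^s e^{-\lambda(s-\tau)}\mathbf{B}(s)\mathbf{U}(s,\tau)f(\tau)\,\mathrm{d}\tau$ for a.e. $s\ge 0$; $\mathfrak{B}_\lambda$ is a bounded operator on $\mathfrak{X}$. $\mathcal{Z}$-bounded means $\|\widehat{\mathfrak{B}}f\|\le a\|f\|+b\|\mathcal{Z}f\|$ on $\mathscr{D}(\mathcal{Z})$ for some $a,b\ge 0$. *)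

theory Defs
  imports "HOL-Analysis.Analysis"
begin

section \<open>Bochner integration in arbitrary Banach spaces\<close>

text \<open>
  The library predicates \<^term>\<open>has_bochner_integral\<close> and \<^term>\<open>integrable\<close> are restricted to
  second countable (separable) codomains. The definitions below have no such restriction: a function
  is measurable in the sense of Bochner if it is an almost everywhere limit of simple functions.
  They are only used with complete measures. They are insensitive to the values of the function on
  null sets, so they apply to functions that are only defined almost everywhere.
\<close>

definition strongly_measurable :: "'x measure \<Rightarrow> ('x \<Rightarrow> 'b::real_normed_vector) \<Rightarrow> bool" where
  "strongly_measurable M f \<longleftrightarrow>
     (\<exists>\<phi>. (\<forall>i. simple_function M (\<phi> i)) \<and> (AE x in M. (\<lambda>i. \<phi> i x) \<longlonglongrightarrow> f x))"

definition strongly_integrable :: "'x measure \<Rightarrow> ('x \<Rightarrow> 'b::real_normed_vector) \<Rightarrow> bool" where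
  "strongly_integrable M f \<longleftrightarrow>
     strongly_measurable M f \<and> (\<integral>\<^sup>+x. ennreal (norm (f x)) \<partial>M) < \<infinity>"

definition strong_integral :: "'x measure \<Rightarrow> ('x \<Rightarrow> 'b::real_normed_vector) \<Rightarrow> 'b" where
  "strong_integral M f =
     (if strongly_integrable M f
      then THE I. \<exists>\<phi>. (\<forall>i. Bochner_Integration.simple_bochner_integrable M (\<phi> i)) \<and>
                      (\<lambda>i. \<integral>\<^sup>+x. ennreal (norm (f x - \<phi> i x)) \<partial>M) \<longlonglongrightarrow> 0 \<and>
                      (\<lambda>i. Bochner_Integration.simple_bochner_integral M (\<phi> i)) \<longlonglongrightarrow> I
      else 0)"

text \<open>For separable codomains the strong notions agree with those of the library.\<close>

lemma integrable_imp_strongly_integrable: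
  fixes f :: "'x \<Rightarrow> 'b::{banach, second_countable_topology}"
  assumes "integrable M f"
  shows "strongly_integrable M f"
proof -
  from borel_measurable_implies_sequence_metric[OF borel_measurable_integrable[OF assms], of 0]
  obtain \<phi> where "\<forall>i. simple_function M (\<phi> i)" "\<forall>x\<in>space M. (\<lambda>i. \<phi> i x) \<longlonglongrightarrow> f x"
    by blast
  then have "strongly_measurable M f"
    unfolding strongly_measurable_def by (intro exI[of _ \<phi>]) auto
  moreover have "(\<integral>\<^sup>+x. ennreal (norm (f x)) \<partial>M) < \<infinity>"
    using assms by (simp add: integrable_iff_bounded)
  ultimately show ?thesis
    by (simp add: strongly_integrable_def)
qed

lemma strong_integral_eq_lebesgue_integral:
  fixes f :: "'x \<Rightarrow> 'b::{banach, second_countable_topology}"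
  assumes "integrable M f"
  shows "strong_integral M f = integral\<^sup>L M f"
proof -
  have f: "f \<in> borel_measurable M"
    using assms by (rule borel_measurable_integrable)
  have "(\<exists>\<phi>. (\<forall>i. Bochner_Integration.simple_bochner_integrable M (\<phi> i)) \<and>
          (\<lambda>i. \<integral>\<^sup>+x. ennreal (norm (f x - \<phi> i x)) \<partial>M) \<longlonglongrightarrow> 0 \<and>
          (\<lambda>i. Bochner_Integration.simple_bochner_integral M (\<phi> i)) \<longlonglongrightarrow> I) \<longleftrightarrow>
        has_bochner_integral M f I" for I
    using f by (auto simp: has_bochner_integral.simps)
  then have "strong_integral M f = (THE I. has_bochner_integral M f I)"
    by (simp add: strong_integral_def integrable_imp_strongly_integrable[OF assms])
  also have "\<dots> = integral\<^sup>L M f"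
    using has_bochner_integral_integrable[OF assms]
    by (intro the_equality) (auto dest: has_bochner_integral_integral_eq)
  finally show ?thesis .
qed

lemma strongly_measurable_add:
  assumes "strongly_measurable M f" "strongly_measurable M g"
  shows "strongly_measurable M (\<lambda>x. f x + g x)"
proof -
  from assms obtain \<phi> \<psi> where
    "\<And>i. simple_function M (\<phi> i)" "AE x in M. (\<lambda>i. \<phi> i x) \<longlonglongrightarrow> f x"
    "\<And>i. simple_function M (\<psi> i)" "AE x in M. (\<lambda>i. \<psi> i x) \<longlonglongrightarrow> g x"
    unfolding strongly_measurable_def by blast
  then have "\<forall>i. simple_function M (\<lambda>x. \<phi> i x + \<psi> i x)"
    "AE x in M. (\<lambda>i. \<phi> i x + \<psi> i x) \<longlonglongrightarrow> f x + g x"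
    by (auto intro: tendsto_add simple_function_compose2)
  then show ?thesis
    unfolding strongly_measurable_def by (intro exI[of _ "\<lambda>i x. \<phi> i x + \<psi> i x"]) auto
qed

lemma strongly_measurable_scaleR:
  assumes "strongly_measurable M f"
  shows "strongly_measurable M (\<lambda>x. c *\<^sub>R f x)"
proof -
  from assms obtain \<phi> where
    "\<And>i. simple_function M (\<phi> i)" "AE x in M. (\<lambda>i. \<phi> i x) \<longlonglongrightarrow> f x"
    unfolding strongly_measurable_def by blast
  then have "\<forall>i. simple_function M (\<lambda>x. c *\<^sub>R \<phi> i x)"
    "AE x in M. (\<lambda>i. c *\<^sub>R \<phi> i x) \<longlonglongrightarrow> c *\<^sub>R f x"
    by (auto intro: simple_function_compose1 elim!: eventually_mono intro!: tendsto_scaleR tendsto_const)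
  then show ?thesis
    unfolding strongly_measurable_def by (intro exI[of _ "\<lambda>i x. c *\<^sub>R \<phi> i x"]) auto
qed

lemma strongly_measurable_0: "strongly_measurable M (\<lambda>x. 0)"
  unfolding strongly_measurable_def by (intro exI[of _ "\<lambda>i x. 0"]) auto

lemma complete_measure_restrict_space:
  assumes "complete_measure M" "S \<in> sets M"
  shows "complete_measure (restrict_space M S)"
proof
  fix A B assume "B \<subseteq> A" "A \<in> null_sets (restrict_space M S)"
  then have "A \<in> null_sets M" "A \<subseteq> S"
    using assms(2) by (auto simp: null_sets_restrict_space)
  then have "B \<in> sets M" "B \<subseteq> S"
    using complete_measure.complete[OF assms(1) \<open>B \<subseteq> A\<close>] \<open>B \<subseteq> A\<close> by auto
  then show "B \<in> sets (restrict_space M S)"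
    using assms(2) by (simp add: sets_restrict_space_iff)
qed

lemma strongly_measurable_norm:
  assumes "complete_measure M" "strongly_measurable M f"
  shows "(\<lambda>x. norm (f x)) \<in> borel_measurable M"
proof -
  from assms obtain \<phi> where \<phi>: "\<And>i. simple_function M (\<phi> i)" 
      and lim: "AE x in M. (\<lambda>i. \<phi> i x) \<longlonglongrightarrow> f x"
    unfolding strongly_measurable_def by blast
  define g where "g = (\<lambda>x. lim (\<lambda>i. norm (\<phi> i x)))"
  have "(\<lambda>x. norm (\<phi> i x)) \<in> borel_measurable M" for i
    using simple_function_compose1[OF \<phi>, of norm] by (rule borel_measurable_simple_function)
  then have g: "g \<in> borel_measurable M"
    unfolding g_def by (rule borel_measurable_lim_metric)
  have AE: "AE x in M. g x = norm (f x)"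
    using lim unfolding g_def by eventually_elim (auto intro: limI tendsto_norm)
  have "{x \<in> space M. norm (f x) \<in> A} \<in> sets M" if "A \<in> sets borel" for A
  proof (rule complete_measure.in_sets_AE[OF assms(1)])
    show "AE x in M. (x \<in> g -` A \<inter> space M) = (x \<in> {x \<in> space M. norm (f x) \<in> A})"
      using AE by eventually_elim auto
    show "g -` A \<inter> space M \<in> sets M"
      using g that by (rule measurable_sets)
  qed auto
  then show ?thesis
    by (auto simp: measurable_def vimage_def Int_def conj_commute)
qed

section \<open>The space \<open>L\<^sup>1\<close> on the half-line\<close>

abbreviation half_line :: "real measure" where
  "half_line \<equiv> lebesgue_on {0..}"

lemma complete_measure_half_line: "complete_measure half_line"
  by (rule complete_measure_restrict_space) (auto intro: completion.complete_measure_axioms)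

lemma strongly_integrable_norm:
  assumes "strongly_integrable half_line f"
  shows "integrable half_line (\<lambda>s. norm (f s))"
  using assms strongly_measurable_norm[OF complete_measure_half_line, of f]
  by (simp add: strongly_integrable_def integrable_iff_bounded)

lemma strongly_integrable_halfI:
  assumes "strongly_measurable half_line f" "integrable half_line h" 
    and "\<And>s. norm (f s) \<le> h s"
  shows "strongly_integrable half_line f"
proof -
  have "(\<integral>\<^sup>+s. ennreal (norm (f s)) \<partial>half_line) \<le> (\<integral>\<^sup>+s. ennreal (norm (h s)) \<partial>half_line)"
    using assms(3) by (intro nn_integral_mono ennreal_leI) (smt (verit) real_norm_def)
  also have "\<dots> < \<infinity>"
    using assms(2) by (simp add: integrable_iff_bounded)
  finally show ?thesis
    using assms(1) by (simp add: strongly_integrable_def)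
qed

lemma strongly_integrable_add:
  assumes "strongly_integrable half_line f" "strongly_integrable half_line g"
  shows "strongly_integrable half_line (\<lambda>s. f s + g s)"
proof (rule strongly_integrable_halfI)
  show "strongly_measurable half_line (\<lambda>s. f s + g s)"
    using assms by (intro strongly_measurable_add) (auto simp: strongly_integrable_def)
  show "integrable half_line (\<lambda>s. norm (f s) + norm (g s))"
    using assms by (intro Bochner_Integration.integrable_add strongly_integrable_norm)
qed (rule norm_triangle_ineq)

lemma strongly_integrable_scaleR:
  assumes "strongly_integrable half_line f"
  shows "strongly_integrable half_line (\<lambda>s. c *\<^sub>R f s)"
proof (rule strongly_integrable_halfI)
  show "strongly_measurable half_line (\<lambda>s. c *\<^sub>R f s)"
    using assms by (intro strongly_measurable_scaleR) (auto simp: strongly_integrable_def)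
  show "integrable half_line (\<lambda>s. \<bar>c\<bar> * norm (f s))"
    using assms by (intro integrable_mult_right strongly_integrable_norm)
qed simp

lemma strongly_integrable_0: "strongly_integrable half_line (\<lambda>s. 0)"
  by (simp add: strongly_integrable_def strongly_measurable_0)

definition L1_rel :: "(real \<Rightarrow> 'a::real_normed_vector) \<Rightarrow> (real \<Rightarrow> 'a) \<Rightarrow> bool" where
  "L1_rel f g \<longleftrightarrow> strongly_integrable half_line f \<and> strongly_integrable half_line g \<and>
     (AE s in half_line. f s = g s)"

quotient_type (overloaded) 'a L1 = "real \<Rightarrow> 'a::real_normed_vector" / partial: L1_rel
proof (rule part_equivpI)
  show "\<exists>f::real \<Rightarrow> 'a. L1_rel f f"
    by (intro exI[of _ "\<lambda>s. 0"]) (simp add: L1_rel_def strongly_integrable_0)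
  show "symp (L1_rel :: (real \<Rightarrow> 'a) \<Rightarrow> _)"
    by (auto intro!: sympI simp: L1_rel_def eq_commute)
  show "transp (L1_rel :: (real \<Rightarrow> 'a) \<Rightarrow> _)"
  proof (rule transpI)
    fix f g h :: "real \<Rightarrow> 'a" assume fg: "L1_rel f g" and gh: "L1_rel g h"
    have "AE s in half_line. f s = g s" "AE s in half_line. g s = h s"
      using fg gh by (auto simp: L1_rel_def)
    then have "AE s in half_line. f s = h s"
      by eventually_elim simp
    with fg gh show "L1_rel f h"
      by (simp add: L1_rel_def)
  qed
qed

instantiation L1 :: (real_normed_vector) real_normed_vector
begin

lift_definition zero_L1 :: "'a L1" is "\<lambda>s. 0"
  by (simp add: L1_rel_def strongly_integrable_0)

lift_definition plus_L1 :: "'a L1 \<Rightarrow> 'a L1 \<Rightarrow> 'a L1" is "\<lambda>f g s. f s + g s"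
  by (auto simp: L1_rel_def strongly_integrable_add)

lift_definition scaleR_L1 :: "real \<Rightarrow> 'a L1 \<Rightarrow> 'a L1" is "\<lambda>c f s. c *\<^sub>R f s"
  by (auto simp: L1_rel_def strongly_integrable_scaleR)

definition uminus_L1 :: "'a L1 \<Rightarrow> 'a L1" where
  "uminus_L1 f = (-1) *\<^sub>R f"

definition minus_L1 :: "'a L1 \<Rightarrow> 'a L1 \<Rightarrow> 'a L1" where
  "minus_L1 f g = f + (-1) *\<^sub>R g"

lift_definition norm_L1 :: "'a L1 \<Rightarrow> real" is "\<lambda>f. LINT s|half_line. norm (f s)"
proof -
  fix f g :: "real \<Rightarrow> 'a" assume fg: "L1_rel f g"
  then have "integrable half_line (\<lambda>s. norm (f s))" "integrable half_line (\<lambda>s. norm (g s))"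
    "AE s in half_line. norm (f s) = norm (g s)"
    by (auto simp: L1_rel_def strongly_integrable_norm)
  then show "(LINT s|half_line. norm (f s)) = (LINT s|half_line. norm (g s))"
    by (intro integral_cong_AE borel_measurable_integrable)
qed

definition dist_L1 :: "'a L1 \<Rightarrow> 'a L1 \<Rightarrow> real" where
  "dist_L1 f g = norm (f - g)"

definition sgn_L1 :: "'a L1 \<Rightarrow> 'a L1" where
  "sgn_L1 f = inverse (norm f) *\<^sub>R f"

definition uniformity_L1 :: "('a L1 \<times> 'a L1) filter" where
  "uniformity_L1 = (INF e\<in>{0<..}. principal {(f, g). dist f g < e})"

definition open_L1 :: "'a L1 set \<Rightarrow> bool" where
  "open_L1 S = (\<forall>f\<in>S. \<forall>\<^sub>F (f', g) in uniformity. f' = f \<longrightarrow> g \<in> S)"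

instance
proof
  fix f g h :: "'a L1" and c d :: real
  show "f + g + h = f + (g + h)"
    by transfer (simp add: L1_rel_def strongly_integrable_add add.assoc)
  show "f + g = g + f"
    by transfer (simp add: L1_rel_def strongly_integrable_add add.commute)
  show "0 + f = f"
    by transfer (simp add: L1_rel_def)
  show "- f + f = 0"
    unfolding uminus_L1_def
    by transfer (simp add: L1_rel_def strongly_integrable_0)
  show "f - g = f + - g"
    by (simp add: uminus_L1_def minus_L1_def)
  show "c *\<^sub>R (f + g) = c *\<^sub>R f + c *\<^sub>R g"
    by transfer
       (simp add: L1_rel_def strongly_integrable_add strongly_integrable_scaleR scaleR_add_right)
  show "(c + d) *\<^sub>R f = c *\<^sub>R f + d *\<^sub>R f"
    by transfer
       (simp add: L1_rel_def strongly_integrable_add strongly_integrable_scaleR scaleR_add_left)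
  show "c *\<^sub>R d *\<^sub>R f = (c * d) *\<^sub>R f"
    by transfer (simp add: L1_rel_def strongly_integrable_scaleR)
  show "1 *\<^sub>R f = f"
    by transfer (simp add: L1_rel_def)
  show "dist f g = norm (f - g)"
    by (rule dist_L1_def)
  show "sgn f = inverse (norm f) *\<^sub>R f"
    by (rule sgn_L1_def)
  show "uniformity = (INF e\<in>{0<..}. principal {(f :: 'a L1, g). dist f g < e})"
    by (rule uniformity_L1_def)
  show "open S = (\<forall>f\<in>S. \<forall>\<^sub>F (f', g) in uniformity. f' = f \<longrightarrow> g \<in> S)" for S :: "'a L1 set"
    by (rule open_L1_def)
  show "norm f = 0 \<longleftrightarrow> f = 0"
  proof transfer
    fix f :: "real \<Rightarrow> 'a" assume "L1_rel f f"
    then have f: "strongly_integrable half_line f"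
      by (simp add: L1_rel_def)
    from integral_nonneg_eq_0_iff_AE[OF strongly_integrable_norm[OF f]] f
    show "((LINT s|half_line. norm (f s)) = 0) = L1_rel f (\<lambda>s. 0)"
      by (simp add: L1_rel_def strongly_integrable_0)
  qed
  show "norm (f + g) \<le> norm f + norm g"
  proof transfer
    fix f g :: "real \<Rightarrow> 'a" assume "L1_rel f f" "L1_rel g g"
    then have fg: "strongly_integrable half_line f" "strongly_integrable half_line g"
      by (auto simp: L1_rel_def)
    have "(LINT s|half_line. norm (f s + g s)) \<le> (LINT s|half_line. norm (f s) + norm (g s))"
      using fg
      by (intro integral_mono Bochner_Integration.integrable_add strongly_integrable_norm strongly_integrable_add
            norm_triangle_ineq)
    also have "\<dots> = (LINT s|half_line. norm (f s)) + (LINT s|half_line. norm (g s))"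
      using fg by (intro Bochner_Integration.integral_add strongly_integrable_norm)
    finally show "(LINT s|half_line. norm (f s + g s)) \<le>
      (LINT s|half_line. norm (f s)) + (LINT s|half_line. norm (g s))" .
  qed
  show "norm (c *\<^sub>R f) = \<bar>c\<bar> * norm f"
    by transfer simp
qed

end

text \<open>
  Operators on \<^typ>\<open>'a L1\<close> are described below through \<^term>\<open>abs_L1\<close>, which maps an integrable
  function to its class, and \<^term>\<open>rep_L1\<close>, which picks a representative. \<^term>\<open>abs_L1\<close> carries no
  information about functions that are not integrable.
\<close>

definition L1_cone :: "'a::{real_normed_vector, ordered_real_vector} L1 set" where
  "L1_cone = {f. AE s in half_line. 0 \<le> rep_L1 f s}"

text \<open>
  If the cone is generating and the norm is additive on it, then the cone of \<^typ>\<open>'a L1\<close> is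
  generating as well, and exactly one functional satisfies the description below. It is positive,
  since it coincides with the norm on the cone.
\<close>

definition L1_functional :: "'a::{real_normed_vector, ordered_real_vector} L1 \<Rightarrow> real" where
  "L1_functional = (THE \<Psi>. bounded_linear \<Psi> \<and> (\<forall>f\<in>L1_cone. \<Psi> f = norm f))"

section \<open>Unbounded operators and generators\<close>

definition linear_operator :: "'a::real_vector set \<Rightarrow> ('a \<Rightarrow> 'b::real_vector) \<Rightarrow> bool" where
  "linear_operator D A \<longleftrightarrow> subspace D \<and>
     (\<forall>x\<in>D. \<forall>y\<in>D. A (x + y) = A x + A y) \<and> (\<forall>c. \<forall>x\<in>D. A (c *\<^sub>R x) = c *\<^sub>R A x)"

definition relatively_bounded ::
  "'a::real_normed_vector set \<Rightarrow> ('a \<Rightarrow> 'a) \<Rightarrow> ('a \<Rightarrow> 'a) \<Rightarrow> bool" where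
  "relatively_bounded D A K \<longleftrightarrow>
     (\<exists>a\<ge>0. \<exists>b\<ge>0. \<forall>x\<in>D. norm (K x) \<le> a * norm x + b * norm (A x))"

definition generator_domain :: "(real \<Rightarrow> 'a::real_normed_vector \<Rightarrow> 'a) \<Rightarrow> 'a set" where
  "generator_domain S = {x. \<exists>y. ((\<lambda>h. (S h x - x) /\<^sub>R h) \<longlongrightarrow> y) (at_right 0)}"

definition generator :: "(real \<Rightarrow> 'a::real_normed_vector \<Rightarrow> 'a) \<Rightarrow> 'a \<Rightarrow> 'a" where
  "generator S x = Lim (at_right 0) (\<lambda>h. (S h x - x) /\<^sub>R h)"

section \<open>Evolution families\<close>

definition evolution_family :: "(real \<Rightarrow> real \<Rightarrow> 'a::real_normed_vector \<Rightarrow> 'a) \<Rightarrow> bool" where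
  "evolution_family U \<longleftrightarrow>
     (\<forall>t s. 0 \<le> s \<and> s \<le> t \<longrightarrow> bounded_linear (U t s)) \<and>
     (\<forall>u. continuous_on {(t, s). 0 \<le> s \<and> s \<le> t} (\<lambda>(t, s). U t s u)) \<and>
     (\<forall>t r s u. 0 \<le> s \<and> s \<le> r \<and> r \<le> t \<longrightarrow> U t s u = U t r (U r s u)) \<and>
     (\<forall>t\<ge>0. \<forall>u. U t t u = u) \<and>
     (\<exists>C>0. \<exists>\<beta>>0. \<forall>t s. 0 \<le> s \<and> s \<le> t \<longrightarrow> onorm (U t s) \<le> C * exp (\<beta> * (t - s)))"

text \<open>
  An unbounded operator \<open>B(t)\<close> is given by its domain and a total function that is only meaningful on
  that domain. The domains do not enter the following definitions, because \<open>U(r,s)u\<close> lies in the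
  domain of \<open>B(r)\<close> for almost every \<open>r \<ge> s\<close> and the integrals ignore null sets.
\<close>

primrec perturbation_term ::
  "(real \<Rightarrow> real \<Rightarrow> 'a \<Rightarrow> 'a) \<Rightarrow> (real \<Rightarrow> 'a \<Rightarrow> 'a) \<Rightarrow> nat \<Rightarrow> real \<Rightarrow> real \<Rightarrow> 'a \<Rightarrow> 'a::real_normed_vector"
where
  "perturbation_term U B 0 = U"
| "perturbation_term U B (Suc n) = (\<lambda>t s u.
     strong_integral (lebesgue_on {s..t}) (\<lambda>r. perturbation_term U B n t r (B r (U r s u))))"

definition perturbed_family ::
  "(real \<Rightarrow> real \<Rightarrow> 'a \<Rightarrow> 'a) \<Rightarrow> (real \<Rightarrow> 'a \<Rightarrow> 'a) \<Rightarrow> real \<Rightarrow> real \<Rightarrow> 'a \<Rightarrow> 'a::real_normed_vector"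
where
  "perturbed_family U B t s u = (\<Sum>n. perturbation_term U B n t s u)"

definition evolution_semigroup ::
  "(real \<Rightarrow> real \<Rightarrow> 'a \<Rightarrow> 'a) \<Rightarrow> real \<Rightarrow> 'a L1 \<Rightarrow> 'a::real_normed_vector L1"
where
  "evolution_semigroup U t f =
     abs_L1 (\<lambda>s. if t \<le> s then U s (s - t) (rep_L1 f (s - t)) else 0)"

definition B_lambda ::
  "(real \<Rightarrow> real \<Rightarrow> 'a \<Rightarrow> 'a) \<Rightarrow> (real \<Rightarrow> 'a \<Rightarrow> 'a) \<Rightarrow> real \<Rightarrow> 'a L1 \<Rightarrow> 'a::real_normed_vector L1"
where
  "B_lambda U B l f =
     abs_L1 (\<lambda>s. strong_integral (lebesgue_on {0..s})
                  (\<lambda>\<tau>. exp (- l * (s - \<tau>)) *\<^sub>R B s (U s \<tau> (rep_L1 f \<tau>))))"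

end

theory Submission
  imports Defs
begin

text \<open>
  For an evolution family \<open>W\<close> with evolution semigroup \<open>S\<close> on
  \<open>L\<^sup>1\<close>, a class \<open>f\<close> lies in the domain of the generator and is
  mapped to \<open>y\<close> if and only if \<open>f(s) = - \<integral>\<^sub>0\<^sup>s
  W(s,\<tau>) y(\<tau>) d\<tau>\<close> for almost every \<open>s \<ge> 0\<close>
  (\<open>generator_if_mild\<close>, \<open>mild_if_generator\<close>). The theorem compares these
  two descriptions for \<open>U\<close> and for the perturbed family \<open>V\<close>. Integrating
  the Duhamel formula \<open>V(t,s)u = U(t,s)u + \<integral>\<^sub>s\<^sup>t V(t,r) B(r) U(r,s)u
  dr\<close> against a datum \<open>z\<close> and exchanging the two integrations
  (\<open>mild_Duhamel\<close>) yields \<open>\<integral>\<^sub>0\<^sup>s U(s,\<tau>) z(\<tau>)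
  d\<tau> = \<integral>\<^sub>0\<^sup>s V(s,\<tau>) (z - \<BB>\<^sub>0 z)(\<tau>) d\<tau>\<close>,
  where \<open>\<BB>\<^sub>0\<close> is \<open>\<BB>\<^sub>\<lambda>\<close> for \<open>\<lambda>
  = 0\<close>. Hence the domain of \<open>Z\<close> is contained in that of \<open>G\<close>, and
  \<open>Gf - Zf = - \<BB>\<^sub>0 Zf\<close> (\<open>perturbed_generator\<close>). The operator
  \<open>\<BB>\<^sub>0\<close> is bounded, because the integral estimate on \<open>BU\<close> is
  uniform in the final time; so \<open>G - Z\<close> is \<open>Z\<close>-bounded.

  The remaining claims are consequences of this formula. Shifting the datum by \<open>h\<close>
  removes from the kernel of \<open>\<BB>\<^sub>\<lambda>\<close> the part with \<open>s - \<tau>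
  < h\<close>; comparing the result for \<open>\<lambda>\<close> and for \<open>0\<close> and
  letting \<open>h\<close> tend to \<open>0\<close> gives \<open>\<lambda> \<BB>\<^sub>\<lambda> f
  = \<BB>\<^sub>\<lambda> Zf - \<BB>\<^sub>0 Zf\<close> (\<open>BL_on_domain\<close>). As
  \<open>\<BB>\<^sub>\<lambda> g\<close> tends to \<open>0\<close> for every \<open>g\<close>
  (\<open>BL_tendsto_0\<close>), \<open>\<lambda> \<BB>\<^sub>\<lambda> f\<close> tends to
  \<open>Gf - Zf\<close>. Each \<open>\<BB>\<^sub>\<lambda>\<close> is positive and the cone of
  \<open>L\<^sup>1\<close> is closed, so \<open>G - Z\<close> is positive
  (\<open>perturbation_nonneg\<close>). The functional is the norm on the cone, and the perturbed
  semigroup does not increase the norm there; differentiating at time \<open>0\<close> gives the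
  inequality (\<open>functional_generator_le\<close>). The Duhamel identity integrates the right
  derivative of \<open>s \<mapsto> - T(t-s) T\<^sub>0(s) f\<close> (\<open>Duhamel\<close>).

  Two preparations carry this through in an arbitrary, possibly non-separable, ordered Banach
  space. First, a function is strongly measurable if and only if it agrees almost everywhere with
  a Borel function of separable range (\<open>strongly_measurable_iff_sep\<close>); with such
  representatives the integral, its convergence theorems and Fubini's theorem reduce to scalar
  integration. Second, all estimates are given on the cone only. Baire's theorem provides a
  constant \<open>M\<close> such that every \<open>w\<close> is a difference \<open>u - v\<close>
  of positive vectors with \<open>norm u + norm v \<le> M * norm w\<close>
  (\<open>bounded_cone_decomposition\<close>), so linear maps that are contractive on the cone are
  bounded by \<open>M\<close>. On the cone the hypotheses on \<open>U\<close> and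
  \<open>BU\<close> add up to \<open>norm (V\<^sub>0 u) + \<dots> + norm (V\<^sub>n u) \<le> norm
  u\<close> for the terms of the Dyson series (\<open>Vn_Suc_sum_bound\<close>), which yields all
  properties of \<open>V\<close>.
\<close>

section \<open>Measurable functions with separable range\<close>

text \<open>
  Over a non-separable space sums of Borel functions need not be Borel, and Borel functions need
  not be limits of simple functions. Both defects disappear for functions whose range is contained
  in the closure of a countable set.
\<close>
definition sep_measurable :: "'x measure \<Rightarrow> ('x \<Rightarrow> 'b::metric_space) \<Rightarrow> bool" where
  "sep_measurable M f \<longleftrightarrow>
     f \<in> borel_measurable M \<and> (\<exists>C. countable C \<and> f ` space M \<subseteq> closure C)"

lemma sep_measurable_borel: "sep_measurable M f \<Longrightarrow> f \<in> borel_measurable M"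
  by (simp add: sep_measurable_def)

lemma sep_measurable_simple_function:
  assumes "simple_function M f"
  shows "sep_measurable M f"
  unfolding sep_measurable_def
proof (intro conjI exI)
  show "f \<in> borel_measurable M" using assms by (rule borel_measurable_simple_function)
  show "countable (f ` space M)"
    using assms by (simp add: simple_function_def countable_finite)
  show "f ` space M \<subseteq> closure (f ` space M)" by (rule closure_subset)
qed

lemma sep_measurable_const: "sep_measurable M (\<lambda>x. c)"
  by (rule sep_measurable_simple_function) simp

lemma sep_measurable_LIMSEQ:
  assumes f: "\<And>i. sep_measurable M (f i)" and lim: "\<And>x. x \<in> space M \<Longrightarrow> (\<lambda>i. f i x) \<longlonglongrightarrow> g x"
  shows "sep_measurable M g"
  unfolding sep_measurable_def
proof (intro conjI)
  show "g \<in> borel_measurable M"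
    using sep_measurable_borel[OF f] lim by (rule borel_measurable_LIMSEQ_metric)
  obtain C where C: "\<And>i. countable (C i)" "\<And>i. f i ` space M \<subseteq> closure (C i)"
    using f unfolding sep_measurable_def by metis
  have "g x \<in> closure (\<Union>i. C i)" if x: "x \<in> space M" for x
  proof (rule Lim_in_closed_set[OF closed_closure _ _ lim[OF x]])
    show "\<forall>\<^sub>F i in sequentially. f i x \<in> closure (\<Union>i. C i)"
      using C(2) x closure_mono[of "C _" "\<Union>i. C i"] by (intro always_eventually) blast
  qed simp
  then show "\<exists>C. countable C \<and> g ` space M \<subseteq> closure C"
    using C(1) by (intro exI[of _ "\<Union>i. C i"]) auto
qed

lemma sep_measurable_continuous_compose:
  assumes f: "sep_measurable M f" and g: "continuous_on UNIV g"
  shows "sep_measurable M (\<lambda>x. g (f x))"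
  unfolding sep_measurable_def
proof (intro conjI)
  show "(\<lambda>x. g (f x)) \<in> borel_measurable M"
    using measurable_compose[OF sep_measurable_borel[OF f] borel_measurable_continuous_onI[OF g]] .
  obtain C where C: "countable C" "f ` space M \<subseteq> closure C"
    using f unfolding sep_measurable_def by metis
  have "g ` closure C \<subseteq> closure (g ` C)"
    by (intro image_closure_subset continuous_on_subset[OF g] closure_subset) auto
  then show "\<exists>C. countable C \<and> (\<lambda>x. g (f x)) ` space M \<subseteq> closure C"
    using C by (intro exI[of _ "g ` C"]) auto
qed

lemma sep_measurable_compose:
  assumes "sep_measurable N f" "T \<in> measurable M N"
  shows "sep_measurable M (\<lambda>x. f (T x))"
proof -
  obtain C where C: "countable C" "f ` space N \<subseteq> closure C"
    using assms(1) unfolding sep_measurable_def by metis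
  have "(\<lambda>x. f (T x)) ` space M \<subseteq> closure C"
    using measurable_space[OF assms(2)] C(2) by auto
  with C(1) show ?thesis
    using measurable_compose[OF assms(2) sep_measurable_borel[OF assms(1)]]
    unfolding sep_measurable_def by blast
qed

lemma sep_measurable_cong:
  assumes "\<And>x. x \<in> space M \<Longrightarrow> f x = g x"
  shows "sep_measurable M f \<longleftrightarrow> sep_measurable M g"
proof -
  have "f \<in> borel_measurable M \<longleftrightarrow> g \<in> borel_measurable M"
    using assms by (rule measurable_cong)
  moreover have "f ` space M = g ` space M" using assms by (rule image_cong[OF refl])
  ultimately show ?thesis by (simp add: sep_measurable_def)
qed

lemma sep_measurable_cong_sets:
  "sets M = sets N \<Longrightarrow> sep_measurable M f = sep_measurable N f"
  unfolding sep_measurable_def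
  using measurable_cong_sets[of M N borel borel] sets_eq_imp_space_eq[of M N] by auto

text \<open>
  A countable set whose closure contains the values of \<open>f\<close> is enumerated with first
  element \<open>0\<close>; the \<open>i\<close>-th approximation takes the first of the nearest
  points to \<open>f x\<close> among the first \<open>i + 1\<close>. Since \<open>0\<close>
  competes, the error never exceeds \<open>norm (f x)\<close>, which provides a majorant for
  dominated convergence.
\<close>
lemma sep_measurable_simple_approximation:
  fixes f :: "'x \<Rightarrow> 'b::real_normed_vector"
  assumes f: "sep_measurable M f"
  obtains \<phi> where "\<And>i. simple_function M (\<phi> i)" "\<And>x. x \<in> space M \<Longrightarrow> (\<lambda>i. \<phi> i x) \<longlonglongrightarrow> f x"
    "\<And>i x. norm (f x - \<phi> i x) \<le> norm (f x)"
proof -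
  obtain C where C: "countable C" "f ` space M \<subseteq> closure C"
    using f unfolding sep_measurable_def by metis
  define c where "c = (\<lambda>i. case i of 0 \<Rightarrow> 0 | Suc j \<Rightarrow> from_nat_into (insert 0 C) j)"
  have c0: "c 0 = 0" by (simp add: c_def)
  have cC: "\<exists>k. c k = y" if "y \<in> C" for y
  proof -
    have "y \<in> range (from_nat_into (insert 0 C))"
      using C(1) that by (subst range_from_nat_into) auto
    then obtain j where "from_nat_into (insert 0 C) j = y" by auto
    then have "c (Suc j) = y" by (simp add: c_def)
    then show ?thesis ..
  qed
  define near where "near = (\<lambda>i x k. k \<le> i \<and> (\<forall>j\<le>i. dist (f x) (c k) \<le> dist (f x) (c j)))"
  define K where "K = (\<lambda>i x. LEAST k. near i x k)"
  define \<phi> where "\<phi> = (\<lambda>i x. c (K i x))"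
  have ex: "\<exists>k. near i x k" for i x
  proof -
    have "\<exists>k\<in>{..i}. \<forall>j\<in>{..i}. dist (f x) (c k) \<le> dist (f x) (c j)"
      using ex_is_arg_min_if_finite[of "{..i}" "\<lambda>k. dist (f x) (c k)"]
      by (auto simp: is_arg_min_linorder)
    then show ?thesis by (auto simp: near_def)
  qed
  have K: "near i x (K i x)" for i x
    unfolding K_def by (rule LeastI_ex[OF ex])
  have "(\<lambda>y. dist y (c k)) \<in> borel_measurable borel" for k
    by (intro borel_measurable_continuous_onI continuous_intros)
  then have [measurable]: "(\<lambda>x. dist (f x) (c k)) \<in> borel_measurable M" for k
    using measurable_compose[OF sep_measurable_borel[OF f]] by blast
  have Kmeas: "K i \<in> measurable M (count_space UNIV)" for i
    unfolding K_def near_def by measurable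
  have sf: "simple_function M (\<phi> i)" for i
  proof -
    have "K i ` space M \<subseteq> {..i}" using K by (auto simp: near_def)
    then have "finite (K i ` space M)" by (rule finite_subset) simp
    moreover have "K i -` {k} \<inter> space M \<in> sets M" for k
      using Kmeas by (rule measurable_sets) simp
    ultimately have "simple_function M (K i)" by (simp add: simple_function_def)
    then show ?thesis unfolding \<phi>_def by (rule simple_function_compose1)
  qed
  have lim: "(\<lambda>i. \<phi> i x) \<longlonglongrightarrow> f x" if x: "x \<in> space M" for x
  proof (rule metric_LIMSEQ_I)
    fix e :: real assume "0 < e"
    have "f x \<in> closure C" using C x by auto
    then obtain y where "y \<in> C" "dist y (f x) < e"
      using \<open>0 < e\<close> by (meson closure_approachable)
    with cC obtain k where k: "dist (f x) (c k) < e" by (metis dist_commute)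
    have "dist (\<phi> i x) (f x) < e" if "k \<le> i" for i
      using K[of i x] k that unfolding \<phi>_def near_def by (metis dist_commute le_less_trans)
    then show "\<exists>k. \<forall>i\<ge>k. dist (\<phi> i x) (f x) < e" by blast
  qed
  have "norm (f x - \<phi> i x) \<le> norm (f x)" for i x
    using K[of i x] unfolding \<phi>_def near_def by (metis c0 dist_0_norm dist_commute dist_norm le0)
  with sf lim show ?thesis by (rule that)
qed

lemma sep_measurable_add:
  fixes f g :: "'x \<Rightarrow> 'b::real_normed_vector"
  assumes "sep_measurable M f" "sep_measurable M g"
  shows "sep_measurable M (\<lambda>x. f x + g x)"
proof -
  obtain \<phi> where \<phi>: "\<And>i. simple_function M (\<phi> i)" "\<And>x. x \<in> space M \<Longrightarrow> (\<lambda>i. \<phi> i x) \<longlonglongrightarrow> f x"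
    using sep_measurable_simple_approximation[OF assms(1)] by metis
  obtain \<psi> where \<psi>: "\<And>i. simple_function M (\<psi> i)" "\<And>x. x \<in> space M \<Longrightarrow> (\<lambda>i. \<psi> i x) \<longlonglongrightarrow> g x"
    using sep_measurable_simple_approximation[OF assms(2)] by metis
  show ?thesis
  proof (rule sep_measurable_LIMSEQ)
    show "sep_measurable M (\<lambda>x. \<phi> i x + \<psi> i x)" for i
      by (intro sep_measurable_simple_function simple_function_compose2[where h="(+)"] \<phi> \<psi>)
    show "(\<lambda>i. \<phi> i x + \<psi> i x) \<longlonglongrightarrow> f x + g x" if "x \<in> space M" for x
      using \<phi>(2)[OF that] \<psi>(2)[OF that] by (rule tendsto_add)
  qed
qed

lemma sep_measurable_scaleR:
  fixes g :: "'x \<Rightarrow> 'b::real_normed_vector"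
  assumes f: "f \<in> borel_measurable M" and g: "sep_measurable M g"
  shows "sep_measurable M (\<lambda>x. f x *\<^sub>R g x)"
proof -
  obtain \<phi> where \<phi>: "\<And>i. simple_function M (\<phi> i)" "\<And>x. x \<in> space M \<Longrightarrow> (\<lambda>i. \<phi> i x) \<longlonglongrightarrow> f x"
    using borel_measurable_implies_sequence_metric[OF f, of 0] by metis
  obtain \<psi> where \<psi>: "\<And>i. simple_function M (\<psi> i)" "\<And>x. x \<in> space M \<Longrightarrow> (\<lambda>i. \<psi> i x) \<longlonglongrightarrow> g x"
    using sep_measurable_simple_approximation[OF g] by metis
  show ?thesis
  proof (rule sep_measurable_LIMSEQ)
    show "sep_measurable M (\<lambda>x. \<phi> i x *\<^sub>R \<psi> i x)" for i
      by (intro sep_measurable_simple_function simple_function_compose2[where h="(*\<^sub>R)"] \<phi> \<psi>)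
    show "(\<lambda>i. \<phi> i x *\<^sub>R \<psi> i x) \<longlonglongrightarrow> f x *\<^sub>R g x" if "x \<in> space M" for x
      using \<phi>(2)[OF that] \<psi>(2)[OF that] by (rule tendsto_scaleR)
  qed
qed

lemma sep_measurable_diff:
  fixes f g :: "'x \<Rightarrow> 'b::real_normed_vector"
  assumes "sep_measurable M f" "sep_measurable M g"
  shows "sep_measurable M (\<lambda>x. f x - g x)"
  using sep_measurable_add[OF assms(1) sep_measurable_scaleR[OF borel_measurable_const[of "-1"] assms(2)]] by simp

lemma sep_measurable_sum:
  fixes f :: "'i \<Rightarrow> 'x \<Rightarrow> 'b::real_normed_vector"
  assumes "\<And>i. i \<in> I \<Longrightarrow> sep_measurable M (f i)"
  shows "sep_measurable M (\<lambda>x. \<Sum>i\<in>I. f i x)"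
  using assms by (induction I rule: infinite_finite_induct) (auto intro: sep_measurable_const sep_measurable_add)

lemma sep_measurable_norm: "sep_measurable M f \<Longrightarrow> (\<lambda>x. norm (f x)) \<in> borel_measurable M"
  by (drule sep_measurable_borel) simp

lemma sep_measurable_If:
  fixes f g :: "'x \<Rightarrow> 'b::real_normed_vector"
  assumes P: "Measurable.pred M P" and f: "sep_measurable M f"
  shows "sep_measurable M (\<lambda>x. if P x then f x else 0)"
proof -
  have "(\<lambda>x. (if P x then 1 else 0) :: real) \<in> borel_measurable M" using P by measurable
  from sep_measurable_scaleR[OF this f] show ?thesis
    by (rule back_subst[where P="sep_measurable M"]) auto
qed

lemma sep_measurable_continuous_on:
  fixes f :: "'x::{metric_space, second_countable_topology} \<Rightarrow> 'b::real_normed_vector"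
  assumes S: "S \<in> sets borel" and f: "continuous_on S f"
  shows "sep_measurable borel (\<lambda>x. if x \<in> S then f x else 0)"
  unfolding sep_measurable_def
proof (intro conjI)
  show "(\<lambda>x. if x \<in> S then f x else 0) \<in> borel_measurable borel"
    using borel_measurable_continuous_on_indicator[OF S f]
    by (rule back_subst[where P="\<lambda>g. g \<in> borel_measurable borel"]) auto
  obtain T where T: "countable T" "T \<subseteq> S" "S \<subseteq> closure T" by (rule separable)
  have "f x \<in> closure (f ` T)" if x: "x \<in> S" for x
  proof (rule ccontr)
    assume fx: "f x \<notin> closure (f ` T)"
    obtain A where A: "open A" "A \<inter> S = f -` (- closure (f ` T)) \<inter> S"
      using f[unfolded continuous_on_open_invariant, rule_format, OF open_Compl[OF closed_closure[of "f ` T"]]]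
      by blast
    then have "x \<in> A" using x fx by auto
    then have "A \<inter> T \<noteq> {}"
      using A(1) T(3) x open_Int_closure_eq_empty[OF A(1), of T] by blast
    then obtain y where "y \<in> T" "f y \<notin> closure (f ` T)" using A T by auto
    then show False using closure_subset[of "f ` T"] by auto
  qed
  then show "\<exists>C. countable C \<and> (\<lambda>x. if x \<in> S then f x else 0) ` space borel \<subseteq> closure C"
    using T(1) closure_mono[of "f ` T" "insert 0 (f ` T)"] closure_subset[of "insert 0 (f ` T)"]
    by (intro exI[of _ "insert 0 (f ` T)"]) auto
qed

text \<open>
  If \<open>H\<close> is simple, \<open>W p (H p)\<close> is a finite sum of functions \<open>W p
  c\<close> cut off to the level sets of \<open>H\<close>; the general case is a pointwise limit,
  by continuity of each \<open>W p\<close>. So an operator family that is measurable on each fixed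
  vector may be applied to a measurable function.
\<close>
lemma sep_measurable_operator_apply:
  fixes W :: "'x \<Rightarrow> 'b::real_normed_vector \<Rightarrow> 'c::real_normed_vector"
  assumes W: "\<And>x. sep_measurable M (\<lambda>p. W p x)" and lin: "\<And>p. p \<in> space M \<Longrightarrow> bounded_linear (W p)"
    and H: "sep_measurable M H"
  shows "sep_measurable M (\<lambda>p. W p (H p))"
proof -
  obtain \<phi> where \<phi>: "\<And>i. simple_function M (\<phi> i)" "\<And>x. x \<in> space M \<Longrightarrow> (\<lambda>i. \<phi> i x) \<longlonglongrightarrow> H x"
    using sep_measurable_simple_approximation[OF H] by metis
  show ?thesis
  proof (rule sep_measurable_LIMSEQ)
    fix i
    have fin: "finite (\<phi> i ` space M)" using \<phi>(1) by (simp add: simple_function_def)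
    have "sep_measurable M (\<lambda>p. \<Sum>c\<in>\<phi> i ` space M. indicator (\<phi> i -` {c} \<inter> space M) p *\<^sub>R W p c)"
      using \<phi>(1) by (intro sep_measurable_sum sep_measurable_scaleR W borel_measurable_indicator simple_functionD)
    moreover have "(\<Sum>c\<in>\<phi> i ` space M. indicator (\<phi> i -` {c} \<inter> space M) p *\<^sub>R W p c) = W p (\<phi> i p)"
      if p: "p \<in> space M" for p
    proof -
      have "(\<Sum>c\<in>\<phi> i ` space M. indicator (\<phi> i -` {c} \<inter> space M) p *\<^sub>R W p c) =
        (\<Sum>c\<in>\<phi> i ` space M. if \<phi> i p = c then W p c else 0)"
        using p by (intro sum.cong) auto
      also have "\<dots> = W p (\<phi> i p)" using p fin by (simp add: sum.delta)
      finally show ?thesis .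
    qed
    ultimately show "sep_measurable M (\<lambda>p. W p (\<phi> i p))"
      by (subst sep_measurable_cong[symmetric])
  next
    fix p assume "p \<in> space M"
    then show "(\<lambda>i. W p (\<phi> i p)) \<longlonglongrightarrow> W p (H p)"
      using bounded_linear.tendsto[OF lin] \<phi>(2) by blast
  qed
qed

subsection \<open>Strong measurability\<close>

text \<open>
  Cutting the exceptional null set out of the approximating simple functions makes their limit
  exist everywhere, and the closure of their countably many values contains its range. This
  equivalence is used throughout to replace a function by a representative that can be composed
  and added pointwise.
\<close>
lemma strongly_measurable_iff_sep:
  fixes f :: "'x \<Rightarrow> 'b::real_normed_vector"
  shows "strongly_measurable M f \<longleftrightarrow> (\<exists>g. sep_measurable M g \<and> (AE x in M. f x = g x))"
proof
  assume "strongly_measurable M f"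
  then obtain \<phi> where \<phi>: "\<And>i. simple_function M (\<phi> i)" "AE x in M. (\<lambda>i. \<phi> i x) \<longlonglongrightarrow> f x"
    unfolding strongly_measurable_def by blast
  from AE_E3[OF \<phi>(2)] obtain N where N: "\<And>x. x \<in> space M - N \<Longrightarrow> (\<lambda>i. \<phi> i x) \<longlonglongrightarrow> f x" "N \<in> null_sets M"
    by blast
  define g where "g = (\<lambda>x. if x \<notin> N then f x else 0)"
  have [measurable]: "N \<in> sets M" using N(2) by auto
  have "sep_measurable M g"
  proof (rule sep_measurable_LIMSEQ)
    show "sep_measurable M (\<lambda>x. if x \<notin> N then \<phi> i x else 0)" for i
      by (intro sep_measurable_If sep_measurable_simple_function \<phi>) measurable
    show "(\<lambda>i. if x \<notin> N then \<phi> i x else 0) \<longlonglongrightarrow> g x" if "x \<in> space M" for x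
      using N(1) that by (auto simp: g_def)
  qed
  moreover have "AE x in M. f x = g x"
    using AE_not_in[OF N(2)] by eventually_elim (simp add: g_def)
  ultimately show "\<exists>g. sep_measurable M g \<and> (AE x in M. f x = g x)" by blast
next
  assume "\<exists>g. sep_measurable M g \<and> (AE x in M. f x = g x)"
  then obtain g where g: "sep_measurable M g" "AE x in M. f x = g x" by blast
  obtain \<phi> where \<phi>: "\<And>i. simple_function M (\<phi> i)" "\<And>x. x \<in> space M \<Longrightarrow> (\<lambda>i. \<phi> i x) \<longlonglongrightarrow> g x"
    using sep_measurable_simple_approximation[OF g(1)] by metis
  have "AE x in M. (\<lambda>i. \<phi> i x) \<longlonglongrightarrow> f x"
    using g(2) AE_space by eventually_elim (simp add: \<phi>)
  then show "strongly_measurable M f"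
    unfolding strongly_measurable_def using \<phi> by blast
qed

lemma sep_imp_strongly_measurable: "sep_measurable M f \<Longrightarrow> strongly_measurable M f"
  unfolding strongly_measurable_iff_sep by auto

lemma strongly_measurable_scale_fun:
  fixes f :: "'x \<Rightarrow> 'b::real_normed_vector" and c :: "'x \<Rightarrow> real"
  assumes "c \<in> borel_measurable N" "strongly_measurable N f"
  shows "strongly_measurable N (\<lambda>x. c x *\<^sub>R f x)"
proof -
  obtain g where g: "sep_measurable N g" "AE x in N. f x = g x" using assms(2) strongly_measurable_iff_sep by blast
  have "AE x in N. c x *\<^sub>R f x = c x *\<^sub>R g x" using g(2) by eventually_elim simp
  with sep_measurable_scaleR[OF assms(1) g(1)] show ?thesis using strongly_measurable_iff_sep by blast
qed
lemma strongly_measurable_LIMSEQ: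
  fixes g :: "'x \<Rightarrow> 'b::real_normed_vector"
  assumes f: "\<And>i. strongly_measurable M (f i)" and lim: "AE x in M. (\<lambda>i. f i x) \<longlonglongrightarrow> g x"
  shows "strongly_measurable M g"
proof -
  obtain h where h: "\<And>i. sep_measurable M (h i)" "\<And>i. AE x in M. f i x = h i x"
    using f unfolding strongly_measurable_iff_sep by metis
  have "AE x in M. \<forall>i. f i x = h i x" using h(2) by (simp add: AE_all_countable)
  with lim have "AE x in M. (\<lambda>i. h i x) \<longlonglongrightarrow> g x" by eventually_elim simp
  from AE_E3[OF this] obtain N where N: "\<And>x. x \<in> space M - N \<Longrightarrow> (\<lambda>i. h i x) \<longlonglongrightarrow> g x" "N \<in> null_sets M"
    by blast
  define k where "k = (\<lambda>x. if x \<notin> N then g x else 0)"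
  have [measurable]: "N \<in> sets M" using N(2) by auto
  have "sep_measurable M k"
  proof (rule sep_measurable_LIMSEQ)
    show "sep_measurable M (\<lambda>x. if x \<notin> N then h i x else 0)" for i
      by (intro sep_measurable_If h) measurable
    show "(\<lambda>i. if x \<notin> N then h i x else 0) \<longlonglongrightarrow> k x" if "x \<in> space M" for x
      using N(1) that by (auto simp: k_def)
  qed
  moreover have "AE x in M. g x = k x"
    using AE_not_in[OF N(2)] by eventually_elim (simp add: k_def)
  ultimately show ?thesis using strongly_measurable_iff_sep by blast
qed

lemma strongly_measurable_completion:
  "strongly_measurable (completion M) f \<longleftrightarrow> strongly_measurable M f"
proof
  assume "strongly_measurable (completion M) f"
  then obtain \<phi> where \<phi>: "\<And>i. simple_function (completion M) (\<phi> i)" 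
    "AE x in completion M. (\<lambda>i. \<phi> i x) \<longlonglongrightarrow> f x"
    unfolding strongly_measurable_def by blast
  obtain \<psi> where \<psi>: "\<And>i. simple_function M (\<psi> i)" "\<And>i. AE x in M. \<phi> i x = \<psi> i x"
    using completion_ex_simple_function[OF \<phi>(1)] by metis
  have "AE x in M. \<forall>i. \<phi> i x = \<psi> i x" using \<psi>(2) by (simp add: AE_all_countable)
  moreover have "AE x in M. (\<lambda>i. \<phi> i x) \<longlonglongrightarrow> f x" using \<phi>(2) by (simp add: AE_completion_iff)
  ultimately have "AE x in M. (\<lambda>i. \<psi> i x) \<longlonglongrightarrow> f x" by eventually_elim simp
  with \<psi>(1) show "strongly_measurable M f" unfolding strongly_measurable_def by blast
next
  assume "strongly_measurable M f"
  then show "strongly_measurable (completion M) f"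
    unfolding strongly_measurable_def using simple_function_completion AE_completion by blast
qed

lemma strongly_measurable_restrict_space:
  fixes f :: "'x \<Rightarrow> 'b::real_normed_vector"
  assumes S: "S \<inter> space M \<in> sets M"
  shows "strongly_measurable (restrict_space M S) f \<longleftrightarrow>
    strongly_measurable M (\<lambda>x. indicator S x *\<^sub>R f x)"
proof
  assume "strongly_measurable (restrict_space M S) f"
  then obtain \<phi> where \<phi>: "\<And>i. simple_function (restrict_space M S) (\<phi> i)" 
    "AE x in restrict_space M S. (\<lambda>i. \<phi> i x) \<longlonglongrightarrow> f x"
    unfolding strongly_measurable_def by blast
  have "AE x in M. x \<in> S \<longrightarrow> (\<lambda>i. \<phi> i x) \<longlonglongrightarrow> f x" 
    using \<phi>(2) S by (subst (asm) AE_restrict_space_iff) auto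
  then have "AE x in M. (\<lambda>i. indicator S x *\<^sub>R \<phi> i x) \<longlonglongrightarrow> indicator S x *\<^sub>R f x"
    by eventually_elim (auto simp: indicator_def)
  moreover have "simple_function M (\<lambda>x. indicator S x *\<^sub>R \<phi> i x)" for i
    using \<phi>(1)[of i] simple_function_restrict_space[OF S, of "\<phi> i"] by simp
  ultimately show "strongly_measurable M (\<lambda>x. indicator S x *\<^sub>R f x)"
    unfolding strongly_measurable_def by (intro exI[of _ "\<lambda>i x. indicator S x *\<^sub>R \<phi> i x"]) simp
next
  assume "strongly_measurable M (\<lambda>x. indicator S x *\<^sub>R f x)"
  then obtain \<phi> where \<phi>: "\<And>i. simple_function M (\<phi> i)" 
    "AE x in M. (\<lambda>i. \<phi> i x) \<longlonglongrightarrow> indicator S x *\<^sub>R f x"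
    unfolding strongly_measurable_def by blast
  have "simple_function M (\<lambda>x. indicator S x *\<^sub>R \<phi> i x)" for i
  proof -
    have "simple_function M (\<lambda>x. indicator (S \<inter> space M) x *\<^sub>R \<phi> i x)"
      using S by (intro simple_function_compose2[where h="(*\<^sub>R)"] \<phi> simple_function_indicator)
    then show ?thesis
      by (rule simple_function_cong[THEN iffD1, rotated]) (simp add: indicator_def)
  qed
  then have "simple_function (restrict_space M S) (\<phi> i)" for i
    using simple_function_restrict_space[OF S, of "\<phi> i"] by simp
  moreover have "AE x in restrict_space M S. (\<lambda>i. \<phi> i x) \<longlonglongrightarrow> f x"
    using \<phi>(2) S by (subst AE_restrict_space_iff) (auto elim!: eventually_mono)
  ultimately show "strongly_measurable (restrict_space M S) f"
    unfolding strongly_measurable_def by blast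
qed

section \<open>Integration in Banach spaces\<close>

lemma strongly_integrable_iff_sep:
  fixes f :: "'x \<Rightarrow> 'b::real_normed_vector"
  shows "strongly_integrable M f \<longleftrightarrow>
    (\<exists>g. sep_measurable M g \<and> integrable M (\<lambda>x. norm (g x)) \<and> (AE x in M. f x = g x))"
proof
  assume f: "strongly_integrable M f"
  then obtain g where g: "sep_measurable M g" "AE x in M. f x = g x"
    by (auto simp: strongly_integrable_def strongly_measurable_iff_sep)
  have "(\<integral>\<^sup>+x. ennreal (norm (g x)) \<partial>M) = (\<integral>\<^sup>+x. ennreal (norm (f x)) \<partial>M)"
    using g(2) by (intro nn_integral_cong_AE) auto
  then have "integrable M (\<lambda>x. norm (g x))"
    using f sep_measurable_norm[OF g(1)] by (simp add: integrable_iff_bounded strongly_integrable_def)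
  with g show "\<exists>g. sep_measurable M g \<and> integrable M (\<lambda>x. norm (g x)) \<and> (AE x in M. f x = g x)" by blast
next
  assume "\<exists>g. sep_measurable M g \<and> integrable M (\<lambda>x. norm (g x)) \<and> (AE x in M. f x = g x)"
  then obtain g where g: "sep_measurable M g" "integrable M (\<lambda>x. norm (g x))" "AE x in M. f x = g x" by blast
  have "(\<integral>\<^sup>+x. ennreal (norm (g x)) \<partial>M) = (\<integral>\<^sup>+x. ennreal (norm (f x)) \<partial>M)"
    using g(3) by (intro nn_integral_cong_AE) auto
  with g show "strongly_integrable M f"
    by (auto simp: integrable_iff_bounded strongly_integrable_def strongly_measurable_iff_sep)
qed

lemma strongly_integrable_measurable: "strongly_integrable M f \<Longrightarrow> strongly_measurable M f"
  by (simp add: strongly_integrable_def)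

lemma strongly_integrable_cong_AE:
  fixes f g :: "'x \<Rightarrow> 'b::real_normed_vector"
  assumes "AE x in M. f x = g x"
  shows "strongly_integrable M f \<longleftrightarrow> strongly_integrable M g"
proof -
  have "(AE x in M. f x = h x) \<longleftrightarrow> (AE x in M. g x = h x)" for h
    using assms by (intro iffI; elim AE_mp) auto
  then show ?thesis unfolding strongly_integrable_iff_sep by simp
qed

lemma strongly_integrable_dominated:
  fixes f :: "'x \<Rightarrow> 'b::real_normed_vector" and w :: "'x \<Rightarrow> 'c::real_normed_vector"
  assumes f: "strongly_measurable M f" and w: "strongly_integrable M w"
    and le: "AE x in M. norm (f x) \<le> norm (w x)"
  shows "strongly_integrable M f"
proof -
  have "(\<integral>\<^sup>+x. ennreal (norm (f x)) \<partial>M) \<le> (\<integral>\<^sup>+x. ennreal (norm (w x)) \<partial>M)"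
    using le by (intro nn_integral_mono_AE) (auto intro: ennreal_leI)
  with f w show ?thesis by (auto simp: strongly_integrable_def)
qed

lemma strongly_integrable_norm_sep:
  "sep_measurable M f \<Longrightarrow> integrable M (\<lambda>x. norm (f x)) \<Longrightarrow> strongly_integrable M f"
  unfolding strongly_integrable_iff_sep by auto

lemma strongly_integrable_plus:
  fixes f g :: "'x \<Rightarrow> 'b::real_normed_vector"
  assumes "strongly_integrable M f" "strongly_integrable M g"
  shows "strongly_integrable M (\<lambda>x. f x + g x)"
proof -
  obtain f' where f': "sep_measurable M f'" "integrable M (\<lambda>x. norm (f' x))" "AE x in M. f x = f' x"
    using assms(1) strongly_integrable_iff_sep by blast
  obtain g' where g': "sep_measurable M g'" "integrable M (\<lambda>x. norm (g' x))" "AE x in M. g x = g' x"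
    using assms(2) strongly_integrable_iff_sep by blast
  have s: "sep_measurable M (\<lambda>x. f' x + g' x)" using f' g' by (intro sep_measurable_add)
  have "integrable M (\<lambda>x. norm (f' x + g' x))"
    by (rule Bochner_Integration.integrable_bound[OF Bochner_Integration.integrable_add[OF f'(2) g'(2)]])
      (auto intro: sep_measurable_norm[OF s] norm_triangle_ineq)
  moreover have "AE x in M. f x + g x = f' x + g' x" using f'(3) g'(3) by eventually_elim simp
  ultimately show ?thesis using s strongly_integrable_iff_sep by blast
qed

lemma strongly_integrable_bounded_linear:
  fixes f :: "'x \<Rightarrow> 'b::real_normed_vector" and T :: "'b \<Rightarrow> 'c::real_normed_vector"
  assumes T: "bounded_linear T" and f: "strongly_integrable M f"
  shows "strongly_integrable M (\<lambda>x. T (f x))"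
proof -
  obtain g where g: "sep_measurable M g" "integrable M (\<lambda>x. norm (g x))" "AE x in M. f x = g x"
    using f strongly_integrable_iff_sep by blast
  have s: "sep_measurable M (\<lambda>x. T (g x))"
    using T by (intro sep_measurable_continuous_compose[OF g(1)]) (simp add: linear_continuous_on)
  obtain K where K: "\<And>x. norm (T x) \<le> norm x * K" using bounded_linear.bounded[OF T] by blast
  have "integrable M (\<lambda>x. norm (T (g x)))"
  proof (rule Bochner_Integration.integrable_bound)
    show "integrable M (\<lambda>x. norm (g x) * K)" using g(2) by simp
    show "(\<lambda>x. norm (T (g x))) \<in> borel_measurable M" using s by (rule sep_measurable_norm)
    show "AE x in M. norm (norm (T (g x))) \<le> norm (norm (g x) * K)"
      using K by (intro AE_I2) (smt (verit) norm_ge_zero real_norm_def)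
  qed
  then have "strongly_integrable M (\<lambda>x. T (g x))" using s by (rule strongly_integrable_norm_sep[rotated])
  moreover have "AE x in M. T (f x) = T (g x)" using g(3) by eventually_elim simp
  ultimately show ?thesis by (simp add: strongly_integrable_cong_AE)
qed

lemma strongly_integrable_scale:
  fixes f :: "'x \<Rightarrow> 'b::real_normed_vector"
  shows "strongly_integrable M f \<Longrightarrow> strongly_integrable M (\<lambda>x. c *\<^sub>R f x)"
  by (rule strongly_integrable_bounded_linear[OF bounded_linear_scaleR_right])

lemma strongly_integrable_minus:
  fixes f g :: "'x \<Rightarrow> 'b::real_normed_vector"
  assumes "strongly_integrable M f" "strongly_integrable M g"
  shows "strongly_integrable M (\<lambda>x. f x - g x)"
  using strongly_integrable_plus[OF assms(1) strongly_integrable_scale[OF assms(2), of "-1"]] by simp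

lemma strongly_integrable_zero: "strongly_integrable M (\<lambda>x. 0)"
  by (simp add: strongly_integrable_def strongly_measurable_0)

lemma strongly_integrable_sum:
  fixes f :: "'i \<Rightarrow> 'x \<Rightarrow> 'b::real_normed_vector"
  assumes "\<And>i. i \<in> I \<Longrightarrow> strongly_integrable M (f i)"
  shows "strongly_integrable M (\<lambda>x. \<Sum>i\<in>I. f i x)"
  using assms
  by (induction I rule: infinite_finite_induct) (auto intro: strongly_integrable_zero strongly_integrable_plus)

lemma strongly_integrable_indicator:
  fixes f :: "'x \<Rightarrow> 'b::real_normed_vector"
  assumes "strongly_integrable M f" "A \<in> sets M"
  shows "strongly_integrable M (\<lambda>x. indicator A x *\<^sub>R f x)"
proof (rule strongly_integrable_dominated[OF _ assms(1)])
  obtain g where g: "sep_measurable M g" "AE x in M. f x = g x"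
    using assms(1) by (auto simp: strongly_integrable_def strongly_measurable_iff_sep)
  have "sep_measurable M (\<lambda>x. indicat_real A x *\<^sub>R g x)"
    using assms(2) by (intro sep_measurable_scaleR g) simp
  with g(2) show "strongly_measurable M (\<lambda>x. indicator A x *\<^sub>R f x)"
    unfolding strongly_measurable_iff_sep by (intro exI[of _ "\<lambda>x. indicator A x *\<^sub>R g x"]) auto
qed (auto simp: indicator_def)

text \<open>
  The norm of a strongly measurable function is measurable only up to a null set. The upper
  integral does not see this, whereas the Lebesgue integral of a non-measurable norm would be
  \<open>0\<close>.
\<close>
definition L1_seminorm :: "'x measure \<Rightarrow> ('x \<Rightarrow> 'b::real_normed_vector) \<Rightarrow> real" where
  "L1_seminorm M f = enn2real (\<integral>\<^sup>+x. ennreal (norm (f x)) \<partial>M)"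

lemma L1_seminorm_nonneg: "0 \<le> L1_seminorm M f"
  by (simp add: L1_seminorm_def)

lemma nn_integral_eq_L1_seminorm:
  "strongly_integrable M f \<Longrightarrow> (\<integral>\<^sup>+x. ennreal (norm (f x)) \<partial>M) = ennreal (L1_seminorm M f)"
  by (simp add: L1_seminorm_def strongly_integrable_def)

lemma L1_seminorm_cong_AE:
  assumes "AE x in M. norm (f x) = norm (g x)"
  shows "L1_seminorm M f = L1_seminorm M g"
  unfolding L1_seminorm_def using assms by (intro arg_cong[where f=enn2real] nn_integral_cong_AE) auto

lemma L1_seminorm_mono_AE:
  assumes g: "strongly_integrable M g" and "AE x in M. norm (f x) \<le> norm (g x)"
  shows "L1_seminorm M f \<le> L1_seminorm M g"
  unfolding L1_seminorm_def using assms
  by (intro enn2real_mono nn_integral_mono_AE) (auto intro: ennreal_leI simp: strongly_integrable_def)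

lemma L1_seminorm_sep:
  assumes "sep_measurable M f" 
  shows "L1_seminorm M f = (LINT x|M. norm (f x))"
  unfolding L1_seminorm_def using assms by (subst integral_eq_nn_integral) (auto intro: sep_measurable_norm)

lemma L1_seminorm_eq_integral_sep:
  assumes "strongly_integrable M f"
  obtains g where "sep_measurable M g" "integrable M (\<lambda>x. norm (g x))" "AE x in M. f x = g x"
    "L1_seminorm M f = (LINT x|M. norm (g x))"
proof -
  obtain g where g: "sep_measurable M g" "integrable M (\<lambda>x. norm (g x))" "AE x in M. f x = g x"
    using assms strongly_integrable_iff_sep by blast
  moreover have "L1_seminorm M f = L1_seminorm M g" using g(3) by (intro L1_seminorm_cong_AE) auto
  ultimately show ?thesis using that L1_seminorm_sep by metis
qed

lemma L1_seminorm_bound_nn: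
  assumes "(\<integral>\<^sup>+x. ennreal (norm (f x)) \<partial>M) \<le> ennreal c" "0 \<le> c"
  shows "L1_seminorm M f \<le> c"
  unfolding L1_seminorm_def using assms
  by (metis enn2real_ennreal enn2real_mono ennreal_less_top)

lemma L1_seminorm_triangle:
  fixes f g :: "'x \<Rightarrow> 'b::real_normed_vector"
  assumes "strongly_integrable M f" "strongly_integrable M g"
  shows "L1_seminorm M (\<lambda>x. f x + g x) \<le> L1_seminorm M f + L1_seminorm M g"
proof -
  obtain f' where f': "sep_measurable M f'" "integrable M (\<lambda>x. norm (f' x))" "AE x in M. f x = f' x"
    "L1_seminorm M f = (LINT x|M. norm (f' x))"
    using assms(1) by (rule L1_seminorm_eq_integral_sep)
  obtain g' where g': "sep_measurable M g'" "integrable M (\<lambda>x. norm (g' x))" "AE x in M. g x = g' x"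
    "L1_seminorm M g = (LINT x|M. norm (g' x))"
    using assms(2) by (rule L1_seminorm_eq_integral_sep)
  have s: "sep_measurable M (\<lambda>x. f' x + g' x)" using f' g' by (intro sep_measurable_add)
  have i: "integrable M (\<lambda>x. norm (f' x + g' x))"
    by (rule Bochner_Integration.integrable_bound[OF Bochner_Integration.integrable_add[OF f'(2) g'(2)]])
      (auto intro: sep_measurable_norm[OF s] norm_triangle_ineq)
  have "L1_seminorm M (\<lambda>x. f x + g x) = L1_seminorm M (\<lambda>x. f' x + g' x)"
    using f'(3) g'(3) by (intro L1_seminorm_cong_AE) (elim AE_mp, auto)
  also have "\<dots> = (LINT x|M. norm (f' x + g' x))" using s by (rule L1_seminorm_sep)
  also have "\<dots> \<le> (LINT x|M. norm (f' x) + norm (g' x))"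
    using f' g' i by (intro integral_mono Bochner_Integration.integrable_add norm_triangle_ineq)
  also have "\<dots> = (LINT x|M. norm (f' x)) + (LINT x|M. norm (g' x))"
    using f' g' by (intro Bochner_Integration.integral_add)
  finally show ?thesis using f' g' by simp
qed

lemma L1_seminorm_scale: "L1_seminorm M (\<lambda>x. c *\<^sub>R f x) = \<bar>c\<bar> * L1_seminorm M f" 
  if f: "strongly_integrable M f" for f :: "'x \<Rightarrow> 'b::real_normed_vector"
proof -
  obtain g where g: "sep_measurable M g" "AE x in M. f x = g x" "L1_seminorm M f = (LINT x|M. norm (g x))"
    using L1_seminorm_eq_integral_sep[OF f] by metis
  have "L1_seminorm M (\<lambda>x. c *\<^sub>R f x) = L1_seminorm M (\<lambda>x. c *\<^sub>R g x)"
    using g(2) by (intro L1_seminorm_cong_AE) (elim AE_mp, auto)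
  also have "\<dots> = (LINT x|M. norm (c *\<^sub>R g x))"
    using g by (intro L1_seminorm_sep sep_measurable_scaleR) auto
  finally show ?thesis using g by simp
qed

lemma L1_seminorm_commute: "L1_seminorm M (\<lambda>x. f x - g x) = L1_seminorm M (\<lambda>x. g x - f x)"
  unfolding L1_seminorm_def by (simp add: norm_minus_commute)

lemma L1_seminorm_eq_0:
  fixes f :: "'x \<Rightarrow> 'b::real_normed_vector"
  assumes f: "strongly_integrable M f" and "L1_seminorm M f = 0"
  shows "AE x in M. f x = 0"
proof -
  obtain g where g: "sep_measurable M g" "integrable M (\<lambda>x. norm (g x))" "AE x in M. f x = g x"
      "L1_seminorm M f = (LINT x|M. norm (g x))"
    using f by (rule L1_seminorm_eq_integral_sep)
  then have "AE x in M. norm (g x) = 0"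
    using assms integral_nonneg_eq_0_iff_AE[OF g(2)] by simp
  with g(3) show ?thesis by eventually_elim simp
qed

lemma L1_seminorm_dominated_convergence:
  fixes f :: "nat \<Rightarrow> 'x \<Rightarrow> 'b::real_normed_vector" and w :: "'x \<Rightarrow> 'c::real_normed_vector"
  assumes f: "\<And>n. strongly_measurable M (f n)" and w: "strongly_integrable M w"
    and le: "\<And>n. AE x in M. norm (f n x) \<le> norm (w x)"
    and lim: "AE x in M. (\<lambda>n. f n x) \<longlonglongrightarrow> g x"
  shows "strongly_integrable M g" "(\<lambda>n. L1_seminorm M (\<lambda>x. f n x - g x)) \<longlonglongrightarrow> 0"
proof -
  have "AE x in M. \<forall>n. norm (f n x) \<le> norm (w x)" using le by (simp add: AE_all_countable)
  with lim have gw: "AE x in M. norm (g x) \<le> norm (w x)"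
    by eventually_elim (rule Lim_bounded[OF tendsto_norm], auto)
  have gm: "strongly_measurable M g" using f lim by (rule strongly_measurable_LIMSEQ)
  show g: "strongly_integrable M g"
    using gm w gw by (rule strongly_integrable_dominated)
  obtain w' where w': "sep_measurable M w'" "integrable M (\<lambda>x. norm (w' x))" "AE x in M. w x = w' x"
    using w strongly_integrable_iff_sep by blast
  obtain g' where g': "sep_measurable M g'" "AE x in M. g x = g' x"
    using gm strongly_measurable_iff_sep by blast
  obtain f' where f': "\<And>n. sep_measurable M (f' n)" "\<And>n. AE x in M. f n x = f' n x"
    using f unfolding strongly_measurable_iff_sep by metis
  have f'all: "AE x in M. \<forall>n. f n x = f' n x" using f'(2) by (simp add: AE_all_countable)
  have "(\<lambda>n. LINT x|M. norm (f' n x - g' x)) \<longlonglongrightarrow> (LINT x|M. 0)"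
  proof (rule integral_dominated_convergence)
    show "(\<lambda>x. norm (f' n x - g' x)) \<in> borel_measurable M" for n
      by (intro sep_measurable_norm sep_measurable_diff f' g')
    show "integrable M (\<lambda>x. 2 * norm (w' x))" using w' by simp
    show "AE x in M. (\<lambda>n. norm (f' n x - g' x)) \<longlonglongrightarrow> 0"
      using lim f'all g'(2)
      by eventually_elim (simp add: LIM_zero tendsto_norm_zero)
    show "AE x in M. norm (norm (f' n x - g' x)) \<le> 2 * norm (w' x)" for n
      using le[of n] gw f'(2)[of n] g'(2) w'(3)
    proof eventually_elim
      case (elim x)
      then have "norm (f' n x) \<le> norm (w' x)" "norm (g' x) \<le> norm (w' x)" by auto
      then show ?case using norm_triangle_ineq4[of "f' n x" "g' x"] by simp
    qed
  qed simp
  moreover have "L1_seminorm M (\<lambda>x. f n x - g x) = (LINT x|M. norm (f' n x - g' x))" for n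
  proof -
    have "L1_seminorm M (\<lambda>x. f n x - g x) = L1_seminorm M (\<lambda>x. f' n x - g' x)"
      using f'(2)[of n] g'(2) by (intro L1_seminorm_cong_AE) (elim AE_mp, auto)
    also have "\<dots> = (LINT x|M. norm (f' n x - g' x))"
      by (intro L1_seminorm_sep sep_measurable_diff f' g')
    finally show ?thesis .
  qed
  ultimately show "(\<lambda>n. L1_seminorm M (\<lambda>x. f n x - g x)) \<longlonglongrightarrow> 0" by simp
qed

abbreviation simple_bochner_integrable :: "'x measure \<Rightarrow> ('x \<Rightarrow> 'b::real_vector) \<Rightarrow> bool" where
  "simple_bochner_integrable \<equiv> Bochner_Integration.simple_bochner_integrable"

abbreviation simple_bochner_integral :: "'x measure \<Rightarrow> ('x \<Rightarrow> 'b::real_vector) \<Rightarrow> 'b" where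
  "simple_bochner_integral \<equiv> Bochner_Integration.simple_bochner_integral"

lemma simple_bochner_strongly_integrable:
  fixes \<phi> :: "'x \<Rightarrow> 'b::real_normed_vector"
  assumes "simple_bochner_integrable M \<phi>"
  shows "strongly_integrable M \<phi>"
proof (rule strongly_integrable_norm_sep)
  show "sep_measurable M \<phi>"
    using assms by (intro sep_measurable_simple_function) (auto elim: simple_bochner_integrable.cases)
  have "simple_bochner_integrable M (\<lambda>x. norm (\<phi> x))"
    using simple_bochner_integrable_compose2[of "\<lambda>x y. norm x" M \<phi> \<phi>] assms by simp
  then show "integrable M (\<lambda>x. norm (\<phi> x))"
    using has_bochner_integral_simple_bochner_integrable integrable.intros by blast
qed

lemma simple_bochner_decomposition:
  fixes \<phi> :: "'x \<Rightarrow> 'b::real_vector"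
  assumes \<phi>: "simple_bochner_integrable M \<phi>"
  obtains C A where "finite C" "\<And>c. c \<in> C \<Longrightarrow> A c \<in> sets M" "\<And>c. c \<in> C \<Longrightarrow> emeasure M (A c) < \<infinity>"
    "\<And>x. x \<in> space M \<Longrightarrow> \<phi> x = (\<Sum>c\<in>C. indicator (A c) x *\<^sub>R c)"
proof -
  define C where "C = \<phi> ` space M - {0}"
  define A where "A = (\<lambda>c. \<phi> -` {c} \<inter> space M)"
  have sf: "simple_function M \<phi>" using \<phi> by (auto elim: simple_bochner_integrable.cases)
  have fin: "finite C" using sf by (simp add: C_def simple_function_def)
  have sets: "A c \<in> sets M" for c unfolding A_def using simple_functionD(2)[OF sf] .
  have em: "emeasure M (A c) < \<infinity>" if "c \<in> C" for c
  proof -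
    have "c \<noteq> 0" using that by (simp add: C_def)
    then have "emeasure M (A c) \<le> emeasure M {p \<in> space M. \<phi> p \<noteq> 0}"
    proof (intro emeasure_mono)
      have "{p \<in> space M. \<phi> p \<noteq> 0} = space M - A 0" by (auto simp: A_def)
      then show "{p \<in> space M. \<phi> p \<noteq> 0} \<in> sets M" using sets by auto
    qed (auto simp: A_def)
    then show ?thesis
      using \<phi> by (auto simp: simple_bochner_integrable.simps less_top top_unique)
  qed
  have "\<phi> p = (\<Sum>c\<in>C. indicator (A c) p *\<^sub>R c)" if p: "p \<in> space M" for p
  proof -
    have "(\<Sum>c\<in>C. indicator (A c) p *\<^sub>R c) = (\<Sum>c\<in>C. if \<phi> p = c then c else 0)"
      using p by (intro sum.cong) (auto simp: A_def)
    also have "\<dots> = (if \<phi> p \<in> C then \<phi> p else 0)" using fin by simp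
    also have "\<dots> = \<phi> p" using p by (auto simp: C_def)
    finally show ?thesis ..
  qed
  with fin sets em show ?thesis by (intro that[of C A])
qed

lemma simple_bochner_integral_norm_le:
  fixes \<phi> \<psi> :: "'x \<Rightarrow> 'b::real_normed_vector"
  assumes s: "simple_bochner_integrable M \<phi>" and t: "simple_bochner_integrable M \<psi>"
  shows "norm (simple_bochner_integral M \<phi> - simple_bochner_integral M \<psi>) \<le> L1_seminorm M (\<lambda>x. \<phi> x - \<psi> x)"
proof -
  have i: "simple_bochner_integrable M (\<lambda>x. \<phi> x - \<psi> x)"
    using simple_bochner_integrable_compose2[of "(-)" M \<phi> \<psi>] s t by simp
  have "simple_bochner_integrable M (\<lambda>x. norm (\<phi> x - \<psi> x))"
    using simple_bochner_integrable_compose2[of "\<lambda>x y. norm (x - y)" M \<phi> \<psi>] s t by simp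
  then have "ennreal (simple_bochner_integral M (\<lambda>x. norm (\<phi> x - \<psi> x))) = 
      (\<integral>\<^sup>+x. ennreal (norm (\<phi> x - \<psi> x)) \<partial>M)"
    by (intro simple_bochner_integral_eq_nn_integral) auto
  also have "\<dots> = ennreal (L1_seminorm M (\<lambda>x. \<phi> x - \<psi> x))"
    by (rule nn_integral_eq_L1_seminorm[OF simple_bochner_strongly_integrable[OF i]])
  finally have "simple_bochner_integral M (\<lambda>x. norm (\<phi> x - \<psi> x)) = L1_seminorm M (\<lambda>x. \<phi> x - \<psi> x)"
    by (simp add: ennreal_inj L1_seminorm_nonneg)
  then show ?thesis
    using simple_bochner_integral_norm_bound[OF i] s t by (simp add: simple_bochner_integral_diff)
qed

text \<open>
  The relation whose unique value is \<^const>\<open>strong_integral\<close>.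
\<close>
definition has_strong_integral :: "'x measure \<Rightarrow> ('x \<Rightarrow> 'b::real_normed_vector) \<Rightarrow> 'b \<Rightarrow> bool" where
  "has_strong_integral M f I \<longleftrightarrow> strongly_integrable M f \<and>
     (\<exists>\<phi>. (\<forall>i. simple_bochner_integrable M (\<phi> i)) \<and>
          (\<lambda>i. L1_seminorm M (\<lambda>x. f x - \<phi> i x)) \<longlonglongrightarrow> 0 \<and>
          (\<lambda>i. simple_bochner_integral M (\<phi> i)) \<longlonglongrightarrow> I)"

lemma has_strong_integralI:
  assumes "strongly_integrable M f" "\<And>i. simple_bochner_integrable M (\<phi> i)"
    "(\<lambda>i. L1_seminorm M (\<lambda>x. f x - \<phi> i x)) \<longlonglongrightarrow> 0" "(\<lambda>i. simple_bochner_integral M (\<phi> i)) \<longlonglongrightarrow> I"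
  shows "has_strong_integral M f I"
  using assms unfolding has_strong_integral_def by blast

lemma has_strong_integralE:
  assumes "has_strong_integral M f I"
  obtains \<phi> where "strongly_integrable M f" "\<And>i. simple_bochner_integrable M (\<phi> i)"
    "(\<lambda>i. L1_seminorm M (\<lambda>x. f x - \<phi> i x)) \<longlonglongrightarrow> 0" "(\<lambda>i. simple_bochner_integral M (\<phi> i)) \<longlonglongrightarrow> I"
  using assms unfolding has_strong_integral_def by blast

lemma L1_seminorm_triangle_sub:
  fixes f g h :: "'x \<Rightarrow> 'b::real_normed_vector"
  assumes "strongly_integrable M f" "strongly_integrable M g" "strongly_integrable M h"
  shows "L1_seminorm M (\<lambda>x. f x - h x) \<le> L1_seminorm M (\<lambda>x. g x - f x) + L1_seminorm M (\<lambda>x. g x - h x)"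
  using L1_seminorm_triangle[OF strongly_integrable_minus[OF assms(1,2)] strongly_integrable_minus[OF assms(2,3)]]
  by (simp add: L1_seminorm_commute[of M f g])

text \<open>
  For \<open>f = g\<close> this is uniqueness of the integral, in general its continuity with
  respect to the seminorm of \<open>L\<^sup>1\<close>.
\<close>
lemma has_strong_integral_dist_le:
  fixes f g :: "'x \<Rightarrow> 'b::real_normed_vector"
  assumes f: "has_strong_integral M f I" and g: "has_strong_integral M g J"
  shows "norm (I - J) \<le> L1_seminorm M (\<lambda>x. f x - g x)"
proof -
  obtain \<phi> where \<phi>: "strongly_integrable M f" "\<And>i. simple_bochner_integrable M (\<phi> i)"
    "(\<lambda>i. L1_seminorm M (\<lambda>x. f x - \<phi> i x)) \<longlonglongrightarrow> 0" "(\<lambda>i. simple_bochner_integral M (\<phi> i)) \<longlonglongrightarrow> I"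
    using f by (rule has_strong_integralE) blast
  obtain \<psi> where \<psi>: "strongly_integrable M g" "\<And>i. simple_bochner_integrable M (\<psi> i)"
    "(\<lambda>i. L1_seminorm M (\<lambda>x. g x - \<psi> i x)) \<longlonglongrightarrow> 0" "(\<lambda>i. simple_bochner_integral M (\<psi> i)) \<longlonglongrightarrow> J"
    using g by (rule has_strong_integralE) blast
  note si = simple_bochner_strongly_integrable[OF \<phi>(2)] simple_bochner_strongly_integrable[OF \<psi>(2)]
  have le: "norm (simple_bochner_integral M (\<phi> i) - simple_bochner_integral M (\<psi> i)) \<le>
     L1_seminorm M (\<lambda>x. f x - g x) + L1_seminorm M (\<lambda>x. f x - \<phi> i x) + L1_seminorm M (\<lambda>x. g x - \<psi> i x)" for i
  proof -
    have "L1_seminorm M (\<lambda>x. \<phi> i x - \<psi> i x) \<le>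
        L1_seminorm M (\<lambda>x. f x - \<phi> i x) + L1_seminorm M (\<lambda>x. f x - \<psi> i x)"
      by (rule L1_seminorm_triangle_sub[OF si(1) \<phi>(1) si(2)])
    also have "L1_seminorm M (\<lambda>x. f x - \<psi> i x) \<le> 
        L1_seminorm M (\<lambda>x. g x - f x) + L1_seminorm M (\<lambda>x. g x - \<psi> i x)"
      by (rule L1_seminorm_triangle_sub[OF \<phi>(1) \<psi>(1) si(2)])
    finally show ?thesis
      using simple_bochner_integral_norm_le[OF \<phi>(2) \<psi>(2), of i i] by (simp add: L1_seminorm_commute[of M g f])
  qed
  have "(\<lambda>i. norm (simple_bochner_integral M (\<phi> i) - simple_bochner_integral M (\<psi> i))) \<longlonglongrightarrow> norm (I - J)"
    by (intro tendsto_intros \<phi> \<psi>)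
  moreover have "(\<lambda>i. L1_seminorm M (\<lambda>x. f x - g x) + L1_seminorm M (\<lambda>x. f x - \<phi> i x) + L1_seminorm M (\<lambda>x. g x - \<psi> i x))
      \<longlonglongrightarrow> L1_seminorm M (\<lambda>x. f x - g x) + 0 + 0"
    by (intro tendsto_intros \<phi> \<psi>)
  ultimately show ?thesis
    using le by (intro LIMSEQ_le[where Y="\<lambda>i. L1_seminorm M (\<lambda>x. f x - g x) + L1_seminorm M (\<lambda>x. f x - \<phi> i x) + L1_seminorm M (\<lambda>x. g x - \<psi> i x)"]) auto
qed

lemma has_strong_integral_unique:
  assumes "has_strong_integral M f I" "has_strong_integral M f J"
  shows "I = J"
  using has_strong_integral_dist_le[OF assms] by (simp add: L1_seminorm_def)

lemma strong_integral_eqI: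
  fixes f :: "'x \<Rightarrow> 'b::real_normed_vector"
  assumes "has_strong_integral M f I"
  shows "strong_integral M f = I"
proof -
  have f: "strongly_integrable M f" using assms by (simp add: has_strong_integral_def)
  have "((\<lambda>i. \<integral>\<^sup>+x. ennreal (norm (f x - \<phi> i x)) \<partial>M) \<longlonglongrightarrow> 0) = 
        ((\<lambda>i. L1_seminorm M (\<lambda>x. f x - \<phi> i x)) \<longlonglongrightarrow> 0)"
    if "\<forall>i. simple_bochner_integrable M (\<phi> i)" for \<phi> :: "nat \<Rightarrow> 'x \<Rightarrow> 'b"
  proof -
    have "strongly_integrable M (\<lambda>x. f x - \<phi> i x)" for i
      using f simple_bochner_strongly_integrable that by (intro strongly_integrable_minus) auto
    then have eq: "(\<integral>\<^sup>+x. ennreal (norm (f x - \<phi> i x)) \<partial>M) = ennreal (L1_seminorm M (\<lambda>x. f x - \<phi> i x))" for i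
      by (rule nn_integral_eq_L1_seminorm)
    show ?thesis unfolding eq using tendsto_ennreal_iff[of "\<lambda>i. L1_seminorm M (\<lambda>x. f x - \<phi> i x)" sequentially 0]
      by (simp add: L1_seminorm_nonneg)
  qed
  then have "(\<exists>\<phi>. (\<forall>i. simple_bochner_integrable M (\<phi> i)) \<and>
                      (\<lambda>i. \<integral>\<^sup>+x. ennreal (norm (f x - \<phi> i x)) \<partial>M) \<longlonglongrightarrow> 0 \<and>
                      (\<lambda>i. simple_bochner_integral M (\<phi> i)) \<longlonglongrightarrow> J) \<longleftrightarrow> has_strong_integral M f J" for J
    unfolding has_strong_integral_def using f by blast
  then have "strong_integral M f = (THE I. has_strong_integral M f I)"
    using f by (simp add: strong_integral_def)
  also have "\<dots> = I" using assms has_strong_integral_unique by (intro the_equality) auto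
  finally show ?thesis .
qed

lemma strongly_integrable_simple_approximation:
  fixes f :: "'x \<Rightarrow> 'b::real_normed_vector"
  assumes f: "strongly_integrable M f"
  obtains \<phi> where "\<And>i. simple_bochner_integrable M (\<phi> i)" "(\<lambda>i. L1_seminorm M (\<lambda>x. f x - \<phi> i x)) \<longlonglongrightarrow> 0"
proof -
  obtain g where g: "sep_measurable M g" "integrable M (\<lambda>x. norm (g x))" "AE x in M. f x = g x"
    using f strongly_integrable_iff_sep by blast
  obtain \<phi> where \<phi>: "\<And>i. simple_function M (\<phi> i)" "\<And>x. x \<in> space M \<Longrightarrow> (\<lambda>i. \<phi> i x) \<longlonglongrightarrow> g x"
    "\<And>i x. norm (g x - \<phi> i x) \<le> norm (g x)"
    using sep_measurable_simple_approximation[OF g(1)] by metis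
  have le: "norm (\<phi> i x) \<le> norm (2 *\<^sub>R g x)" for i x
    using \<phi>(3)[of x i] norm_triangle_ineq2[of "\<phi> i x" "g x"] by (simp add: norm_minus_commute)
  have w: "strongly_integrable M (\<lambda>x. 2 *\<^sub>R g x)"
    using g by (intro strongly_integrable_scale strongly_integrable_norm_sep)
  have sm: "strongly_measurable M (\<phi> i)" for i
    by (intro sep_imp_strongly_measurable sep_measurable_simple_function \<phi>)
  have "strongly_integrable M (\<phi> i)" for i
    using sm w le by (intro strongly_integrable_dominated[OF _ w]) auto
  then have sbi: "simple_bochner_integrable M (\<phi> i)" for i
    using \<phi>(1) by (intro simple_bochner_integrableI_bounded) (auto simp: strongly_integrable_def)
  have "(\<lambda>i. L1_seminorm M (\<lambda>x. \<phi> i x - f x)) \<longlonglongrightarrow> 0"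
  proof (rule L1_seminorm_dominated_convergence[OF sm w])
    show "AE x in M. (\<lambda>i. \<phi> i x) \<longlonglongrightarrow> f x" using g(3) AE_space by eventually_elim (simp add: \<phi>)
  qed (use le in auto)
  then have "(\<lambda>i. L1_seminorm M (\<lambda>x. f x - \<phi> i x)) \<longlonglongrightarrow> 0" by (simp add: L1_seminorm_commute[of M f])
  with sbi show ?thesis by (rule that)
qed

lemma has_strong_integral_strong_integral:
  fixes f :: "'x \<Rightarrow> 'b::banach"
  assumes f: "strongly_integrable M f"
  shows "has_strong_integral M f (strong_integral M f)"
proof -
  obtain \<phi> where \<phi>: "\<And>i. simple_bochner_integrable M (\<phi> i)" "(\<lambda>i. L1_seminorm M (\<lambda>x. f x - \<phi> i x)) \<longlonglongrightarrow> 0"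
    using strongly_integrable_simple_approximation[OF f] by metis
  have "Cauchy (\<lambda>i. simple_bochner_integral M (\<phi> i))"
  proof (rule metric_CauchyI)
    fix e :: real assume "0 < e"
    then have "\<forall>\<^sub>F i in sequentially. L1_seminorm M (\<lambda>x. f x - \<phi> i x) < e / 2"
      using order_tendstoD(2)[OF \<phi>(2), of "e / 2"] by simp
    then obtain N where N: "\<And>i. N \<le> i \<Longrightarrow> L1_seminorm M (\<lambda>x. f x - \<phi> i x) < e / 2"
      unfolding eventually_sequentially by blast
    have "dist (simple_bochner_integral M (\<phi> i)) (simple_bochner_integral M (\<phi> j)) < e" if "N \<le> i" "N \<le> j" for i j
    proof -
      have "dist (simple_bochner_integral M (\<phi> i)) (simple_bochner_integral M (\<phi> j)) \<le> L1_seminorm M (\<lambda>x. \<phi> i x - \<phi> j x)"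
        unfolding dist_norm by (rule simple_bochner_integral_norm_le[OF \<phi>(1) \<phi>(1)])
      also have "\<dots> \<le> L1_seminorm M (\<lambda>x. f x - \<phi> i x) + L1_seminorm M (\<lambda>x. f x - \<phi> j x)"
        by (rule L1_seminorm_triangle_sub) (auto intro: f simple_bochner_strongly_integrable \<phi>)
      finally show ?thesis using N[OF that(1)] N[OF that(2)] by simp
    qed
    then show "\<exists>N. \<forall>i\<ge>N. \<forall>j\<ge>N. dist (simple_bochner_integral M (\<phi> i)) (simple_bochner_integral M (\<phi> j)) < e" by blast
  qed
  then obtain I where "(\<lambda>i. simple_bochner_integral M (\<phi> i)) \<longlonglongrightarrow> I"
    using Cauchy_convergent convergent_def by blast
  then have "has_strong_integral M f I" by (rule has_strong_integralI[OF f \<phi>])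
  with strong_integral_eqI show ?thesis by metis
qed

lemma norm_strong_integral_diff_le:
  fixes f g :: "'x \<Rightarrow> 'b::banach"
  assumes "strongly_integrable M f" "strongly_integrable M g"
  shows "norm (strong_integral M f - strong_integral M g) \<le> L1_seminorm M (\<lambda>x. f x - g x)"
  using assms by (intro has_strong_integral_dist_le has_strong_integral_strong_integral)

lemma has_strong_integral_simple:
  "simple_bochner_integrable M \<phi> \<Longrightarrow> has_strong_integral M \<phi> (simple_bochner_integral M \<phi>)"
  by (rule has_strong_integralI[of _ _ "\<lambda>i. \<phi>"])
    (auto intro: simple_bochner_strongly_integrable simp: L1_seminorm_def)

lemma strong_integral_zero: "strong_integral M (\<lambda>x. 0 :: 'b::real_normed_vector) = 0"
proof -
  have "simple_bochner_integrable M (\<lambda>x. 0 :: 'b)" by (simp add: simple_bochner_integrable.simps)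
  from strong_integral_eqI[OF has_strong_integral_simple[OF this]] show ?thesis
    by (auto simp: simple_bochner_integral_def intro!: sum.neutral)
qed

lemma norm_strong_integral_le:
  fixes f :: "'x \<Rightarrow> 'b::banach"
  assumes "strongly_integrable M f"
  shows "norm (strong_integral M f) \<le> L1_seminorm M f"
  using norm_strong_integral_diff_le[OF assms strongly_integrable_zero] by (simp add: strong_integral_zero)

lemma strong_integral_cong_AE:
  fixes f g :: "'x \<Rightarrow> 'b::real_normed_vector"
  assumes "AE x in M. f x = g x"
  shows "strong_integral M f = strong_integral M g"
proof -
  have "(\<integral>\<^sup>+x. ennreal (norm (f x - h x)) \<partial>M) = (\<integral>\<^sup>+x. ennreal (norm (g x - h x)) \<partial>M)" for h
    using assms by (intro nn_integral_cong_AE) auto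
  then show ?thesis
    unfolding strong_integral_def strongly_integrable_cong_AE[OF assms] by simp
qed

lemma has_strong_integral_bounded_linear:
  fixes f :: "'x \<Rightarrow> 'b::real_normed_vector" and T :: "'b \<Rightarrow> 'c::real_normed_vector"
  assumes T: "bounded_linear T" and f: "has_strong_integral M f I"
  shows "has_strong_integral M (\<lambda>x. T (f x)) (T I)"
proof -
  obtain \<phi> where \<phi>: "strongly_integrable M f" "\<And>i. simple_bochner_integrable M (\<phi> i)"
    "(\<lambda>i. L1_seminorm M (\<lambda>x. f x - \<phi> i x)) \<longlonglongrightarrow> 0" "(\<lambda>i. simple_bochner_integral M (\<phi> i)) \<longlonglongrightarrow> I"
    using f by (rule has_strong_integralE) blast
  obtain K where K: "0 \<le> K" "\<And>x. norm (T x) \<le> norm x * K" using bounded_linear.nonneg_bounded[OF T] by blast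
  note si = simple_bochner_strongly_integrable[OF \<phi>(2)]
  have T0: "T 0 = 0" using T by (simp add: linear_simps(3))
  have sbi: "simple_bochner_integrable M (\<lambda>x. T (\<phi> i x))" for i
    using simple_bochner_integrable_compose2[of "\<lambda>x y. T x" M "\<phi> i" "\<phi> i"] \<phi>(2) T0 by simp
  have le: "L1_seminorm M (\<lambda>x. T (f x) - T (\<phi> i x)) \<le> K * L1_seminorm M (\<lambda>x. f x - \<phi> i x)" for i
  proof -
    have s: "strongly_integrable M (\<lambda>x. f x - \<phi> i x)" using \<phi>(1) si by (rule strongly_integrable_minus)
    have "L1_seminorm M (\<lambda>x. T (f x) - T (\<phi> i x)) \<le> L1_seminorm M (\<lambda>x. K *\<^sub>R (f x - \<phi> i x))"
    proof (rule L1_seminorm_mono_AE)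
      show "strongly_integrable M (\<lambda>x. K *\<^sub>R (f x - \<phi> i x))" using s by (rule strongly_integrable_scale)
      show "AE x in M. norm (T (f x) - T (\<phi> i x)) \<le> norm (K *\<^sub>R (f x - \<phi> i x))"
        using K linear_simps(2)[OF T] by (intro AE_I2) (metis abs_of_nonneg mult.commute norm_scaleR)
    qed
    also have "\<dots> = K * L1_seminorm M (\<lambda>x. f x - \<phi> i x)" using s K(1) by (simp add: L1_seminorm_scale)
    finally show ?thesis .
  qed
  show ?thesis
  proof (rule has_strong_integralI)
    show "strongly_integrable M (\<lambda>x. T (f x))" using T \<phi>(1) by (rule strongly_integrable_bounded_linear)
    show "(\<lambda>i. L1_seminorm M (\<lambda>x. T (f x) - T (\<phi> i x))) \<longlonglongrightarrow> 0"
    proof (rule tendsto_sandwich[OF _ _ tendsto_const])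
      show "(\<lambda>i. K * L1_seminorm M (\<lambda>x. f x - \<phi> i x)) \<longlonglongrightarrow> 0"
        using tendsto_mult_left[OF \<phi>(3), of K] by simp
    qed (auto intro!: always_eventually le L1_seminorm_nonneg)
    have "simple_bochner_integral M (\<lambda>x. T (\<phi> i x)) = T (simple_bochner_integral M (\<phi> i))" for i
      by (rule simple_bochner_integral_linear[OF bounded_linear.linear[OF T] \<phi>(2)])
    then show "(\<lambda>i. simple_bochner_integral M (\<lambda>x. T (\<phi> i x))) \<longlonglongrightarrow> T I"
      using bounded_linear.tendsto[OF T \<phi>(4)] by simp
  qed (rule sbi)
qed

lemma strong_integral_bounded_linear:
  fixes f :: "'x \<Rightarrow> 'b::banach" and T :: "'b \<Rightarrow> 'c::real_normed_vector"
  assumes "bounded_linear T" "strongly_integrable M f"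
  shows "strong_integral M (\<lambda>x. T (f x)) = T (strong_integral M f)"
  by (rule has_strong_integral_bounded_linear[OF assms(1) has_strong_integral_strong_integral[OF assms(2)],
        THEN strong_integral_eqI])

lemma strong_integral_scaleR:
  fixes f :: "'x \<Rightarrow> 'b::banach"
  shows "strongly_integrable M f \<Longrightarrow> strong_integral M (\<lambda>x. c *\<^sub>R f x) = c *\<^sub>R strong_integral M f"
  by (rule strong_integral_bounded_linear[OF bounded_linear_scaleR_right])

lemma has_strong_integral_add:
  fixes f g :: "'x \<Rightarrow> 'b::real_normed_vector"
  assumes f: "has_strong_integral M f I" and g: "has_strong_integral M g J"
  shows "has_strong_integral M (\<lambda>x. f x + g x) (I + J)"
proof -
  obtain \<phi> where \<phi>: "strongly_integrable M f" "\<And>i. simple_bochner_integrable M (\<phi> i)"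
    "(\<lambda>i. L1_seminorm M (\<lambda>x. f x - \<phi> i x)) \<longlonglongrightarrow> 0" "(\<lambda>i. simple_bochner_integral M (\<phi> i)) \<longlonglongrightarrow> I"
    using f by (rule has_strong_integralE) blast
  obtain \<psi> where \<psi>: "strongly_integrable M g" "\<And>i. simple_bochner_integrable M (\<psi> i)"
    "(\<lambda>i. L1_seminorm M (\<lambda>x. g x - \<psi> i x)) \<longlonglongrightarrow> 0" "(\<lambda>i. simple_bochner_integral M (\<psi> i)) \<longlonglongrightarrow> J"
    using g by (rule has_strong_integralE) blast
  note si = simple_bochner_strongly_integrable[OF \<phi>(2)] simple_bochner_strongly_integrable[OF \<psi>(2)]
  have le: "L1_seminorm M (\<lambda>x. (f x + g x) - (\<phi> i x + \<psi> i x)) \<le>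
      L1_seminorm M (\<lambda>x. f x - \<phi> i x) + L1_seminorm M (\<lambda>x. g x - \<psi> i x)" for i
    using L1_seminorm_triangle[OF strongly_integrable_minus[OF \<phi>(1) si(1)] strongly_integrable_minus[OF \<psi>(1) si(2)], of i i]
    by (simp add: algebra_simps)
  show ?thesis
  proof (rule has_strong_integralI)
    show "strongly_integrable M (\<lambda>x. f x + g x)" using \<phi>(1) \<psi>(1) by (rule strongly_integrable_plus)
    show "simple_bochner_integrable M (\<lambda>x. \<phi> i x + \<psi> i x)" for i
      using simple_bochner_integrable_compose2[of "(+)" M "\<phi> i" "\<psi> i"] \<phi>(2) \<psi>(2) by simp
    show "(\<lambda>i. L1_seminorm M (\<lambda>x. (f x + g x) - (\<phi> i x + \<psi> i x))) \<longlonglongrightarrow> 0"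
    proof (rule tendsto_sandwich[OF _ _ tendsto_const])
      show "(\<lambda>i. L1_seminorm M (\<lambda>x. f x - \<phi> i x) + L1_seminorm M (\<lambda>x. g x - \<psi> i x)) \<longlonglongrightarrow> 0"
        using tendsto_add[OF \<phi>(3) \<psi>(3)] by simp
    qed (auto intro!: always_eventually le L1_seminorm_nonneg)
    show "(\<lambda>i. simple_bochner_integral M (\<lambda>x. \<phi> i x + \<psi> i x)) \<longlonglongrightarrow> I + J"
      using tendsto_add[OF \<phi>(4) \<psi>(4)] by (simp add: simple_bochner_integral_add \<phi> \<psi>)
  qed
qed

lemma strong_integral_add:
  fixes f g :: "'x \<Rightarrow> 'b::banach"
  assumes "strongly_integrable M f" "strongly_integrable M g"
  shows "strong_integral M (\<lambda>x. f x + g x) = strong_integral M f + strong_integral M g"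
  using assms by (intro strong_integral_eqI has_strong_integral_add has_strong_integral_strong_integral)

lemma strong_integral_diff:
  fixes f g :: "'x \<Rightarrow> 'b::banach"
  assumes "strongly_integrable M f" "strongly_integrable M g"
  shows "strong_integral M (\<lambda>x. f x - g x) = strong_integral M f - strong_integral M g"
  using strong_integral_add[OF assms(1) strongly_integrable_scale[OF assms(2), of "-1"]]
    strong_integral_scaleR[OF assms(2), of "-1"] by simp

lemma strong_integral_sum:
  fixes f :: "'i \<Rightarrow> 'x \<Rightarrow> 'b::banach"
  assumes "\<And>i. i \<in> I \<Longrightarrow> strongly_integrable M (f i)"
  shows "strong_integral M (\<lambda>x. \<Sum>i\<in>I. f i x) = (\<Sum>i\<in>I. strong_integral M (f i))"
  using assms
proof (induction I rule: infinite_finite_induct)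
  case (insert i I)
  then show ?case
    using strong_integral_add[of M "f i" "\<lambda>x. \<Sum>i\<in>I. f i x"] strongly_integrable_sum[of I M f] by simp
qed (simp_all add: strong_integral_zero)

lemma strong_integral_dominated_convergence:
  fixes f :: "nat \<Rightarrow> 'x \<Rightarrow> 'b::banach" and w :: "'x \<Rightarrow> 'c::real_normed_vector"
  assumes f: "\<And>n. strongly_measurable M (f n)" and w: "strongly_integrable M w"
    and le: "\<And>n. AE x in M. norm (f n x) \<le> norm (w x)"
    and lim: "AE x in M. (\<lambda>n. f n x) \<longlonglongrightarrow> g x"
  shows "(\<lambda>n. strong_integral M (f n)) \<longlonglongrightarrow> strong_integral M g"
proof -
  note g = L1_seminorm_dominated_convergence[OF f w le lim]
  have "strongly_integrable M (f n)" for n using f w le by (rule strongly_integrable_dominated)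
  then have "norm (strong_integral M (f n) - strong_integral M g) \<le> L1_seminorm M (\<lambda>x. f n x - g x)" for n
    using g(1) by (rule norm_strong_integral_diff_le)
  then show ?thesis
    by (intro LIM_zero_cancel[OF Lim_null_comparison[OF _ g(2)]]) auto
qed

lemma integrable_real_strongly_integrable_scaleR:
  fixes f :: "'x \<Rightarrow> real" and c :: "'b::banach"
  assumes f: "integrable M f"
  shows "strongly_integrable M (\<lambda>x. f x *\<^sub>R c)" "strong_integral M (\<lambda>x. f x *\<^sub>R c) = (LINT x|M. f x) *\<^sub>R c"
  using strongly_integrable_bounded_linear[OF bounded_linear_scaleR_left integrable_imp_strongly_integrable[OF f]]
    strong_integral_bounded_linear[OF bounded_linear_scaleR_left integrable_imp_strongly_integrable[OF f]]
    strong_integral_eq_lebesgue_integral[OF f] by auto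

text \<open>
  The distance \<open>d\<close> to the cone is subadditive and positively homogeneous. For a
  simple function \<open>\<phi>\<close> it follows that \<open>d\<close> of the integral of
  \<open>\<phi>\<close> is at most the integral of \<open>d \<circ> \<phi>\<close>, and this is at
  most the integral of \<open>norm (f - \<phi>)\<close> because \<open>f\<close> has values in the
  cone. Along approximating \<open>\<phi>\<close> the distance tends to \<open>0\<close>, and the
  cone is closed.
\<close>
lemma strong_integral_nonneg:
  fixes f :: "'x \<Rightarrow> 'b::{banach, ordered_real_vector}"
  assumes cl: "closed {u::'b. 0 \<le> u}" and f: "strongly_integrable M f" and pos: "AE x in M. 0 \<le> f x"
  shows "0 \<le> strong_integral M f"
proof -
  define P where "P = {u::'b. 0 \<le> u}"
  define d where "d = (\<lambda>x::'b. infdist x P)"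
  have P0: "P \<noteq> {}" by (auto simp: P_def)
  have mem: "x \<in> P \<longleftrightarrow> 0 \<le> x" for x by (simp add: P_def)
  have dP: "d x = 0 \<longleftrightarrow> 0 \<le> x" for x
    using in_closed_iff_infdist_zero[OF cl[folded P_def] P0, of x] mem[of x] unfolding d_def by metis
  have d0: "0 \<le> d x" for x by (simp add: d_def infdist_nonneg)
  have dle: "d x \<le> norm (y - x)" if "0 \<le> y" for x y
    unfolding d_def using infdist_le[of y P x] that by (simp add: P_def dist_norm norm_minus_commute)
  have near: "\<exists>u\<ge>0. norm (x - u) < d x + e" if "e > 0" for x e
  proof -
    have "\<exists>u\<in>P. dist x u < d x + e"
      unfolding d_def using P0 that by (intro cINF_less_iff[THEN iffD1, of P "dist x" "infdist x P + e"]) 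
        (auto simp: infdist_notempty[OF P0])
    then show ?thesis by (auto simp: P_def dist_norm)
  qed
  have dadd: "d (x + y) \<le> d x + d y" for x y
  proof (rule field_le_epsilon)
    fix e :: real assume e: "0 < e"
    obtain u where u: "0 \<le> u" "norm (x - u) < d x + e / 2" using near[of "e / 2" x] e by auto
    obtain v where v: "0 \<le> v" "norm (y - v) < d y + e / 2" using near[of "e / 2" y] e by auto
    have "d (x + y) \<le> norm (u + v - (x + y))" using u v by (intro dle) simp
    also have "\<dots> \<le> norm (x - u) + norm (y - v)"
      using norm_triangle_ineq[of "u - x" "v - y"] by (simp add: algebra_simps norm_minus_commute)
    finally show "d (x + y) \<le> d x + d y + e" using u v by simp
  qed
  have dscale: "d (c *\<^sub>R x) \<le> c * d x" if c: "0 \<le> c" for c x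
  proof (cases "c = 0")
    case True
    then show ?thesis using dle[of 0 0] d0[of 0] by simp
  next
    case False
    then have c: "0 < c" using c by simp
    show ?thesis
    proof (rule field_le_epsilon)
      fix e :: real assume e: "0 < e"
      obtain u where u: "0 \<le> u" "norm (x - u) < d x + e / c" using near[of "e / c" x] e c by auto
      have "d (c *\<^sub>R x) \<le> norm (c *\<^sub>R u - c *\<^sub>R x)" using u c by (intro dle) (simp add: scaleR_nonneg_nonneg)
      also have "\<dots> = c * norm (x - u)"
        using c by (simp add: norm_minus_commute flip: scaleR_diff_right)
      also have "\<dots> \<le> c * (d x + e / c)" using u c by simp
      also have "\<dots> = c * d x + e" using c by (simp add: distrib_left)
      finally show "d (c *\<^sub>R x) \<le> c * d x + e" .
    qed
  qed
  have dsum: "d (\<Sum>i\<in>I. h i) \<le> (\<Sum>i\<in>I. d (h i))" for I and h :: "'b \<Rightarrow> 'b"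
  proof (induction I rule: infinite_finite_induct)
    case (insert i I)
    then show ?case using dadd[of "h i" "\<Sum>i\<in>I. h i"] by simp
  qed (use dP[of 0] in auto)
  obtain \<phi> where \<phi>: "strongly_integrable M f" "\<And>i. simple_bochner_integrable M (\<phi> i)"
    "(\<lambda>i. L1_seminorm M (\<lambda>x. f x - \<phi> i x)) \<longlonglongrightarrow> 0"
    "(\<lambda>i. simple_bochner_integral M (\<phi> i)) \<longlonglongrightarrow> strong_integral M f"
    using has_strong_integral_strong_integral[OF f] by (rule has_strong_integralE) blast
  have le: "d (simple_bochner_integral M (\<phi> i)) \<le> L1_seminorm M (\<lambda>x. f x - \<phi> i x)" for i
  proof -
    have sbi: "simple_bochner_integrable M (\<lambda>x. d (\<phi> i x))"
      using simple_bochner_integrable_compose2[of "\<lambda>x y. d x" M "\<phi> i" "\<phi> i"] \<phi>(2) dP[of 0] by simp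
    have "d (simple_bochner_integral M (\<phi> i)) \<le>
       (\<Sum>y\<in>\<phi> i ` space M. d (measure M {x \<in> space M. \<phi> i x = y} *\<^sub>R y))"
      unfolding simple_bochner_integral_def by (rule dsum)
    also have "\<dots> \<le> (\<Sum>y\<in>\<phi> i ` space M. measure M {x \<in> space M. \<phi> i x = y} *\<^sub>R d y)"
      by (intro sum_mono) (simp add: dscale)
    also have "\<dots> = simple_bochner_integral M (\<lambda>x. d (\<phi> i x))"
      using \<phi>(2)[of i] dP[of 0] by (intro simple_bochner_integral_partition[symmetric] sbi)
        (auto simp: simple_bochner_integrable.simps)
    finally have "ennreal (d (simple_bochner_integral M (\<phi> i))) \<le> ennreal (simple_bochner_integral M (\<lambda>x. d (\<phi> i x)))"
      by (rule ennreal_leI)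
    also have "\<dots> = (\<integral>\<^sup>+x. ennreal (d (\<phi> i x)) \<partial>M)"
      using sbi d0 by (rule simple_bochner_integral_eq_nn_integral)
    also have "\<dots> \<le> (\<integral>\<^sup>+x. ennreal (norm (f x - \<phi> i x)) \<partial>M)"
      using pos by (intro nn_integral_mono_AE) (auto intro!: ennreal_leI dle)
    also have "\<dots> = ennreal (L1_seminorm M (\<lambda>x. f x - \<phi> i x))"
      by (intro nn_integral_eq_L1_seminorm strongly_integrable_minus f simple_bochner_strongly_integrable \<phi>)
    finally show ?thesis by (simp add: L1_seminorm_nonneg)
  qed
  have "(\<lambda>i. d (simple_bochner_integral M (\<phi> i))) \<longlonglongrightarrow> d (strong_integral M f)"
    unfolding d_def by (intro tendsto_infdist \<phi>)
  moreover have "(\<lambda>i. d (simple_bochner_integral M (\<phi> i))) \<longlonglongrightarrow> 0"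
    by (rule tendsto_sandwich[OF _ _ tendsto_const \<phi>(3)]) (use le d0 in auto)
  ultimately have "d (strong_integral M f) = 0" by (rule LIMSEQ_unique)
  then show ?thesis by (simp add: dP)
qed

subsection \<open>Restriction and completion\<close>

text \<open>
  Integrals over \<^term>\<open>lebesgue_on S\<close> are expressed by integrals over
  \<^term>\<open>lborel\<close>, where products of measures are again Borel and translations are
  available.
\<close>

lemma has_strong_integral_completion:
  fixes f :: "'x \<Rightarrow> 'b::real_normed_vector"
  assumes "has_strong_integral M f I"
  shows "has_strong_integral (completion M) f I"
proof -
  obtain \<phi> where \<phi>: "strongly_integrable M f" "\<And>i. simple_bochner_integrable M (\<phi> i)"
    "(\<lambda>i. L1_seminorm M (\<lambda>x. f x - \<phi> i x)) \<longlonglongrightarrow> 0" "(\<lambda>i. simple_bochner_integral M (\<phi> i)) \<longlonglongrightarrow> I"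
    using assms by (rule has_strong_integralE) blast
  have sf: "simple_function M (\<phi> i)" for i using \<phi>(2) by (auto elim: simple_bochner_integrable.cases)
  have sets: "{x \<in> space M. \<phi> i x = y} \<in> sets M" for i y
    using simple_functionD(2)[OF sf, of i "{y}"] by (simp add: vimage_def Int_def conj_commute)
  have sets': "{x \<in> space M. \<phi> i x \<noteq> 0} \<in> sets M" for i
    using sets.compl_sets[OF sets[of i 0]] by (rule back_subst[where P="\<lambda>A. A \<in> sets M"]) auto
  show ?thesis
  proof (rule has_strong_integralI)
    show "strongly_integrable (completion M) f"
      using \<phi>(1) by (simp add: strongly_integrable_def strongly_measurable_completion nn_integral_completion)
    show "simple_bochner_integrable (completion M) (\<phi> i)" for i
      using \<phi>(2)[of i] sets'[of i] simple_function_completion[OF sf[of i]]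
      by (simp add: simple_bochner_integrable.simps emeasure_completion)
    show "(\<lambda>i. L1_seminorm (completion M) (\<lambda>x. f x - \<phi> i x)) \<longlonglongrightarrow> 0"
      using \<phi>(3) by (simp add: L1_seminorm_def nn_integral_completion)
    show "(\<lambda>i. simple_bochner_integral (completion M) (\<phi> i)) \<longlonglongrightarrow> I"
      using \<phi>(4) sets by (simp add: simple_bochner_integral_def)
  qed
qed

lemma strongly_integrable_restrict_space:
  fixes f :: "'x \<Rightarrow> 'b::real_normed_vector"
  assumes S: "S \<inter> space M \<in> sets M"
  shows "strongly_integrable (restrict_space M S) f \<longleftrightarrow> strongly_integrable M (\<lambda>x. indicator S x *\<^sub>R f x)"
proof -
  have "(\<integral>\<^sup>+x. ennreal (norm (f x)) \<partial>(restrict_space M S)) = (\<integral>\<^sup>+x. ennreal (norm (indicator S x *\<^sub>R f x)) \<partial>M)"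
    using S by (subst nn_integral_restrict_space) (auto intro!: nn_integral_cong simp: indicator_def)
  then show ?thesis
    by (simp add: strongly_integrable_def strongly_measurable_restrict_space[OF S])
qed

lemma has_strong_integral_restrict_space:
  fixes f :: "'x \<Rightarrow> 'b::real_normed_vector"
  assumes S: "S \<inter> space M \<in> sets M" and f: "has_strong_integral M (\<lambda>x. indicator S x *\<^sub>R f x) I"
  shows "has_strong_integral (restrict_space M S) f I"
proof -
  obtain \<phi> where \<phi>: "strongly_integrable M (\<lambda>x. indicator S x *\<^sub>R f x)" "\<And>i. simple_bochner_integrable M (\<phi> i)"
    "(\<lambda>i. L1_seminorm M (\<lambda>x. indicator S x *\<^sub>R f x - \<phi> i x)) \<longlonglongrightarrow> 0" 
    "(\<lambda>i. simple_bochner_integral M (\<phi> i)) \<longlonglongrightarrow> I"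
    using f by (rule has_strong_integralE) blast
  define \<psi> where "\<psi> = (\<lambda>i x. indicator (S \<inter> space M) x *\<^sub>R \<phi> i x)"
  have "simple_bochner_integrable M (\<lambda>x. indicator (S \<inter> space M) x *\<^sub>R \<phi> i x)" for i
  proof (rule simple_bochner_integrable.intros)
    show "simple_function M (\<lambda>x. indicator (S \<inter> space M) x *\<^sub>R \<phi> i x)"
      using \<phi>(2)[of i] S
      by (intro simple_function_compose2[where h="(*\<^sub>R)"] simple_function_indicator)
         (auto elim: simple_bochner_integrable.cases)
    have "emeasure M {y \<in> space M. indicator (S \<inter> space M) y *\<^sub>R \<phi> i y \<noteq> 0} \<le> emeasure M {y \<in> space M. \<phi> i y \<noteq> 0}"
    proof (rule emeasure_mono)
      have "simple_function M (\<phi> i)" using \<phi>(2)[of i] by (auto elim: simple_bochner_integrable.cases)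
      from sets.compl_sets[OF simple_functionD(2)[OF this, of "{0}"]]
      show "{y \<in> space M. \<phi> i y \<noteq> 0} \<in> sets M" by (rule back_subst[where P="\<lambda>A. A \<in> sets M"]) auto
    qed auto
    then show "emeasure M {y \<in> space M. indicator (S \<inter> space M) y *\<^sub>R \<phi> i y \<noteq> 0} \<noteq> \<infinity>"
      using \<phi>(2)[of i] by (auto simp: simple_bochner_integrable.simps top_unique)
  qed
  then have \<psi>: "simple_bochner_integrable M (\<psi> i)" for i by (simp add: \<psi>_def)
  have eq: "indicator S x *\<^sub>R \<phi> i x = \<psi> i x" if "x \<in> space M" for i x
    using that by (simp add: \<psi>_def indicator_def)
  have sbi: "simple_bochner_integrable M (\<lambda>x. indicator S x *\<^sub>R \<phi> i x)" for i
  proof -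
    have "simple_function M (\<lambda>x. indicator S x *\<^sub>R \<phi> i x) \<longleftrightarrow> simple_function M (\<psi> i)"
      by (rule simple_function_cong) (rule eq)
    moreover have "{y \<in> space M. indicator S y *\<^sub>R \<phi> i y \<noteq> 0} = {y \<in> space M. \<psi> i y \<noteq> 0}"
      by (intro Collect_cong conj_cong refl) (simp only: eq)
    ultimately show ?thesis using \<psi>[of i] unfolding simple_bochner_integrable.simps by simp
  qed
  note si = simple_bochner_strongly_integrable[OF \<phi>(2)] simple_bochner_strongly_integrable[OF sbi]
  have le: "L1_seminorm M (\<lambda>x. indicator S x *\<^sub>R f x - indicator S x *\<^sub>R \<phi> i x) \<le>
     L1_seminorm M (\<lambda>x. indicator S x *\<^sub>R f x - \<phi> i x)" for i
    by (rule L1_seminorm_mono_AE[OF strongly_integrable_minus[OF \<phi>(1) si(1)]])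
      (auto simp: indicator_def)
  have lim: "(\<lambda>i. L1_seminorm M (\<lambda>x. indicator S x *\<^sub>R f x - indicator S x *\<^sub>R \<phi> i x)) \<longlonglongrightarrow> 0"
    by (rule tendsto_sandwich[OF _ _ tendsto_const \<phi>(3)]) (auto intro!: always_eventually le L1_seminorm_nonneg)
  have I: "(\<lambda>i. simple_bochner_integral M (\<lambda>x. indicator S x *\<^sub>R \<phi> i x)) \<longlonglongrightarrow> I"
  proof -
    have le2: "norm (simple_bochner_integral M (\<lambda>x. indicator S x *\<^sub>R \<phi> i x) - simple_bochner_integral M (\<phi> i)) \<le>
      L1_seminorm M (\<lambda>x. indicator S x *\<^sub>R f x - indicator S x *\<^sub>R \<phi> i x) +
      L1_seminorm M (\<lambda>x. indicator S x *\<^sub>R f x - \<phi> i x)" for i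
      using simple_bochner_integral_norm_le[OF sbi \<phi>(2), of i i]
        L1_seminorm_triangle_sub[OF si(2) \<phi>(1) si(1), of i i] by simp
    have lim2: "(\<lambda>i. L1_seminorm M (\<lambda>x. indicator S x *\<^sub>R f x - indicator S x *\<^sub>R \<phi> i x) +
      L1_seminorm M (\<lambda>x. indicator S x *\<^sub>R f x - \<phi> i x)) \<longlonglongrightarrow> 0"
      using tendsto_add[OF lim \<phi>(3)] by simp
    have "(\<lambda>i. simple_bochner_integral M (\<lambda>x. indicator S x *\<^sub>R \<phi> i x) - simple_bochner_integral M (\<phi> i)) \<longlonglongrightarrow> 0"
      using le2 by (intro Lim_null_comparison[OF always_eventually lim2]) blast
    from tendsto_add[OF this \<phi>(4)] show ?thesis by simp
  qed
  have restr: "simple_bochner_integrable (restrict_space M S) (\<phi> i)" for i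
    using simple_bochner_integrable_restrict_space[OF S, of "\<phi> i"] sbi by simp
  show ?thesis
  proof (rule has_strong_integralI)
    show "strongly_integrable (restrict_space M S) f"
      using \<phi>(1) strongly_integrable_restrict_space[OF S] by blast
    have "L1_seminorm (restrict_space M S) (\<lambda>x. f x - \<phi> i x) =
      L1_seminorm M (\<lambda>x. indicator S x *\<^sub>R f x - indicator S x *\<^sub>R \<phi> i x)" for i
      unfolding L1_seminorm_def using S
      by (subst nn_integral_restrict_space) (auto intro!: arg_cong[where f=enn2real] nn_integral_cong simp: indicator_def)
    then show "(\<lambda>i. L1_seminorm (restrict_space M S) (\<lambda>x. f x - \<phi> i x)) \<longlonglongrightarrow> 0"
      using lim by simp
    show "(\<lambda>i. simple_bochner_integral (restrict_space M S) (\<phi> i)) \<longlonglongrightarrow> I"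
      using I by (simp add: simple_bochner_integral_restrict_space[OF S restr])
  qed (rule restr)
qed

lemma strongly_measurable_lebesgue_on:
  fixes f :: "'x::euclidean_space \<Rightarrow> 'b::real_normed_vector"
  assumes "S \<in> sets borel"
  shows "strongly_measurable (lebesgue_on S) f \<longleftrightarrow> strongly_measurable lborel (\<lambda>x. indicator S x *\<^sub>R f x)"
  using assms by (simp add: strongly_measurable_restrict_space strongly_measurable_completion)

lemma strongly_integrable_lebesgue_on:
  fixes f :: "'x::euclidean_space \<Rightarrow> 'b::real_normed_vector"
  assumes "S \<in> sets borel"
  shows "strongly_integrable (lebesgue_on S) f \<longleftrightarrow> strongly_integrable lborel (\<lambda>x. indicator S x *\<^sub>R f x)"
  using assms
  by (simp add: strongly_integrable_restrict_space strongly_integrable_def[of lebesgue] 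
      strongly_integrable_def[of lborel] strongly_measurable_completion nn_integral_completion)

lemma has_strong_integral_lebesgue_on:
  fixes f :: "'x::euclidean_space \<Rightarrow> 'b::real_normed_vector"
  assumes "S \<in> sets borel" "has_strong_integral lborel (\<lambda>x. indicator S x *\<^sub>R f x) I"
  shows "has_strong_integral (lebesgue_on S) f I"
  using assms by (intro has_strong_integral_restrict_space has_strong_integral_completion) auto

lemma strong_integral_lebesgue_on:
  fixes f :: "'x::euclidean_space \<Rightarrow> 'b::banach"
  assumes S: "S \<in> sets borel"
  shows "strong_integral (lebesgue_on S) f = strong_integral lborel (\<lambda>x. indicator S x *\<^sub>R f x)"
proof (cases "strongly_integrable (lebesgue_on S) f")
  case True
  then have "has_strong_integral lborel (\<lambda>x. indicator S x *\<^sub>R f x) (strong_integral lborel (\<lambda>x. indicator S x *\<^sub>R f x))"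
    using strongly_integrable_lebesgue_on[OF S] by (intro has_strong_integral_strong_integral) blast
  from has_strong_integral_lebesgue_on[OF S this] show ?thesis by (rule strong_integral_eqI)
next
  case False
  then show ?thesis
    using strongly_integrable_lebesgue_on[OF S, of f] by (simp add: strong_integral_def)
qed

subsection \<open>Measure preserving maps\<close>

lemma AE_measure_preserving:
  assumes T: "T \<in> measurable M N" "distr M N T = N" and P: "AE y in N. P y"
  shows "AE x in M. P (T x)"
  by (rule AE_distrD[OF T(1)]) (unfold T(2), rule P)

lemma strongly_measurable_distr:
  fixes f :: "'y \<Rightarrow> 'b::real_normed_vector"
  assumes T: "T \<in> measurable M N" "distr M N T = N" and f: "strongly_measurable N f"
  shows "strongly_measurable M (\<lambda>x. f (T x))"
proof -
  obtain g where g: "sep_measurable N g" "AE y in N. f y = g y"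
    using f strongly_measurable_iff_sep by blast
  have "AE x in M. f (T x) = g (T x)"
    by (rule AE_measure_preserving[OF T g(2)])
  with sep_measurable_compose[OF g(1) T(1)] show ?thesis
    using strongly_measurable_iff_sep by blast
qed

lemma nn_integral_norm_distr:
  fixes f :: "'y \<Rightarrow> 'b::real_normed_vector"
  assumes T: "T \<in> measurable M N" "distr M N T = N" and f: "strongly_measurable N f"
  shows "(\<integral>\<^sup>+x. ennreal (norm (f (T x))) \<partial>M) = (\<integral>\<^sup>+y. ennreal (norm (f y)) \<partial>N)"
proof -
  obtain g where g: "sep_measurable N g" "AE y in N. f y = g y"
    using f strongly_measurable_iff_sep by blast
  have "AE x in M. f (T x) = g (T x)"
    by (rule AE_measure_preserving[OF T g(2)])
  then have "(\<integral>\<^sup>+x. ennreal (norm (f (T x))) \<partial>M) = (\<integral>\<^sup>+x. ennreal (norm (g (T x))) \<partial>M)"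
    by (intro nn_integral_cong_AE) auto
  also have "\<dots> = (\<integral>\<^sup>+y. ennreal (norm (g y)) \<partial>distr M N T)"
    using sep_measurable_norm[OF g(1)] T(1) by (subst nn_integral_distr) auto
  also have "\<dots> = (\<integral>\<^sup>+y. ennreal (norm (f y)) \<partial>N)"
    unfolding T(2) using g(2) by (intro nn_integral_cong_AE) auto
  finally show ?thesis .
qed

lemma strongly_integrable_distr:
  fixes f :: "'y \<Rightarrow> 'b::real_normed_vector"
  assumes T: "T \<in> measurable M N" "distr M N T = N" and f: "strongly_integrable N f"
  shows "strongly_integrable M (\<lambda>x. f (T x))" "L1_seminorm M (\<lambda>x. f (T x)) = L1_seminorm N f"
  using strongly_measurable_distr[OF T, of f] nn_integral_norm_distr[OF T, of f] f
  by (auto simp: strongly_integrable_def L1_seminorm_def)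

lemma strong_integral_distr:
  fixes f :: "'y \<Rightarrow> 'b::banach"
  assumes T: "T \<in> measurable M N" "distr M N T = N" "T ` space M = space N" and f: "strongly_integrable N f"
  shows "strong_integral M (\<lambda>x. f (T x)) = strong_integral N f"
proof -
  obtain \<phi> where \<phi>: "strongly_integrable N f" "\<And>i. simple_bochner_integrable N (\<phi> i)"
    "(\<lambda>i. L1_seminorm N (\<lambda>x. f x - \<phi> i x)) \<longlonglongrightarrow> 0" 
    "(\<lambda>i. simple_bochner_integral N (\<phi> i)) \<longlonglongrightarrow> strong_integral N f"
    using has_strong_integral_strong_integral[OF f] by (rule has_strong_integralE) blast
  have sf: "simple_function N (\<phi> i)" for i using \<phi>(2) by (auto elim: simple_bochner_integrable.cases)
  have em: "emeasure M {x \<in> space M. P (T x)} = emeasure N {y \<in> space N. P y}"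
    if "{y \<in> space N. P y} \<in> sets N" for P
  proof -
    have "emeasure N {y \<in> space N. P y} = emeasure (distr M N T) {y \<in> space N. P y}" using T(2) by simp
    also have "\<dots> = emeasure M (T -` {y \<in> space N. P y} \<inter> space M)"
      using T(1) that by (rule emeasure_distr)
    also have "T -` {y \<in> space N. P y} \<inter> space M = {x \<in> space M. P (T x)}"
      using T(3) by auto
    finally show ?thesis ..
  qed
  have sets: "{x \<in> space N. \<phi> i x = y} \<in> sets N" for i y
    using simple_functionD(2)[OF sf, of i "{y}"] by (simp add: vimage_def Int_def conj_commute)
  have sets': "{x \<in> space N. \<phi> i x \<noteq> 0} \<in> sets N" for i
    using sets.compl_sets[OF sets[of i 0]] by (rule back_subst[where P="\<lambda>A. A \<in> sets N"]) auto
  have sbi: "simple_bochner_integrable M (\<lambda>x. \<phi> i (T x))" for i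
  proof (rule simple_bochner_integrable.intros)
    show "simple_function M (\<lambda>x. \<phi> i (T x))" using sf T(1) by (rule simple_function_comp[rotated])
    show "emeasure M {y \<in> space M. \<phi> i (T y) \<noteq> 0} \<noteq> \<infinity>"
      using em[OF sets'] \<phi>(2) by (auto simp: simple_bochner_integrable.simps)
  qed
  have int: "simple_bochner_integral M (\<lambda>x. \<phi> i (T x)) = simple_bochner_integral N (\<phi> i)" for i
  proof -
    have "(\<lambda>x. \<phi> i (T x)) ` space M = \<phi> i ` space N" using T(3) by (simp add: image_image[symmetric])
    then show ?thesis
      unfolding simple_bochner_integral_def Sigma_Algebra.measure_def using em[OF sets] by simp
  qed
  have "has_strong_integral M (\<lambda>x. f (T x)) (strong_integral N f)"
  proof (rule has_strong_integralI[where \<phi>="\<lambda>i x. \<phi> i (T x)"])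
    show "strongly_integrable M (\<lambda>x. f (T x))" by (rule strongly_integrable_distr[OF T(1,2) f])
    have "L1_seminorm M (\<lambda>x. f (T x) - \<phi> i (T x)) = L1_seminorm N (\<lambda>x. f x - \<phi> i x)" for i
      by (rule strongly_integrable_distr(2)[OF T(1,2)], intro strongly_integrable_minus f simple_bochner_strongly_integrable \<phi>)
    then show "(\<lambda>i. L1_seminorm M (\<lambda>x. f (T x) - \<phi> i (T x))) \<longlonglongrightarrow> 0" using \<phi>(3) by simp
    show "(\<lambda>i. simple_bochner_integral M (\<lambda>x. \<phi> i (T x))) \<longlonglongrightarrow> strong_integral N f"
      using \<phi>(4) int by simp
  qed (rule sbi)
  then show ?thesis by (rule strong_integral_eqI)
qed

lemma lborel_isometry:
  fixes c t :: real
  assumes "\<bar>c\<bar> = 1"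
  shows "(\<lambda>x. t + c * x) \<in> measurable lborel lborel" "distr lborel lborel (\<lambda>x. t + c * x) = lborel"
    "(\<lambda>x. t + c * x) ` space lborel = space (lborel :: real measure)"
proof -
  show "(\<lambda>x. t + c * x) \<in> measurable lborel lborel" by measurable
  have "c \<noteq> 0" using assms by auto
  then have "lborel = density (distr lborel borel (\<lambda>x. t + c * x)) (\<lambda>_. ennreal (abs c))"
    by (rule lborel_real_affine)
  then have "lborel = distr lborel borel (\<lambda>x. t + c * x)" using assms by (simp add: density_1)
  also have "\<dots> = distr lborel lborel (\<lambda>x. t + c * x)" by (rule distr_cong) auto
  finally show "distr lborel lborel (\<lambda>x. t + c * x) = lborel" ..
  have "c * c = 1" using assms by (metis abs_mult_self_eq mult_1)
  then have "t + c * (c * (y - t)) = y" for y by (simp flip: mult.assoc)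
  then show "(\<lambda>x. t + c * x) ` space lborel = space (lborel :: real measure)"
    by (auto simp: image_iff) metis
qed

lemma AE_lborel_isometry:
  fixes c t :: real
  assumes "\<bar>c\<bar> = 1" "AE x in lborel. P x"
  shows "AE x in lborel. P (t + c * x)"
  by (rule AE_measure_preserving[OF lborel_isometry(1,2)[OF assms(1)] assms(2)])

lemma strong_integral_lborel_isometry:
  fixes f :: "real \<Rightarrow> 'b::banach" and c t :: real
  assumes c: "\<bar>c\<bar> = 1"
  shows "strong_integral lborel (\<lambda>x. f (t + c * x)) = strong_integral lborel f"
proof (cases "strongly_integrable lborel f")
  case True
  then show ?thesis by (rule strong_integral_distr[OF lborel_isometry[OF c]])
next
  case False
  have "\<not> strongly_integrable lborel (\<lambda>x. f (t + c * x))"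
  proof
    assume "strongly_integrable lborel (\<lambda>x. f (t + c * x))"
    from strongly_integrable_distr(1)[OF lborel_isometry(1,2)[OF c, of "- c * t"] this]
    have "strongly_integrable lborel (\<lambda>x. f (t + c * (- c * t + c * x)))" .
    moreover consider "c = 1" | "c = -1" using c by linarith
    then have "t + c * (- c * t + c * x) = x" for x by cases auto
    ultimately show False using False by simp
  qed
  with False show ?thesis by (simp add: strong_integral_def)
qed

subsection \<open>Iterated integrals\<close>

text \<open>
  For a simple function the inner integral is a finite sum over its values, with the measures of
  the slices of the level sets as coefficients; these are measurable by the scalar theory. The
  simple approximations of \<open>H\<close> are bounded by \<open>2 * norm H\<close>, so their
  inner integrals converge by dominated convergence in each slice.
\<close>
lemma (in sigma_finite_measure) sep_measurable_strong_integral: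
  fixes H :: "'y \<times> 'a \<Rightarrow> 'b::banach"
  assumes H: "sep_measurable (N \<Otimes>\<^sub>M M) H"
    and int: "\<And>x. x \<in> space N \<Longrightarrow> strongly_integrable M (\<lambda>y. H (x, y))"
  shows "sep_measurable N (\<lambda>x. strong_integral M (\<lambda>y. H (x, y)))"
proof -
  obtain \<phi> where \<phi>: "\<And>i. simple_function (N \<Otimes>\<^sub>M M) (\<phi> i)" 
    "\<And>p. p \<in> space (N \<Otimes>\<^sub>M M) \<Longrightarrow> (\<lambda>i. \<phi> i p) \<longlonglongrightarrow> H p"
    "\<And>i p. norm (H p - \<phi> i p) \<le> norm (H p)"
    using sep_measurable_simple_approximation[OF H] by metis
  have le: "norm (\<phi> i p) \<le> norm (2 *\<^sub>R H p)" for i p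
    using \<phi>(3)[of p i] norm_triangle_ineq2[of "\<phi> i p" "H p"] by (simp add: norm_minus_commute)
  have sf: "simple_function M (\<lambda>y. \<phi> i (x, y))" if "x \<in> space N" for i x
    using \<phi>(1) that by (intro simple_function_comp[of "Pair x" M "N \<Otimes>\<^sub>M M"]) auto
  have sm: "strongly_measurable M (\<lambda>y. \<phi> i (x, y))" if "x \<in> space N" for i x
    using sf[OF that] by (intro sep_imp_strongly_measurable sep_measurable_simple_function)
  have si: "strongly_integrable M (\<lambda>y. \<phi> i (x, y))" if "x \<in> space N" for i x
    using le by (intro strongly_integrable_dominated[OF sm[OF that] strongly_integrable_scale[OF int[OF that]]] AE_I2)
  have sbi: "simple_bochner_integrable M (\<lambda>y. \<phi> i (x, y))" if "x \<in> space N" for i x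
    using si[OF that] by (intro simple_bochner_integrableI_bounded sf that) (auto simp: strongly_integrable_def)
  have meas: "sep_measurable N (\<lambda>x. strong_integral M (\<lambda>y. \<phi> i (x, y)))" for i
  proof -
    define C where "C = \<phi> i ` space (N \<Otimes>\<^sub>M M)"
    have fin: "finite C" using \<phi>(1) by (simp add: C_def simple_function_def)
    have sets: "\<phi> i -` {c} \<inter> space (N \<Otimes>\<^sub>M M) \<in> sets (N \<Otimes>\<^sub>M M)" for c
      using simple_functionD(2)[OF \<phi>(1)] .
    have "(\<lambda>x. measure M (Pair x -` (\<phi> i -` {c} \<inter> space (N \<Otimes>\<^sub>M M)))) \<in> borel_measurable N" for c
      using measurable_emeasure_Pair[OF sets[of c]] unfolding Sigma_Algebra.measure_def by measurable
    then have "sep_measurable N (\<lambda>x. \<Sum>c\<in>C. measure M (Pair x -` (\<phi> i -` {c} \<inter> space (N \<Otimes>\<^sub>M M))) *\<^sub>R c)"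
      by (intro sep_measurable_sum sep_measurable_scaleR sep_measurable_const)
    moreover have "(\<Sum>c\<in>C. measure M (Pair x -` (\<phi> i -` {c} \<inter> space (N \<Otimes>\<^sub>M M))) *\<^sub>R c) =
      strong_integral M (\<lambda>y. \<phi> i (x, y))" if x: "x \<in> space N" for x
    proof -
      have eq: "Pair x -` (\<phi> i -` {c} \<inter> space (N \<Otimes>\<^sub>M M)) = {y \<in> space M. \<phi> i (x, y) = c}" for c
        using x by (auto simp: space_pair_measure)
      have "strong_integral M (\<lambda>y. \<phi> i (x, y)) = simple_bochner_integral M (\<lambda>y. \<phi> i (x, y))"
        by (rule strong_integral_eqI[OF has_strong_integral_simple[OF sbi[OF x]]])
      also have "\<dots> = (\<Sum>c\<in>C. measure M {y \<in> space M. \<phi> i (x, y) = c} *\<^sub>R c)"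
        unfolding simple_bochner_integral_def
      proof (rule sum.mono_neutral_left[OF fin])
        show "(\<lambda>y. \<phi> i (x, y)) ` space M \<subseteq> C" using x by (auto simp: C_def space_pair_measure)
        show "\<forall>c\<in>C - (\<lambda>y. \<phi> i (x, y)) ` space M. measure M {y \<in> space M. \<phi> i (x, y) = c} *\<^sub>R c = 0"
        proof
          fix c assume "c \<in> C - (\<lambda>y. \<phi> i (x, y)) ` space M"
          then have "{y \<in> space M. \<phi> i (x, y) = c} = {}" by auto
          then show "measure M {y \<in> space M. \<phi> i (x, y) = c} *\<^sub>R c = 0"
            by (simp only: measure_empty scaleR_zero_left)
        qed
      qed
      finally show ?thesis by (simp only: eq)
    qed
    ultimately show ?thesis by (subst sep_measurable_cong[symmetric])
  qed
  show ?thesis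
  proof (rule sep_measurable_LIMSEQ[OF meas])
    fix x assume x: "x \<in> space N"
    show "(\<lambda>i. strong_integral M (\<lambda>y. \<phi> i (x, y))) \<longlonglongrightarrow> strong_integral M (\<lambda>y. H (x, y))"
    proof (rule strong_integral_dominated_convergence[OF sm[OF x] strongly_integrable_scale[OF int[OF x]]])
      show "AE y in M. norm (\<phi> i (x, y)) \<le> norm (2 *\<^sub>R H (x, y))" for i
        by (intro AE_I2 le)
      show "AE y in M. (\<lambda>i. \<phi> i (x, y)) \<longlonglongrightarrow> H (x, y)"
        using x by (intro AE_I2 \<phi>(2)) (simp add: space_pair_measure)
    qed
  qed
qed

context pair_sigma_finite
begin

lemma nn_integral_norm_fst:
  fixes H :: "'a \<times> 'b \<Rightarrow> 'c::real_normed_vector"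
  assumes "strongly_measurable (M1 \<Otimes>\<^sub>M M2) H"
  shows "(\<integral>\<^sup>+x. (\<integral>\<^sup>+y. ennreal (norm (H (x, y))) \<partial>M2) \<partial>M1) = (\<integral>\<^sup>+p. ennreal (norm (H p)) \<partial>(M1 \<Otimes>\<^sub>M M2))"
proof -
  obtain G where G: "sep_measurable (M1 \<Otimes>\<^sub>M M2) G" "AE p in M1 \<Otimes>\<^sub>M M2. H p = G p"
    using assms strongly_measurable_iff_sep by blast
  have "AE x in M1. (\<integral>\<^sup>+y. ennreal (norm (H (x, y))) \<partial>M2) = (\<integral>\<^sup>+y. ennreal (norm (G (x, y))) \<partial>M2)"
    using AE_pair[OF G(2)] by eventually_elim (auto intro: nn_integral_cong_AE)
  then have "(\<integral>\<^sup>+x. (\<integral>\<^sup>+y. ennreal (norm (H (x, y))) \<partial>M2) \<partial>M1) = (\<integral>\<^sup>+x. (\<integral>\<^sup>+y. ennreal (norm (G (x, y))) \<partial>M2) \<partial>M1)"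
    by (rule nn_integral_cong_AE)
  also have "\<dots> = (\<integral>\<^sup>+p. ennreal (norm (G p)) \<partial>(M1 \<Otimes>\<^sub>M M2))"
    using sep_measurable_norm[OF G(1)] by (intro M2.nn_integral_fst[of "\<lambda>p. ennreal (norm (G p))"]) auto
  also have "\<dots> = (\<integral>\<^sup>+p. ennreal (norm (H p)) \<partial>(M1 \<Otimes>\<^sub>M M2))"
    using G(2) by (intro nn_integral_cong_AE) auto
  finally show ?thesis .
qed

lemma swap_isometry:
  "(\<lambda>(y, x). (x, y)) \<in> measurable (M2 \<Otimes>\<^sub>M M1) (M1 \<Otimes>\<^sub>M M2)"
  "distr (M2 \<Otimes>\<^sub>M M1) (M1 \<Otimes>\<^sub>M M2) (\<lambda>(y, x). (x, y)) = M1 \<Otimes>\<^sub>M M2"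
  "(\<lambda>(y, x). (x, y)) ` space (M2 \<Otimes>\<^sub>M M1) = space (M1 \<Otimes>\<^sub>M M2)"
  using distr_pair_swap by (auto simp: space_pair_measure)

lemma strongly_integrable_iterated:
  fixes H :: "'a \<times> 'b \<Rightarrow> 'c::banach"
  assumes H: "strongly_integrable (M1 \<Otimes>\<^sub>M M2) H"
  shows "AE x in M1. strongly_integrable M2 (\<lambda>y. H (x, y))"
    and "strongly_integrable M1 (\<lambda>x. strong_integral M2 (\<lambda>y. H (x, y)))"
    and "L1_seminorm M1 (\<lambda>x. strong_integral M2 (\<lambda>y. H (x, y))) \<le> L1_seminorm (M1 \<Otimes>\<^sub>M M2) H"
proof -
  obtain G where G: "sep_measurable (M1 \<Otimes>\<^sub>M M2) G" "integrable (M1 \<Otimes>\<^sub>M M2) (\<lambda>x. norm (G x))" 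
    "AE p in M1 \<Otimes>\<^sub>M M2. H p = G p"
    using H strongly_integrable_iff_sep by blast
  have Gm: "(\<lambda>p. ennreal (norm (G p))) \<in> borel_measurable (M1 \<Otimes>\<^sub>M M2)"
    using sep_measurable_norm[OF G(1)] by simp
  define h where "h = (\<lambda>x. \<integral>\<^sup>+y. ennreal (norm (G (x, y))) \<partial>M2)"
  have h[measurable]: "h \<in> borel_measurable M1"
    unfolding h_def by (rule M2.borel_measurable_nn_integral_fst[OF Gm])
  have hfin: "(\<integral>\<^sup>+x. h x \<partial>M1) = ennreal (L1_seminorm (M1 \<Otimes>\<^sub>M M2) H)"
    unfolding h_def M2.nn_integral_fst[OF Gm] using G(3) nn_integral_eq_L1_seminorm[OF H]
    by (subst nn_integral_cong_AE[where v="\<lambda>p. ennreal (norm (H p))"]) auto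
  then have hAE: "AE x in M1. h x \<noteq> \<infinity>"
    by (intro nn_integral_PInf_AE h) simp
  \<comment> \<open>Slices with infinite integral are cut off, so that the slice integrals exist everywhere.\<close>
  define G' where "G' = (\<lambda>p. if h (fst p) \<noteq> \<infinity> then G p else 0)"
  have G': "sep_measurable (M1 \<Otimes>\<^sub>M M2) G'"
    unfolding G'_def by (rule sep_measurable_If[OF _ G(1)]) measurable
  have slice: "strongly_integrable M2 (\<lambda>y. G' (x, y))" if "x \<in> space M1" for x
  proof (cases "h x = \<infinity>")
    case False
    have "sep_measurable M2 (\<lambda>y. G' (x, y))"
      using that by (intro sep_measurable_compose[OF G']) auto
    moreover have "(\<integral>\<^sup>+y. ennreal (norm (G' (x, y))) \<partial>M2) < \<infinity>"
      using False by (simp add: G'_def h_def less_top)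
    ultimately show ?thesis by (simp add: strongly_integrable_def sep_imp_strongly_measurable)
  qed (simp add: G'_def strongly_integrable_zero)
  have AEeq: "AE x in M1. AE y in M2. H (x, y) = G' (x, y)"
    using AE_pair[OF G(3)] hAE by eventually_elim (simp add: G'_def)
  show "AE x in M1. strongly_integrable M2 (\<lambda>y. H (x, y))"
    using AEeq AE_space
  proof eventually_elim
    case (elim x)
    then show ?case using slice[of x] strongly_integrable_cong_AE[OF elim(1)] by simp
  qed
  have eq: "AE x in M1. strong_integral M2 (\<lambda>y. H (x, y)) = strong_integral M2 (\<lambda>y. G' (x, y))"
    using AEeq by eventually_elim (rule strong_integral_cong_AE)
  have sm: "sep_measurable M1 (\<lambda>x. strong_integral M2 (\<lambda>y. G' (x, y)))"
    by (rule M2.sep_measurable_strong_integral[OF G' slice])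
  have "(\<integral>\<^sup>+x. ennreal (norm (strong_integral M2 (\<lambda>y. H (x, y)))) \<partial>M1) =
      (\<integral>\<^sup>+x. ennreal (norm (strong_integral M2 (\<lambda>y. G' (x, y)))) \<partial>M1)"
    using eq by (intro nn_integral_cong_AE) auto
  also have "\<dots> \<le> (\<integral>\<^sup>+x. h x \<partial>M1)"
  proof (rule nn_integral_mono)
    fix x assume x: "x \<in> space M1"
    have "ennreal (norm (strong_integral M2 (\<lambda>y. G' (x, y)))) \<le> ennreal (L1_seminorm M2 (\<lambda>y. G' (x, y)))"
      by (intro ennreal_leI norm_strong_integral_le slice x)
    also have "\<dots> = (\<integral>\<^sup>+y. ennreal (norm (G' (x, y))) \<partial>M2)"
      by (rule nn_integral_eq_L1_seminorm[symmetric, OF slice[OF x]])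
    also have "\<dots> \<le> h x" unfolding h_def by (intro nn_integral_mono) (simp add: G'_def)
    finally show "ennreal (norm (strong_integral M2 (\<lambda>y. G' (x, y)))) \<le> h x" .
  qed
  finally have le: "(\<integral>\<^sup>+x. ennreal (norm (strong_integral M2 (\<lambda>y. H (x, y)))) \<partial>M1) \<le> ennreal (L1_seminorm (M1 \<Otimes>\<^sub>M M2) H)"
    by (simp add: hfin)
  have "strongly_measurable M1 (\<lambda>x. strong_integral M2 (\<lambda>y. H (x, y)))"
    using eq sm strongly_measurable_iff_sep by blast
  with le show "strongly_integrable M1 (\<lambda>x. strong_integral M2 (\<lambda>y. H (x, y)))"
    unfolding strongly_integrable_def using le_less_trans[OF le ennreal_less_top] by (simp add: infinity_ennreal_def)
  show "L1_seminorm M1 (\<lambda>x. strong_integral M2 (\<lambda>y. H (x, y))) \<le> L1_seminorm (M1 \<Otimes>\<^sub>M M2) H"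
    using le by (rule L1_seminorm_bound_nn) (rule L1_seminorm_nonneg)
qed

lemma strong_integral_iterated_scaleR:
  fixes f :: "'a \<times> 'b \<Rightarrow> real" and c :: "'c::banach"
  assumes f: "integrable (M1 \<Otimes>\<^sub>M M2) f"
  shows "strong_integral M1 (\<lambda>x. strong_integral M2 (\<lambda>y. f (x, y) *\<^sub>R c)) =
    strong_integral (M1 \<Otimes>\<^sub>M M2) (\<lambda>p. f p *\<^sub>R c)"
proof -
  have "AE x in M1. strong_integral M2 (\<lambda>y. f (x, y) *\<^sub>R c) = (LINT y|M2. f (x, y)) *\<^sub>R c"
    using AE_integrable_fst'[OF f] by eventually_elim (rule integrable_real_strongly_integrable_scaleR)
  then have "strong_integral M1 (\<lambda>x. strong_integral M2 (\<lambda>y. f (x, y) *\<^sub>R c)) =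
      strong_integral M1 (\<lambda>x. (LINT y|M2. f (x, y)) *\<^sub>R c)"
    by (rule strong_integral_cong_AE)
  also have "\<dots> = (LINT x|M1. LINT y|M2. f (x, y)) *\<^sub>R c"
    by (rule integrable_real_strongly_integrable_scaleR(2)[OF integrable_fst'[OF f]])
  also have "\<dots> = strong_integral (M1 \<Otimes>\<^sub>M M2) (\<lambda>p. f p *\<^sub>R c)"
    by (simp add: integral_fst'[OF f] integrable_real_strongly_integrable_scaleR(2)[OF f])
  finally show ?thesis .
qed

lemma strong_integral_iterated_simple:
  fixes \<phi> :: "'a \<times> 'b \<Rightarrow> 'c::banach"
  assumes \<phi>: "simple_bochner_integrable (M1 \<Otimes>\<^sub>M M2) \<phi>"
  shows "strong_integral M1 (\<lambda>x. strong_integral M2 (\<lambda>y. \<phi> (x, y))) = strong_integral (M1 \<Otimes>\<^sub>M M2) \<phi>"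
proof -
  let ?P = "M1 \<Otimes>\<^sub>M M2"
  obtain C A where CA: "finite C" "\<And>c. c \<in> C \<Longrightarrow> A c \<in> sets ?P" "\<And>c. c \<in> C \<Longrightarrow> emeasure ?P (A c) < \<infinity>"
    "\<And>x. x \<in> space ?P \<Longrightarrow> \<phi> x = (\<Sum>c\<in>C. indicator (A c) x *\<^sub>R c)"
    using simple_bochner_decomposition[OF \<phi>] by blast
  define f where "f = (\<lambda>c. indicat_real (A c))"
  note fin = CA(1)
  have f: "integrable ?P (f c)" if "c \<in> C" for c
    unfolding f_def using CA(2,3)[OF that] by (intro integrable_real_indicator)
  have eq: "\<phi> p = (\<Sum>c\<in>C. f c p *\<^sub>R c)" if p: "p \<in> space ?P" for p
    unfolding f_def by (rule CA(4)[OF p])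
  have fc: "strongly_integrable ?P (\<lambda>p. f c p *\<^sub>R c)" if "c \<in> C" for c
    by (rule integrable_real_strongly_integrable_scaleR(1)[OF f[OF that]])
  have "AE x in M1. \<forall>c\<in>C. strongly_integrable M2 (\<lambda>y. f c (x, y) *\<^sub>R c)"
    using fin strongly_integrable_iterated(1)[OF fc] by (intro AE_finite_allI) auto
  then have "AE x in M1. strong_integral M2 (\<lambda>y. \<phi> (x, y)) = (\<Sum>c\<in>C. strong_integral M2 (\<lambda>y. f c (x, y) *\<^sub>R c))"
    using AE_space
  proof eventually_elim
    case (elim x)
    have "strong_integral M2 (\<lambda>y. \<phi> (x, y)) = strong_integral M2 (\<lambda>y. \<Sum>c\<in>C. f c (x, y) *\<^sub>R c)"
      using elim by (intro strong_integral_cong_AE AE_I2 eq) (simp add: space_pair_measure)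
    also have "\<dots> = (\<Sum>c\<in>C. strong_integral M2 (\<lambda>y. f c (x, y) *\<^sub>R c))"
      using elim by (intro strong_integral_sum) auto
    finally show ?case .
  qed
  then have "strong_integral M1 (\<lambda>x. strong_integral M2 (\<lambda>y. \<phi> (x, y))) =
    strong_integral M1 (\<lambda>x. \<Sum>c\<in>C. strong_integral M2 (\<lambda>y. f c (x, y) *\<^sub>R c))"
    by (rule strong_integral_cong_AE)
  also have "\<dots> = (\<Sum>c\<in>C. strong_integral M1 (\<lambda>x. strong_integral M2 (\<lambda>y. f c (x, y) *\<^sub>R c)))"
    by (intro strong_integral_sum strongly_integrable_iterated(2) fc)
  also have "\<dots> = (\<Sum>c\<in>C. strong_integral ?P (\<lambda>p. f c p *\<^sub>R c))"
    by (intro sum.cong refl strong_integral_iterated_scaleR f)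
  also have "\<dots> = strong_integral ?P (\<lambda>p. \<Sum>c\<in>C. f c p *\<^sub>R c)"
    by (rule strong_integral_sum[symmetric, OF fc])
  also have "\<dots> = strong_integral ?P \<phi>"
    by (intro strong_integral_cong_AE AE_I2) (simp add: eq)
  finally show ?thesis .
qed

text \<open>
  Both sides are continuous in \<open>H\<close> for the seminorm of \<open>L\<^sup>1\<close>. On
  simple functions the identity is scalar Fubini, applied to the indicator of each level set.
\<close>
theorem strong_integral_fst:
  fixes H :: "'a \<times> 'b \<Rightarrow> 'c::banach"
  assumes H: "strongly_integrable (M1 \<Otimes>\<^sub>M M2) H"
  shows "strong_integral M1 (\<lambda>x. strong_integral M2 (\<lambda>y. H (x, y))) = strong_integral (M1 \<Otimes>\<^sub>M M2) H"
proof -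
  let ?P = "M1 \<Otimes>\<^sub>M M2"
  obtain \<phi> where \<phi>: "\<And>i. simple_bochner_integrable ?P (\<phi> i)" "(\<lambda>i. L1_seminorm ?P (\<lambda>x. H x - \<phi> i x)) \<longlonglongrightarrow> 0"
    using strongly_integrable_simple_approximation[OF H] by metis
  note si = simple_bochner_strongly_integrable[OF \<phi>(1)]
  let ?J = "\<lambda>H. strong_integral M1 (\<lambda>x. strong_integral M2 (\<lambda>y. H (x, y)))"
  have le: "norm (?J (\<phi> i) - ?J H) \<le> L1_seminorm ?P (\<lambda>p. H p - \<phi> i p)" for i
  proof -
    have d: "strongly_integrable ?P (\<lambda>p. \<phi> i p - H p)" using si H by (intro strongly_integrable_minus)
    have "?J (\<phi> i) - ?J H = strong_integral M1 (\<lambda>x. strong_integral M2 (\<lambda>y. \<phi> i (x, y)) - strong_integral M2 (\<lambda>y. H (x, y)))"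
      by (rule strong_integral_diff[symmetric]; rule strongly_integrable_iterated(2); rule si H)
    also have "\<dots> = ?J (\<lambda>p. \<phi> i p - H p)"
      using strongly_integrable_iterated(1)[OF H] strongly_integrable_iterated(1)[OF si, of i]
      by (intro strong_integral_cong_AE, eventually_elim) (simp add: strong_integral_diff)
    finally have "norm (?J (\<phi> i) - ?J H) \<le> L1_seminorm M1 (\<lambda>x. strong_integral M2 (\<lambda>y. \<phi> i (x, y) - H (x, y)))"
      using norm_strong_integral_le[OF strongly_integrable_iterated(2)[OF d]] by simp
    also have "\<dots> \<le> L1_seminorm ?P (\<lambda>p. \<phi> i p - H p)" by (rule strongly_integrable_iterated(3)[OF d])
    finally show ?thesis by (simp add: L1_seminorm_commute[of ?P H])
  qed
  then have "(\<lambda>i. ?J (\<phi> i) - ?J H) \<longlonglongrightarrow> 0"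
    by (intro Lim_null_comparison[OF _ \<phi>(2)]) auto
  then have "(\<lambda>i. ?J (\<phi> i)) \<longlonglongrightarrow> ?J H" by (rule LIM_zero_cancel)
  moreover have "(\<lambda>i. ?J (\<phi> i)) = (\<lambda>i. strong_integral ?P (\<phi> i))"
    by (intro ext strong_integral_iterated_simple \<phi>)
  moreover have "(\<lambda>i. strong_integral ?P (\<phi> i)) \<longlonglongrightarrow> strong_integral ?P H"
  proof (rule LIM_zero_cancel, rule Lim_null_comparison[OF _ \<phi>(2)])
    show "\<forall>\<^sub>F i in sequentially. norm (strong_integral ?P (\<phi> i) - strong_integral ?P H) \<le> L1_seminorm ?P (\<lambda>x. H x - \<phi> i x)"
      using norm_strong_integral_diff_le[OF si H] by (simp add: L1_seminorm_commute[of ?P H])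
  qed
  ultimately show ?thesis using LIMSEQ_unique by metis
qed

theorem strong_integral_swap:
  fixes H :: "'a \<times> 'b \<Rightarrow> 'c::banach"
  assumes H: "strongly_integrable (M1 \<Otimes>\<^sub>M M2) H"
  shows "strong_integral M1 (\<lambda>x. strong_integral M2 (\<lambda>y. H (x, y))) =
    strong_integral M2 (\<lambda>y. strong_integral M1 (\<lambda>x. H (x, y)))"
proof -
  interpret Q: pair_sigma_finite M2 M1 ..
  have "strongly_integrable (M2 \<Otimes>\<^sub>M M1) (\<lambda>q. H (case q of (y, x) \<Rightarrow> (x, y)))"
    by (rule strongly_integrable_distr(1)[OF swap_isometry(1,2) H])
  from Q.strong_integral_fst[OF this] 
  have "strong_integral M2 (\<lambda>y. strong_integral M1 (\<lambda>x. H (x, y))) = 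
      strong_integral (M2 \<Otimes>\<^sub>M M1) (\<lambda>q. H (case q of (y, x) \<Rightarrow> (x, y)))" by simp
  also have "\<dots> = strong_integral (M1 \<Otimes>\<^sub>M M2) H" by (rule strong_integral_distr[OF swap_isometry H])
  finally show ?thesis using strong_integral_fst[OF H] by simp
qed

lemma nn_integral_norm_snd:
  fixes H :: "'a \<times> 'b \<Rightarrow> 'c::real_normed_vector"
  assumes H: "strongly_measurable (M1 \<Otimes>\<^sub>M M2) H"
  shows "(\<integral>\<^sup>+y. (\<integral>\<^sup>+x. ennreal (norm (H (x, y))) \<partial>M1) \<partial>M2) = (\<integral>\<^sup>+p. ennreal (norm (H p)) \<partial>(M1 \<Otimes>\<^sub>M M2))"
proof -
  interpret Q: pair_sigma_finite M2 M1 ..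
  have "strongly_measurable (M2 \<Otimes>\<^sub>M M1) (\<lambda>q. H (case q of (y, x) \<Rightarrow> (x, y)))"
    by (rule strongly_measurable_distr[OF swap_isometry(1,2) H])
  from Q.nn_integral_norm_fst[OF this] show ?thesis
    using nn_integral_norm_distr[OF swap_isometry(1,2) H] by simp
qed

end

section \<open>Decomposition along a generating cone\<close>

lemma suminf_nonneg_cone:
  fixes f :: "nat \<Rightarrow> 'a::{real_normed_vector, ordered_real_vector}"
  assumes cl: "closed {u::'a. 0 \<le> u}" and f: "summable f" "\<And>k. 0 \<le> f k"
  shows "0 \<le> suminf f"
proof -
  have "suminf f \<in> {u. 0 \<le> u}"
    using f by (intro Lim_in_closed_set[OF cl _ _ summable_LIMSEQ[OF f(1)]]) (auto intro!: always_eventually sum_nonneg)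
  then show ?thesis by simp
qed

text \<open>
  As in the proof of the open mapping theorem, approximate solutions yield exact ones: the
  remainder is halved in each round, so the positive parts of the rounds form absolutely
  convergent series whose sums decompose \<open>w\<close>.
\<close>
lemma cone_approximation_imp_decomposition:
  fixes w :: "'a::{banach, ordered_real_vector}"
  assumes cl: "closed {u::'a. 0 \<le> u}" and K: "0 \<le> K"
    and pq: "\<And>w::'a. 0 \<le> p w" "\<And>w::'a. 0 \<le> q w" "\<And>w::'a. norm (p w) + norm (q w) \<le> K * norm w"
      "\<And>w::'a. norm (w - (p w - q w)) \<le> norm w / 2"
  shows "\<exists>u v. 0 \<le> u \<and> 0 \<le> v \<and> w = u - v \<and> norm u + norm v \<le> 2 * K * norm w"
proof -
  define r where "r = rec_nat w (\<lambda>k x. x - (p x - q x))"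
  have r: "r 0 = w" "r (Suc k) = r k - (p (r k) - q (r k))" for k by (simp_all add: r_def)
  have rb: "norm (r k) \<le> norm w * (1/2)^k" for k
  proof (induction k)
    case (Suc k)
    then show ?case using pq(4)[of "r k"] by (simp add: r)
  qed (simp add: r)
  have s0: "summable (\<lambda>k. norm w * (1/2::real)^k)" by (intro summable_mult summable_geometric) simp
  have sum0: "(\<Sum>k. K * (norm w * (1/2::real)^k)) = 2 * K * norm w"
    using suminf_mult[OF s0, of K] suminf_mult[OF summable_geometric, of "1/2::real" "norm w"] suminf_geometric[of "1/2::real"] by simp
  have le: "norm (p (r k)) + norm (q (r k)) \<le> K * (norm w * (1/2)^k)" for k
    using pq(3)[of "r k"] mult_left_mono[OF rb[of k] K] by linarith
  have sK: "summable (\<lambda>k. K * (norm w * (1/2::real)^k))" by (intro summable_mult s0)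
  have sp: "summable (\<lambda>k. norm (p (r k)))"
    using le by (intro summable_comparison_test'[OF sK, of 0]) (smt (verit) norm_ge_zero real_norm_def)
  have sq: "summable (\<lambda>k. norm (q (r k)))"
    using le by (intro summable_comparison_test'[OF sK, of 0]) (smt (verit) norm_ge_zero real_norm_def)
  define u where "u = (\<Sum>k. p (r k))"
  define v where "v = (\<Sum>k. q (r k))"
  have "(\<lambda>k. norm w * (1/2)^k) \<longlonglongrightarrow> norm w * 0"
    by (intro tendsto_intros LIMSEQ_power_zero) simp
  then have r0: "r \<longlonglongrightarrow> 0" using rb by (intro Lim_null_comparison[of r "\<lambda>k. norm w * (1/2)^k"]) auto
  have "(\<lambda>k. r k - r (Suc k)) sums (r 0 - 0)" by (rule telescope_sums'[OF r0])
  then have "(\<lambda>k. p (r k) - q (r k)) sums w" by (simp add: r)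
  moreover have "(\<lambda>k. p (r k) - q (r k)) sums (u - v)"
    unfolding u_def v_def by (intro sums_diff summable_sums summable_norm_cancel[OF sp] summable_norm_cancel[OF sq])
  ultimately have "w = u - v" by (rule sums_unique2)
  moreover have "0 \<le> u" "0 \<le> v"
    unfolding u_def v_def using pq(1,2) summable_norm_cancel[OF sp] summable_norm_cancel[OF sq]
    by (auto intro!: suminf_nonneg_cone[OF cl])
  moreover have "norm u + norm v \<le> 2 * K * norm w"
  proof -
    have "norm u + norm v \<le> (\<Sum>k. norm (p (r k))) + (\<Sum>k. norm (q (r k)))"
      unfolding u_def v_def by (intro add_mono summable_norm sp sq)
    also have "\<dots> = (\<Sum>k. norm (p (r k)) + norm (q (r k)))" by (rule suminf_add[OF sp sq])
    also have "\<dots> \<le> (\<Sum>k. K * (norm w * (1/2)^k))"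
      by (intro suminf_le le summable_add sp sq sK)
    finally show ?thesis by (simp only: sum0)
  qed
  ultimately show ?thesis by blast
qed

text \<open>
  The space is the union over \<open>n\<close> of the sets \<open>S n\<close> of differences of
  positive vectors of norm at most \<open>n\<close>. By Baire's theorem the closure of some
  \<open>S n\<close> contains a ball, and differences of elements of \<open>S n\<close> then
  approximate every vector of a ball around \<open>0\<close>; the rest is scaling.
\<close>
lemma generating_cone_approximation:
  fixes dummy :: "'a::{banach, ordered_real_vector}"
  assumes gen: "\<forall>w::'a. \<exists>u v. 0 \<le> u \<and> 0 \<le> v \<and> w = u - v"
  shows "\<exists>K\<ge>0. \<forall>w::'a. \<exists>u v. 0 \<le> u \<and> 0 \<le> v \<and> norm u + norm v \<le> K * norm w \<and> norm (w - (u - v)) \<le> norm w / 2"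
proof -
  define S where "S = (\<lambda>n::nat. {u - v |u v::'a. 0 \<le> u \<and> 0 \<le> v \<and> norm u \<le> n \<and> norm v \<le> n})"
  have cover: "(\<Union>n. closure (S n)) = UNIV"
  proof -
    have "w \<in> (\<Union>n. closure (S n))" for w
    proof -
      obtain u v where uv: "0 \<le> u" "0 \<le> v" "w = u - v" using gen by blast
      obtain n :: nat where "max (norm u) (norm v) \<le> n" using real_arch_simple by blast
      then have "w \<in> S n" using uv by (auto simp: S_def)
      then show ?thesis using closure_subset by blast
    qed
    then show ?thesis by blast
  qed
  have "\<exists>n. interior (closure (S n)) \<noteq> {}"
  proof (rule ccontr)
    assume "\<nexists>n. interior (closure (S n)) \<noteq> {}"
    then have "euclidean interior_of (\<Union>n. closure (S n)) = {}"
      by (intro Baire_category_alt) (auto intro: completely_metrizable_space_euclidean)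
    then show False unfolding cover by simp
  qed
  then obtain n x where "x \<in> interior (closure (S n))" by blast
  then obtain e where e: "0 < e" "ball x e \<subseteq> closure (S n)" by (meson mem_interior)
  have near: "\<exists>u v. 0 \<le> u \<and> 0 \<le> v \<and> norm u \<le> 2 * n \<and> norm v \<le> 2 * n \<and> norm (z - (u - v)) < \<eta>"
    if z: "norm z < e" and \<eta>: "0 < \<eta>" for z :: 'a and \<eta>
  proof -
    have "x + z \<in> closure (S n)" "x \<in> closure (S n)" using e z by (auto simp: subset_iff dist_norm)
    then obtain a b where ab: "a \<in> S n" "dist a (x + z) < \<eta> / 2" "b \<in> S n" "dist b x < \<eta> / 2"
      using \<eta> by (meson closure_approachable half_gt_zero)
    obtain u1 v1 where 1: "a = u1 - v1" "0 \<le> u1" "0 \<le> v1" "norm u1 \<le> n" "norm v1 \<le> n"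
      using ab(1) by (auto simp: S_def)
    obtain u2 v2 where 2: "b = u2 - v2" "0 \<le> u2" "0 \<le> v2" "norm u2 \<le> n" "norm v2 \<le> n"
      using ab(3) by (auto simp: S_def)
    have "z - ((u1 + v2) - (v1 + u2)) = ((x + z) - a) - (x - b)"
      unfolding 1(1) 2(1) by (simp add: algebra_simps)
    then have "norm (z - ((u1 + v2) - (v1 + u2))) \<le> norm (a - (x + z)) + norm (b - x)"
      using norm_triangle_ineq4[of "(x + z) - a" "x - b"]
      by (simp only: norm_minus_commute[of a "x + z"] norm_minus_commute[of b x])
    also have "\<dots> < \<eta>" using ab by (simp add: dist_norm)
    finally have "norm (z - ((u1 + v2) - (v1 + u2))) < \<eta>" .
    moreover have "norm (u1 + v2) \<le> 2 * n" "norm (v1 + u2) \<le> 2 * n"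
      using 1 2 norm_triangle_ineq[of u1 v2] norm_triangle_ineq[of v1 u2] by auto
    moreover have "0 \<le> u1 + v2" "0 \<le> v1 + u2" using 1 2 by auto
    ultimately show ?thesis by blast
  qed
  have "\<exists>u v. 0 \<le> u \<and> 0 \<le> v \<and> norm u + norm v \<le> (8 * n / e) * norm w \<and> norm (w - (u - v)) \<le> norm w / 2" for w :: 'a
  proof (cases "w = 0")
    case True
    then show ?thesis by (intro exI[of _ 0]) simp
  next
    case False
    define c where "c = e / (2 * norm w)"
    have c: "0 < c" using False e by (simp add: c_def)
    have "norm (c *\<^sub>R w) < e" using False e by (simp add: c_def)
    from near[OF this, of "c * norm w / 2"] obtain u v where
      uv: "0 \<le> u" "0 \<le> v" "norm u \<le> 2 * n" "norm v \<le> 2 * n" "norm (c *\<^sub>R w - (u - v)) < c * norm w / 2"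
      using c False by auto
    define u' where "u' = (1 / c) *\<^sub>R u"
    define v' where "v' = (1 / c) *\<^sub>R v"
    have "0 \<le> u'" "0 \<le> v'" using uv c by (auto simp: u'_def v'_def intro!: scaleR_nonneg_nonneg)
    moreover have "norm u' + norm v' \<le> (8 * n / e) * norm w"
    proof -
      have "norm u' + norm v' = (norm u + norm v) / c" using c by (simp add: u'_def v'_def add_divide_distrib)
      also have "\<dots> \<le> (4 * n) / c" using uv c by (intro divide_right_mono) auto
      also have "\<dots> = (8 * n / e) * norm w" using False e by (simp add: c_def field_simps)
      finally show ?thesis .
    qed
    moreover have "norm (w - (u' - v')) \<le> norm w / 2"
    proof -
      have "w - (u' - v') = (1 / c) *\<^sub>R (c *\<^sub>R w - (u - v))"
        using c by (simp add: u'_def v'_def scaleR_diff_right)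
      then have "norm (w - (u' - v')) = norm (c *\<^sub>R w - (u - v)) / c" using c by simp
      also have "\<dots> \<le> (c * norm w / 2) / c" using uv(5) c by (intro divide_right_mono) auto
      finally show ?thesis using c by simp
    qed
    ultimately show ?thesis by blast
  qed
  then show ?thesis using e by (intro exI[of _ "8 * n / e"]) auto
qed

theorem bounded_cone_decomposition:
  fixes dummy :: "'a::{banach, ordered_real_vector}"
  assumes cl: "closed {u::'a. 0 \<le> u}" and gen: "\<forall>w::'a. \<exists>u v. 0 \<le> u \<and> 0 \<le> v \<and> w = u - v"
  shows "\<exists>M\<ge>0. \<forall>w::'a. \<exists>u v. 0 \<le> u \<and> 0 \<le> v \<and> w = u - v \<and> norm u + norm v \<le> M * norm w"
proof -
  obtain K where K: "0 \<le> K" "\<forall>w::'a. \<exists>u v. 0 \<le> u \<and> 0 \<le> v \<and> norm u + norm v \<le> K * norm w \<and> norm (w - (u - v)) \<le> norm w / 2"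
    using generating_cone_approximation[OF gen] by blast
  have "\<forall>w::'a. \<exists>x. 0 \<le> fst x \<and> 0 \<le> snd x \<and> norm (fst x) + norm (snd x) \<le> K * norm w \<and>
      norm (w - (fst x - snd x)) \<le> norm w / 2"
    using K(2) by simp
  from choice[OF this] obtain f :: "'a \<Rightarrow> 'a \<times> 'a" where
    f: "\<forall>w. 0 \<le> fst (f w) \<and> 0 \<le> snd (f w) \<and> norm (fst (f w)) + norm (snd (f w)) \<le> K * norm w \<and>
      norm (w - (fst (f w) - snd (f w))) \<le> norm w / 2" ..
  have "\<exists>u v. 0 \<le> u \<and> 0 \<le> v \<and> w = u - v \<and> norm u + norm v \<le> (2 * K) * norm w" for w :: 'a
    using f by (intro cone_approximation_imp_decomposition[OF cl K(1), of "\<lambda>w. fst (f w)" "\<lambda>w. snd (f w)"]) auto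
  then show ?thesis using K(1) by (intro exI[of _ "2 * K"]) auto
qed

section \<open>The unperturbed evolution family\<close>

lemma nn_integral_norm_lebesgue_on:
  fixes f :: "'x::euclidean_space \<Rightarrow> 'b::real_normed_vector"
  assumes S: "S \<in> sets borel"
  shows "(\<integral>\<^sup>+x. ennreal (norm (f x)) \<partial>lebesgue_on S) = (\<integral>\<^sup>+x. ennreal (norm (indicator S x *\<^sub>R f x)) \<partial>lborel)"
proof -
  have "(\<integral>\<^sup>+x. ennreal (norm (f x)) \<partial>lebesgue_on S) = (\<integral>\<^sup>+x. ennreal (norm (f x)) * indicator S x \<partial>lebesgue)"
    using S by (intro nn_integral_restrict_space) auto
  also have "\<dots> = (\<integral>\<^sup>+x. ennreal (norm (indicator S x *\<^sub>R f x)) \<partial>lebesgue)"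
    by (intro nn_integral_cong) (simp add: indicator_def)
  finally show ?thesis by (simp add: nn_integral_completion)
qed

lemma AE_lebesgue_on_iff:
  fixes S :: "'x::euclidean_space set"
  assumes S: "S \<in> sets borel"
  shows "(AE x in lebesgue_on S. P x) \<longleftrightarrow> (AE x in lborel. x \<in> S \<longrightarrow> P x)"
  using S by (subst AE_restrict_space_iff) (auto simp: AE_completion_iff)

lemma sum_L1_seminorm_le:
  fixes f :: "'i \<Rightarrow> 'x \<Rightarrow> 'b::real_normed_vector" and w :: "'x \<Rightarrow> 'c::real_normed_vector"
  assumes I: "finite I" and f: "\<And>i. i \<in> I \<Longrightarrow> strongly_integrable M (f i)" and w: "strongly_integrable M w"
    and le: "AE x in M. (\<Sum>i\<in>I. norm (f i x)) \<le> norm (w x)"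
  shows "(\<Sum>i\<in>I. L1_seminorm M (f i)) \<le> L1_seminorm M w"
proof -
  have "\<forall>i\<in>I. \<exists>g. integrable M (\<lambda>x. norm (g x :: 'b)) \<and> (AE x in M. f i x = g x) \<and>
      L1_seminorm M (f i) = (LINT x|M. norm (g x))"
    using L1_seminorm_eq_integral_sep[OF f] by metis
  then obtain g where g: "\<And>i. i \<in> I \<Longrightarrow> integrable M (\<lambda>x. norm (g i x :: 'b))"
     "\<And>i. i \<in> I \<Longrightarrow> AE x in M. f i x = g i x" "\<And>i. i \<in> I \<Longrightarrow> L1_seminorm M (f i) = (LINT x|M. norm (g i x))"
    by metis
  obtain w' where w': "integrable M (\<lambda>x. norm (w' x))" "AE x in M. w x = w' x" "L1_seminorm M w = (LINT x|M. norm (w' x))"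
    using L1_seminorm_eq_integral_sep[OF w] by metis
  have "AE x in M. \<forall>i\<in>I. f i x = g i x" using I g(2) by (intro AE_finite_allI) auto
  then have "AE x in M. (\<Sum>i\<in>I. norm (g i x)) \<le> norm (w' x)"
    using le w'(2) by eventually_elim simp
  then have "(LINT x|M. (\<Sum>i\<in>I. norm (g i x))) \<le> (LINT x|M. norm (w' x))"
    using g w' by (intro integral_mono_AE Bochner_Integration.integrable_sum)
  then show ?thesis using g w' by (simp add: Bochner_Integration.integral_sum)
qed

locale perturbed_evolution =
  fixes U :: "real \<Rightarrow> real \<Rightarrow> 'a \<Rightarrow> 'a::{banach, ordered_real_vector}"
    and D :: "real \<Rightarrow> 'a set"
    and B :: "real \<Rightarrow> 'a \<Rightarrow> 'a"
  assumes cone_closed: "closed {u::'a. 0 \<le> u}"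
    and cone_generating: "\<forall>w::'a. \<exists>u v. 0 \<le> u \<and> 0 \<le> v \<and> w = u - v"
    and norm_additive: "\<forall>u v::'a. 0 \<le> u \<longrightarrow> 0 \<le> v \<longrightarrow> norm (u + v) = norm u + norm v"
    and U_evolution: "evolution_family U"
    and B_linear: "\<forall>t\<ge>0. linear_operator (D t) (B t)"
    and U_pos: "\<forall>t s u. 0 \<le> s \<longrightarrow> s \<le> t \<longrightarrow> 0 \<le> u \<longrightarrow> 0 \<le> U t s u"
    and U_contr: "\<forall>t s u. 0 \<le> s \<longrightarrow> s \<le> t \<longrightarrow> 0 \<le> u \<longrightarrow> norm (U t s u) \<le> norm u"
    and B_pos: "\<forall>t\<ge>0. \<forall>u\<in>D t. 0 \<le> u \<longrightarrow> 0 \<le> B t u"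
    and BU_defined: "\<forall>s\<ge>0. \<forall>u. AE t in lebesgue_on {s..}. U t s u \<in> D t"
    and BU_measurable: "\<forall>s\<ge>0. \<forall>u. strongly_measurable (lebesgue_on {s..}) (\<lambda>t. B t (U t s u))"
    and BU_bound: "\<forall>t s u. 0 \<le> s \<longrightarrow> s \<le> t \<longrightarrow> 0 \<le> u \<longrightarrow>
       (\<integral>\<^sup>+\<tau>. ennreal (norm (B \<tau> (U \<tau> s u))) \<partial>(lebesgue_on {s..t}))
         \<le> ennreal (norm u - norm (U t s u))"
    and BUf_defined: "\<forall>f. strongly_integrable half_line f \<longrightarrow>
       (AE (t, s) in lebesgue_on {(t, s). 0 \<le> s \<and> s \<le> t}. U t s (f s) \<in> D t)"
    and BUf_measurable: "\<forall>f. strongly_integrable half_line f \<longrightarrow>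
       strongly_measurable (lebesgue_on {(t, s). 0 \<le> s \<and> s \<le> t}) (\<lambda>(t, s). B t (U t s (f s)))"
begin

abbreviation \<Delta> :: "(real \<times> real) set" where
  "\<Delta> \<equiv> {(t, s). 0 \<le> s \<and> s \<le> t}"

text \<open>
  A constant for decompositions along the cone. By \<open>linear_bound_from_cone\<close> it bounds
  every linear map that is contractive on the cone.
\<close>
definition M :: real where
  "M = (SOME M. 0 \<le> M \<and> (\<forall>w::'a. \<exists>u v. 0 \<le> u \<and> 0 \<le> v \<and> w = u - v \<and> norm u + norm v \<le> M * norm w))"

lemma M: "0 \<le> M" "\<exists>u v. 0 \<le> u \<and> 0 \<le> v \<and> w = u - v \<and> norm u + norm v \<le> M * norm (w::'a)"
proof -
  have "0 \<le> M \<and> (\<forall>w::'a. \<exists>u v. 0 \<le> u \<and> 0 \<le> v \<and> w = u - v \<and> norm u + norm v \<le> M * norm w)"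
    unfolding M_def by (rule someI_ex[OF bounded_cone_decomposition[OF cone_closed cone_generating]])
  then show "0 \<le> M" "\<exists>u v. 0 \<le> u \<and> 0 \<le> v \<and> w = u - v \<and> norm u + norm v \<le> M * norm (w::'a)" by blast+
qed

lemma cone_split:
  obtains u v :: 'a where "0 \<le> u" "0 \<le> v" "w = u - v" "norm u + norm v \<le> M * norm w"
  using M(2)[of w] by blast

lemma linear_bound_from_cone:
  fixes T :: "'a \<Rightarrow> 'b::real_normed_vector"
  assumes "\<And>u v. T (u - v) = T u - T v" "\<And>u. 0 \<le> u \<Longrightarrow> norm (T u) \<le> norm u"
  shows "norm (T w) \<le> M * norm w"
proof -
  obtain u v where uv: "0 \<le> u" "0 \<le> v" "w = u - v" "norm u + norm v \<le> M * norm w" by (rule cone_split)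
  have "norm (T w) \<le> norm (T u) + norm (T v)" unfolding uv(3) assms(1) by (rule norm_triangle_ineq4)
  also have "\<dots> \<le> norm u + norm v" using assms(2) uv by (intro add_mono) auto
  finally show ?thesis using uv(4) by simp
qed

lemma U_bounded_linear: "0 \<le> s \<Longrightarrow> s \<le> t \<Longrightarrow> bounded_linear (U t s)"
  and U_continuous: "continuous_on \<Delta> (\<lambda>(t, s). U t s u)"
  and U_compose: "0 \<le> s \<Longrightarrow> s \<le> r \<Longrightarrow> r \<le> t \<Longrightarrow> U t s u = U t r (U r s u)"
  and U_refl: "0 \<le> t \<Longrightarrow> U t t u = u"
  using U_evolution unfolding evolution_family_def by blast+

lemma U_bound: "0 \<le> s \<Longrightarrow> s \<le> t \<Longrightarrow> norm (U t s w) \<le> M * norm w"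
  using U_contr U_bounded_linear by (intro linear_bound_from_cone) (auto simp: linear_simps)

text \<open>
  The function \<open>r \<mapsto> B(r) U(r,s) u\<close>, extended by \<open>0\<close> to times
  before \<open>s\<close>, so that integrals over it live on the whole line.
\<close>
definition BU :: "real \<Rightarrow> 'a \<Rightarrow> real \<Rightarrow> 'a" where
  "BU s u r = indicator {s..} r *\<^sub>R B r (U r s u)"

lemma BU_strongly_measurable: "0 \<le> s \<Longrightarrow> strongly_measurable lborel (BU s u)"
  using BU_measurable unfolding BU_def by (simp add: strongly_measurable_lebesgue_on)

lemma BU_D: "0 \<le> s \<Longrightarrow> AE r in lborel. s \<le> r \<longrightarrow> U r s u \<in> D r"
  using BU_defined by (simp add: AE_lebesgue_on_iff)

lemma BU_add:
  assumes s: "0 \<le> s"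
  shows "AE r in lborel. BU s (u + v) r = BU s u r + BU s v r"
  using BU_D[OF s, of u] BU_D[OF s, of v]
proof eventually_elim
  case (elim r)
  then show ?case
    using s B_linear U_bounded_linear[OF s, of r] unfolding BU_def linear_operator_def
    by (cases "s \<le> r") (auto simp: linear_simps)
qed

lemma BU_scale:
  assumes s: "0 \<le> s"
  shows "AE r in lborel. BU s (c *\<^sub>R u) r = c *\<^sub>R BU s u r"
  using BU_D[OF s, of u]
proof eventually_elim
  case (elim r)
  then show ?case
    using s B_linear U_bounded_linear[OF s, of r] unfolding BU_def linear_operator_def
    by (cases "s \<le> r") (auto simp: linear_simps)
qed

lemma BU_diff:
  assumes s: "0 \<le> s"
  shows "AE r in lborel. BU s (u - v) r = BU s u r - BU s v r"
  using BU_add[OF s, of u "-1 *\<^sub>R v"] BU_scale[OF s, of "-1" v] by eventually_elim simp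

lemma BU_nonneg:
  assumes s: "0 \<le> s" and u: "0 \<le> u"
  shows "AE r in lborel. 0 \<le> BU s u r"
  using BU_D[OF s, of u]
proof eventually_elim
  case (elim r)
  then show ?case
    using s u B_pos U_pos unfolding BU_def by (cases "s \<le> r") auto
qed

lemma BU_compose: "0 \<le> s \<Longrightarrow> s \<le> s' \<Longrightarrow> s' \<le> r \<Longrightarrow> BU s u r = BU s' (U s' s u) r"
  by (simp add: BU_def U_compose[of s s' r])

lemma BU_interval_bound:
  assumes s: "0 \<le> s" "s \<le> t" and u: "0 \<le> u"
  shows "(\<integral>\<^sup>+r. ennreal (norm (indicator {s..t} r *\<^sub>R BU s u r)) \<partial>lborel) \<le> ennreal (norm u - norm (U t s u))"
proof -
  have "(\<integral>\<^sup>+r. ennreal (norm (indicator {s..t} r *\<^sub>R BU s u r)) \<partial>lborel) =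
     (\<integral>\<^sup>+r. ennreal (norm (indicator {s..t} r *\<^sub>R B r (U r s u))) \<partial>lborel)"
    by (intro nn_integral_cong) (simp add: BU_def indicator_def)
  also have "\<dots> = (\<integral>\<^sup>+\<tau>. ennreal (norm (B \<tau> (U \<tau> s u))) \<partial>(lebesgue_on {s..t}))"
    by (rule nn_integral_norm_lebesgue_on[symmetric]) simp
  finally show ?thesis using BU_bound s u by simp
qed

text \<open>
  The bounds on the intervals \<open>{s..s + n}\<close> do not depend on \<open>n\<close>, so
  monotone convergence applies.
\<close>
lemma BU_total_bound:
  assumes s: "0 \<le> s" and u: "0 \<le> u"
  shows "(\<integral>\<^sup>+r. ennreal (norm (BU s u r)) \<partial>lborel) \<le> ennreal (norm u)"
proof -
  obtain G where G: "sep_measurable lborel G" "AE r in lborel. BU s u r = G r"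
    using BU_strongly_measurable[OF s] strongly_measurable_iff_sep by blast
  have [measurable]: "(\<lambda>r. norm (G r)) \<in> borel_measurable lborel" using sep_measurable_norm[OF G(1)] .
  have le: "(\<integral>\<^sup>+r. ennreal (norm (G r)) * indicator {s..s + real n} r \<partial>lborel) \<le> ennreal (norm u)" for n
  proof -
    have "(\<integral>\<^sup>+r. ennreal (norm (G r)) * indicator {s..s + real n} r \<partial>lborel) =
       (\<integral>\<^sup>+r. ennreal (norm (indicator {s..s + real n} r *\<^sub>R BU s u r)) \<partial>lborel)"
      using G(2) by (intro nn_integral_cong_AE) (elim AE_mp, auto simp: indicator_def)
    also have "\<dots> \<le> ennreal (norm u - norm (U (s + real n) s u))" using s u by (intro BU_interval_bound) auto
    also have "\<dots> \<le> ennreal (norm u)" by (intro ennreal_leI) simp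
    finally show ?thesis .
  qed
  have "(\<integral>\<^sup>+r. ennreal (norm (BU s u r)) \<partial>lborel) = (\<integral>\<^sup>+r. (SUP n. ennreal (norm (G r)) * indicator {s..s + real n} r) \<partial>lborel)"
  proof (rule nn_integral_cong_AE)
    show "AE r in lborel. ennreal (norm (BU s u r)) = (SUP n. ennreal (norm (G r)) * indicator {s..s + real n} r)"
      using G(2)
    proof eventually_elim
      case (elim r)
      show ?case
      proof (cases "s \<le> r")
        case True
        obtain n :: nat where "r - s \<le> n" using real_arch_simple by blast
        then have "ennreal (norm (G r)) \<le> (SUP n. ennreal (norm (G r)) * indicator {s..s + real n} r)"
          using True by (intro SUP_upper2[of n]) auto
        moreover have "(SUP n. ennreal (norm (G r)) * indicator {s..s + real n} r) \<le> ennreal (norm (G r))"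
          by (intro SUP_least) (simp add: indicator_def)
        ultimately show ?thesis using elim by simp
      next
        case False
        then have "BU s u r = 0" by (simp add: BU_def)
        with False elim show ?thesis by simp
      qed
    qed
  qed
  also have "\<dots> = (SUP n. \<integral>\<^sup>+r. ennreal (norm (G r)) * indicator {s..s + real n} r \<partial>lborel)"
    by (intro nn_integral_monotone_convergence_SUP)
      (auto simp: incseq_def le_fun_def indicator_def)
  also have "\<dots> \<le> ennreal (norm u)" by (intro SUP_least le)
  finally show ?thesis .
qed

lemma BU_strongly_integrable:
  assumes s: "0 \<le> s"
  shows "strongly_integrable lborel (BU s u)"
proof -
  obtain a b where ab: "0 \<le> a" "0 \<le> b" "u = a - b" by (rule cone_split)
  have "strongly_integrable lborel (BU s a)" "strongly_integrable lborel (BU s b)"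
    using BU_total_bound[OF s] ab BU_strongly_measurable[OF s] le_less_trans[OF _ ennreal_less_top]
    by (auto simp: strongly_integrable_def)
  then have "strongly_integrable lborel (\<lambda>r. BU s a r - BU s b r)" by (rule strongly_integrable_minus)
  then show ?thesis using strongly_integrable_cong_AE[OF BU_diff[OF s, of a b]] ab(3) by simp
qed

lemma BU_L1_bound:
  assumes s: "0 \<le> s"
  shows "L1_seminorm lborel (BU s u) \<le> M * norm u"
proof -
  obtain a b where ab: "0 \<le> a" "0 \<le> b" "u = a - b" "norm a + norm b \<le> M * norm u" by (rule cone_split)
  have "L1_seminorm lborel (BU s u) = L1_seminorm lborel (\<lambda>r. BU s a r + -1 *\<^sub>R BU s b r)"
    using BU_diff[OF s, of a b] ab(3) by (intro L1_seminorm_cong_AE) (elim AE_mp, auto)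
  also have "\<dots> \<le> L1_seminorm lborel (BU s a) + L1_seminorm lborel (\<lambda>r. -1 *\<^sub>R BU s b r)"
    using s by (intro L1_seminorm_triangle strongly_integrable_scale BU_strongly_integrable)
  also have "\<dots> = L1_seminorm lborel (BU s a) + L1_seminorm lborel (BU s b)"
    using L1_seminorm_scale[OF BU_strongly_integrable[OF s], of "-1" b] by simp
  also have "\<dots> \<le> norm a + norm b"
    using s ab by (intro add_mono L1_seminorm_bound_nn BU_total_bound) auto
  finally show ?thesis using ab(4) by simp
qed

lemma BU_interval_L1_bound:
  assumes s: "0 \<le> s" "s \<le> t" and u: "0 \<le> u"
  shows "L1_seminorm lborel (\<lambda>r. indicator {s..t} r *\<^sub>R BU s u r) \<le> norm u - norm (U t s u)"
  using BU_interval_bound[OF assms] U_contr assms by (intro L1_seminorm_bound_nn) auto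

end

section \<open>The Dyson series\<close>

declare perturbation_term.simps(2) [simp del]

context perturbed_evolution
begin

abbreviation Vn :: "nat \<Rightarrow> real \<Rightarrow> real \<Rightarrow> 'a \<Rightarrow> 'a" where
  "Vn \<equiv> perturbation_term U B"

abbreviation V :: "real \<Rightarrow> real \<Rightarrow> 'a \<Rightarrow> 'a" where
  "V \<equiv> perturbed_family U B"

definition dyson_integrand :: "nat \<Rightarrow> real \<Rightarrow> real \<Rightarrow> 'a \<Rightarrow> real \<Rightarrow> 'a" where
  "dyson_integrand n t s u r = (if s \<le> r \<and> r \<le> t then Vn n t r (BU s u r) else 0)"

text \<open>
  One induction on \<open>n\<close> carries the following five properties together. Joint
  continuity of \<open>V\<^sub>n\<close> makes the integrand of
  \<open>V\<^sub>n\<^sub>+\<^sub>1\<close> measurable and the bound makes it integrable;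
  conversely, continuity of \<open>V\<^sub>n\<^sub>+\<^sub>1\<close> in the initial time is
  obtained from its cocycle identity and its bound.
\<close>
definition Vn_linear :: "nat \<Rightarrow> bool" where
  "Vn_linear n \<longleftrightarrow> (\<forall>s t. 0 \<le> s \<and> s \<le> t \<longrightarrow> linear (Vn n t s))"

definition Vn_positive :: "nat \<Rightarrow> bool" where
  "Vn_positive n \<longleftrightarrow> (\<forall>s t u. 0 \<le> s \<and> s \<le> t \<and> 0 \<le> u \<longrightarrow> 0 \<le> Vn n t s u)"

definition Vn_cocycle :: "nat \<Rightarrow> bool" where
  "Vn_cocycle n \<longleftrightarrow> (\<forall>s r t u. 0 \<le> s \<and> s \<le> r \<and> r \<le> t \<longrightarrow> Vn n t s u = (\<Sum>k\<le>n. Vn k t r (Vn (n - k) r s u)))"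

definition Vn_continuous :: "nat \<Rightarrow> bool" where
  "Vn_continuous n \<longleftrightarrow> (\<forall>u. continuous_on \<Delta> (\<lambda>(t, s). Vn n t s u))"

definition Vn_sum_bound :: "nat \<Rightarrow> bool" where
  "Vn_sum_bound n \<longleftrightarrow> (\<forall>s t u. 0 \<le> s \<and> s \<le> t \<and> 0 \<le> u \<longrightarrow> (\<Sum>k\<le>n. norm (Vn k t s u)) \<le> norm u)"

lemma Vn_term_bound:
  assumes b: "Vn_sum_bound n" and l: "Vn_linear k" and k: "k \<le> n" and st: "0 \<le> s" "s \<le> t"
  shows "norm (Vn k t s w) \<le> M * norm w" "bounded_linear (Vn k t s)"
proof -
  have lin: "linear (Vn k t s)" using l st by (auto simp: Vn_linear_def)
  have "norm (Vn k t s u) \<le> norm u" if "0 \<le> u" for u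
  proof -
    have "norm (Vn k t s u) \<le> (\<Sum>k\<le>n. norm (Vn k t s u))"
      using k by (intro member_le_sum) auto
    also have "\<dots> \<le> norm u" using b st that by (auto simp: Vn_sum_bound_def)
    finally show ?thesis .
  qed
  then have bd: "norm (Vn k t s w) \<le> M * norm w" for w
    using linear_diff[OF lin] by (intro linear_bound_from_cone)
  then show "norm (Vn k t s w) \<le> M * norm w" .
  show "bounded_linear (Vn k t s)"
    using lin bd by (intro bounded_linear.intro bounded_linear_axioms.intro exI[of _ M])
      (auto simp: mult.commute)
qed

lemma Delta_borel: "\<Delta> \<in> sets borel"
proof -
  have "closed {p :: real \<times> real. 0 \<le> snd p \<and> snd p \<le> fst p}"
    by (intro closed_Collect_conj closed_Collect_le continuous_intros)
  moreover have "\<Delta> = {p. 0 \<le> snd p \<and> snd p \<le> fst p}" by auto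
  ultimately show ?thesis by (simp add: borel_closed)
qed

lemma Vn_sep_measurable:
  assumes "Vn_continuous n"
  shows "sep_measurable borel (\<lambda>(t, s). if 0 \<le> s \<and> s \<le> t then Vn n t s x else 0)"
proof -
  have "sep_measurable borel (\<lambda>p. if p \<in> \<Delta> then (case p of (t, s) \<Rightarrow> Vn n t s x) else 0)"
    using assms by (intro sep_measurable_continuous_on Delta_borel) (simp add: Vn_continuous_def)
  then show ?thesis by (rule back_subst[where P="sep_measurable borel"]) auto
qed

lemma dyson_integrand_strongly_integrable:
  assumes b: "Vn_sum_bound n" and l: "Vn_linear k" and k: "k \<le> n" and c: "Vn_continuous k" and st: "0 \<le> s" "s \<le> t"
  shows "strongly_integrable lborel (dyson_integrand k t s u)"
    and "AE r in lborel. norm (dyson_integrand k t s u r) \<le> norm (M *\<^sub>R BU s u r)"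
proof -
  let ?W = "\<lambda>r x. if 0 \<le> r \<and> r \<le> t then Vn k t r x else 0"
  obtain G where G: "sep_measurable lborel G" "AE r in lborel. BU s u r = G r"
    using BU_strongly_measurable[OF st(1)] strongly_measurable_iff_sep by blast
  have sm: "sep_measurable lborel (\<lambda>r. ?W r (G r))"
  proof (rule sep_measurable_operator_apply[OF _ _ G(1)])
    fix x
    have "(\<lambda>r. (t, r)) \<in> measurable lborel (borel :: (real \<times> real) measure)" by measurable
    from sep_measurable_compose[OF Vn_sep_measurable[OF c, of x] this]
    show "sep_measurable lborel (\<lambda>r. ?W r x)" by simp
  next
    fix r
    show "bounded_linear (?W r)"
      using Vn_term_bound(2)[OF b l k, of r t] by (cases "0 \<le> r \<and> r \<le> t") auto
  qed
  have "Measurable.pred lborel (\<lambda>r. s \<le> r)" by measurable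
  from sep_measurable_If[OF this sm]
  have "sep_measurable lborel (\<lambda>r. if s \<le> r then ?W r (G r) else 0)" .
  moreover have "AE r in lborel. dyson_integrand k t s u r = (if s \<le> r then ?W r (G r) else 0)"
    using G(2)
  proof eventually_elim
    case (elim r)
    then show ?case using st by (simp add: dyson_integrand_def)
  qed
  ultimately have m: "strongly_measurable lborel (dyson_integrand k t s u)"
    using strongly_measurable_iff_sep by blast
  have "norm (dyson_integrand k t s u r) \<le> norm (M *\<^sub>R BU s u r)" for r
    using Vn_term_bound(1)[OF b l k, of r t] st M(1) by (auto simp: dyson_integrand_def)
  then show le: "AE r in lborel. norm (dyson_integrand k t s u r) \<le> norm (M *\<^sub>R BU s u r)" by simp
  show "strongly_integrable lborel (dyson_integrand k t s u)"
    by (rule strongly_integrable_dominated[OF m strongly_integrable_scale[OF BU_strongly_integrable[OF st(1)]] le])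
qed

lemma Vn_Suc: "Vn (Suc n) t s u = strong_integral lborel (dyson_integrand n t s u)"
proof -
  have "indicator {s..t} r *\<^sub>R Vn n t r (B r (U r s u)) = dyson_integrand n t s u r" for r
    by (simp add: dyson_integrand_def BU_def indicator_def)
  then show ?thesis by (simp add: perturbation_term.simps(2) strong_integral_lebesgue_on)
qed

lemma Vn_Suc_linear:
  assumes b: "Vn_sum_bound n" and l: "Vn_linear n" and c: "Vn_continuous n"
  shows "Vn_linear (Suc n)"
  unfolding Vn_linear_def
proof (intro allI impI linearI)
  fix s t a :: real and u v :: 'a assume st: "0 \<le> s \<and> s \<le> t"
  note si = dyson_integrand_strongly_integrable(1)[OF b l order_refl c, of s t]
  have bl: "bounded_linear (Vn n t r)" if "s \<le> r" "r \<le> t" for r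
    using Vn_term_bound(2)[OF b l order_refl, of r t] st that by auto
  have "AE r in lborel. dyson_integrand n t s (u + v) r = dyson_integrand n t s u r + dyson_integrand n t s v r"
    using BU_add[of s u v, OF conjunct1[OF st]]
    by eventually_elim (simp add: dyson_integrand_def linear_simps(1)[OF bl])
  then show "Vn (Suc n) t s (u + v) = Vn (Suc n) t s u + Vn (Suc n) t s v"
    unfolding Vn_Suc using si st by (subst strong_integral_add[symmetric]) (auto intro: strong_integral_cong_AE)
  have "AE r in lborel. dyson_integrand n t s (a *\<^sub>R u) r = a *\<^sub>R dyson_integrand n t s u r"
    using BU_scale[of s a u, OF conjunct1[OF st]]
    by eventually_elim (simp add: dyson_integrand_def linear_simps(5)[OF bl])
  then show "Vn (Suc n) t s (a *\<^sub>R u) = a *\<^sub>R Vn (Suc n) t s u"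
    unfolding Vn_Suc using si st by (subst strong_integral_scaleR[symmetric]) (auto intro: strong_integral_cong_AE)
qed

lemma Vn_Suc_positive:
  assumes b: "Vn_sum_bound n" and l: "Vn_linear n" and c: "Vn_continuous n" and p: "Vn_positive n"
  shows "Vn_positive (Suc n)"
  unfolding Vn_positive_def
proof (intro allI impI)
  fix s t :: real and u :: 'a assume st: "0 \<le> s \<and> s \<le> t \<and> 0 \<le> u"
  have "AE r in lborel. 0 \<le> dyson_integrand n t s u r"
    using BU_nonneg[OF conjunct1[OF st], of u, OF conjunct2[OF conjunct2[OF st]]]
  proof eventually_elim
    case (elim r)
    then show ?case using st p by (simp add: dyson_integrand_def Vn_positive_def)
  qed
  then show "0 \<le> Vn (Suc n) t s u"
    unfolding Vn_Suc using dyson_integrand_strongly_integrable(1)[OF b l order_refl c, of s t u] st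
    by (intro strong_integral_nonneg[OF cone_closed]) auto
qed

text \<open>
  The norms of \<open>V\<^sub>1 u, \<dots>, V\<^sub>n\<^sub>+\<^sub>1 u\<close> are estimated
  under the integral by the norms of \<open>V\<^sub>k(t,r)\<close>, \<open>k \<le> n\<close>, on
  the positive vector \<open>B(r) U(r,s) u\<close>. By induction these add up to at most the norm
  of that vector, whose integral is at most \<open>norm u - norm (U t s u)\<close>; what is
  subtracted here is the norm of \<open>V\<^sub>0 u\<close>.
\<close>
lemma Vn_Suc_sum_bound:
  assumes b: "Vn_sum_bound n" and l: "\<And>k. k \<le> n \<Longrightarrow> Vn_linear k" and c: "\<And>k. k \<le> n \<Longrightarrow> Vn_continuous k"
  shows "Vn_sum_bound (Suc n)"
  unfolding Vn_sum_bound_def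
proof (intro allI impI)
  fix s t :: real and u :: 'a assume st: "0 \<le> s \<and> s \<le> t \<and> 0 \<le> u"
  have si: "strongly_integrable lborel (dyson_integrand k t s u)" if "k \<le> n" for k
    using dyson_integrand_strongly_integrable(1)[OF b l[OF that] that c[OF that], of s t u] st by auto
  have w: "strongly_integrable lborel (\<lambda>r. indicator {s..t} r *\<^sub>R BU s u r)"
    using st by (intro strongly_integrable_indicator BU_strongly_integrable) auto
  have "(\<Sum>k\<le>Suc n. norm (Vn k t s u)) = norm (U t s u) + (\<Sum>k\<le>n. norm (Vn (Suc k) t s u))"
    using sum.atMost_Suc_shift[of "\<lambda>k. norm (Vn k t s u)" n] by simp
  also have "(\<Sum>k\<le>n. norm (Vn (Suc k) t s u)) \<le> (\<Sum>k\<le>n. L1_seminorm lborel (dyson_integrand k t s u))"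
    unfolding Vn_Suc by (intro sum_mono norm_strong_integral_le si) auto
  also have "\<dots> \<le> L1_seminorm lborel (\<lambda>r. indicator {s..t} r *\<^sub>R BU s u r)"
  proof (rule sum_L1_seminorm_le[OF _ si w])
    show "AE r in lborel. (\<Sum>k\<le>n. norm (dyson_integrand k t s u r)) \<le> norm (indicator {s..t} r *\<^sub>R BU s u r)"
      using BU_nonneg[OF conjunct1[OF st], of u, OF conjunct2[OF conjunct2[OF st]]]
    proof eventually_elim
      case (elim r)
      then show ?case
        using st b by (cases "s \<le> r \<and> r \<le> t") (auto simp: dyson_integrand_def Vn_sum_bound_def)
    qed
  qed auto
  also have "\<dots> \<le> norm u - norm (U t s u)" using st by (intro BU_interval_L1_bound) auto
  finally show "(\<Sum>k\<le>Suc n. norm (Vn k t s u)) \<le> norm u" by simp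
qed

text \<open>
  The integral from \<open>s\<close> to \<open>t\<close> is split at \<open>r\<close>. Before
  \<open>r\<close> the identity for \<open>n\<close> applies to the integrand; after
  \<open>r\<close> the integrand only sees \<open>U(r,s) u\<close>, which gives the term
  \<open>V\<^sub>n\<^sub>+\<^sub>1(t,r) V\<^sub>0(r,s) u\<close>.
\<close>
lemma Vn_Suc_cocycle:
  assumes b: "Vn_sum_bound n" and l: "\<And>k. k \<le> n \<Longrightarrow> Vn_linear k" and c: "\<And>k. k \<le> n \<Longrightarrow> Vn_continuous k"
    and coc: "Vn_cocycle n"
  shows "Vn_cocycle (Suc n)"
  unfolding Vn_cocycle_def
proof (intro allI impI)
  fix s r t :: real and u :: 'a assume srt: "0 \<le> s \<and> s \<le> r \<and> r \<le> t"
  note si = dyson_integrand_strongly_integrable(1)[OF b l _ c]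
  have bl: "bounded_linear (Vn k t r)" if "k \<le> n" for k
    using Vn_term_bound(2)[OF b l[OF that] that, of r t] srt by auto
  have bi: "strongly_integrable lborel (\<lambda>\<tau>. Vn k t r (dyson_integrand (n - k) r s u \<tau>))" if "k \<le> n" for k
    by (rule strongly_integrable_bounded_linear[OF bl[OF that] si]) (use srt in auto)
  have "AE \<tau> in lborel. \<tau> \<noteq> r" using AE_lborel_singleton[of r] by auto
  then have "AE \<tau> in lborel. dyson_integrand n t s u \<tau> =
      (\<Sum>k\<le>n. Vn k t r (dyson_integrand (n - k) r s u \<tau>)) + dyson_integrand n t r (U r s u) \<tau>"
  proof eventually_elim
    case (elim \<tau>)
    consider "\<tau> < s" | "s \<le> \<tau>" "\<tau> < r" | "r < \<tau>" "\<tau> \<le> t" | "t < \<tau>" using elim by linarith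
    then show ?case
    proof cases
      case 2
      then show ?thesis using srt coc by (simp add: dyson_integrand_def Vn_cocycle_def)
    next
      case 3
      then have "dyson_integrand (n - k) r s u \<tau> = 0" for k by (simp add: dyson_integrand_def)
      then show ?thesis using 3 srt BU_compose[of s r \<tau> u] linear_simps(3)[OF bl] by (simp add: dyson_integrand_def)
    qed (use srt linear_simps(3)[OF bl] in \<open>simp_all add: dyson_integrand_def\<close>)
  qed
  then have "Vn (Suc n) t s u =
      strong_integral lborel (\<lambda>\<tau>. (\<Sum>k\<le>n. Vn k t r (dyson_integrand (n - k) r s u \<tau>)) + dyson_integrand n t r (U r s u) \<tau>)"
    unfolding Vn_Suc by (rule strong_integral_cong_AE)
  also have "\<dots> = strong_integral lborel (\<lambda>\<tau>. \<Sum>k\<le>n. Vn k t r (dyson_integrand (n - k) r s u \<tau>)) +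
      strong_integral lborel (dyson_integrand n t r (U r s u))"
    by (rule strong_integral_add[OF strongly_integrable_sum[OF bi] si]) (use srt in auto)
  also have "strong_integral lborel (\<lambda>\<tau>. \<Sum>k\<le>n. Vn k t r (dyson_integrand (n - k) r s u \<tau>)) =
      (\<Sum>k\<le>n. strong_integral lborel (\<lambda>\<tau>. Vn k t r (dyson_integrand (n - k) r s u \<tau>)))"
    by (rule strong_integral_sum[OF bi]) simp
  also have "\<dots> = (\<Sum>k\<le>n. Vn k t r (strong_integral lborel (dyson_integrand (n - k) r s u)))"
    by (rule sum.cong[OF refl], rule strong_integral_bounded_linear[OF bl si]) (use srt in auto)
  also have "\<dots> = (\<Sum>k\<le>n. Vn k t r (Vn (Suc n - k) r s u))"
    by (intro sum.cong refl) (simp add: Suc_diff_le Vn_Suc)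
  finally show "Vn (Suc n) t s u = (\<Sum>k\<le>Suc n. Vn k t r (Vn (Suc n - k) r s u))"
    by (simp add: Vn_Suc)
qed

text \<open>
  On \<open>[s,s']\<close> the terms of positive order have total norm at most \<open>norm u -
  norm (U s' s u)\<close>, hence at most \<open>norm (U s' s u - u)\<close>. Splitting at
  \<open>s'\<close> therefore gives continuity in the initial time, uniformly in the final time.
\<close>
lemma Vn_initial_time_estimate:
  assumes b: "Vn_sum_bound n" and l: "\<And>k. k \<le> n \<Longrightarrow> Vn_linear k"
    and coc: "Vn_cocycle n" and st: "0 \<le> s" "s \<le> s'" "s' \<le> t" and u: "0 \<le> u"
  shows "norm (Vn n t s u - Vn n t s' u) \<le> 2 * M * norm (U s' s u - u)"
proof -
  have lin: "linear (Vn n t s')" using l[of n] st by (auto simp: Vn_linear_def)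
  have bd: "norm (Vn k t s' x) \<le> M * norm x" if "k \<le> n" for k x
    using Vn_term_bound(1)[OF b l[OF that] that] st by auto
  have "Vn n t s u = (\<Sum>k\<le>n. Vn k t s' (Vn (n - k) s' s u))"
    using coc st by (auto simp: Vn_cocycle_def)
  also have "\<dots> = (\<Sum>k<n. Vn k t s' (Vn (n - k) s' s u)) + Vn n t s' (U s' s u)"
    by (simp add: lessThan_Suc_atMost[symmetric])
  finally have "Vn n t s u - Vn n t s' u = (\<Sum>k<n. Vn k t s' (Vn (n - k) s' s u)) + Vn n t s' (U s' s u - u)"
    by (simp add: linear_diff[OF lin])
  then have "norm (Vn n t s u - Vn n t s' u) \<le>
      norm (\<Sum>k<n. Vn k t s' (Vn (n - k) s' s u)) + norm (Vn n t s' (U s' s u - u))"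
    by (simp only: norm_triangle_ineq)
  moreover have "norm (\<Sum>k<n. Vn k t s' (Vn (n - k) s' s u)) \<le> (\<Sum>k<n. M * norm (Vn (n - k) s' s u))"
    by (intro sum_norm_le bd) auto
  moreover have "(\<Sum>k<n. M * norm (Vn (n - k) s' s u)) = M * (\<Sum>k\<in>{1..n}. norm (Vn k s' s u))"
    unfolding sum_distrib_left by (rule sum.reindex_bij_witness[of _ "\<lambda>k. n - k" "\<lambda>k. n - k"]) auto
  moreover have "norm (Vn n t s' (U s' s u - u)) \<le> M * norm (U s' s u - u)" by (rule bd) simp
  moreover have "(\<Sum>k\<in>{1..n}. norm (Vn k s' s u)) \<le> norm (U s' s u - u)"
  proof -
    have "(\<Sum>k\<le>n. norm (Vn k s' s u)) = norm (U s' s u) + (\<Sum>k\<in>{1..n}. norm (Vn k s' s u))"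
      by (simp add: atMost_atLeast0 sum.atLeast_Suc_atMost[of 0 n])
    moreover have "(\<Sum>k\<le>n. norm (Vn k s' s u)) \<le> norm u" using b st u by (auto simp: Vn_sum_bound_def)
    moreover have "norm u - norm (U s' s u) \<le> norm (U s' s u - u)"
      using norm_triangle_ineq2[of u "U s' s u"] by (simp add: norm_minus_commute)
    ultimately show ?thesis by simp
  qed
  then have "M * (\<Sum>k\<in>{1..n}. norm (Vn k s' s u)) \<le> M * norm (U s' s u - u)"
    using M(1) by (rule mult_left_mono)
  ultimately show ?thesis by simp
qed

lemma tendsto_in_Delta:
  assumes "Vn_continuous n" and "\<And>i. 0 \<le> s i \<and> s i \<le> t i" "t \<longlonglongrightarrow> t0" "s \<longlonglongrightarrow> s0" "0 \<le> s0" "s0 \<le> t0"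
  shows "(\<lambda>i. Vn n (t i) (s i) u) \<longlonglongrightarrow> Vn n t0 s0 u"
proof -
  have "continuous_on \<Delta> (\<lambda>(t, s). Vn n t s u)" using assms(1) by (simp add: Vn_continuous_def)
  from continuous_on_tendsto_compose[OF this tendsto_Pair[OF assms(3,4)]]
  show ?thesis using assms by simp
qed

lemma Vn_0_continuous: "Vn_continuous 0"
  using U_continuous by (simp add: Vn_continuous_def)

lemma Vn_Suc_final_time:
  assumes b: "Vn_sum_bound n" and l: "Vn_linear n" and c: "Vn_continuous n"
    and s: "0 \<le> s" and t: "t \<longlonglongrightarrow> t0" "s < t0" "\<And>i. s \<le> t i"
  shows "(\<lambda>i. Vn (Suc n) (t i) s u) \<longlonglongrightarrow> Vn (Suc n) t0 s u"
  unfolding Vn_Suc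
proof (rule strong_integral_dominated_convergence)
  show "strongly_measurable lborel (dyson_integrand n (t i) s u)" for i
    using dyson_integrand_strongly_integrable(1)[OF b l order_refl c s t(3)] by (rule strongly_integrable_measurable)
  show "strongly_integrable lborel (\<lambda>r. M *\<^sub>R BU s u r)" by (intro strongly_integrable_scale BU_strongly_integrable s)
  show "AE r in lborel. norm (dyson_integrand n (t i) s u r) \<le> norm (M *\<^sub>R BU s u r)" for i
    by (rule dyson_integrand_strongly_integrable(2)[OF b l order_refl c s t(3)])
  have "AE r in lborel. r \<noteq> t0" using AE_lborel_singleton[of t0] by auto
  then show "AE r in lborel. (\<lambda>i. dyson_integrand n (t i) s u r) \<longlonglongrightarrow> dyson_integrand n t0 s u r"
  proof eventually_elim
    case (elim r)
    consider "r < s" | "s \<le> r" "r < t0" | "t0 < r" using elim by linarith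
    then show ?case
    proof cases
      case 2
      then have ev: "\<forall>\<^sub>F i in sequentially. r < t i" using order_tendstoD(1)[OF t(1)] by auto
      have "(\<lambda>i. Vn n (max r (t i)) r (BU s u r)) \<longlonglongrightarrow> Vn n (max r t0) r (BU s u r)"
        using s 2 t by (intro tendsto_in_Delta[OF c] tendsto_max tendsto_const) auto
      moreover have "max r t0 = t0" using 2 by simp
      ultimately have lim: "(\<lambda>i. Vn n (max r (t i)) r (BU s u r)) \<longlonglongrightarrow> dyson_integrand n t0 s u r"
        using 2 by (simp add: dyson_integrand_def)
      have "\<forall>\<^sub>F i in sequentially. Vn n (max r (t i)) r (BU s u r) = dyson_integrand n (t i) s u r"
        using ev
      proof eventually_elim
        case (elim i)
        then show ?case using 2 by (simp add: dyson_integrand_def max_def)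
      qed
      with lim show ?thesis by (rule Lim_transform_eventually)
    next
      case 3
      then have ev: "\<forall>\<^sub>F i in sequentially. t i < r" using order_tendstoD(2)[OF t(1)] by auto
      have "(\<lambda>i. 0) \<longlonglongrightarrow> dyson_integrand n t0 s u r" using 3 by (simp add: dyson_integrand_def)
      moreover have "\<forall>\<^sub>F i in sequentially. 0 = dyson_integrand n (t i) s u r"
        using ev by eventually_elim (simp add: dyson_integrand_def)
      ultimately show ?thesis by (rule Lim_transform_eventually)
    qed (simp add: dyson_integrand_def)
  qed
qed

text \<open>
  At a point of the diagonal the term is dominated by \<open>norm u - norm (U t s u)\<close>,
  which is continuous and vanishes there. Off the diagonal the initial time is moved first,
  uniformly in the final time, and the final time afterwards by dominated convergence.
\<close>
lemma Vn_Suc_continuous_cone: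
  assumes b: "Vn_sum_bound (Suc n)" and l: "\<And>k. k \<le> Suc n \<Longrightarrow> Vn_linear k" and c: "Vn_continuous n"
    and coc: "Vn_cocycle (Suc n)" and u: "0 \<le> u"
    and ts: "\<And>i. 0 \<le> s i \<and> s i \<le> t i" "t \<longlonglongrightarrow> t0" "s \<longlonglongrightarrow> s0" "0 \<le> s0" "s0 \<le> t0"
  shows "(\<lambda>i. Vn (Suc n) (t i) (s i) u) \<longlonglongrightarrow> Vn (Suc n) t0 s0 u"
proof (cases "s0 = t0")
  case True
  have le: "norm (Vn (Suc n) t s u) \<le> norm u - norm (U t s u)" if "0 \<le> s" "s \<le> t" for s t
  proof -
    have "norm (U t s u) + norm (Vn (Suc n) t s u) = (\<Sum>k\<in>{0, Suc n}. norm (Vn k t s u))"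
      by (simp)
    also have "\<dots> \<le> (\<Sum>k\<le>Suc n. norm (Vn k t s u))" by (intro sum_mono2) auto
    also have "\<dots> \<le> norm u" using b that u by (auto simp: Vn_sum_bound_def)
    finally show ?thesis by simp
  qed
  have "Vn (Suc n) t0 s0 u = 0" using le[of s0 t0] True ts(4) by (simp add: U_refl)
  moreover have "(\<lambda>i. norm u - norm (U (t i) (s i) u)) \<longlonglongrightarrow> norm u - norm (U t0 s0 u)"
    using tendsto_in_Delta[OF Vn_0_continuous ts] by (intro tendsto_intros) simp
  then have z: "(\<lambda>i. norm u - norm (U (t i) (s i) u)) \<longlonglongrightarrow> 0" using True ts(4) by (simp add: U_refl)
  have "\<forall>i. norm (Vn (Suc n) (t i) (s i) u) \<le> norm u - norm (U (t i) (s i) u)" using le ts(1) by blast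
  then have "(\<lambda>i. Vn (Suc n) (t i) (s i) u) \<longlonglongrightarrow> 0"
    by (rule Lim_null_comparison[OF always_eventually z])
  ultimately show ?thesis by simp
next
  case False
  then have s0t0: "s0 < t0" using ts by simp
  define t' where "t' = (\<lambda>i. max s0 (t i))"
  have t': "t' \<longlonglongrightarrow> t0" "\<And>i. s0 \<le> t' i"
    unfolding t'_def using tendsto_max[OF tendsto_const ts(2), of s0] s0t0 by (auto simp: max_def)
  have bn: "Vn_sum_bound n"
    unfolding Vn_sum_bound_def
  proof (intro allI impI)
    fix s t :: real and u :: 'a assume "0 \<le> s \<and> s \<le> t \<and> 0 \<le> u"
    then have "(\<Sum>k\<le>Suc n. norm (Vn k t s u)) \<le> norm u" using b by (auto simp: Vn_sum_bound_def)
    then have "(\<Sum>k\<le>n. norm (Vn k t s u)) + norm (Vn (Suc n) t s u) \<le> norm u" by simp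
    then show "(\<Sum>k\<le>n. norm (Vn k t s u)) \<le> norm u"
      using norm_ge_zero[of "Vn (Suc n) t s u"] by linarith
  qed
  have lim1: "(\<lambda>i. Vn (Suc n) (t' i) s0 u) \<longlonglongrightarrow> Vn (Suc n) t0 s0 u"
    using l[of n] by (intro Vn_Suc_final_time[OF bn _ c ts(4) t'(1) s0t0 t'(2)]) simp
  define d where "d = (\<lambda>i. 2 * M * norm (U (max (s i) s0) (min (s i) s0) u - u))"
  have "(\<lambda>i. U (max (s i) s0) (min (s i) s0) u) \<longlonglongrightarrow> U (max s0 s0) (min s0 s0) u"
    using ts tendsto_max[OF ts(3) tendsto_const, of s0] tendsto_min[OF ts(3) tendsto_const, of s0]
      tendsto_in_Delta[OF Vn_0_continuous, of "\<lambda>i. min (s i) s0" "\<lambda>i. max (s i) s0" "max s0 s0" "min s0 s0" u]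
    by (auto simp: min_le_iff_disj le_max_iff_disj)
  then have "d \<longlonglongrightarrow> 2 * M * norm (u - u)"
    unfolding d_def using U_refl[OF ts(4)] by (intro tendsto_intros) simp
  then have d: "d \<longlonglongrightarrow> 0" by simp
  have "\<forall>\<^sub>F i in sequentially. s0 < t i" using order_tendstoD(1)[OF ts(2) s0t0] .
  then have "\<forall>\<^sub>F i in sequentially. norm (Vn (Suc n) (t i) (s i) u - Vn (Suc n) (t' i) s0 u) \<le> d i"
  proof eventually_elim
    case (elim i)
    then have t'i: "t' i = t i" by (simp add: t'_def)
    show ?case
    proof (cases "s i \<le> s0")
      case True
      then show ?thesis
        using Vn_initial_time_estimate[OF b l coc, of "s i" s0 "t i" u] elim ts(1)[of i] u t'i by (simp add: d_def)
    next
      case False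
      then show ?thesis
        using Vn_initial_time_estimate[OF b l coc, of s0 "s i" "t i" u] elim ts(1)[of i] ts(4) u t'i
        by (simp add: d_def norm_minus_commute)
    qed
  qed
  then have "(\<lambda>i. Vn (Suc n) (t i) (s i) u - Vn (Suc n) (t' i) s0 u) \<longlonglongrightarrow> 0"
    using d by (rule Lim_null_comparison)
  from tendsto_add[OF this lim1] show ?thesis by simp
qed

lemma Vn_Suc_continuous:
  assumes b: "Vn_sum_bound (Suc n)" and l: "\<And>k. k \<le> Suc n \<Longrightarrow> Vn_linear k" and c: "Vn_continuous n"
    and coc: "Vn_cocycle (Suc n)"
  shows "Vn_continuous (Suc n)"
  unfolding Vn_continuous_def continuous_on_sequentially
proof (intro allI ballI impI, elim conjE)
  fix u :: 'a and x :: "nat \<Rightarrow> real \<times> real" and a assume a: "a \<in> \<Delta>" and x: "\<forall>i. x i \<in> \<Delta>" "x \<longlonglongrightarrow> a"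
  obtain p q where pq: "0 \<le> p" "0 \<le> q" "u = p - q" by (rule cone_split)
  have ts: "\<And>i. 0 \<le> snd (x i) \<and> snd (x i) \<le> fst (x i)" "(\<lambda>i. fst (x i)) \<longlonglongrightarrow> fst a" "(\<lambda>i. snd (x i)) \<longlonglongrightarrow> snd a"
     "0 \<le> snd a" "snd a \<le> fst a"
    using x a by (auto intro: tendsto_fst tendsto_snd simp: case_prod_beta)
  have lin: "Vn (Suc n) (fst y) (snd y) u = Vn (Suc n) (fst y) (snd y) p - Vn (Suc n) (fst y) (snd y) q" 
    if "0 \<le> snd y" "snd y \<le> fst y" for y
    unfolding pq(3) using l[of "Suc n"] that by (intro linear_diff) (simp add: Vn_linear_def)
  show "((\<lambda>(t, s). Vn (Suc n) t s u) \<circ> x) \<longlonglongrightarrow> (case a of (t, s) \<Rightarrow> Vn (Suc n) t s u)"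
    using tendsto_diff[OF Vn_Suc_continuous_cone[OF b l c coc pq(1) ts] Vn_Suc_continuous_cone[OF b l c coc pq(2) ts]]
    using lin ts by (simp add: case_prod_beta comp_def)
qed

lemma Vn_properties:
  "(\<forall>k\<le>n. Vn_linear k \<and> Vn_positive k \<and> Vn_cocycle k \<and> Vn_continuous k) \<and> Vn_sum_bound n"
proof (induction n)
  case 0
  have "Vn_linear 0" using U_bounded_linear by (auto simp: Vn_linear_def bounded_linear.linear)
  moreover have "Vn_positive 0" using U_pos by (auto simp: Vn_positive_def)
  moreover have "Vn_cocycle 0" using U_compose by (auto simp: Vn_cocycle_def)
  moreover have "Vn_sum_bound 0" using U_contr by (auto simp: Vn_sum_bound_def)
  ultimately show ?case using Vn_0_continuous by simp
next
  case (Suc n)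
  then have IH: "Vn_sum_bound n" "\<And>k. k \<le> n \<Longrightarrow> Vn_linear k" "\<And>k. k \<le> n \<Longrightarrow> Vn_positive k"
    "\<And>k. k \<le> n \<Longrightarrow> Vn_cocycle k" "\<And>k. k \<le> n \<Longrightarrow> Vn_continuous k" by auto
  have l: "Vn_linear (Suc n)" using IH by (intro Vn_Suc_linear) auto
  have p: "Vn_positive (Suc n)" using IH by (intro Vn_Suc_positive) auto
  have b: "Vn_sum_bound (Suc n)" using IH by (intro Vn_Suc_sum_bound) auto
  have coc: "Vn_cocycle (Suc n)" using IH by (intro Vn_Suc_cocycle) auto
  have l': "Vn_linear k" if "k \<le> Suc n" for k using IH(2) l that le_Suc_eq by auto
  have c: "Vn_continuous (Suc n)" using IH b l' coc by (intro Vn_Suc_continuous) auto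
  show ?case using IH l p b coc c le_Suc_eq by auto
qed

lemma Vn_bounded_linear: "0 \<le> s \<Longrightarrow> s \<le> t \<Longrightarrow> bounded_linear (Vn n t s)"
  using Vn_properties[of n] Vn_term_bound(2)[of n n s t] by auto

lemma Vn_nonneg: "0 \<le> s \<Longrightarrow> s \<le> t \<Longrightarrow> 0 \<le> u \<Longrightarrow> 0 \<le> Vn n t s u"
  using Vn_properties[of n] by (auto simp: Vn_positive_def)

lemma Vn_compose:
  "0 \<le> s \<Longrightarrow> s \<le> r \<Longrightarrow> r \<le> t \<Longrightarrow> Vn n t s u = (\<Sum>k\<le>n. Vn k t r (Vn (n - k) r s u))"
  using Vn_properties[of n] unfolding Vn_cocycle_def by blast

lemma Vn_sum_le: "0 \<le> s \<Longrightarrow> s \<le> t \<Longrightarrow> 0 \<le> u \<Longrightarrow> (\<Sum>k\<le>n. norm (Vn k t s u)) \<le> norm u"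
  using Vn_properties[of n] unfolding Vn_sum_bound_def by blast

lemma Vn_sum_lessThan_le: "0 \<le> s \<Longrightarrow> s \<le> t \<Longrightarrow> 0 \<le> u \<Longrightarrow> (\<Sum>k<n. norm (Vn k t s u)) \<le> norm u"
  by (rule order_trans[OF sum_mono2 Vn_sum_le[of s t u n]]) auto

lemma Vn_measurable: "sep_measurable borel (\<lambda>(t, s). if 0 \<le> s \<and> s \<le> t then Vn n t s x else 0)"
  using Vn_properties[of n] by (intro Vn_sep_measurable) auto

lemma dyson_integrand_integrable: "0 \<le> s \<Longrightarrow> s \<le> t \<Longrightarrow> strongly_integrable lborel (dyson_integrand n t s u)"
  using Vn_properties[of n] by (intro dyson_integrand_strongly_integrable) auto

subsection \<open>Summation of the series\<close>

lemma Vn_summable_cone: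
  assumes "0 \<le> s" "s \<le> t" "0 \<le> u"
  shows "summable (\<lambda>n. norm (Vn n t s u))" "(\<Sum>n. norm (Vn n t s u)) \<le> norm u"
proof -
  show "summable (\<lambda>n. norm (Vn n t s u))"
    by (rule summableI_nonneg_bounded[OF _ Vn_sum_lessThan_le[OF assms]]) simp
  then show "(\<Sum>n. norm (Vn n t s u)) \<le> norm u"
    by (rule suminf_le_const) (rule Vn_sum_lessThan_le[OF assms])
qed

lemma Vn_norm_summable:
  assumes "0 \<le> s" "s \<le> t"
  shows "summable (\<lambda>n. norm (Vn n t s u))"
proof -
  obtain p q where pq: "0 \<le> p" "0 \<le> q" "u = p - q" by (rule cone_split)
  have "norm (norm (Vn n t s u)) \<le> norm (Vn n t s p) + norm (Vn n t s q)" for n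
    unfolding pq(3) linear_simps(2)[OF Vn_bounded_linear[OF assms]] using norm_triangle_ineq4 by simp
  then show ?thesis
    by (rule summable_comparison_test'[OF summable_add[OF Vn_summable_cone(1)[OF assms pq(1)] Vn_summable_cone(1)[OF assms pq(2)]], of 0])
qed

lemma V_sums: "0 \<le> s \<Longrightarrow> s \<le> t \<Longrightarrow> (\<lambda>n. Vn n t s u) sums V t s u"
  unfolding perturbed_family_def by (rule summable_sums[OF summable_norm_cancel[OF Vn_norm_summable]])

lemma V_diff: "0 \<le> s \<Longrightarrow> s \<le> t \<Longrightarrow> V t s (u - v) = V t s u - V t s v"
  using sums_diff[OF V_sums[of s t u] V_sums[of s t v]] V_sums[of s t "u - v"] sums_unique2
  by (simp add: linear_simps(2)[OF Vn_bounded_linear])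

lemma V_add: "0 \<le> s \<Longrightarrow> s \<le> t \<Longrightarrow> V t s (u + v) = V t s u + V t s v"
  using sums_add[OF V_sums[of s t u] V_sums[of s t v]] V_sums[of s t "u + v"] sums_unique2
  by (simp add: linear_simps(1)[OF Vn_bounded_linear])

lemma V_scaleR: "0 \<le> s \<Longrightarrow> s \<le> t \<Longrightarrow> V t s (c *\<^sub>R u) = c *\<^sub>R V t s u"
  using sums_scaleR_right[OF V_sums[of s t u], of c] V_sums[of s t "c *\<^sub>R u"] sums_unique2
  by (simp add: linear_simps(5)[OF Vn_bounded_linear])

lemma V_nonneg:
  assumes "0 \<le> s" "s \<le> t" "0 \<le> u"
  shows "0 \<le> V t s u"
  unfolding perturbed_family_def using assms
  by (intro suminf_nonneg_cone[OF cone_closed] sums_summable[OF V_sums] Vn_nonneg)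

lemma V_contr:
  assumes "0 \<le> s" "s \<le> t" "0 \<le> u"
  shows "norm (V t s u) \<le> norm u"
  unfolding perturbed_family_def
  using summable_norm[OF Vn_summable_cone(1)[OF assms]] Vn_summable_cone(2)[OF assms] by simp

lemma V_bound: "0 \<le> s \<Longrightarrow> s \<le> t \<Longrightarrow> norm (V t s u) \<le> M * norm u"
  by (rule linear_bound_from_cone[OF V_diff V_contr])

lemma V_bounded_linear: "0 \<le> s \<Longrightarrow> s \<le> t \<Longrightarrow> bounded_linear (V t s)"
  using V_add V_scaleR V_bound by (intro bounded_linear_intro[of _ M]) (auto simp: mult.commute)

lemma V_partial_sum_bound:
  assumes "0 \<le> s" "s \<le> t"
  shows "norm (\<Sum>k<n. Vn k t s u) \<le> M * norm u"
proof (rule linear_bound_from_cone)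
  show "(\<Sum>k<n. Vn k t s (u - v)) = (\<Sum>k<n. Vn k t s u) - (\<Sum>k<n. Vn k t s v)" for u v
    by (simp add: linear_simps(2)[OF Vn_bounded_linear[OF assms]] sum_subtractf)
  show "norm (\<Sum>k<n. Vn k t s u) \<le> norm u" if "0 \<le> u" for u
    using norm_sum[of "\<lambda>k. Vn k t s u" "{..<n}"] Vn_sum_lessThan_le[OF assms that, of n] by simp
qed

lemma V_minus_U_bound:
  assumes "0 \<le> s" "s \<le> t" "0 \<le> u"
  shows "norm (V t s u - U t s u) \<le> norm u - norm (U t s u)"
proof -
  have "(\<lambda>n. Vn (Suc n) t s u) sums (V t s u - U t s u)"
    using V_sums[OF assms(1,2), of u] by (subst sums_Suc_iff) simp
  moreover have "summable (\<lambda>n. norm (Vn (Suc n) t s u))"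
    using Vn_summable_cone(1)[OF assms] by (subst summable_Suc_iff)
  ultimately have "norm (V t s u - U t s u) \<le> (\<Sum>n. norm (Vn (Suc n) t s u))"
    using summable_norm sums_unique by metis
  also have "\<dots> = (\<Sum>n. norm (Vn n t s u)) - norm (Vn 0 t s u)"
    using suminf_split_head[OF Vn_summable_cone(1)[OF assms]] by simp
  finally show ?thesis using Vn_summable_cone(2)[OF assms] by simp
qed

lemma V_refl: "0 \<le> t \<Longrightarrow> V t t u = u"
proof -
  assume t: "0 \<le> t"
  have *: "V t t u = u" if "0 \<le> u" for u
    using V_minus_U_bound[OF t order_refl that] by (simp add: U_refl[OF t])
  obtain p q where pq: "0 \<le> p" "0 \<le> q" "u = p - q" by (rule cone_split)
  show ?thesis unfolding pq(3) V_diff[OF t order_refl] using * pq by simp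
qed

text \<open>
  By the cocycle identities the partial sums of \<open>V(t,s) u\<close> are triangular partial
  sums of the double series of \<open>V\<^sub>k(t,r) V\<^sub>j(r,s) u\<close>. The partial sums
  over \<open>k\<close> are bounded by \<open>M\<close> uniformly, so \<open>2 * M * norm
  (V\<^sub>j(r,s) u)\<close> is a summable majorant and Tannery's theorem applies in
  \<open>j\<close>.
\<close>
lemma V_compose:
  assumes srt: "0 \<le> s" "s \<le> r" "r \<le> t"
  shows "V t s u = V t r (V r s u)"
proof -
  let ?T = "\<lambda>j N. if j < N then \<Sum>k<N - j. Vn k t r (Vn j r s u) else 0"
  have r: "0 \<le> r" using srt by simp
  have blV: "bounded_linear (V t r)" using V_bounded_linear r srt by blast
  have partial: "(\<Sum>n<N. Vn n t s u) = (\<Sum>j. ?T j N)" for N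
  proof -
    have "(\<Sum>n<N. Vn n t s u) = (\<Sum>n<N. \<Sum>k\<le>n. Vn k t r (Vn (n - k) r s u))"
      using srt by (intro sum.cong refl Vn_compose)
    also have "\<dots> = (\<Sum>(k, j)\<in>{(k, j). k + j < N}. Vn k t r (Vn j r s u))"
      by (simp add: sum.triangle_reindex)
    also have "\<dots> = (\<Sum>(j, k)\<in>Sigma {..<N} (\<lambda>j. {..<N - j}). Vn k t r (Vn j r s u))"
      by (rule sum.reindex_bij_witness[of _ "\<lambda>(a, b). (b, a)" "\<lambda>(a, b). (b, a)"]) auto
    also have "\<dots> = (\<Sum>j<N. \<Sum>k<N - j. Vn k t r (Vn j r s u))" by (simp add: sum.Sigma)
    also have "\<dots> = (\<Sum>j<N. ?T j N)" by (intro sum.cong) auto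
    also have "\<dots> = (\<Sum>j. ?T j N)" by (intro suminf_finite[symmetric]) auto
    finally show ?thesis .
  qed
  define a where "a = (\<lambda>j N. norm (?T j N - V t r (Vn j r s u)))"
  have le: "norm (?T j N) \<le> M * norm (Vn j r s u)" for j N
    using V_partial_sum_bound[OF r srt(3)] M(1) by simp
  have ale: "a j N \<le> 2 * M * norm (Vn j r s u)" for j N
    using norm_triangle_ineq4[of "?T j N" "V t r (Vn j r s u)"] le[of j N] V_bound[OF r srt(3), of "Vn j r s u"]
    unfolding a_def by linarith
  have lim: "(\<lambda>N. a j N) \<longlonglongrightarrow> 0" for j
  proof -
    have "(\<lambda>n. \<Sum>k<n. Vn k t r (Vn j r s u)) \<longlonglongrightarrow> V t r (Vn j r s u)"
      using V_sums[OF r srt(3)] by (simp add: sums_def)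
    from filterlim_compose[OF this filterlim_minus_const_nat_at_top[of j]]
    have "(\<lambda>N. \<Sum>k<N - j. Vn k t r (Vn j r s u)) \<longlonglongrightarrow> V t r (Vn j r s u)" .
    then have "(\<lambda>N. ?T j N) \<longlonglongrightarrow> V t r (Vn j r s u)"
      by (rule Lim_transform_eventually) (use eventually_gt_at_top[of j] in \<open>auto elim!: eventually_mono\<close>)
    then show ?thesis unfolding a_def by (intro tendsto_norm_zero LIM_zero)
  qed
  have sm: "summable (\<lambda>j. 2 * M * norm (Vn j r s u))"
    by (intro summable_mult Vn_norm_summable srt)
  have a_sum: "summable (\<lambda>j. a j N)" for N
    using ale by (intro summable_comparison_test'[OF sm, of 0]) (simp add: a_def)
  have "norm (a j N) \<le> 2 * M * norm (Vn j r s u)" for j N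
    using ale[of j N] by (simp add: a_def)
  then have "\<forall>\<^sub>F (j, N) in sequentially \<times>\<^sub>F sequentially. norm (a j N) \<le> 2 * M * norm (Vn j r s u)"
    by (intro always_eventually) auto
  then have "((\<lambda>N. \<Sum>j. a j N) \<longlongrightarrow> (\<Sum>j. 0)) sequentially"
    using tannerys_theorem[where a=a and b="\<lambda>_. 0" and F=sequentially, OF lim _ sm sequentially_bot] by blast
  then have lim0: "(\<lambda>N. \<Sum>j. a j N) \<longlonglongrightarrow> 0" by simp
  have VV: "(\<lambda>j. V t r (Vn j r s u)) sums V t r (V r s u)"
    using bounded_linear.sums[OF blV V_sums[OF srt(1,2)]] .
  have "norm ((\<Sum>n<N. Vn n t s u) - V t r (V r s u)) \<le> (\<Sum>j. a j N)" for N
  proof -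
    have sT: "summable (\<lambda>j. ?T j N)"
      by (rule summable_finite[of "{..<N}"]) auto
    have eq: "(\<Sum>n<N. Vn n t s u) - V t r (V r s u) = (\<Sum>j. ?T j N - V t r (Vn j r s u))"
      unfolding partial using suminf_diff[OF sT sums_summable[OF VV]] sums_unique[OF VV] by simp
    show ?thesis
      unfolding eq a_def by (rule summable_norm) (rule a_sum[unfolded a_def])
  qed
  then have "(\<lambda>N. (\<Sum>n<N. Vn n t s u) - V t r (V r s u)) \<longlonglongrightarrow> 0"
    by (intro Lim_null_comparison[OF _ lim0]) auto
  then have "(\<lambda>N. \<Sum>n<N. Vn n t s u) \<longlonglongrightarrow> V t r (V r s u)" by (rule LIM_zero_cancel)
  moreover have "(\<lambda>N. \<Sum>n<N. Vn n t s u) \<longlonglongrightarrow> V t s u"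
    using V_sums[of s t u] srt by (simp add: sums_def)
  ultimately show ?thesis using LIMSEQ_unique by blast
qed

lemma V_measurable: "sep_measurable borel (\<lambda>(t, s). if 0 \<le> s \<and> s \<le> t then V t s x else 0)"
proof (rule sep_measurable_LIMSEQ)
  show "sep_measurable borel (\<lambda>p. \<Sum>k<n. (\<lambda>(t, s). if 0 \<le> s \<and> s \<le> t then Vn k t s x else 0) p)" for n
    by (intro sep_measurable_sum Vn_measurable)
  fix p :: "real \<times> real"
  show "(\<lambda>n. \<Sum>k<n. (\<lambda>(t, s). if 0 \<le> s \<and> s \<le> t then Vn k t s x else 0) p) \<longlonglongrightarrow>
      (case p of (t, s) \<Rightarrow> if 0 \<le> s \<and> s \<le> t then V t s x else 0)"
    using V_sums[of "snd p" "fst p" x] by (cases p) (auto simp: sums_def)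
qed

text \<open>
  On the cone \<open>V(s + h,s) u\<close> differs from \<open>U(s + h,s) u\<close> by at most
  \<open>norm u - norm (U(s + h,s) u)\<close>, which tends to \<open>0\<close> with
  \<open>h\<close>.
\<close>
lemma V_right_continuous:
  assumes s: "0 \<le> s" and h: "h \<longlonglongrightarrow> 0" "\<And>i. 0 \<le> h i"
  shows "(\<lambda>i. V (s + h i) s x) \<longlonglongrightarrow> x"
proof -
  have *: "(\<lambda>i. V (s + h i) s u) \<longlonglongrightarrow> u" if u: "0 \<le> u" for u
  proof -
    have "(\<lambda>i. Vn 0 (s + h i) s u) \<longlonglongrightarrow> Vn 0 s s u"
      using s h tendsto_add[OF tendsto_const h(1), of s] by (intro tendsto_in_Delta[OF Vn_0_continuous]) auto
    then have U: "(\<lambda>i. U (s + h i) s u) \<longlonglongrightarrow> u" using U_refl[OF s] by simp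
    have "(\<lambda>i. norm u - norm (U (s + h i) s u)) \<longlonglongrightarrow> norm u - norm u" by (intro tendsto_intros U)
    then have z: "(\<lambda>i. norm u - norm (U (s + h i) s u)) \<longlonglongrightarrow> 0" by simp
    have "(\<lambda>i. V (s + h i) s u - U (s + h i) s u) \<longlonglongrightarrow> 0"
      using V_minus_U_bound[OF s _ u] h(2) by (intro Lim_null_comparison[OF _ z]) auto
    from tendsto_add[OF this U] show ?thesis by simp
  qed
  obtain p q where pq: "0 \<le> p" "0 \<le> q" "x = p - q" by (rule cone_split)
  have "V (s + h i) s x = V (s + h i) s p - V (s + h i) s q" for i
    unfolding pq(3) using s h(2)[of i] by (intro V_diff) auto
  with tendsto_diff[OF *[OF pq(1)] *[OF pq(2)]] pq(3) show ?thesis by simp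
qed

text \<open>
  The recursion for the terms is summed under the integral; the partial sums of
  \<open>V(t,r)\<close> are bounded by \<open>M\<close>, so \<open>M * norm (B(r) U(r,s)
  u)\<close> is a majorant.
\<close>
lemma V_Duhamel:
  fixes u :: 'a
  assumes st: "0 \<le> s" "s \<le> t"
  defines "F \<equiv> \<lambda>r. if s \<le> r \<and> r \<le> t then V t r (BU s u r) else 0"
  shows "strongly_integrable lborel F" "V t s u = U t s u + strong_integral lborel F"
proof -
  let ?S = "\<lambda>n r. \<Sum>k<n. dyson_integrand k t s u r"
  have m: "strongly_integrable lborel (?S n)" for n
    by (intro strongly_integrable_sum dyson_integrand_integrable st)
  have le: "AE r in lborel. norm (?S n r) \<le> norm (M *\<^sub>R BU s u r)" for n
  proof (rule AE_I2)
    fix r show "norm (?S n r) \<le> norm (M *\<^sub>R BU s u r)"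
      using V_partial_sum_bound[of r t "BU s u r" n] st M(1)
      by (cases "s \<le> r \<and> r \<le> t") (auto simp: dyson_integrand_def)
  qed
  have lim: "AE r in lborel. (\<lambda>n. ?S n r) \<longlonglongrightarrow> F r"
  proof (rule AE_I2)
    fix r show "(\<lambda>n. ?S n r) \<longlonglongrightarrow> F r"
      using V_sums[of r t "BU s u r"] st by (auto simp: dyson_integrand_def F_def sums_def)
  qed
  note dom = strongly_integrable_measurable[OF m] strongly_integrable_scale[OF BU_strongly_integrable[OF st(1)]] le lim
  show "strongly_integrable lborel F" by (rule L1_seminorm_dominated_convergence(1)[OF dom])
  have "(\<lambda>n. strong_integral lborel (?S n)) \<longlonglongrightarrow> strong_integral lborel F"
    by (rule strong_integral_dominated_convergence[OF dom])
  moreover have "strong_integral lborel (?S n) = (\<Sum>k<n. Vn (Suc k) t s u)" for n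
    unfolding Vn_Suc by (intro strong_integral_sum dyson_integrand_integrable st)
  ultimately have "(\<lambda>k. Vn (Suc k) t s u) sums strong_integral lborel F" by (simp add: sums_def)
  moreover have "(\<lambda>n. Vn (Suc n) t s u) sums (V t s u - U t s u)"
    using V_sums[OF st, of u] by (subst sums_Suc_iff) simp
  ultimately have "strong_integral lborel F = V t s u - U t s u" by (rule sums_unique2)
  then show "V t s u = U t s u + strong_integral lborel F" by simp
qed

end

section \<open>Representatives of classes in \<open>L\<^sup>1\<close>\<close>

text \<open>
  Representatives are extended by \<open>0\<close> to the negative axis, so that time shifts act
  on them as translations of the line.
\<close>
definition half_supported :: "(real \<Rightarrow> 'a::real_normed_vector) \<Rightarrow> bool" where
  "half_supported g \<longleftrightarrow> strongly_integrable lborel g \<and> (\<forall>s<0. g s = 0)"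

lemma half_supported_integrable: "half_supported g \<Longrightarrow> strongly_integrable lborel g"
  by (simp add: half_supported_def)

lemma half_line_integrable_iff:
  "strongly_integrable half_line f \<longleftrightarrow> strongly_integrable lborel (\<lambda>s. indicator {0..} s *\<^sub>R f s)"
  by (rule strongly_integrable_lebesgue_on) simp

lemma half_line_AE_iff: "(AE s in half_line. P s) \<longleftrightarrow> (AE s in lborel. 0 \<le> s \<longrightarrow> P s)"
  by (simp add: AE_lebesgue_on_iff)

lemma half_supported_indicator: "half_supported g \<Longrightarrow> indicator {0..} s *\<^sub>R g s = g s"
  by (auto simp: half_supported_def indicator_def)

lemma half_supported_half_line: "half_supported g \<Longrightarrow> strongly_integrable half_line g"
  by (simp add: half_line_integrable_iff half_supported_indicator half_supported_integrable)

lemma half_supported_add: "half_supported f \<Longrightarrow> half_supported g \<Longrightarrow> half_supported (\<lambda>s. f s + g s)"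
  and half_supported_diff: "half_supported f \<Longrightarrow> half_supported g \<Longrightarrow> half_supported (\<lambda>s. f s - g s)"
  and half_supported_scaleR: "half_supported f \<Longrightarrow> half_supported (\<lambda>s. c *\<^sub>R f s)"
  for f g :: "real \<Rightarrow> 'a::real_normed_vector"
  by (auto simp: half_supported_def intro: strongly_integrable_plus strongly_integrable_minus strongly_integrable_scale)

lemma rep_abs_L1:
  assumes "strongly_integrable half_line f"
  shows "AE s in half_line. rep_L1 (abs_L1 f) s = f s"
proof -
  have "L1_rel f f" using assms by (simp add: L1_rel_def)
  then have "L1_rel (rep_L1 (abs_L1 f)) f" by (rule Quotient3_L1[THEN rep_abs_rsp_left])
  then show ?thesis by (simp add: L1_rel_def)
qed

lemma abs_L1_cong:
  assumes "AE s in half_line. f s = g s" "strongly_integrable half_line g"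
  shows "abs_L1 f = abs_L1 g"
proof -
  have "strongly_integrable half_line f" using assms strongly_integrable_cong_AE by blast
  then have "L1_rel f g" using assms by (simp add: L1_rel_def)
  then show ?thesis by (rule Quotient3_rel_abs[OF Quotient3_L1])
qed

lemma abs_rep_L1: "abs_L1 (rep_L1 f) = f"
  by (rule Quotient3_abs_rep[OF Quotient3_L1])

lemma rep_L1_integrable: "strongly_integrable half_line (rep_L1 f)"
  using Quotient3_rep_reflp[OF Quotient3_L1, of f] by (simp add: L1_rel_def)

lemma abs_L1_eq_iff:
  assumes "strongly_integrable half_line f" "strongly_integrable half_line g"
  shows "abs_L1 f = abs_L1 g \<longleftrightarrow> (AE s in half_line. f s = g s)"
proof
  assume "abs_L1 f = abs_L1 g"
  then have "L1_rel f g" using assms Quotient3_rel[OF Quotient3_L1, of f g] by (simp add: L1_rel_def)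
  then show "AE s in half_line. f s = g s" by (simp add: L1_rel_def)
qed (rule abs_L1_cong[OF _ assms(2)])

lemma norm_abs_L1:
  assumes "half_supported g"
  shows "norm (abs_L1 g) = L1_seminorm lborel g"
proof -
  have g: "strongly_integrable half_line g" using assms by (rule half_supported_half_line)
  then have "norm (abs_L1 g) = (LINT s|half_line. norm (g s))"
    by (simp add: norm_L1.abs_eq L1_rel_def)
  also have "\<dots> = enn2real (\<integral>\<^sup>+s. ennreal (norm (g s)) \<partial>half_line)"
    using strongly_integrable_norm[OF g] by (intro integral_eq_nn_integral) auto
  also have "\<dots> = L1_seminorm lborel g"
    by (simp add: nn_integral_norm_lebesgue_on half_supported_indicator[OF assms] L1_seminorm_def
        del: norm_scaleR)
  finally show ?thesis .
qed

lemma abs_L1_add: "half_supported f \<Longrightarrow> half_supported g \<Longrightarrow> abs_L1 f + abs_L1 g = abs_L1 (\<lambda>s. f s + g s)"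
  by (simp add: plus_L1.abs_eq L1_rel_def half_supported_half_line)

lemma abs_L1_scaleR: "half_supported f \<Longrightarrow> c *\<^sub>R abs_L1 f = abs_L1 (\<lambda>s. c *\<^sub>R f s)"
  by (simp add: scaleR_L1.abs_eq L1_rel_def half_supported_half_line)

lemma abs_L1_diff:
  fixes f g :: "real \<Rightarrow> 'a::real_normed_vector"
  assumes "half_supported f" "half_supported g"
  shows "abs_L1 f - abs_L1 g = abs_L1 (\<lambda>s. f s - g s)"
proof -
  have "abs_L1 f + (-1) *\<^sub>R abs_L1 g = abs_L1 (\<lambda>s. f s + (-1) *\<^sub>R g s)"
    unfolding abs_L1_scaleR[OF assms(2)] by (rule abs_L1_add[OF assms(1) half_supported_scaleR[OF assms(2)]])
  then show ?thesis by simp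
qed

lemma abs_L1_zero: "abs_L1 (\<lambda>s. 0) = 0"
  by (simp add: zero_L1_def)

lemma L1_cases:
  fixes F :: "'a::real_normed_vector L1"
  obtains g where "sep_measurable borel g" "half_supported g" "F = abs_L1 g"
proof -
  have "strongly_integrable lborel (\<lambda>s. indicator {0..} s *\<^sub>R rep_L1 F s)"
    using rep_L1_integrable[of F] by (simp add: half_line_integrable_iff)
  then obtain h where h: "sep_measurable lborel h" "AE s in lborel. indicator {0..} s *\<^sub>R rep_L1 F s = h s"
    by (auto simp: strongly_integrable_def strongly_measurable_iff_sep)
  define g where "g = (\<lambda>s. indicator {0..} s *\<^sub>R h s)"
  have g: "sep_measurable borel g"
    unfolding g_def using h(1) sep_measurable_cong_sets[of lborel borel h]
    by (intro sep_measurable_scaleR) auto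
  have eq: "AE s in lborel. indicator {0..} s *\<^sub>R rep_L1 F s = g s"
    using h(2) by eventually_elim (auto simp: g_def indicator_def split: if_splits)
  then have i: "strongly_integrable lborel g"
    using rep_L1_integrable[of F] strongly_integrable_cong_AE[OF eq] by (simp add: half_line_integrable_iff)
  then have hs: "half_supported g" by (simp add: half_supported_def g_def)
  have "AE s in half_line. rep_L1 F s = g s"
    using eq unfolding half_line_AE_iff by eventually_elim auto
  then have "abs_L1 (rep_L1 F) = abs_L1 g" by (rule abs_L1_cong[OF _ half_supported_half_line[OF hs]])
  then show ?thesis using that[OF g hs] abs_rep_L1[of F] by simp
qed

lemma half_supported_indicator_scaleR:
  assumes "A \<in> sets borel" "A \<subseteq> {0..}" "emeasure lborel A < \<infinity>"
  shows "half_supported (\<lambda>s. indicator A s *\<^sub>R (x::'a::banach))"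
proof -
  have "integrable lborel (indicat_real A)" using assms by (intro integrable_real_indicator) auto
  from integrable_real_strongly_integrable_scaleR(1)[OF this] show ?thesis
    using assms(2) by (auto simp: half_supported_def split: split_indicator)
qed

text \<open>
  Step functions approximate every integrable function, and they are finite sums of functions with
  one value; the sets are arbitrary Borel sets of finite measure.
\<close>
lemma L1_dense_induct [consumes 0, case_names indicator add limit]:
  fixes P :: "'a::banach L1 \<Rightarrow> bool" and F :: "'a L1"
  assumes ind: "\<And>A x. A \<in> sets borel \<Longrightarrow> A \<subseteq> {0..} \<Longrightarrow> emeasure lborel A < \<infinity> \<Longrightarrow>
      P (abs_L1 (\<lambda>s. indicator A s *\<^sub>R x))"
    and add: "\<And>f g. P f \<Longrightarrow> P g \<Longrightarrow> P (f + g)"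
    and lim: "\<And>f. (\<And>e. 0 < e \<Longrightarrow> \<exists>g. P g \<and> norm (f - g) < e) \<Longrightarrow> P f"
  shows "P F"
proof (rule lim)
  fix e :: real assume e: "0 < e"
  obtain g where g: "half_supported g" "F = abs_L1 g" by (rule L1_cases)
  obtain \<phi> where \<phi>: "\<And>i. simple_bochner_integrable lborel (\<phi> i)" "(\<lambda>i. L1_seminorm lborel (\<lambda>x. g x - \<phi> i x)) \<longlonglongrightarrow> 0"
    using strongly_integrable_simple_approximation[OF half_supported_integrable[OF g(1)]] by metis
  obtain i where i: "L1_seminorm lborel (\<lambda>x. g x - \<phi> i x) < e"
    using eventually_happens[OF order_tendstoD(2)[OF \<phi>(2) e]] by auto
  obtain C A where CA: "finite C" "\<And>c. c \<in> C \<Longrightarrow> A c \<in> sets lborel" "\<And>c. c \<in> C \<Longrightarrow> emeasure lborel (A c) < \<infinity>"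
    "\<And>x. x \<in> space lborel \<Longrightarrow> \<phi> i x = (\<Sum>c\<in>C. indicator (A c) x *\<^sub>R c)"
    using simple_bochner_decomposition[OF \<phi>(1)[of i]] by blast
  define h where "h = (\<lambda>C' s. \<Sum>c\<in>C'. indicator (A c \<inter> {0..}) s *\<^sub>R c)"
  have A0: "A c \<inter> {0..} \<in> sets borel" "A c \<inter> {0..} \<subseteq> {0..}" "emeasure lborel (A c \<inter> {0..}) < \<infinity>" if "c \<in> C" for c
    using CA(2,3)[OF that] emeasure_mono[of "A c \<inter> {0..}" "A c" lborel] by auto
  have P0: "P 0" using ind[of "{}" 0] by (simp add: abs_L1_zero)
  have "C' \<subseteq> C \<Longrightarrow> half_supported (h C') \<and> P (abs_L1 (h C'))" if "finite C'" for C'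
    using that
  proof (induction C')
    case empty
    then show ?case using P0 by (simp add: h_def half_supported_def strongly_integrable_zero abs_L1_zero)
  next
    case (insert c C')
    then have c: "c \<in> C" and IH: "half_supported (h C')" "P (abs_L1 (h C'))" by auto
    have eq: "h (insert c C') = (\<lambda>s. indicator (A c \<inter> {0..}) s *\<^sub>R c + h C' s)"
      by (simp only: h_def sum.insert[OF insert.hyps])
    have hc: "half_supported (\<lambda>s. indicator (A c \<inter> {0..}) s *\<^sub>R c)" by (rule half_supported_indicator_scaleR[OF A0[OF c]])
    show ?case
      unfolding eq using half_supported_add[OF hc IH(1)] add[OF ind[OF A0[OF c], of c] IH(2)]
      by (simp add: abs_L1_add[OF hc IH(1)])
  qed
  then have h: "half_supported (h C)" "P (abs_L1 (h C))" using CA(1) by auto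
  have "norm (F - abs_L1 (h C)) = L1_seminorm lborel (\<lambda>s. g s - h C s)"
    unfolding g(2) using g h by (simp add: abs_L1_diff norm_abs_L1 half_supported_diff)
  also have "\<dots> \<le> L1_seminorm lborel (\<lambda>s. g s - \<phi> i s)"
  proof (rule L1_seminorm_mono_AE)
    show "strongly_integrable lborel (\<lambda>s. g s - \<phi> i s)"
      by (intro strongly_integrable_minus half_supported_integrable g simple_bochner_strongly_integrable \<phi>)
    have "norm (g s - h C s) \<le> norm (g s - \<phi> i s)" for s
    proof (cases "0 \<le> s")
      case True
      then have "h C s = \<phi> i s" using CA(4)[of s] by (simp add: h_def indicator_def)
      then show ?thesis by simp
    next
      case False
      then have "h C s = 0" "g s = 0" using g(1) by (auto simp: h_def half_supported_def)
      then show ?thesis by simp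
    qed
    then show "AE s in lborel. norm (g s - h C s) \<le> norm (g s - \<phi> i s)" by simp
  qed
  finally show "\<exists>g. P g \<and> norm (F - g) < e" using h(2) i by auto
qed

lemma sep_measurable_lborel: "sep_measurable lborel f \<longleftrightarrow> sep_measurable borel f"
  by (rule sep_measurable_cong_sets) simp

section \<open>Evolution semigroups and their generators\<close>

text \<open>
  The common ground of \<open>U\<close> and \<open>V\<close>: joint measurability and right
  continuity at the diagonal make the evolution semigroup strongly continuous and determine its
  generator.
\<close>
locale measurable_evolution =
  fixes W :: "real \<Rightarrow> real \<Rightarrow> 'a \<Rightarrow> 'a::banach" and C :: real
  assumes W_linear: "0 \<le> s \<Longrightarrow> s \<le> t \<Longrightarrow> bounded_linear (W t s)"
    and W_bound: "0 \<le> s \<Longrightarrow> s \<le> t \<Longrightarrow> norm (W t s x) \<le> C * norm x"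
    and C_nonneg: "0 \<le> C"
    and W_refl: "0 \<le> t \<Longrightarrow> W t t x = x"
    and W_compose: "0 \<le> s \<Longrightarrow> s \<le> r \<Longrightarrow> r \<le> t \<Longrightarrow> W t s x = W t r (W r s x)"
    and W_measurable: "sep_measurable borel (\<lambda>(t, s). if 0 \<le> s \<and> s \<le> t then W t s x else 0)"
    and W_right_continuous: "0 \<le> s \<Longrightarrow> h \<longlonglongrightarrow> 0 \<Longrightarrow> (\<And>i. 0 \<le> h i) \<Longrightarrow> (\<lambda>i. W (s + h i) s x) \<longlonglongrightarrow> x"
begin

lemma W_zero: "0 \<le> s \<Longrightarrow> s \<le> t \<Longrightarrow> W t s 0 = 0"
  using linear_simps(3)[OF W_linear] .

lemma W_apply_measurable:
  assumes a: "a \<in> borel_measurable N" and b: "b \<in> borel_measurable N" and H: "sep_measurable N H"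
  shows "sep_measurable N (\<lambda>p. if 0 \<le> b p \<and> b p \<le> a p then W (a p) (b p) (H p) else 0)"
proof (rule sep_measurable_operator_apply[OF _ _ H])
  fix x
  have "(\<lambda>p. (a p, b p)) \<in> measurable N (borel :: (real \<times> real) measure)"
    using a b by (rule borel_measurable_Pair)
  from sep_measurable_compose[OF W_measurable[of x] this]
  show "sep_measurable N (\<lambda>p. if 0 \<le> b p \<and> b p \<le> a p then W (a p) (b p) x else 0)" by simp
next
  fix p
  show "bounded_linear (\<lambda>x. if 0 \<le> b p \<and> b p \<le> a p then W (a p) (b p) x else 0)"
    using W_linear[of "b p" "a p"] by (cases "0 \<le> b p \<and> b p \<le> a p") auto
qed

text \<open>
  The evolution semigroup on representatives.
\<close>
definition shift :: "real \<Rightarrow> (real \<Rightarrow> 'a) \<Rightarrow> real \<Rightarrow> 'a" where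
  "shift t g s = (if t \<le> s then W s (s - t) (g (s - t)) else 0)"

abbreviation S :: "real \<Rightarrow> 'a L1 \<Rightarrow> 'a L1" where
  "S \<equiv> evolution_semigroup W"

lemma shift_measurable:
  assumes g: "sep_measurable borel g" and t: "0 \<le> t"
  shows "sep_measurable borel (shift t g)"
proof -
  have "sep_measurable borel (\<lambda>s. g (s - t))" by (rule sep_measurable_compose[OF g]) measurable
  from W_apply_measurable[of "\<lambda>s. s" borel "\<lambda>s. s - t", OF _ _ this]
  have m: "sep_measurable borel (\<lambda>s. if 0 \<le> s - t \<and> s - t \<le> s then W s (s - t) (g (s - t)) else 0)" by simp
  show ?thesis
    using m t unfolding shift_def by simp
qed

lemma norm_shift_le: "0 \<le> t \<Longrightarrow> norm (shift t g s) \<le> C * norm (g (s - t))"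
  using W_bound[of "s - t" s] C_nonneg by (simp add: shift_def)

lemma shift_translate:
  assumes "half_supported g"
  shows "strongly_integrable lborel (\<lambda>s. g (s - t))" "L1_seminorm lborel (\<lambda>s. g (s - t)) = L1_seminorm lborel g"
  using strongly_integrable_distr[OF lborel_isometry(1,2)[of 1 "-t"] half_supported_integrable[OF assms]] by simp_all

lemma shift_half_supported:
  assumes g: "sep_measurable borel g" "half_supported g" and t: "0 \<le> t"
  shows "half_supported (shift t g)" "L1_seminorm lborel (shift t g) \<le> C * L1_seminorm lborel g"
proof -
  have le: "AE s in lborel. norm (shift t g s) \<le> norm (C *\<^sub>R g (s - t))"
    using norm_shift_le[OF t] C_nonneg by simp
  have i: "strongly_integrable lborel (\<lambda>s. C *\<^sub>R g (s - t))"
    by (intro strongly_integrable_scale shift_translate g)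
  have m: "strongly_measurable lborel (shift t g)"
    using shift_measurable[OF g(1) t] by (intro sep_imp_strongly_measurable) (simp add: sep_measurable_lborel)
  show "half_supported (shift t g)"
    unfolding half_supported_def
  proof (intro conjI allI impI)
    show "strongly_integrable lborel (shift t g)" by (rule strongly_integrable_dominated[OF m i le])
    show "shift t g s = 0" if "s < 0" for s using that t by (simp add: shift_def)
  qed
  have "L1_seminorm lborel (shift t g) \<le> L1_seminorm lborel (\<lambda>s. C *\<^sub>R g (s - t))"
    by (rule L1_seminorm_mono_AE[OF i le])
  also have "\<dots> = C * L1_seminorm lborel g"
    using C_nonneg by (simp add: L1_seminorm_scale shift_translate[OF g(2)])
  finally show "L1_seminorm lborel (shift t g) \<le> C * L1_seminorm lborel g" .
qed

lemma S_abs: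
  assumes g: "sep_measurable borel g" "half_supported g" and t: "0 \<le> t"
  shows "S t (abs_L1 g) = abs_L1 (shift t g)"
  unfolding evolution_semigroup_def
proof (rule abs_L1_cong)
  show "strongly_integrable half_line (shift t g)" by (intro half_supported_half_line shift_half_supported g t)
  have "AE s in lborel. 0 \<le> s \<longrightarrow> rep_L1 (abs_L1 g) s = g s"
    using rep_abs_L1[OF half_supported_half_line[OF g(2)]] by (simp add: half_line_AE_iff)
  from AE_lborel_isometry[OF _ this, of 1 "-t"]
  have "AE s in lborel. 0 \<le> s - t \<longrightarrow> rep_L1 (abs_L1 g) (s - t) = g (s - t)" by simp
  then show "AE s in half_line. (if t \<le> s then W s (s - t) (rep_L1 (abs_L1 g) (s - t)) else 0) = shift t g s"
    unfolding half_line_AE_iff by eventually_elim (simp add: shift_def)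
qed

lemma shift_add: "0 \<le> t \<Longrightarrow> shift t (\<lambda>s. f s + g s) = (\<lambda>s. shift t f s + shift t g s)"
  and shift_diff: "0 \<le> t \<Longrightarrow> shift t (\<lambda>s. f s - g s) = (\<lambda>s. shift t f s - shift t g s)"
  and shift_scaleR: "0 \<le> t \<Longrightarrow> shift t (\<lambda>s. c *\<^sub>R f s) = (\<lambda>s. c *\<^sub>R shift t f s)"
  using W_linear by (auto simp: shift_def fun_eq_iff linear_simps)

lemma shift_shift: "0 \<le> t \<Longrightarrow> 0 \<le> r \<Longrightarrow> shift t (shift r g) = shift (t + r) g"
  using W_compose[of "s - t - r" "s - t" s for s] W_zero
  by (auto simp: shift_def fun_eq_iff algebra_simps)

lemma S_bounded_linear:
  assumes t: "0 \<le> t"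
  shows "bounded_linear (S t)" and "norm (S t f) \<le> C * norm f"
proof -
  have bd: "norm (S t f) \<le> C * norm f" for f
  proof -
    obtain g where g: "sep_measurable borel g" "half_supported g" "f = abs_L1 g" by (rule L1_cases)
    show ?thesis
      unfolding g(3) S_abs[OF g(1,2) t] using shift_half_supported[OF g(1,2) t] g(2) by (simp add: norm_abs_L1)
  qed
  then show "norm (S t f) \<le> C * norm f" .
  show "bounded_linear (S t)"
  proof (rule bounded_linear_intro[of _ C])
    fix x y :: "'a L1" and c :: real
    obtain f where f: "sep_measurable borel f" "half_supported f" "x = abs_L1 f" by (rule L1_cases)
    obtain g where g: "sep_measurable borel g" "half_supported g" "y = abs_L1 g" by (rule L1_cases)
    note s = shift_half_supported(1)[OF f(1,2) t] shift_half_supported(1)[OF g(1,2) t]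
    show "S t (x + y) = S t x + S t y"
      unfolding f(3) g(3) using f g t s
      by (simp add: abs_L1_add S_abs sep_measurable_add half_supported_add shift_add)
    show "S t (c *\<^sub>R x) = c *\<^sub>R S t x"
      unfolding f(3) using f t s
      by (simp add: abs_L1_scaleR S_abs sep_measurable_scaleR half_supported_scaleR shift_scaleR)
    show "norm (S t x) \<le> norm x * C" using bd[of x] by (simp add: mult.commute)
  qed
qed

lemma S_compose:
  assumes "0 \<le> t" "0 \<le> r"
  shows "S t (S r f) = S (t + r) f"
proof -
  obtain g where g: "sep_measurable borel g" "half_supported g" "f = abs_L1 g" by (rule L1_cases)
  show ?thesis
    unfolding g(3) using assms g(1,2)
    by (simp add: S_abs shift_measurable shift_half_supported shift_shift)
qed

lemma S_zero: "S 0 f = f"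
proof -
  obtain g where g: "sep_measurable borel g" "half_supported g" "f = abs_L1 g" by (rule L1_cases)
  have "shift 0 g = g" using g(2) by (auto simp: shift_def fun_eq_iff W_refl half_supported_def)
  then show ?thesis unfolding g(3) using g(1,2) by (simp add: S_abs)
qed

subsection \<open>Strong continuity\<close>

definition strongly_continuous_at :: "'a L1 \<Rightarrow> bool" where
  "strongly_continuous_at f \<longleftrightarrow> (\<forall>h. (\<forall>i. 0 \<le> h i) \<longrightarrow> h \<longlonglongrightarrow> 0 \<longrightarrow> (\<lambda>i. S (h i) f) \<longlonglongrightarrow> f)"

lemma S_add: "0 \<le> t \<Longrightarrow> S t (f + g) = S t f + S t g"
  and S_diff: "0 \<le> t \<Longrightarrow> S t (f - g) = S t f - S t g"
  and S_scaleR: "0 \<le> t \<Longrightarrow> S t (c *\<^sub>R f) = c *\<^sub>R S t f"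
  using S_bounded_linear(1) by (auto simp: linear_simps)

lemma strongly_continuous_at_add:
  "strongly_continuous_at f \<Longrightarrow> strongly_continuous_at g \<Longrightarrow> strongly_continuous_at (f + g)"
  unfolding strongly_continuous_at_def
proof (intro allI impI)
  fix h :: "nat \<Rightarrow> real" 
  assume "\<forall>h. (\<forall>i. 0 \<le> h i) \<longrightarrow> h \<longlonglongrightarrow> 0 \<longrightarrow> (\<lambda>i. S (h i) f) \<longlonglongrightarrow> f"
    and "\<forall>h. (\<forall>i. 0 \<le> h i) \<longrightarrow> h \<longlonglongrightarrow> 0 \<longrightarrow> (\<lambda>i. S (h i) g) \<longlonglongrightarrow> g"
    and h: "\<forall>i. 0 \<le> h i" "h \<longlonglongrightarrow> 0"
  then have "(\<lambda>i. S (h i) f + S (h i) g) \<longlonglongrightarrow> f + g" by (intro tendsto_add) auto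
  then show "(\<lambda>i. S (h i) (f + g)) \<longlonglongrightarrow> f + g" using h(1) by (simp add: S_add)
qed

lemma strongly_continuous_at_limit:
  assumes "\<And>e. 0 < e \<Longrightarrow> \<exists>g. strongly_continuous_at g \<and> norm (f - g) < e"
  shows "strongly_continuous_at f"
  unfolding strongly_continuous_at_def
proof (intro allI impI)
  fix h :: "nat \<Rightarrow> real" assume h: "\<forall>i. 0 \<le> h i" "h \<longlonglongrightarrow> 0"
  show "(\<lambda>i. S (h i) f) \<longlonglongrightarrow> f"
  proof (rule tendstoI)
    fix e :: real assume e: "0 < e"
    define d where "d = e / 2 / (C + 1)"
    have C1: "C + 1 \<noteq> 0" using C_nonneg by linarith
    have d: "0 < d" using e C_nonneg by (simp add: d_def)
    have d2: "(C + 1) * d = e / 2"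
      using nonzero_eq_divide_eq[OF C1, of d "e / 2"] d_def by (metis mult.commute)
    obtain g where g: "strongly_continuous_at g" "norm (f - g) < d" using assms[OF d] by blast
    then have "(\<lambda>i. S (h i) g) \<longlonglongrightarrow> g" using h by (auto simp: strongly_continuous_at_def)
    then have "\<forall>\<^sub>F i in sequentially. dist (S (h i) g) g < e / 2" using e by (intro tendstoD) auto
    then show "\<forall>\<^sub>F i in sequentially. dist (S (h i) f) f < e"
    proof eventually_elim
      case (elim i)
      have "S (h i) f - f = S (h i) (f - g) + (S (h i) g - g) + (g - f)"
        using h(1) by (simp add: S_diff)
      then have "norm (S (h i) f - f) \<le> norm (S (h i) (f - g)) + norm (S (h i) g - g) + norm (g - f)"
        using norm_triangle_ineq[of "S (h i) (f - g) + (S (h i) g - g)" "g - f"]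
          norm_triangle_ineq[of "S (h i) (f - g)" "S (h i) g - g"] by simp
      also have "\<dots> \<le> C * norm (f - g) + norm (S (h i) g - g) + norm (f - g)"
        using S_bounded_linear(2)[of "h i" "f - g"] h(1) by (simp add: norm_minus_commute)
      also have "\<dots> = (C + 1) * norm (f - g) + norm (S (h i) g - g)" by (simp add: algebra_simps)
      also have "\<dots> < e / 2 + e / 2"
      proof (rule add_le_less_mono)
        have "(C + 1) * norm (f - g) \<le> (C + 1) * d" using g(2) C_nonneg by (intro mult_left_mono) auto
        then show "(C + 1) * norm (f - g) \<le> e / 2" using d2 by simp
        show "norm (S (h i) g - g) < e / 2" using elim by (simp add: dist_norm)
      qed
      finally show ?case by (simp add: dist_norm)
    qed
  qed
qed

text \<open>
  A point of an open set \<open>V\<close> stays in \<open>V\<close> under small translations, so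
  the overlap of \<open>V\<close> with its translate by \<open>h\<close> tends to \<open>V\<close>
  in measure. As both sets have the same finite measure, the measure of their symmetric difference
  tends to \<open>0\<close>. On the overlap the claim is right continuity of \<open>W\<close> at
  the diagonal.
\<close>
lemma strongly_continuous_at_open:
  assumes V: "open V" "V \<subseteq> {0..}" "emeasure lborel V < \<infinity>"
  shows "strongly_continuous_at (abs_L1 (\<lambda>s. indicator V s *\<^sub>R x))"
  unfolding strongly_continuous_at_def
proof (intro allI impI)
  fix h :: "nat \<Rightarrow> real" assume h: "\<forall>i. 0 \<le> h i" "h \<longlonglongrightarrow> 0"
  let ?g = "\<lambda>s. indicator V s *\<^sub>R x"
  have Vb: "V \<in> sets borel" using V(1) by simp
  have hs: "half_supported ?g" by (rule half_supported_indicator_scaleR[OF Vb V(2,3)])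
  have gm: "sep_measurable borel ?g"
    using Vb by (intro sep_measurable_scaleR sep_measurable_const) auto
  have iV: "integrable lborel (indicat_real V)" using Vb V(3) by (intro integrable_real_indicator) auto
  \<comment> \<open>After translation by \<open>h i\<close> the difference \<open>S (h i) f - f\<close> is \<open>p i + q i\<close>.\<close>
  define p where "p = (\<lambda>i s. indicator V s *\<^sub>R (W (s + h i) s x - x))"
  define q where "q = (\<lambda>i s. (indicat_real V s - indicator V (s + h i)) *\<^sub>R x)"
  have pm: "strongly_measurable lborel (p i)" for i
  proof -
    have "sep_measurable borel (\<lambda>s. if 0 \<le> s \<and> s \<le> s + h i then W (s + h i) s x else 0)"
      by (rule W_apply_measurable) (auto intro: sep_measurable_const)
    then have "sep_measurable borel (\<lambda>s. indicat_real V s *\<^sub>R ((if 0 \<le> s \<and> s \<le> s + h i then W (s + h i) s x else 0) - x))"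
      using Vb by (intro sep_measurable_scaleR sep_measurable_diff sep_measurable_const) auto
    moreover have "(\<lambda>s. indicat_real V s *\<^sub>R ((if 0 \<le> s \<and> s \<le> s + h i then W (s + h i) s x else 0) - x)) = p i"
      using h(1) V(2) by (auto simp: p_def fun_eq_iff indicator_def)
    ultimately show ?thesis by (metis sep_imp_strongly_measurable sep_measurable_lborel)
  qed
  have wi: "strongly_integrable lborel (\<lambda>s. indicat_real V s *\<^sub>R ((C + 1) * norm x))"
    by (rule integrable_real_strongly_integrable_scaleR(1)[OF iV])
  have ple: "norm (p i s) \<le> norm (indicat_real V s *\<^sub>R ((C + 1) * norm x))" for i s
  proof (cases "s \<in> V")
    case True
    have "norm (W (s + h i) s x - x) \<le> norm (W (s + h i) s x) + norm x" by (rule norm_triangle_ineq4)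
    also have "\<dots> \<le> C * norm x + norm x" using W_bound[of s "s + h i" x] True V(2) h(1) by auto
    also have "\<dots> = (C + 1) * norm x" by (simp add: algebra_simps)
    finally show ?thesis using True C_nonneg by (simp add: p_def)
  qed (simp add: p_def)
  have plim: "(\<lambda>i. p i s) \<longlonglongrightarrow> 0" for s
  proof (cases "s \<in> V")
    case True
    have "(\<lambda>i. W (s + h i) s x) \<longlonglongrightarrow> x" using True V(2) h by (intro W_right_continuous) auto
    from tendsto_diff[OF this tendsto_const[of x]] show ?thesis using True by (simp add: p_def)
  qed (simp add: p_def)
  have p0: "(\<lambda>i. L1_seminorm lborel (p i)) \<longlonglongrightarrow> 0"
    and pi: "strongly_integrable lborel (p i)" for i
  proof -
    show "(\<lambda>i. L1_seminorm lborel (p i)) \<longlonglongrightarrow> 0"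
      using L1_seminorm_dominated_convergence(2)[where f=p and g="\<lambda>_. 0", OF pm wi] ple plim by simp
    show "strongly_integrable lborel (p i)"
      using ple by (intro strongly_integrable_dominated[OF pm wi]) simp
  qed
  define m where "m = measure lborel V"
  define ov where "ov = (\<lambda>i. LINT s|lborel. indicat_real V s * indicator V (s + h i))"
  have iVh: "integrable lborel (\<lambda>s. indicat_real V (s + h i))" for i
    using lborel_integrable_real_affine[OF iV, of 1 "h i"] by (simp add: add.commute)
  have LVh: "(LINT s|lborel. indicat_real V (s + h i)) = m" for i
    using lborel_integral_real_affine[of 1 "indicat_real V" "h i"] iV Vb V(3)
    by (simp add: add.commute m_def)
  have LV: "(LINT s|lborel. indicat_real V s) = m" using Vb V(3) by (simp add: m_def)
  have ibor: "(\<lambda>s. indicat_real V s * indicator V (s + h i)) \<in> borel_measurable lborel" for i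
    using borel_measurable_integrable[OF iV] borel_measurable_integrable[OF iVh[of i]] by measurable
  have iVV: "integrable lborel (\<lambda>s. indicat_real V s * indicator V (s + h i))" for i
    by (rule Bochner_Integration.integrable_bound[OF iV ibor]) (auto simp: indicator_def)
  have "ov \<longlonglongrightarrow> (LINT s|lborel. indicat_real V s)"
    unfolding ov_def
  proof (rule integral_dominated_convergence[OF _ ibor iV])
    show "indicat_real V \<in> borel_measurable lborel" using Vb by simp
    show "AE s in lborel. (\<lambda>i. indicat_real V s * indicator V (s + h i)) \<longlonglongrightarrow> indicat_real V s"
    proof (rule AE_I2)
      fix s
      show "(\<lambda>i. indicat_real V s * indicator V (s + h i)) \<longlonglongrightarrow> indicat_real V s"
      proof (cases "s \<in> V")
        case True
        have "(\<lambda>i. s + h i) \<longlonglongrightarrow> s" using tendsto_add[OF tendsto_const h(2), of s] by simp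
        then have "\<forall>\<^sub>F i in sequentially. s + h i \<in> V" using V(1) True by (rule topological_tendstoD)
        then have "\<forall>\<^sub>F i in sequentially. indicat_real V s = indicat_real V s * indicator V (s + h i)"
          by eventually_elim simp
        with tendsto_const show ?thesis by (rule Lim_transform_eventually)
      qed simp
    qed
    show "AE s in lborel. norm (indicat_real V s * indicator V (s + h i)) \<le> indicat_real V s" for i
      by (auto simp: indicator_def)
  qed
  then have o0: "(\<lambda>i. (2 * m - 2 * ov i) * norm x) \<longlonglongrightarrow> (2 * m - 2 * m) * norm x"
    unfolding LV by (intro tendsto_intros)
  have q: "strongly_integrable lborel (q i)" "L1_seminorm lborel (q i) = (2 * m - 2 * ov i) * norm x" for i
  proof -
    have i: "integrable lborel (\<lambda>s. indicat_real V s - indicator V (s + h i))" using iV iVh by simp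
    show "strongly_integrable lborel (q i)"
      unfolding q_def by (rule integrable_real_strongly_integrable_scaleR(1)[OF i])
    have "L1_seminorm lborel (q i) = (LINT s|lborel. norm (q i s))"
      using borel_measurable_integrable[OF i] unfolding q_def
      by (intro L1_seminorm_sep sep_measurable_scaleR sep_measurable_const)
    also have "\<dots> = (LINT s|lborel. (indicat_real V s + indicator V (s + h i) - 2 * (indicat_real V s * indicator V (s + h i))) * norm x)"
      by (intro Bochner_Integration.integral_cong) (auto simp: q_def indicator_def)
    also have "\<dots> = (2 * m - 2 * ov i) * norm x"
      using iV iVh[of i] iVV[of i] LV LVh[of i] by (simp add: ov_def)
    finally show "L1_seminorm lborel (q i) = (2 * m - 2 * ov i) * norm x" .
  qed
  have le: "norm (S (h i) (abs_L1 ?g) - abs_L1 ?g) \<le> L1_seminorm lborel (p i) + L1_seminorm lborel (q i)" for i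
  proof -
    have hi: "0 \<le> h i" using h(1) by simp
    note sh = shift_half_supported(1)[OF gm hs hi]
    let ?d = "\<lambda>s. shift (h i) ?g s - ?g s"
    have "norm (S (h i) (abs_L1 ?g) - abs_L1 ?g) = L1_seminorm lborel ?d"
      unfolding S_abs[OF gm hs hi] using sh hs by (simp add: abs_L1_diff norm_abs_L1 half_supported_diff)
    also have "\<dots> = L1_seminorm lborel (\<lambda>s. ?d (h i + 1 * s))"
      by (rule strongly_integrable_distr(2)[OF lborel_isometry(1,2), symmetric])
        (use half_supported_diff[OF sh hs] in \<open>auto simp: half_supported_integrable\<close>)
    also have "(\<lambda>s. ?d (h i + 1 * s)) = (\<lambda>s. p i s + q i s)"
    proof
      fix s
      show "?d (h i + 1 * s) = p i s + q i s"
        using V(2) hi W_zero[of s "s + h i"]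
        by (auto simp: shift_def p_def q_def indicator_def add.commute algebra_simps subset_iff W_zero split: if_splits)
    qed
    also have "L1_seminorm lborel (\<lambda>s. p i s + q i s) \<le> L1_seminorm lborel (p i) + L1_seminorm lborel (q i)"
      by (rule L1_seminorm_triangle[OF pi q(1)])
    finally show ?thesis .
  qed
  have "(\<lambda>i. L1_seminorm lborel (p i) + L1_seminorm lborel (q i)) \<longlonglongrightarrow> 0"
    using tendsto_add[OF p0 o0] by (simp add: q(2))
  with always_eventually[OF allI[OF le]] have "(\<lambda>i. S (h i) (abs_L1 ?g) - abs_L1 ?g) \<longlonglongrightarrow> 0"
    by (rule Lim_null_comparison)
  then show "(\<lambda>i. S (h i) (abs_L1 ?g)) \<longlonglongrightarrow> abs_L1 ?g" by (rule LIM_zero_cancel)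
qed

text \<open>
  By outer regularity a Borel set of finite measure is, up to small measure, an open set;
  intersecting with the positive axis costs only the point \<open>0\<close>.
\<close>
lemma strongly_continuous_at_indicator:
  assumes A: "A \<in> sets borel" "A \<subseteq> {0..}" "emeasure lborel A < \<infinity>"
  shows "strongly_continuous_at (abs_L1 (\<lambda>s. indicator A s *\<^sub>R x))"
proof (rule strongly_continuous_at_limit)
  fix e :: real assume e: "0 < e"
  define d where "d = e / (norm x + 1)"
  have d: "0 < d" using e by (simp add: d_def add_nonneg_pos)
  obtain T where T: "open T" "A \<subseteq> T" "emeasure lebesgue (T - A) < ennreal d"
    using sets_lebesgue_outer_open[of A d] A(1) d by (metis sets_completionI_sets sets_lborel)
  have TA: "T - A \<in> sets borel" using T(1) A(1) by simp
  have em: "emeasure lborel (T - A) < ennreal d" using T(3) TA by (simp add: emeasure_completion)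
  define V where "V = T \<inter> {0<..}"
  have "emeasure lborel V \<le> emeasure lborel (A \<union> (T - A))"
    using A(1) T(1) by (intro emeasure_mono) (auto simp: V_def)
  also have "\<dots> \<le> emeasure lborel A + emeasure lborel (T - A)"
    using A(1) TA by (intro emeasure_subadditive) auto
  also have "\<dots> < \<infinity>" using A(3) em by (auto simp: less_top[symmetric])
  finally have Vfin: "emeasure lborel V < \<infinity>" .
  have V: "open V" "V \<subseteq> {0..}" using T(1) by (auto simp: V_def)
  let ?f = "\<lambda>s. indicator A s *\<^sub>R x" and ?g = "\<lambda>s. indicator V s *\<^sub>R x"
  have f: "half_supported ?f" by (rule half_supported_indicator_scaleR[OF A])
  have g: "half_supported ?g" using V Vfin by (intro half_supported_indicator_scaleR) auto
  have i: "integrable lborel (indicat_real (T - A))"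
    using TA em by (intro integrable_real_indicator) (auto simp: less_top[symmetric] top_unique)
  have "norm (abs_L1 ?f - abs_L1 ?g) = L1_seminorm lborel (\<lambda>s. ?f s - ?g s)"
    using f g by (simp add: abs_L1_diff norm_abs_L1 half_supported_diff)
  also have "\<dots> \<le> L1_seminorm lborel (\<lambda>s. indicat_real (T - A) s *\<^sub>R x)"
  proof (rule L1_seminorm_mono_AE)
    show "strongly_integrable lborel (\<lambda>s. indicat_real (T - A) s *\<^sub>R x)"
      by (rule integrable_real_strongly_integrable_scaleR(1)[OF i])
    have "AE s in lborel. s \<noteq> (0::real)" using AE_lborel_singleton[of 0] by auto
    then show "AE s in lborel. norm (?f s - ?g s) \<le> norm (indicat_real (T - A) s *\<^sub>R x)"
    proof eventually_elim
      case (elim s)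
      then show ?case using A(2) T(2) by (auto simp: V_def indicator_def)
    qed
  qed
  also have "\<dots> = (LINT s|lborel. norm (indicat_real (T - A) s *\<^sub>R x))"
    using TA by (intro L1_seminorm_sep sep_measurable_scaleR sep_measurable_const) auto
  also have "\<dots> = measure lborel (T - A) * norm x" using TA by simp
  also have "\<dots> \<le> d * norm x"
    using em d by (intro mult_right_mono) (auto simp: Sigma_Algebra.measure_def enn2real_leI less_imp_le)
  also have "\<dots> < d * (norm x + 1)" using d by simp
  also have "\<dots> = e"
    using nonzero_eq_divide_eq[of "norm x + 1" d e] norm_ge_zero[of x] d_def by linarith
  finally have "norm (abs_L1 ?f - abs_L1 ?g) < e" .
  then show "\<exists>g. strongly_continuous_at g \<and> norm (abs_L1 ?f - g) < e"
    using strongly_continuous_at_open[OF V Vfin] by blast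
qed

lemma S_strongly_continuous: "strongly_continuous_at f"
  by (rule L1_dense_induct[of strongly_continuous_at])
    (auto intro: strongly_continuous_at_indicator strongly_continuous_at_add strongly_continuous_at_limit)

end

lemma borel_measurable_plane:
  "fst \<in> borel_measurable (borel :: (real \<times> real) measure)"
  "snd \<in> borel_measurable (borel :: (real \<times> real) measure)"
  "(\<lambda>p. fst p - snd p) \<in> borel_measurable (borel :: (real \<times> real) measure)"
  by (intro borel_measurable_continuous_onI continuous_intros)+

lemma sep_measurable_plane:
  "sep_measurable (lborel \<Otimes>\<^sub>M lborel) H \<longleftrightarrow> sep_measurable (borel :: (real \<times> real) measure) H"
  by (rule sep_measurable_cong_sets) (simp only: lborel_prod sets_lborel)

lemma exp_plane_measurable: "(\<lambda>p. exp (- l * (fst p - snd p))) \<in> borel_measurable (lborel \<Otimes>\<^sub>M lborel)"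
  for l :: real
  unfolding lborel_prod measurable_lborel2 by (intro borel_measurable_continuous_onI continuous_intros)

lemma generator_tendsto:
  fixes T :: "real \<Rightarrow> 'b::real_normed_vector \<Rightarrow> 'b"
  assumes "x \<in> generator_domain T"
  shows "((\<lambda>h. (T h x - x) /\<^sub>R h) \<longlongrightarrow> generator T x) (at_right 0)"
proof -
  obtain y where y: "((\<lambda>h. (T h x - x) /\<^sub>R h) \<longlongrightarrow> y) (at_right 0)"
    using assms by (auto simp: generator_domain_def)
  then have "generator T x = y" unfolding generator_def by (intro tendsto_Lim) auto
  with y show ?thesis by simp
qed

lemma generator_eqI:
  fixes T :: "real \<Rightarrow> 'b::real_normed_vector \<Rightarrow> 'b"
  assumes "((\<lambda>h. (T h x - x) /\<^sub>R h) \<longlongrightarrow> y) (at_right 0)"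
  shows "x \<in> generator_domain T" "generator T x = y"
  using assms tendsto_Lim[OF _ assms] by (auto simp: generator_domain_def generator_def)

context measurable_evolution
begin

lemma S_continuous_0:
  assumes e: "0 < e"
  obtains d where "0 < d" "\<And>h. 0 \<le> h \<Longrightarrow> h < d \<Longrightarrow> norm (S h f - f) < e"
proof -
  have "\<exists>d>0. \<forall>h. 0 \<le> h \<longrightarrow> h < d \<longrightarrow> norm (S h f - f) < e"
  proof (rule ccontr)
    assume "\<not> ?thesis"
    then have "\<forall>i. \<exists>h. 0 \<le> h \<and> h < inverse (real (Suc i)) \<and> \<not> norm (S h f - f) < e" by simp
    from choice[OF this] obtain h where h: "\<And>i. 0 \<le> h i" "\<And>i. h i < inverse (real (Suc i))" "\<And>i. \<not> norm (S (h i) f - f) < e" by blast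
    have "h \<longlonglongrightarrow> 0"
      using h(1,2) by (intro tendsto_sandwich[OF _ _ tendsto_const LIMSEQ_inverse_real_of_nat])
        (auto intro!: always_eventually less_imp_le)
    then have "(\<lambda>i. S (h i) f) \<longlonglongrightarrow> f"
      using S_strongly_continuous[of f] h(1) by (simp add: strongly_continuous_at_def)
    from tendstoD[OF this e] obtain i where "dist (S (h i) f) f < e"
      using eventually_happens[of _ sequentially] by auto
    then show False using h(3)[of i] by (simp add: dist_norm)
  qed
  then show ?thesis using that by blast
qed

lemma S_continuous_on: "continuous_on {0..} (\<lambda>t. S t f)"
proof (rule continuous_onI)
  fix t e :: real assume t: "t \<in> {0..}" and e: "0 < e"
  have "0 < e / (C + 1)" using e C_nonneg by simp
  then obtain d where d: "0 < d" "\<And>h. 0 \<le> h \<Longrightarrow> h < d \<Longrightarrow> norm (S h f - f) < e / (C + 1)"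
    by (rule S_continuous_0) blast
  have key: "norm (S b f - S a f) < e" if "0 \<le> a" "a \<le> b" "b - a < d" for a b
  proof -
    have "S b f - S a f = S a (S (b - a) f - f)"
      using that by (simp add: S_diff S_compose)
    then have "norm (S b f - S a f) \<le> C * norm (S (b - a) f - f)"
      using S_bounded_linear(2)[OF that(1)] by simp
    also have "\<dots> \<le> C * (e / (C + 1))"
      using d(2)[of "b - a"] that C_nonneg by (intro mult_left_mono) auto
    also have "\<dots> < e" using e C_nonneg by (simp add: field_simps)
    finally show ?thesis .
  qed
  have "dist (S x f) (S t f) \<le> e" if "x \<in> {0..}" "dist x t < d" for x
  proof (cases "x \<le> t")
    case True
    then show ?thesis using key[of x t] that by (simp add: dist_norm dist_real_def norm_minus_commute)
  next
    case False
    then show ?thesis using key[of t x] that t by (simp add: dist_norm dist_real_def)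
  qed
  then show "\<exists>d>0. \<forall>x'\<in>{0..}. dist x' t < d \<longrightarrow> dist (S x' f) (S t f) \<le> e" using d(1) by blast
qed

subsection \<open>Mild solutions and the generator\<close>

definition mild_integrand :: "(real \<Rightarrow> 'a) \<Rightarrow> real \<Rightarrow> real \<Rightarrow> 'a" where
  "mild_integrand y s \<tau> = (if 0 \<le> \<tau> \<and> \<tau> \<le> s then W s \<tau> (y \<tau>) else 0)"

text \<open>
  If \<open>W\<close> propagates \<open>u' = A(s) u\<close>, this is the mild solution of
  \<open>u' = A(s) u + y(s)\<close> with \<open>u(0) = 0\<close>.
\<close>
definition mild :: "(real \<Rightarrow> 'a) \<Rightarrow> real \<Rightarrow> 'a" where
  "mild y s = strong_integral lborel (mild_integrand y s)"

text \<open>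
  The part of the mild solution that the last \<open>h\<close> units of time contribute.
\<close>
definition recent :: "real \<Rightarrow> (real \<Rightarrow> 'a) \<Rightarrow> real \<Rightarrow> 'a" where
  "recent h y s = strong_integral lborel (\<lambda>\<tau>. indicator {s - h<..} \<tau> *\<^sub>R mild_integrand y s \<tau>)"

lemma mild_integrand_measurable:
  assumes y: "sep_measurable borel y"
  shows "sep_measurable (borel :: (real \<times> real) measure) (\<lambda>(s, \<tau>). mild_integrand y s \<tau>)"
proof -
  from W_apply_measurable[OF borel_measurable_plane(1,2) sep_measurable_compose[OF y borel_measurable_plane(2)]]
  show ?thesis
    by (rule back_subst[where P="sep_measurable borel"]) (auto simp: fun_eq_iff mild_integrand_def)
qed

lemma mild_integrand_bound: "norm (mild_integrand y s \<tau>) \<le> norm (C *\<^sub>R y \<tau>)"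
  using W_bound[of \<tau> s "y \<tau>"] C_nonneg by (simp add: mild_integrand_def)

lemma mild_integrand_integrable:
  assumes y: "sep_measurable borel y" "half_supported y"
  shows "strongly_integrable lborel (mild_integrand y s)"
proof (rule strongly_integrable_dominated)
  have "(\<lambda>\<tau>. (s, \<tau>)) \<in> measurable borel (borel :: (real \<times> real) measure)" by measurable
  from sep_measurable_compose[OF mild_integrand_measurable[OF y(1)] this]
  show "strongly_measurable lborel (mild_integrand y s)"
    by (intro sep_imp_strongly_measurable) (simp add: sep_measurable_lborel)
  show "strongly_integrable lborel (\<lambda>\<tau>. C *\<^sub>R y \<tau>)"
    by (intro strongly_integrable_scale half_supported_integrable y)
qed (intro AE_I2 mild_integrand_bound)

lemma norm_mild_le:
  assumes y: "sep_measurable borel y" "half_supported y"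
  shows "norm (mild y s) \<le> C * L1_seminorm lborel y"
proof -
  have "norm (mild y s) \<le> L1_seminorm lborel (mild_integrand y s)"
    unfolding mild_def by (rule norm_strong_integral_le[OF mild_integrand_integrable[OF y]])
  also have "\<dots> \<le> L1_seminorm lborel (\<lambda>\<tau>. C *\<^sub>R y \<tau>)"
    by (intro L1_seminorm_mono_AE strongly_integrable_scale half_supported_integrable y AE_I2 mild_integrand_bound)
  also have "\<dots> = C * L1_seminorm lborel y"
    using C_nonneg by (simp add: L1_seminorm_scale half_supported_integrable y)
  finally show ?thesis .
qed

lemma mild_diff:
  assumes "sep_measurable borel f" "half_supported f" "sep_measurable borel g" "half_supported g"
  shows "mild (\<lambda>s. f s - g s) s = mild f s - mild g s"
proof -
  have "mild_integrand (\<lambda>s. f s - g s) s = (\<lambda>\<tau>. mild_integrand f s \<tau> - mild_integrand g s \<tau>)"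
    using W_linear by (auto simp: mild_integrand_def fun_eq_iff linear_simps)
  then show ?thesis
    unfolding mild_def using assms by (simp add: strong_integral_diff mild_integrand_integrable)
qed

lemma mild_scaleR:
  assumes "sep_measurable borel f" "half_supported f"
  shows "mild (\<lambda>s. c *\<^sub>R f s) s = c *\<^sub>R mild f s"
proof -
  have "mild_integrand (\<lambda>s. c *\<^sub>R f s) s = (\<lambda>\<tau>. c *\<^sub>R mild_integrand f s \<tau>)"
    using W_linear by (auto simp: mild_integrand_def fun_eq_iff linear_simps)
  then show ?thesis
    unfolding mild_def using assms by (simp add: strong_integral_scaleR mild_integrand_integrable)
qed

lemma mild_measurable:
  assumes y: "sep_measurable borel y" "half_supported y"
  shows "sep_measurable borel (mild y)"
proof -
  have "sep_measurable (lborel \<Otimes>\<^sub>M lborel) (\<lambda>(s, \<tau>). mild_integrand y s \<tau>)"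
    unfolding sep_measurable_plane by (rule mild_integrand_measurable[OF y(1)])
  from lborel.sep_measurable_strong_integral[OF this]
  have "sep_measurable lborel (\<lambda>s. strong_integral lborel (\<lambda>\<tau>. mild_integrand y s \<tau>))"
    using mild_integrand_integrable[OF y] by simp
  then show ?thesis by (simp add: sep_measurable_lborel mild_def[abs_def])
qed

lemma mild_split:
  assumes y: "sep_measurable borel y" "half_supported y" and h: "0 \<le> h"
  shows "mild y s = recent h y s + (if h \<le> s then W s (s - h) (mild y (s - h)) else 0)"
proof -
  note i = mild_integrand_integrable[OF y]
  have 1: "strongly_integrable lborel (\<lambda>\<tau>. indicator {s - h<..} \<tau> *\<^sub>R mild_integrand y s \<tau>)"
    and 2: "strongly_integrable lborel (\<lambda>\<tau>. indicator {..s - h} \<tau> *\<^sub>R mild_integrand y s \<tau>)"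
    by (auto intro!: strongly_integrable_indicator i)
  have "mild_integrand y s = (\<lambda>\<tau>. indicator {s - h<..} \<tau> *\<^sub>R mild_integrand y s \<tau> + indicator {..s - h} \<tau> *\<^sub>R mild_integrand y s \<tau>)"
    by (auto simp: fun_eq_iff split: split_indicator)
  then have "mild y s = recent h y s + strong_integral lborel (\<lambda>\<tau>. indicator {..s - h} \<tau> *\<^sub>R mild_integrand y s \<tau>)"
    unfolding mild_def recent_def using strong_integral_add[OF 1 2] by metis
  moreover have "strong_integral lborel (\<lambda>\<tau>. indicator {..s - h} \<tau> *\<^sub>R mild_integrand y s \<tau>) =
    (if h \<le> s then W s (s - h) (mild y (s - h)) else 0)"
  proof (cases "h \<le> s")
    case True
    have "indicator {..s - h} \<tau> *\<^sub>R mild_integrand y s \<tau> = W s (s - h) (mild_integrand y (s - h) \<tau>)" for \<tau>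
      using True h W_compose[of \<tau> "s - h" s "y \<tau>"] W_zero[of "s - h" s]
      by (auto simp: mild_integrand_def split: split_indicator)
    then have "strong_integral lborel (\<lambda>\<tau>. indicator {..s - h} \<tau> *\<^sub>R mild_integrand y s \<tau>) =
        strong_integral lborel (\<lambda>\<tau>. W s (s - h) (mild_integrand y (s - h) \<tau>))" by simp
    also have "\<dots> = W s (s - h) (strong_integral lborel (mild_integrand y (s - h)))"
      using True h by (intro strong_integral_bounded_linear i W_linear) auto
    finally show ?thesis using True by (simp add: mild_def)
  next
    case False
    then have "indicator {..s - h} \<tau> *\<^sub>R mild_integrand y s \<tau> = 0" for \<tau>
      by (auto simp: mild_integrand_def split: split_indicator)
    then show ?thesis using False by (simp only: strong_integral_zero if_False)
  qed
  ultimately show ?thesis by simp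
qed

text \<open>
  Substituting \<open>\<tau> + h\<close> for \<open>\<tau>\<close>, the shifted datum contributes
  exactly what \<open>y\<close> contributes up to time \<open>s - h\<close>.
\<close>
lemma mild_shift:
  assumes y: "sep_measurable borel y" "half_supported y" and h: "0 \<le> h"
  shows "mild (shift h y) s = mild y s - recent h y s"
proof -
  have "mild (shift h y) s = strong_integral lborel (\<lambda>\<tau>. mild_integrand (shift h y) s (h + 1 * \<tau>))"
    unfolding mild_def by (rule strong_integral_lborel_isometry[symmetric]) simp
  also have "\<dots> = strong_integral lborel (\<lambda>\<tau>. indicator {..s - h} \<tau> *\<^sub>R mild_integrand y s \<tau>)"
  proof (rule arg_cong[where f="strong_integral lborel"], rule ext)
    fix \<tau>
    show "mild_integrand (shift h y) s (h + 1 * \<tau>) = indicator {..s - h} \<tau> *\<^sub>R mild_integrand y s \<tau>"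
      using h y(2) W_compose[of \<tau> "h + \<tau>" s "y \<tau>"] W_zero[of "h + \<tau>" s]
      by (cases "0 \<le> \<tau>") (auto simp: mild_integrand_def shift_def half_supported_def split: split_indicator)
  qed
  also have "\<dots> = mild y s - recent h y s"
  proof -
    have "mild_integrand y s \<tau> - indicator {s - h<..} \<tau> *\<^sub>R mild_integrand y s \<tau> =
       indicator {..s - h} \<tau> *\<^sub>R mild_integrand y s \<tau>" for \<tau>
      by (auto split: split_indicator)
    then show ?thesis
      unfolding mild_def recent_def
      by (subst strong_integral_diff[symmetric])
        (auto intro!: strongly_integrable_indicator mild_integrand_integrable y)
  qed
  finally show ?thesis .
qed

lemma recent_eq_shift_integral:
  assumes y: "half_supported y"
  shows "recent h y s = strong_integral lborel (\<lambda>\<sigma>. indicator {0..<h} \<sigma> *\<^sub>R shift \<sigma> y s)"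
proof -
  have "recent h y s = strong_integral lborel (\<lambda>\<sigma>. indicator {s - h<..} (s + (-1) * \<sigma>) *\<^sub>R mild_integrand y s (s + (-1) * \<sigma>))"
    unfolding recent_def by (rule strong_integral_lborel_isometry[symmetric]) simp
  also have "\<dots> = strong_integral lborel (\<lambda>\<sigma>. indicator {0..<h} \<sigma> *\<^sub>R shift \<sigma> y s)"
    by (rule arg_cong[where f="strong_integral lborel"])
      (auto simp: fun_eq_iff mild_integrand_def shift_def split: split_indicator)
  finally show ?thesis .
qed

text \<open>
  By \<open>recent_eq_shift_integral\<close> the average over the last \<open>h\<close> units of
  time is the average of the shifts of \<open>y\<close> by less than \<open>h\<close>, so its
  distance to \<open>y\<close> is at most the largest distance of these shifts to
  \<open>y\<close>. With strong continuity of the semigroup it converges to \<open>y\<close> as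
  \<open>h\<close> tends to \<open>0\<close>.
\<close>
lemma recent_average:
  assumes y: "sep_measurable borel y" "half_supported y" and h: "0 < h" and e: "0 \<le> e"
    and le: "\<And>\<sigma>. 0 \<le> \<sigma> \<Longrightarrow> \<sigma> < h \<Longrightarrow> norm (S \<sigma> (abs_L1 y) - abs_L1 y) \<le> e"
  shows "strongly_integrable lborel (\<lambda>s. (1 / h) *\<^sub>R recent h y s - y s)"
    "L1_seminorm lborel (\<lambda>s. (1 / h) *\<^sub>R recent h y s - y s) \<le> e"
proof -
  define H where "H = (\<lambda>(s, \<sigma>). indicat_real {0..<h} \<sigma> *\<^sub>R ((1 / h) *\<^sub>R (shift \<sigma> y s - y s)))"
  have shm: "sep_measurable (borel :: (real \<times> real) measure) (\<lambda>(s, \<sigma>). indicat_real {0..<h} \<sigma> *\<^sub>R shift \<sigma> y s)"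
  proof -
    have [measurable]: "(\<lambda>p :: real \<times> real. indicat_real {0..<h} (snd p)) \<in> borel_measurable borel"
      using measurable_compose[OF borel_measurable_plane(2), of "indicat_real {0..<h}" borel] by simp
    from W_apply_measurable[OF borel_measurable_plane(1,3) sep_measurable_compose[OF y(1) borel_measurable_plane(3)]]
    have "sep_measurable (borel :: (real \<times> real) measure) (\<lambda>p. indicat_real {0..<h} (snd p) *\<^sub>R
        (if 0 \<le> fst p - snd p \<and> fst p - snd p \<le> fst p then W (fst p) (fst p - snd p) (y (fst p - snd p)) else 0))"
      by (intro sep_measurable_scaleR) measurable
    then show ?thesis
      by (rule back_subst[where P="sep_measurable borel"]) (auto simp: fun_eq_iff shift_def split: split_indicator)
  qed
  have ym: "sep_measurable (borel :: (real \<times> real) measure) (\<lambda>(s, \<sigma>). indicat_real {0..<h} \<sigma> *\<^sub>R y s)"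
  proof -
    have [measurable]: "(\<lambda>p :: real \<times> real. indicat_real {0..<h} (snd p)) \<in> borel_measurable borel"
      using measurable_compose[OF borel_measurable_plane(2), of "indicat_real {0..<h}" borel] by simp
    from sep_measurable_compose[OF y(1) borel_measurable_plane(1)]
    have "sep_measurable (borel :: (real \<times> real) measure) (\<lambda>p. indicat_real {0..<h} (snd p) *\<^sub>R y (fst p))"
      by (intro sep_measurable_scaleR) measurable
    then show ?thesis
      by (rule back_subst[where P="sep_measurable borel"]) (auto simp: fun_eq_iff)
  qed
  have "sep_measurable (borel :: (real \<times> real) measure) (\<lambda>p. (1 / h) *\<^sub>R 
      ((\<lambda>(s, \<sigma>). indicat_real {0..<h} \<sigma> *\<^sub>R shift \<sigma> y s) p - (\<lambda>(s, \<sigma>). indicat_real {0..<h} \<sigma> *\<^sub>R y s) p))"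
    by (intro sep_measurable_scaleR sep_measurable_diff shm ym) simp
  then have "sep_measurable (borel :: (real \<times> real) measure) H"
    by (rule back_subst[where P="sep_measurable borel"]) (auto simp: fun_eq_iff H_def scaleR_diff_right)
  then have "sep_measurable (lborel \<Otimes>\<^sub>M lborel) H"
    by (simp only: sep_measurable_plane)
  then have Hm: "strongly_measurable (lborel \<Otimes>\<^sub>M lborel) H" by (rule sep_imp_strongly_measurable)
  have shi: "half_supported (shift \<sigma> y)" if "0 \<le> \<sigma>" for \<sigma> using shift_half_supported[OF y that] by blast
  have inner: "(\<integral>\<^sup>+s. ennreal (norm (H (s, \<sigma>))) \<partial>lborel) \<le> ennreal (e / h) * indicator {0..<h} \<sigma>" for \<sigma>
  proof (cases "0 \<le> \<sigma> \<and> \<sigma> < h")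
    case True
    have d: "half_supported (\<lambda>s. shift \<sigma> y s - y s)" using True by (intro half_supported_diff shi y) auto
    have i: "strongly_integrable lborel (\<lambda>s. (1 / h) *\<^sub>R (shift \<sigma> y s - y s))"
      by (intro strongly_integrable_scale half_supported_integrable d)
    have "(\<integral>\<^sup>+s. ennreal (norm (H (s, \<sigma>))) \<partial>lborel) = ennreal (L1_seminorm lborel (\<lambda>s. (1 / h) *\<^sub>R (shift \<sigma> y s - y s)))"
      using True nn_integral_eq_L1_seminorm[OF i] by (simp add: H_def)
    also have "L1_seminorm lborel (\<lambda>s. (1 / h) *\<^sub>R (shift \<sigma> y s - y s)) = (1 / h) * norm (S \<sigma> (abs_L1 y) - abs_L1 y)"
      using True h d shi[of \<sigma>] y
      by (simp add: L1_seminorm_scale half_supported_integrable S_abs abs_L1_diff norm_abs_L1)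
    also have "\<dots> \<le> e / h" using le[of \<sigma>] True h by (simp add: divide_right_mono)
    finally show ?thesis using True by (simp add: ennreal_leI)
  next
    case False
    then have "H (s, \<sigma>) = 0" for s by (auto simp: H_def)
    then show ?thesis by simp
  qed
  have "(\<integral>\<^sup>+p. ennreal (norm (H p)) \<partial>(lborel \<Otimes>\<^sub>M lborel)) = (\<integral>\<^sup>+\<sigma>. (\<integral>\<^sup>+s. ennreal (norm (H (s, \<sigma>))) \<partial>lborel) \<partial>lborel)"
    by (rule lborel_pair.nn_integral_norm_snd[OF Hm, symmetric])
  also have "\<dots> \<le> (\<integral>\<^sup>+\<sigma>. ennreal (e / h) * indicator {0..<h} \<sigma> \<partial>lborel)" by (intro nn_integral_mono inner)
  also have "\<dots> = ennreal (e / h) * ennreal h" using h by (simp add: nn_integral_cmult_indicator)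
  also have "\<dots> = ennreal e" using h e by (simp flip: ennreal_mult)
  finally have Hle: "(\<integral>\<^sup>+p. ennreal (norm (H p)) \<partial>(lborel \<Otimes>\<^sub>M lborel)) \<le> ennreal e" .
  then have Hi: "strongly_integrable (lborel \<Otimes>\<^sub>M lborel) H"
    using Hm le_less_trans[OF Hle ennreal_less_top] by (simp add: strongly_integrable_def infinity_ennreal_def)
  have shm': "strongly_integrable lborel (\<lambda>\<sigma>. indicator {0..<h} \<sigma> *\<^sub>R shift \<sigma> y s)" for s
  proof -
    have "strongly_integrable lborel (\<lambda>\<tau>. indicator {s - h<..} \<tau> *\<^sub>R mild_integrand y s \<tau>)"
      by (intro strongly_integrable_indicator mild_integrand_integrable y) simp
    from strongly_integrable_distr(1)[OF lborel_isometry(1,2)[of "-1" s] this]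
    have "strongly_integrable lborel (\<lambda>\<sigma>. indicator {s - h<..} (s + (-1) * \<sigma>) *\<^sub>R mild_integrand y s (s + (-1) * \<sigma>))" by simp
    then show ?thesis
      by (rule back_subst[where P="strongly_integrable lborel"])
        (auto simp: fun_eq_iff mild_integrand_def shift_def split: split_indicator)
  qed
  have slice: "strong_integral lborel (\<lambda>\<sigma>. H (s, \<sigma>)) = (1 / h) *\<^sub>R recent h y s - y s" for s
  proof -
    have ih: "integrable lborel (indicat_real {0..<h})" using h by (intro integrable_real_indicator) auto
    note c = integrable_real_strongly_integrable_scaleR[OF ih, of "y s"]
    have "(\<lambda>\<sigma>. H (s, \<sigma>)) = (\<lambda>\<sigma>. (1 / h) *\<^sub>R (indicator {0..<h} \<sigma> *\<^sub>R shift \<sigma> y s - indicator {0..<h} \<sigma> *\<^sub>R y s))"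
      by (auto simp: H_def fun_eq_iff scaleR_diff_right)
    then have "strong_integral lborel (\<lambda>\<sigma>. H (s, \<sigma>)) =
        (1 / h) *\<^sub>R (strong_integral lborel (\<lambda>\<sigma>. indicator {0..<h} \<sigma> *\<^sub>R shift \<sigma> y s) - (LINT \<sigma>|lborel. indicat_real {0..<h} \<sigma>) *\<^sub>R y s)"
      using shm'[of s] c by (simp add: strong_integral_scaleR strongly_integrable_minus strong_integral_diff)
    then show ?thesis using h by (simp add: recent_eq_shift_integral[OF y(2)] scaleR_diff_right)
  qed
  show "strongly_integrable lborel (\<lambda>s. (1 / h) *\<^sub>R recent h y s - y s)"
    using lborel_pair.strongly_integrable_iterated(2)[OF Hi] by (simp add: slice)
  have "L1_seminorm lborel (\<lambda>s. (1 / h) *\<^sub>R recent h y s - y s) \<le> L1_seminorm (lborel \<Otimes>\<^sub>M lborel) H"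
    using lborel_pair.strongly_integrable_iterated(3)[OF Hi] by (simp add: slice)
  also have "\<dots> \<le> e" using Hle e by (rule L1_seminorm_bound_nn)
  finally show "L1_seminorm lborel (\<lambda>s. (1 / h) *\<^sub>R recent h y s - y s) \<le> e" .
qed

text \<open>
  Splitting the mild solution at time \<open>s - h\<close> shows that the difference quotients of
  \<open>- mild y\<close> are the averages of \<open>recent_average\<close>.
\<close>
lemma generator_if_mild:
  assumes f: "sep_measurable borel f" "half_supported f" and y: "sep_measurable borel y" "half_supported y"
    and eq: "AE s in lborel. 0 \<le> s \<longrightarrow> f s = - mild y s"
  shows "((\<lambda>h. (S h (abs_L1 f) - abs_L1 f) /\<^sub>R h) \<longlongrightarrow> abs_L1 y) (at_right 0)"
proof (rule tendstoI)
  fix e :: real assume e: "0 < e"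
  then have "0 < e / 2" by simp
  then obtain d where d: "0 < d" "\<And>h. 0 \<le> h \<Longrightarrow> h < d \<Longrightarrow> norm (S h (abs_L1 y) - abs_L1 y) < e / 2"
    by (rule S_continuous_0) blast
  have "dist ((S h (abs_L1 f) - abs_L1 f) /\<^sub>R h) (abs_L1 y) < e" if h: "0 < h" "h < d" for h
  proof -
    have h0: "0 \<le> h" using h by simp
    have "AE s in lborel. 0 \<le> s - h \<longrightarrow> f (s - h) = - mild y (s - h)"
      using AE_lborel_isometry[OF _ eq, of 1 "-h"] by simp
    then have ae: "AE s in lborel. (shift h f s - f s) /\<^sub>R h = (1 / h) *\<^sub>R recent h y s"
      using eq
    proof eventually_elim
      case (elim s)
      show ?case
      proof (cases "0 \<le> s")
        case True
        have "shift h f s - f s = recent h y s"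
          using elim True h0 mild_split[OF y h0, of s] W_linear[of "s - h" s]
          by (auto simp: shift_def linear_simps)
        then show ?thesis by (simp add: divide_inverse)
      next
        case False
        then have "mild_integrand y s = (\<lambda>\<tau>. 0)" by (auto simp: mild_integrand_def fun_eq_iff)
        then have "recent h y s = 0" by (simp add: recent_def strong_integral_zero)
        then show ?thesis using False h0 f(2) by (simp add: shift_def half_supported_def)
      qed
    qed
    note sh = shift_half_supported(1)[OF f h0]
    have hs: "half_supported (\<lambda>s. (shift h f s - f s) /\<^sub>R h - y s)"
      using sh f y by (intro half_supported_diff half_supported_scaleR)
    have "(S h (abs_L1 f) - abs_L1 f) /\<^sub>R h - abs_L1 y = abs_L1 (\<lambda>s. (shift h f s - f s) /\<^sub>R h - y s)"
      using f y sh h0 by (simp add: S_abs abs_L1_diff abs_L1_scaleR half_supported_diff half_supported_scaleR)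
    then have "norm ((S h (abs_L1 f) - abs_L1 f) /\<^sub>R h - abs_L1 y) = L1_seminorm lborel (\<lambda>s. (shift h f s - f s) /\<^sub>R h - y s)"
      using norm_abs_L1[OF hs] by simp
    also have "\<dots> = L1_seminorm lborel (\<lambda>s. (1 / h) *\<^sub>R recent h y s - y s)"
      using ae by (intro L1_seminorm_cong_AE) (auto elim!: eventually_mono)
    also have "\<dots> \<le> e / 2"
      using e h d(2) by (intro recent_average(2)[OF y h(1)]) (auto intro: less_imp_le)
    finally show ?thesis using e by (simp add: dist_norm)
  qed
  then show "\<forall>\<^sub>F h in at_right 0. dist ((S h (abs_L1 f) - abs_L1 f) /\<^sub>R h) (abs_L1 y) < e"
    unfolding eventually_at_right_field using d(1) by blast
qed

text \<open>
  The map \<open>mild\<close> is bounded from \<open>L\<^sup>1\<close> into the bounded functions,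
  and by \<open>mild_shift\<close> it sends the difference quotients of \<open>f\<close> to the
  averages \<open>- (1 / h) *\<^sub>R recent h f\<close>. The images converge uniformly to
  \<open>mild y\<close>, the averages in \<open>L\<^sup>1\<close> to \<open>- f\<close>. The two
  limits are compared on the bounded intervals \<open>{0..N}\<close>, where uniform convergence
  implies convergence in \<open>L\<^sup>1\<close>.
\<close>
lemma mild_if_generator:
  assumes f: "sep_measurable borel f" "half_supported f" and y: "sep_measurable borel y" "half_supported y"
    and gen: "((\<lambda>h. (S h (abs_L1 f) - abs_L1 f) /\<^sub>R h) \<longlongrightarrow> abs_L1 y) (at_right 0)"
  shows "AE s in lborel. 0 \<le> s \<longrightarrow> f s = - mild y s"
proof -
  define q where "q = (\<lambda>h. norm ((S h (abs_L1 f) - abs_L1 f) /\<^sub>R h - abs_L1 y))"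
  have pw: "norm (mild y s + (1 / h) *\<^sub>R recent h f s) \<le> C * q h" if h: "0 < h" for h s
  proof -
    have h0: "0 \<le> h" using h by simp
    note sh = shift_half_supported(1)[OF f h0] shift_measurable[OF f(1) h0]
    let ?g = "\<lambda>s. (1 / h) *\<^sub>R (shift h f s - f s) - y s"
    have g1: "half_supported (\<lambda>s. shift h f s - f s)" "sep_measurable borel (\<lambda>s. shift h f s - f s)"
      using sh f by (auto intro: half_supported_diff sep_measurable_diff)
    have g2: "half_supported (\<lambda>s. (1 / h) *\<^sub>R (shift h f s - f s))" "sep_measurable borel (\<lambda>s. (1 / h) *\<^sub>R (shift h f s - f s))"
      using g1 by (auto intro: half_supported_scaleR sep_measurable_scaleR)
    have g: "half_supported ?g" "sep_measurable borel ?g"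
      using g2 y by (auto intro: half_supported_diff sep_measurable_diff)
    have "(S h (abs_L1 f) - abs_L1 f) /\<^sub>R h - abs_L1 y = abs_L1 ?g"
      using f y sh h0 g1 g2 by (simp add: S_abs abs_L1_diff abs_L1_scaleR divide_inverse)
    then have q: "q h = L1_seminorm lborel ?g" using norm_abs_L1[OF g(1)] by (simp add: q_def)
    have "mild ?g s = (1 / h) *\<^sub>R (mild (shift h f) s - mild f s) - mild y s"
      by (simp add: mild_diff[OF g2(2,1) y] mild_scaleR[OF g1(2,1)] mild_diff[OF sh(2,1) f])
    also have "\<dots> = - (mild y s + (1 / h) *\<^sub>R recent h f s)"
      by (simp add: mild_shift[OF f h0])
    finally have eq: "mild ?g s = - (mild y s + (1 / h) *\<^sub>R recent h f s)" .
    have "norm (mild y s + (1 / h) *\<^sub>R recent h f s) = norm (mild ?g s)"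
      unfolding eq by (rule norm_minus_cancel[symmetric])
    then show ?thesis using norm_mild_le[OF g(2,1), of s] q by simp
  qed
  have zero: "L1_seminorm lborel (\<lambda>s. indicator {0..real N} s *\<^sub>R (f s + mild y s)) \<le> e" if e: "0 < e" for N :: nat and e
  proof -
    define e1 where "e1 = e / 2"
    have e1: "0 < e1" using e by (simp add: e1_def)
    obtain d where d: "0 < d" "\<And>h. 0 \<le> h \<Longrightarrow> h < d \<Longrightarrow> norm (S h (abs_L1 f) - abs_L1 f) < e1"
      using e1 by (rule S_continuous_0) blast
    have "(q \<longlongrightarrow> norm (abs_L1 y - abs_L1 y)) (at_right 0)"
      unfolding q_def by (intro tendsto_intros gen)
    then have "((\<lambda>h. real N * (C * q h)) \<longlongrightarrow> real N * (C * 0)) (at_right 0)" by (intro tendsto_intros) simp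
    then have "\<forall>\<^sub>F h in at_right 0. real N * (C * q h) < e1" using e1 by (intro order_tendstoD(2)) auto
    then obtain b where b: "0 < b" "\<And>h. 0 < h \<Longrightarrow> h < b \<Longrightarrow> real N * (C * q h) < e1"
      unfolding eventually_at_right_field by auto
    define h where "h = min d b / 2"
    have h: "0 < h" "h < d" "h < b" using d(1) b(1) by (auto simp: h_def)
    note av = recent_average[OF f h(1) less_imp_le[OF e1]]
    have le: "norm (S \<sigma> (abs_L1 f) - abs_L1 f) \<le> e1" if "0 \<le> \<sigma>" "\<sigma> < h" for \<sigma>
      using d(2)[of \<sigma>] that h by simp
    let ?a = "\<lambda>s. indicator {0..real N} s *\<^sub>R ((1 / h) *\<^sub>R recent h f s - f s)"
    let ?b = "\<lambda>s. indicator {0..real N} s *\<^sub>R (mild y s + (1 / h) *\<^sub>R recent h f s)"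
    have iN: "integrable lborel (indicat_real {0..real N})" by (intro integrable_real_indicator) auto
    have a: "strongly_integrable lborel ?a" "L1_seminorm lborel ?a \<le> e1"
    proof -
      show i: "strongly_integrable lborel ?a" by (intro strongly_integrable_indicator av le) auto
      have "L1_seminorm lborel ?a \<le> L1_seminorm lborel (\<lambda>s. (1 / h) *\<^sub>R recent h f s - f s)"
        by (intro L1_seminorm_mono_AE av le AE_I2) (auto split: split_indicator)
      also have "\<dots> \<le> e1" by (intro av le)
      finally show "L1_seminorm lborel ?a \<le> e1" .
    qed
    have b: "strongly_integrable lborel ?b" "L1_seminorm lborel ?b \<le> real N * (C * q h)"
    proof -
      have w: "strongly_integrable lborel (\<lambda>s. indicat_real {0..real N} s *\<^sub>R (C * q h))"
        by (rule integrable_real_strongly_integrable_scaleR(1)[OF iN])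
      have le': "norm (?b s) \<le> norm (indicat_real {0..real N} s *\<^sub>R (C * q h))" for s
        using pw[OF h(1), of s] by (auto split: split_indicator)
      have fi: "strongly_measurable lborel (\<lambda>s. (1 / h) *\<^sub>R recent h f s)"
      proof -
        have "strongly_integrable lborel (\<lambda>s. ((1 / h) *\<^sub>R recent h f s - f s) + f s)"
          by (intro strongly_integrable_plus av le half_supported_integrable f)
        then show ?thesis by (intro strongly_integrable_measurable) simp
      qed
      have "strongly_measurable lborel (mild y)"
        using mild_measurable[OF y] by (intro sep_imp_strongly_measurable) (simp add: sep_measurable_lborel)
      from strongly_measurable_add[OF this fi]
      obtain k where k: "sep_measurable lborel k" "AE s in lborel. mild y s + (1 / h) *\<^sub>R recent h f s = k s"
        unfolding strongly_measurable_iff_sep by blast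
      have "sep_measurable lborel (\<lambda>s. indicat_real {0..real N} s *\<^sub>R k s)"
        by (intro sep_measurable_scaleR k) simp
      moreover have "AE s in lborel. ?b s = indicator {0..real N} s *\<^sub>R k s" using k(2) by eventually_elim simp
      ultimately have m: "strongly_measurable lborel ?b" using strongly_measurable_iff_sep by blast
      show "strongly_integrable lborel ?b" by (rule strongly_integrable_dominated[OF m w]) (simp only: le' eventually_True AE_I2)
      have "L1_seminorm lborel ?b \<le> L1_seminorm lborel (\<lambda>s. indicat_real {0..real N} s *\<^sub>R (C * q h))"
        by (rule L1_seminorm_mono_AE[OF w AE_I2[OF le']])
      also have "\<dots> = (LINT s|lborel. norm (indicat_real {0..real N} s *\<^sub>R (C * q h)))"
        by (intro L1_seminorm_sep sep_measurable_scaleR sep_measurable_const) simp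
      also have "\<dots> = real N * (C * q h)"
        using C_nonneg by (simp add: q_def)
      finally show "L1_seminorm lborel ?b \<le> real N * (C * q h)" .
    qed
    have "(\<lambda>s. indicator {0..real N} s *\<^sub>R (f s + mild y s)) = (\<lambda>s. ?b s + (-1) *\<^sub>R ?a s)"
      by (auto simp: fun_eq_iff split: split_indicator)
    then have "L1_seminorm lborel (\<lambda>s. indicator {0..real N} s *\<^sub>R (f s + mild y s)) \<le>
        L1_seminorm lborel ?b + L1_seminorm lborel (\<lambda>s. (-1) *\<^sub>R ?a s)"
      using L1_seminorm_triangle[OF b(1) strongly_integrable_scale[OF a(1), of "-1"]] by simp
    also have "L1_seminorm lborel (\<lambda>s. (-1) *\<^sub>R ?a s) = L1_seminorm lborel ?a"
      using L1_seminorm_scale[OF a(1), of "-1"] by simp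
    also have "L1_seminorm lborel ?b + L1_seminorm lborel ?a \<le> e1 + e1"
      using a(2) b(2) \<open>\<And>h. 0 < h \<Longrightarrow> h < b \<Longrightarrow> real N * (C * q h) < e1\<close>[OF h(1) h(3)] by simp
    finally show ?thesis by (simp add: e1_def)
  qed
  have "AE s in lborel. indicator {0..real N} s *\<^sub>R (f s + mild y s) = 0" for N :: nat
  proof (rule L1_seminorm_eq_0)
    have iN: "integrable lborel (indicat_real {0..real N})" by (intro integrable_real_indicator) auto
    have "strongly_integrable lborel (\<lambda>s. indicator {0..real N} s *\<^sub>R mild y s)"
    proof (rule strongly_integrable_dominated)
      show "strongly_measurable lborel (\<lambda>s. indicator {0..real N} s *\<^sub>R mild y s)"
        using mild_measurable[OF y]
        by (intro sep_imp_strongly_measurable sep_measurable_scaleR) (auto simp: sep_measurable_lborel)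
      show "strongly_integrable lborel (\<lambda>s. indicat_real {0..real N} s *\<^sub>R (C * L1_seminorm lborel y))"
        by (rule integrable_real_strongly_integrable_scaleR(1)[OF iN])
      show "AE s in lborel. norm (indicator {0..real N} s *\<^sub>R mild y s) \<le> norm (indicat_real {0..real N} s *\<^sub>R (C * L1_seminorm lborel y))"
        using norm_mild_le[OF y] C_nonneg L1_seminorm_nonneg[of lborel y] by (auto split: split_indicator)
    qed
    from strongly_integrable_plus[OF strongly_integrable_indicator[OF half_supported_integrable[OF f(2)], of "{0..real N}"] this]
    have "strongly_integrable lborel (\<lambda>s. indicator {0..real N} s *\<^sub>R f s + indicator {0..real N} s *\<^sub>R mild y s)"
      by simp
    then show "strongly_integrable lborel (\<lambda>s. indicator {0..real N} s *\<^sub>R (f s + mild y s))"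
      by (simp add: scaleR_add_right)
    show "L1_seminorm lborel (\<lambda>s. indicator {0..real N} s *\<^sub>R (f s + mild y s)) = 0"
    proof (rule antisym[OF field_le_epsilon L1_seminorm_nonneg])
      fix e :: real assume "0 < e"
      then show "L1_seminorm lborel (\<lambda>s. indicator {0..real N} s *\<^sub>R (f s + mild y s)) \<le> 0 + e"
        using zero[of e N] by simp
    qed
  qed
  then have "AE s in lborel. \<forall>N::nat. indicator {0..real N} s *\<^sub>R (f s + mild y s) = 0"
    unfolding AE_all_countable by (rule allI)
  then show ?thesis
  proof eventually_elim
    case (elim s)
    show ?case
    proof
      assume s: "0 \<le> s"
      obtain N :: nat where "s \<le> real N" using real_arch_simple by blast
      then have "f s + mild y s = 0" using elim[rule_format, of N] s by simp
      then show "f s = - mild y s" by (simp add: eq_neg_iff_add_eq_0)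
    qed
  qed
qed

end

context perturbed_evolution
begin

sublocale free: measurable_evolution U M
proof (rule measurable_evolution.intro)
  show "sep_measurable borel (\<lambda>(t, s). if 0 \<le> s \<and> s \<le> t then U t s x else 0)" for x
    using Vn_measurable[of 0 x] unfolding perturbation_term.simps(1) .
  show "(\<lambda>i. U (s + h i) s x) \<longlonglongrightarrow> x" if "0 \<le> s" "h \<longlonglongrightarrow> 0" "\<And>i. 0 \<le> h i" for s x and h :: "nat \<Rightarrow> real"
    using tendsto_in_Delta[OF Vn_0_continuous, of "\<lambda>i. s" "\<lambda>i. s + h i" s s x] that
      tendsto_add[OF tendsto_const that(2), of s] by (simp add: U_refl)
qed (fact U_bounded_linear U_bound M(1) U_refl U_compose)+

sublocale pert: measurable_evolution V M
proof (rule measurable_evolution.intro)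
  show "sep_measurable borel (\<lambda>(t, s). if 0 \<le> s \<and> s \<le> t then V t s x else 0)" for x
    by (rule V_measurable)
  show "(\<lambda>i. V (s + h i) s x) \<longlonglongrightarrow> x" if "0 \<le> s" "h \<longlonglongrightarrow> 0" "\<And>i. 0 \<le> h i" for s x and h :: "nat \<Rightarrow> real"
    using that by (rule V_right_continuous)
qed (fact V_bounded_linear V_bound M(1) V_refl V_compose)+

section \<open>The perturbation operators\<close>

text \<open>
  The time \<open>s\<close> at which \<open>B\<close> acts comes first, the time
  \<open>\<tau>\<close> at which the datum enters second. For fixed \<open>\<tau>\<close> this is
  \<open>BU \<tau> (z \<tau>)\<close>; integrated over \<open>\<tau>\<close> it gives
  \<open>\<BB>\<^sub>0 z\<close>.
\<close>
definition BU_kernel :: "(real \<Rightarrow> 'a) \<Rightarrow> real \<times> real \<Rightarrow> 'a" where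
  "BU_kernel z = (\<lambda>(s, \<tau>). if 0 \<le> \<tau> \<and> \<tau> \<le> s then B s (U s \<tau> (z \<tau>)) else 0)"

lemma BU_kernel_measurable:
  assumes z: "half_supported z"
  shows "strongly_measurable (lborel \<Otimes>\<^sub>M lborel) (BU_kernel z)"
proof -
  have "strongly_measurable (lebesgue_on \<Delta>) (\<lambda>(t, s). B t (U t s (z s)))"
    using BUf_measurable half_supported_half_line[OF z] by blast
  then have "strongly_measurable lborel (\<lambda>p. indicator \<Delta> p *\<^sub>R (case p of (t, s) \<Rightarrow> B t (U t s (z s))))"
    by (simp add: strongly_measurable_lebesgue_on[OF Delta_borel])
  also have "(\<lambda>p. indicator \<Delta> p *\<^sub>R (case p of (t, s) \<Rightarrow> B t (U t s (z s)))) = BU_kernel z"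
    by (auto simp: BU_kernel_def fun_eq_iff split: split_indicator)
  finally show ?thesis unfolding lborel_prod .
qed

lemma BU_kernel_domain:
  assumes z: "half_supported z"
  shows "AE p in lborel \<Otimes>\<^sub>M lborel. 0 \<le> snd p \<and> snd p \<le> fst p \<longrightarrow> U (fst p) (snd p) (z (snd p)) \<in> D (fst p)"
proof -
  have "AE (t, s) in lebesgue_on \<Delta>. U t s (z s) \<in> D t"
    using BUf_defined half_supported_half_line[OF z] by blast
  then have "AE p in lborel. p \<in> \<Delta> \<longrightarrow> (case p of (t, s) \<Rightarrow> U t s (z s) \<in> D t)"
    by (simp add: AE_lebesgue_on_iff[OF Delta_borel])
  then show ?thesis unfolding lborel_prod by eventually_elim (auto simp: case_prod_beta)
qed

text \<open>
  Integrating over \<open>s\<close> first, the inner integral is at most \<open>M * norm (z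
  \<tau>)\<close> by \<open>BU_L1_bound\<close>.
\<close>
lemma BU_kernel_bound:
  assumes z: "half_supported z"
  shows "strongly_integrable (lborel \<Otimes>\<^sub>M lborel) (BU_kernel z)"
    "L1_seminorm (lborel \<Otimes>\<^sub>M lborel) (BU_kernel z) \<le> M * L1_seminorm lborel z"
proof -
  have Mz: "strongly_integrable lborel (\<lambda>\<tau>. M *\<^sub>R z \<tau>)"
    by (intro strongly_integrable_scale half_supported_integrable z)
  have inner: "(\<integral>\<^sup>+s. ennreal (norm (BU_kernel z (s, \<tau>))) \<partial>lborel) \<le> ennreal (norm (M *\<^sub>R z \<tau>))" for \<tau>
  proof (cases "0 \<le> \<tau>")
    case True
    have "BU_kernel z (s, \<tau>) = BU \<tau> (z \<tau>) s" for s using True by (simp add: BU_kernel_def BU_def)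
    then have "(\<integral>\<^sup>+s. ennreal (norm (BU_kernel z (s, \<tau>))) \<partial>lborel) = ennreal (L1_seminorm lborel (BU \<tau> (z \<tau>)))"
      using nn_integral_eq_L1_seminorm[OF BU_strongly_integrable[OF True]] by simp
    also have "\<dots> \<le> ennreal (norm (M *\<^sub>R z \<tau>))"
      using BU_L1_bound[OF True, of "z \<tau>"] M(1) by (intro ennreal_leI) simp
    finally show ?thesis .
  qed (simp add: BU_kernel_def)
  have "(\<integral>\<^sup>+p. ennreal (norm (BU_kernel z p)) \<partial>(lborel \<Otimes>\<^sub>M lborel)) = (\<integral>\<^sup>+\<tau>. (\<integral>\<^sup>+s. ennreal (norm (BU_kernel z (s, \<tau>))) \<partial>lborel) \<partial>lborel)"
    by (rule lborel_pair.nn_integral_norm_snd[OF BU_kernel_measurable[OF z], symmetric])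
  also have "\<dots> \<le> (\<integral>\<^sup>+\<tau>. ennreal (norm (M *\<^sub>R z \<tau>)) \<partial>lborel)" by (intro nn_integral_mono inner)
  also have "\<dots> = ennreal (L1_seminorm lborel (\<lambda>\<tau>. M *\<^sub>R z \<tau>))" by (rule nn_integral_eq_L1_seminorm[OF Mz])
  also have "L1_seminorm lborel (\<lambda>\<tau>. M *\<^sub>R z \<tau>) = M * L1_seminorm lborel z"
    using M(1) by (simp add: L1_seminorm_scale half_supported_integrable z)
  finally have le: "(\<integral>\<^sup>+p. ennreal (norm (BU_kernel z p)) \<partial>(lborel \<Otimes>\<^sub>M lborel)) \<le> ennreal (M * L1_seminorm lborel z)" .
  then show "strongly_integrable (lborel \<Otimes>\<^sub>M lborel) (BU_kernel z)"
    using BU_kernel_measurable[OF z] le_less_trans[OF le ennreal_less_top] by (simp add: strongly_integrable_def infinity_ennreal_def)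
  show "L1_seminorm (lborel \<Otimes>\<^sub>M lborel) (BU_kernel z) \<le> M * L1_seminorm lborel z"
    by (rule L1_seminorm_bound_nn[OF le mult_nonneg_nonneg[OF M(1) L1_seminorm_nonneg]])
qed

lemma B_zero: "0 \<le> s \<Longrightarrow> B s 0 = 0"
  using B_linear subspace_0 unfolding linear_operator_def by (metis scaleR_zero_left)

lemma BU_kernel_lincomb:
  assumes f: "half_supported f" and g: "half_supported g"
  shows "AE p in lborel \<Otimes>\<^sub>M lborel. BU_kernel (\<lambda>s. a *\<^sub>R f s + b *\<^sub>R g s) p = a *\<^sub>R BU_kernel f p + b *\<^sub>R BU_kernel g p"
  using BU_kernel_domain[OF f] BU_kernel_domain[OF g]
proof eventually_elim
  case (elim p)
  obtain s \<tau> where p: "p = (s, \<tau>)" by (cases p)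
  show ?case
  proof (cases "0 \<le> \<tau> \<and> \<tau> \<le> s")
    case True
    then have lin: "linear_operator (D s) (B s)" using B_linear by auto
    have D: "U s \<tau> (f \<tau>) \<in> D s" "U s \<tau> (g \<tau>) \<in> D s" using elim True p by auto
    then have "a *\<^sub>R U s \<tau> (f \<tau>) \<in> D s" "b *\<^sub>R U s \<tau> (g \<tau>) \<in> D s"
      using lin subspace_scale by (auto simp: linear_operator_def)
    then have "B s (a *\<^sub>R U s \<tau> (f \<tau>) + b *\<^sub>R U s \<tau> (g \<tau>)) = a *\<^sub>R B s (U s \<tau> (f \<tau>)) + b *\<^sub>R B s (U s \<tau> (g \<tau>))"
      using lin D by (simp add: linear_operator_def)
    then show ?thesis
      using True p U_bounded_linear[of \<tau> s] by (simp add: BU_kernel_def linear_simps)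
  qed (auto simp: p BU_kernel_def)
qed

definition damped_kernel :: "real \<Rightarrow> (real \<Rightarrow> 'a) \<Rightarrow> real \<times> real \<Rightarrow> 'a" where
  "damped_kernel l z p = exp (- l * (fst p - snd p)) *\<^sub>R BU_kernel z p"

text \<open>
  A representative of \<open>\<BB>\<^sub>l z\<close>.
\<close>
definition history :: "real \<Rightarrow> (real \<Rightarrow> 'a) \<Rightarrow> real \<Rightarrow> 'a" where
  "history l z s = strong_integral lborel (\<lambda>\<tau>. damped_kernel l z (s, \<tau>))"

lemma norm_damped_kernel_le:
  assumes l: "0 \<le> l"
  shows "norm (damped_kernel l z p) \<le> norm (BU_kernel z p)"
proof -
  have "exp (- l * (fst p - snd p)) * norm (BU_kernel z p) \<le> 1 * norm (BU_kernel z p)" if "snd p \<le> fst p"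
    using l that by (intro mult_right_mono) auto
  then show ?thesis
    by (cases "snd p \<le> fst p") (auto simp: damped_kernel_def BU_kernel_def case_prod_beta)
qed

lemma damped_kernel_integrable:
  assumes z: "half_supported z" and l: "0 \<le> l"
  shows "strongly_integrable (lborel \<Otimes>\<^sub>M lborel) (damped_kernel l z)"
    "L1_seminorm (lborel \<Otimes>\<^sub>M lborel) (damped_kernel l z) \<le> M * L1_seminorm lborel z"
proof -
  have m: "strongly_measurable (lborel \<Otimes>\<^sub>M lborel) (damped_kernel l z)"
    unfolding damped_kernel_def[abs_def]
    by (rule strongly_measurable_scale_fun[OF exp_plane_measurable BU_kernel_measurable[OF z]])
  have le: "AE p in lborel \<Otimes>\<^sub>M lborel. norm (damped_kernel l z p) \<le> norm (BU_kernel z p)"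
    by (intro AE_I2 norm_damped_kernel_le l)
  show "strongly_integrable (lborel \<Otimes>\<^sub>M lborel) (damped_kernel l z)"
    by (rule strongly_integrable_dominated[OF m BU_kernel_bound(1)[OF z] le])
  show "L1_seminorm (lborel \<Otimes>\<^sub>M lborel) (damped_kernel l z) \<le> M * L1_seminorm lborel z"
    using L1_seminorm_mono_AE[OF BU_kernel_bound(1)[OF z] le] BU_kernel_bound(2)[OF z] by simp
qed

lemma history_half_supported:
  assumes z: "half_supported z" and l: "0 \<le> l"
  shows "half_supported (history l z)"
    "L1_seminorm lborel (history l z) \<le> L1_seminorm (lborel \<Otimes>\<^sub>M lborel) (damped_kernel l z)"
proof -
  have "damped_kernel l z (s, \<tau>) = 0" if "s < 0" for s \<tau> using that by (auto simp: damped_kernel_def BU_kernel_def)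
  then have "history l z s = 0" if "s < 0" for s
    using that unfolding history_def by (simp add: strong_integral_zero)
  then show "half_supported (history l z)"
    using lborel_pair.strongly_integrable_iterated(2)[OF damped_kernel_integrable(1)[OF z l]]
    by (simp add: half_supported_def history_def[abs_def])
  show "L1_seminorm lborel (history l z) \<le> L1_seminorm (lborel \<Otimes>\<^sub>M lborel) (damped_kernel l z)"
    using lborel_pair.strongly_integrable_iterated(3)[OF damped_kernel_integrable(1)[OF z l]]
    by (simp add: history_def[abs_def])
qed

abbreviation BL :: "real \<Rightarrow> 'a L1 \<Rightarrow> 'a L1" where
  "BL \<equiv> B_lambda U B"

lemma BL_abs:
  assumes z: "half_supported z" and l: "0 \<le> l"
  shows "BL l (abs_L1 z) = abs_L1 (history l z)"
  unfolding B_lambda_def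
proof (rule abs_L1_cong)
  show "strongly_integrable half_line (history l z)"
    by (intro half_supported_half_line history_half_supported z l)
  have ae: "AE \<tau> in lborel. 0 \<le> \<tau> \<longrightarrow> rep_L1 (abs_L1 z) \<tau> = z \<tau>"
    using rep_abs_L1[OF half_supported_half_line[OF z]] by (simp add: half_line_AE_iff)
  have "strong_integral (lebesgue_on {0..s}) (\<lambda>\<tau>. exp (- l * (s - \<tau>)) *\<^sub>R B s (U s \<tau> (rep_L1 (abs_L1 z) \<tau>))) = history l z s" for s
  proof -
    have "AE \<tau> in lborel. indicator {0..s} \<tau> *\<^sub>R exp (- l * (s - \<tau>)) *\<^sub>R B s (U s \<tau> (rep_L1 (abs_L1 z) \<tau>)) = damped_kernel l z (s, \<tau>)"
      using ae by eventually_elim (auto simp: damped_kernel_def BU_kernel_def split: split_indicator)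
    then show ?thesis
      unfolding history_def by (subst strong_integral_lebesgue_on) (auto intro: strong_integral_cong_AE)
  qed
  then show "AE s in half_line. strong_integral (lebesgue_on {0..s}) (\<lambda>\<tau>. exp (- l * (s - \<tau>)) *\<^sub>R B s (U s \<tau> (rep_L1 (abs_L1 z) \<tau>))) = history l z s"
    by simp
qed

lemma history_lincomb:
  assumes f: "half_supported f" and g: "half_supported g" and l: "0 \<le> l"
  shows "AE s in lborel. history l (\<lambda>s. a *\<^sub>R f s + b *\<^sub>R g s) s = a *\<^sub>R history l f s + b *\<^sub>R history l g s"
  using lborel_pair.AE_pair[OF BU_kernel_lincomb[OF f g, of a b]]
    lborel_pair.strongly_integrable_iterated(1)[OF damped_kernel_integrable(1)[OF f l]]
    lborel_pair.strongly_integrable_iterated(1)[OF damped_kernel_integrable(1)[OF g l]]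
proof eventually_elim
  case (elim s)
  have "history l (\<lambda>s. a *\<^sub>R f s + b *\<^sub>R g s) s =
      strong_integral lborel (\<lambda>\<tau>. a *\<^sub>R damped_kernel l f (s, \<tau>) + b *\<^sub>R damped_kernel l g (s, \<tau>))"
    unfolding history_def using elim(1)
    by (intro strong_integral_cong_AE) (auto elim!: eventually_mono simp: damped_kernel_def scaleR_add_right mult.commute)
  also have "\<dots> = a *\<^sub>R history l f s + b *\<^sub>R history l g s"
    unfolding history_def using elim(2,3)
    by (simp add: strong_integral_add strong_integral_scaleR strongly_integrable_scale)
  finally show ?case .
qed

lemma BL_bound:
  assumes l: "0 \<le> l"
  shows "norm (BL l F) \<le> M * norm F" "bounded_linear (BL l)"
proof -
  have bd: "norm (BL l F) \<le> M * norm F" for F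
  proof -
    obtain z where z: "half_supported z" "F = abs_L1 z" by (rule L1_cases)
    have "norm (BL l F) = L1_seminorm lborel (history l z)"
      unfolding z(2) BL_abs[OF z(1) l] by (rule norm_abs_L1[OF history_half_supported(1)[OF z(1) l]])
    also have "\<dots> \<le> M * L1_seminorm lborel z"
      using history_half_supported(2)[OF z(1) l] damped_kernel_integrable(2)[OF z(1) l] by simp
    finally show ?thesis by (simp add: z norm_abs_L1)
  qed
  then show "norm (BL l F) \<le> M * norm F" .
  have comb: "BL l (a *\<^sub>R F + b *\<^sub>R G) = a *\<^sub>R BL l F + b *\<^sub>R BL l G" for a b F G
  proof -
    obtain f where f: "half_supported f" "F = abs_L1 f" by (rule L1_cases)
    obtain g where g: "half_supported g" "G = abs_L1 g" by (rule L1_cases)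
    let ?c = "\<lambda>s. a *\<^sub>R f s + b *\<^sub>R g s"
    have c: "half_supported ?c" using f g by (intro half_supported_add half_supported_scaleR)
    note h = history_half_supported(1)[OF f(1) l] history_half_supported(1)[OF g(1) l]
    have h2: "half_supported (\<lambda>s. a *\<^sub>R history l f s + b *\<^sub>R history l g s)"
      using h by (intro half_supported_add half_supported_scaleR)
    have "BL l (a *\<^sub>R F + b *\<^sub>R G) = BL l (abs_L1 ?c)"
      using f g by (simp add: abs_L1_scaleR abs_L1_add half_supported_scaleR)
    also have "\<dots> = abs_L1 (history l ?c)" by (rule BL_abs[OF c l])
    also have "\<dots> = abs_L1 (\<lambda>s. a *\<^sub>R history l f s + b *\<^sub>R history l g s)"
    proof (rule abs_L1_cong[OF _ half_supported_half_line[OF h2]])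
      show "AE s in half_line. history l ?c s = a *\<^sub>R history l f s + b *\<^sub>R history l g s"
        using history_lincomb[OF f(1) g(1) l, of a b] unfolding half_line_AE_iff by eventually_elim simp
    qed
    also have "\<dots> = a *\<^sub>R BL l F + b *\<^sub>R BL l G"
      unfolding f(2) g(2) BL_abs[OF f(1) l] BL_abs[OF g(1) l]
      using h by (simp add: abs_L1_scaleR abs_L1_add half_supported_scaleR)
    finally show ?thesis .
  qed
  show "bounded_linear (BL l)"
  proof (rule bounded_linear_intro[of _ M])
    show "BL l (F + G) = BL l F + BL l G" for F G using comb[of 1 F 1 G] by simp
    show "BL l (c *\<^sub>R F) = c *\<^sub>R BL l F" for c F using comb[of c F 0 0] by simp
    show "norm (BL l F) \<le> norm F * M" for F using bd[of F] by (simp add: mult.commute)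
  qed
qed

subsection \<open>The generator of the perturbed semigroup\<close>

text \<open>
  The Duhamel formula for \<open>V(s,\<tau>) z(\<tau>)\<close> is integrated over
  \<open>\<tau>\<close> and the two integrations are exchanged: integrating \<open>V(s,r) B(r)
  U(r,\<tau>) z(\<tau>)\<close> over \<open>\<tau>\<close> first gives \<open>V(s,r)\<close>
  applied to \<open>\<BB>\<^sub>0 z\<close>.
\<close>
lemma mild_Duhamel:
  assumes z: "sep_measurable borel z" "half_supported z" and y: "AE s in lborel. y s = history 0 z s"
  shows "pert.mild z s = free.mild z s + pert.mild y s"
proof -
  define H where "H = (\<lambda>p. if 0 \<le> fst p \<and> fst p \<le> s then V s (fst p) (BU_kernel z p) else 0)"
  obtain G where G: "sep_measurable (lborel \<Otimes>\<^sub>M lborel) G" "AE p in lborel \<Otimes>\<^sub>M lborel. BU_kernel z p = G p"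
    using BU_kernel_measurable[OF z(2)] strongly_measurable_iff_sep by blast
  have "fst \<in> borel_measurable (lborel \<Otimes>\<^sub>M lborel :: (real \<times> real) measure)"
    unfolding lborel_prod measurable_lborel2 by (rule borel_measurable_plane(1))
  from pert.W_apply_measurable[OF _ this G(1), of "\<lambda>p. s"]
  have "sep_measurable (lborel \<Otimes>\<^sub>M lborel) (\<lambda>p. if 0 \<le> fst p \<and> fst p \<le> s then V s (fst p) (G p) else 0)" by simp
  moreover have "AE p in lborel \<Otimes>\<^sub>M lborel. H p = (if 0 \<le> fst p \<and> fst p \<le> s then V s (fst p) (G p) else 0)"
    using G(2) by eventually_elim (simp add: H_def)
  ultimately have Hm: "strongly_measurable (lborel \<Otimes>\<^sub>M lborel) H" using strongly_measurable_iff_sep by blast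
  have "norm (H p) \<le> norm (M *\<^sub>R BU_kernel z p)" for p
    using V_bound[of "fst p" s "BU_kernel z p"] M(1) by (simp add: H_def)
  then have Hi: "strongly_integrable (lborel \<Otimes>\<^sub>M lborel) H"
    by (intro strongly_integrable_dominated[OF Hm strongly_integrable_scale[OF BU_kernel_bound(1)[OF z(2)]]] AE_I2)
  have "AE r in lborel. strong_integral lborel (\<lambda>\<tau>. H (r, \<tau>)) = pert.mild_integrand y s r"
    using lborel_pair.strongly_integrable_iterated(1)[OF BU_kernel_bound(1)[OF z(2)]] y
  proof eventually_elim
    case (elim r)
    have "y r = strong_integral lborel (\<lambda>\<tau>. BU_kernel z (r, \<tau>))"
      using elim(2) by (simp add: history_def damped_kernel_def)
    then show ?case
      using elim(1) strong_integral_bounded_linear[OF V_bounded_linear elim(1), of r s]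
      by (auto simp: H_def pert.mild_integrand_def strong_integral_zero)
  qed
  then have "strong_integral lborel (\<lambda>r. strong_integral lborel (\<lambda>\<tau>. H (r, \<tau>))) = pert.mild y s"
    unfolding pert.mild_def by (rule strong_integral_cong_AE)
  moreover have "strong_integral lborel (\<lambda>r. H (r, \<tau>)) = pert.mild_integrand z s \<tau> - free.mild_integrand z s \<tau>" for \<tau>
  proof (cases "0 \<le> \<tau> \<and> \<tau> \<le> s")
    case True
    then have "(\<lambda>r. H (r, \<tau>)) = (\<lambda>r. if \<tau> \<le> r \<and> r \<le> s then V s r (BU \<tau> (z \<tau>) r) else 0)"
      using linear_simps(3)[OF V_bounded_linear] by (auto simp: H_def BU_kernel_def BU_def fun_eq_iff)
    then show ?thesis
      using V_Duhamel(2)[of \<tau> s "z \<tau>"] True by (simp add: pert.mild_integrand_def free.mild_integrand_def)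
  next
    case False
    then have "(\<lambda>r. H (r, \<tau>)) = (\<lambda>r. 0)"
      using linear_simps(3)[OF V_bounded_linear] by (auto simp: H_def BU_kernel_def fun_eq_iff)
    then show ?thesis using False by (auto simp: pert.mild_integrand_def free.mild_integrand_def strong_integral_zero)
  qed
  then have "strong_integral lborel (\<lambda>\<tau>. strong_integral lborel (\<lambda>r. H (r, \<tau>))) = pert.mild z s - free.mild z s"
    using pert.mild_integrand_integrable[OF z] free.mild_integrand_integrable[OF z]
    by (simp add: pert.mild_def free.mild_def strong_integral_diff)
  ultimately have "pert.mild z s - free.mild z s = pert.mild y s"
    using lborel_pair.strong_integral_swap[OF Hi] by simp
  then show ?thesis by (simp add: diff_eq_eq add.commute)
qed

text \<open>
  With \<open>z\<close> representing \<open>Zf\<close> and \<open>y\<close> representing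
  \<open>\<BB>\<^sub>0 Zf\<close>, the formula \<open>f = - mild z\<close> for \<open>U\<close>
  reads \<open>f = - mild (z - y)\<close> for \<open>V\<close>.
\<close>
theorem perturbed_generator:
  assumes F: "F \<in> generator_domain free.S"
  shows "F \<in> generator_domain pert.S"
    "generator pert.S F = generator free.S F - BL 0 (generator free.S F)"
proof -
  let ?Z = "generator free.S F"
  obtain f where f: "sep_measurable borel f" "half_supported f" "F = abs_L1 f" by (rule L1_cases)
  obtain z where z: "sep_measurable borel z" "half_supported z" "?Z = abs_L1 z" by (rule L1_cases)
  obtain y where y: "sep_measurable borel y" "half_supported y" "BL 0 ?Z = abs_L1 y" by (rule L1_cases)
  have hz: "half_supported (history 0 z)" by (rule history_half_supported(1)[OF z(2) order_refl])
  have "abs_L1 y = abs_L1 (history 0 z)" using BL_abs[OF z(2) order_refl] y(3) z(3) by simp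
  then have "AE s in half_line. y s = history 0 z s"
    using abs_L1_eq_iff[OF half_supported_half_line[OF y(2)] half_supported_half_line[OF hz]] by simp
  then have ae: "AE s in lborel. y s = history 0 z s"
    unfolding half_line_AE_iff
  proof eventually_elim
    case (elim s)
    then show ?case using y(2) hz by (cases "0 \<le> s") (auto simp: half_supported_def)
  qed
  have "((\<lambda>h. (free.S h (abs_L1 f) - abs_L1 f) /\<^sub>R h) \<longlongrightarrow> abs_L1 z) (at_right 0)"
    using generator_tendsto[OF F] f(3) z(3) by simp
  from free.mild_if_generator[OF f(1,2) z(1,2) this]
  have "AE s in lborel. 0 \<le> s \<longrightarrow> f s = - pert.mild (\<lambda>s. z s - y s) s"
    by eventually_elim (simp add: mild_Duhamel[OF z(1,2) ae] pert.mild_diff[OF z(1,2) y(1,2)])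
  from pert.generator_if_mild[OF f(1,2) _ _ this]
  have lim: "((\<lambda>h. (pert.S h F - F) /\<^sub>R h) \<longlongrightarrow> ?Z - BL 0 ?Z) (at_right 0)"
    using z y f by (simp add: sep_measurable_diff half_supported_diff abs_L1_diff)
  from generator_eqI[where T=pert.S and x=F, OF lim]
  show "F \<in> generator_domain pert.S" "generator pert.S F = ?Z - BL 0 ?Z" by auto
qed

subsection \<open>Behaviour for large \<open>\<lambda>\<close>\<close>

definition near_kernel :: "real \<Rightarrow> (real \<Rightarrow> 'a) \<Rightarrow> real \<times> real \<Rightarrow> 'a" where
  "near_kernel d z p = (if fst p - snd p < d then BU_kernel z p else 0)"

lemma near_kernel_measurable:
  assumes "strongly_measurable (lborel \<Otimes>\<^sub>M lborel) f"
  shows "strongly_measurable (lborel \<Otimes>\<^sub>M lborel) (\<lambda>p. if fst p - snd p < (d::real) then f p else (0::'a))"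
proof -
  have "(\<lambda>p::real\<times>real. indicat_real {..<d} (fst p - snd p)) \<in> borel_measurable (lborel \<Otimes>\<^sub>M lborel)"
    unfolding lborel_prod measurable_lborel2
    using measurable_compose[OF borel_measurable_plane(3), of "indicat_real {..<d}" borel] by simp
  from strongly_measurable_scale_fun[OF this assms] show ?thesis
    by (rule back_subst[where P="strongly_measurable (lborel \<Otimes>\<^sub>M lborel)"]) (auto simp: fun_eq_iff)
qed

text \<open>
  The diagonal is a null set, so the kernel restricted to \<open>s - \<tau> < d\<close> tends to
  \<open>0\<close> almost everywhere as \<open>d\<close> decreases to \<open>0\<close>, with the
  kernel itself as majorant.
\<close>
lemma near_kernel_small:
  assumes z: "half_supported z" and e: "0 < e"
  obtains d where "0 < d" "\<And>d'. d' \<le> d \<Longrightarrow> L1_seminorm (lborel \<Otimes>\<^sub>M lborel) (near_kernel d' z) < e"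
proof -
  have m: "strongly_measurable (lborel \<Otimes>\<^sub>M lborel) (near_kernel d z)" for d
    unfolding near_kernel_def[abs_def] by (rule near_kernel_measurable[OF BU_kernel_measurable[OF z]])
  have "AE p in lborel \<Otimes>\<^sub>M lborel. fst p \<noteq> (snd p :: real)"
  proof (rule lborel_pair.AE_pair_measure)
    have "open {p :: real \<times> real. fst p \<noteq> snd p}" by (intro open_Collect_neq continuous_intros)
    then show "{p \<in> space (lborel \<Otimes>\<^sub>M lborel). fst p \<noteq> (snd p :: real)} \<in> sets (lborel \<Otimes>\<^sub>M lborel)"
      unfolding lborel_prod by simp
    have "AE y in lborel. x \<noteq> y" for x :: real
      using AE_lborel_singleton[of x] by (auto elim!: eventually_mono)
    then show "AE x in lborel. AE y in lborel. fst (x, y) \<noteq> (snd (x, y) :: real)" by simp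
  qed
  then have ae: "AE p in lborel \<Otimes>\<^sub>M lborel. (\<lambda>n. near_kernel (inverse (real (Suc n))) z p) \<longlonglongrightarrow> 0"
  proof eventually_elim
    case (elim p)
    show ?case
    proof (cases "snd p < fst p")
      case True
      then have "\<forall>\<^sub>F n in sequentially. inverse (real (Suc n)) < fst p - snd p"
        by (intro order_tendstoD(2)[OF LIMSEQ_inverse_real_of_nat]) simp
      then have "\<forall>\<^sub>F n in sequentially. 0 = near_kernel (inverse (real (Suc n))) z p"
        by eventually_elim (simp add: near_kernel_def)
      with tendsto_const show ?thesis by (rule Lim_transform_eventually)
    next
      case False
      then have "BU_kernel z p = 0" using elim by (simp add: BU_kernel_def case_prod_beta)
      then show ?thesis by (simp add: near_kernel_def cong: if_cong)
    qed
  qed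
  have "(\<lambda>n. L1_seminorm (lborel \<Otimes>\<^sub>M lborel) (\<lambda>p. near_kernel (inverse (real (Suc n))) z p - 0)) \<longlonglongrightarrow> 0"
    by (rule L1_seminorm_dominated_convergence(2)[where f="\<lambda>n. near_kernel (inverse (real (Suc n))) z",
          OF m BU_kernel_bound(1)[OF z] _ ae])
      (rule AE_I2, simp add: near_kernel_def)
  then have lim: "(\<lambda>n. L1_seminorm (lborel \<Otimes>\<^sub>M lborel) (near_kernel (inverse (real (Suc n))) z)) \<longlonglongrightarrow> 0" by simp
  obtain n where n: "L1_seminorm (lborel \<Otimes>\<^sub>M lborel) (near_kernel (inverse (real (Suc n))) z) < e"
    using eventually_happens[OF order_tendstoD(2)[OF lim e]] by auto
  have i: "strongly_integrable (lborel \<Otimes>\<^sub>M lborel) (near_kernel d z)" for d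
    by (rule strongly_integrable_dominated[OF m BU_kernel_bound(1)[OF z]], rule AE_I2) (simp add: near_kernel_def)
  have "L1_seminorm (lborel \<Otimes>\<^sub>M lborel) (near_kernel d' z) < e" if "d' \<le> inverse (real (Suc n))" for d'
  proof -
    have "L1_seminorm (lborel \<Otimes>\<^sub>M lborel) (near_kernel d' z) \<le> L1_seminorm (lborel \<Otimes>\<^sub>M lborel) (near_kernel (inverse (real (Suc n))) z)"
      by (rule L1_seminorm_mono_AE[OF i], rule AE_I2) (use that in \<open>simp add: near_kernel_def\<close>)
    with n show ?thesis by simp
  qed
  then show ?thesis using that[of "inverse (real (Suc n))"] by simp
qed

lemma near_kernel_integrable:
  assumes z: "half_supported z"
  shows "strongly_integrable (lborel \<Otimes>\<^sub>M lborel) (near_kernel d z)"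
proof (rule strongly_integrable_dominated[OF _ BU_kernel_bound(1)[OF z]])
  show "strongly_measurable (lborel \<Otimes>\<^sub>M lborel) (near_kernel d z)"
    unfolding near_kernel_def[abs_def] by (rule near_kernel_measurable[OF BU_kernel_measurable[OF z]])
qed (simp add: near_kernel_def)

text \<open>
  Near the diagonal the kernel is small uniformly in \<open>l\<close>; at distance at least
  \<open>d\<close> from it the weight is at most \<open>exp (- l * d)\<close>.
\<close>
lemma BL_tendsto_0: "((\<lambda>l. BL l F) \<longlongrightarrow> 0) at_top"
proof (rule tendstoI)
  fix e :: real assume e: "0 < e"
  obtain z where z: "half_supported z" "F = abs_L1 z" by (rule L1_cases)
  let ?N = "lborel \<Otimes>\<^sub>M lborel :: (real \<times> real) measure"
  have "0 < e / 2" using e by simp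
  then obtain d where d: "0 < d" "\<And>d'. d' \<le> d \<Longrightarrow> L1_seminorm ?N (near_kernel d' z) < e / 2"
    by (rule near_kernel_small[OF z(1)]) blast
  have le: "norm (BL l F) \<le> L1_seminorm ?N (near_kernel d z) + exp (- l * d) * L1_seminorm ?N (BU_kernel z)" if l: "0 \<le> l" for l
  proof -
    let ?a = "\<lambda>p. if fst p - snd p < d then damped_kernel l z p else 0"
    let ?b = "\<lambda>p. damped_kernel l z p - ?a p"
    have a: "strongly_integrable ?N ?a"
    proof (rule strongly_integrable_dominated[OF _ damped_kernel_integrable(1)[OF z(1) l]])
      show "strongly_measurable ?N ?a"
        by (intro near_kernel_measurable strongly_integrable_measurable damped_kernel_integrable z l)
    qed simp
    have b: "strongly_integrable ?N ?b" by (intro strongly_integrable_minus a damped_kernel_integrable z l)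
    have "norm (BL l F) = L1_seminorm lborel (history l z)"
      unfolding z(2) BL_abs[OF z(1) l] by (rule norm_abs_L1[OF history_half_supported(1)[OF z(1) l]])
    also have "\<dots> \<le> L1_seminorm ?N (damped_kernel l z)" by (rule history_half_supported(2)[OF z(1) l])
    also have "\<dots> = L1_seminorm ?N (\<lambda>p. ?a p + ?b p)" by simp
    also have "\<dots> \<le> L1_seminorm ?N ?a + L1_seminorm ?N ?b" by (rule L1_seminorm_triangle[OF a b])
    also have "L1_seminorm ?N ?a \<le> L1_seminorm ?N (near_kernel d z)"
      by (rule L1_seminorm_mono_AE[OF near_kernel_integrable[OF z(1)]], rule AE_I2)
        (use norm_damped_kernel_le[OF l] in \<open>simp add: near_kernel_def\<close>)
    also have "L1_seminorm ?N ?b \<le> L1_seminorm ?N (\<lambda>p. exp (- l * d) *\<^sub>R BU_kernel z p)"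
    proof (rule L1_seminorm_mono_AE[OF strongly_integrable_scale[OF BU_kernel_bound(1)[OF z(1)]]], rule AE_I2)
      fix p :: "real \<times> real"
      have "exp (- l * (fst p - snd p)) \<le> exp (- l * d)" if "\<not> fst p - snd p < d"
        using that l by (simp add: mult_left_mono)
      then show "norm (?b p) \<le> norm (exp (- l * d) *\<^sub>R BU_kernel z p)"
        by (auto simp: damped_kernel_def mult_right_mono)
    qed
    also have "\<dots> = exp (- l * d) * L1_seminorm ?N (BU_kernel z)"
      by (simp add: L1_seminorm_scale BU_kernel_bound z)
    finally show ?thesis by simp
  qed
  have "((\<lambda>l. exp (- l * d) * L1_seminorm ?N (BU_kernel z)) \<longlongrightarrow> 0 * L1_seminorm ?N (BU_kernel z)) at_top"
  proof (intro tendsto_intros)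
    have "filterlim (\<lambda>l. l * d) at_top at_top"
      by (rule filterlim_at_top_mult_tendsto_pos[OF tendsto_const d(1) filterlim_ident, THEN filterlim_cong[THEN iffD1, rotated 3]]) (simp_all add: mult.commute)
    then show "((\<lambda>l. exp (- l * d)) \<longlongrightarrow> 0) at_top"
      by (intro filterlim_compose[OF exp_at_bot]) (simp add: filterlim_uminus_at_bot)
  qed
  then have "\<forall>\<^sub>F l in at_top. exp (- l * d) * L1_seminorm ?N (BU_kernel z) < e / 2"
    using e by (intro order_tendstoD(2)) auto
  then show "\<forall>\<^sub>F l in at_top. dist (BL l F) 0 < e"
    using eventually_ge_at_top[of 0]
  proof eventually_elim
    case (elim l)
    then show ?case using le[of l] d(2)[of d] by simp
  qed
qed

text \<open>
  Substitution of \<open>\<tau> + h\<close> for \<open>\<tau>\<close>: the factor \<open>exp (- l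
  * h)\<close> restores the weight of the earlier time.
\<close>
lemma history_shift:
  assumes f: "sep_measurable borel f" "half_supported f" and h: "0 \<le> h"
  shows "exp (- l * h) *\<^sub>R history l (free.shift h f) s =
    strong_integral lborel (\<lambda>\<tau>. indicator {..s - h} \<tau> *\<^sub>R damped_kernel l f (s, \<tau>))"
    (is "_ = strong_integral lborel ?R")
proof -
  have eq: "damped_kernel l (free.shift h f) (s, h + 1 * \<tau>) = exp (l * h) *\<^sub>R ?R \<tau>" for \<tau>
  proof -
    have "BU_kernel (free.shift h f) (s, h + \<tau>) = indicator {..s - h} \<tau> *\<^sub>R BU_kernel f (s, \<tau>)"
    proof (cases "0 \<le> \<tau>")
      case True
      then show ?thesis using h U_compose[of \<tau> "h + \<tau>" s "f \<tau>"]
        by (auto simp: BU_kernel_def free.shift_def split: split_indicator)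
    next
      case False
      then have "U s (h + \<tau>) 0 = 0" if "0 \<le> h + \<tau>" "h + \<tau> \<le> s" using that free.W_zero by blast
      then show ?thesis using False h B_zero[of s] by (auto simp: BU_kernel_def free.shift_def)
    qed
    moreover have "exp (- l * (s - (h + \<tau>))) = exp (l * h) * exp (- l * (s - \<tau>))"
      by (simp add: exp_add[symmetric] algebra_simps)
    ultimately show ?thesis by (simp add: damped_kernel_def mult.commute)
  qed
  have "history l (free.shift h f) s = strong_integral lborel (\<lambda>\<tau>. damped_kernel l (free.shift h f) (s, h + 1 * \<tau>))"
    unfolding history_def by (rule strong_integral_lborel_isometry[symmetric]) simp
  also have "\<dots> = strong_integral lborel (\<lambda>\<tau>. exp (l * h) *\<^sub>R ?R \<tau>)" by (simp only: eq)
  also have "\<dots> = exp (l * h) *\<^sub>R strong_integral lborel ?R"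
  proof (cases "strongly_integrable lborel ?R")
    case False
    \<comment> \<open>Neither side is integrable then, and both integrals are \<open>0\<close> by default.\<close>
    have "inverse (exp (l * h)) *\<^sub>R (exp (l * h) *\<^sub>R x) = x" for x :: 'a by simp
    then have "\<not> strongly_integrable lborel (\<lambda>\<tau>. exp (l * h) *\<^sub>R ?R \<tau>)"
      using strongly_integrable_scale[of lborel "\<lambda>\<tau>. exp (l * h) *\<^sub>R ?R \<tau>" "inverse (exp (l * h))"] False
      by (auto simp only:)
    then show ?thesis using False by (simp add: strong_integral_def)
  qed (rule strong_integral_scaleR)
  finally show ?thesis by (simp add: exp_minus)
qed

text \<open>
  Shifting the datum by \<open>h\<close> removes from the kernel the part with \<open>s - \<tau> <
  h\<close>. On that part the weights \<open>exp (- l * (s - \<tau>))\<close> and \<open>1\<close>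
  differ by at most \<open>l * h\<close>, and the part itself is small for small \<open>h\<close>;
  the changes for \<open>l\<close> and for \<open>0\<close> therefore agree up to an error of
  smaller order than \<open>h\<close>.
\<close>
lemma BL_shift_estimate:
  assumes l: "0 \<le> l" and h: "0 \<le> h" and f: "sep_measurable borel f" "half_supported f"
  defines "F \<equiv> abs_L1 f"
  shows "norm (exp (- l * h) *\<^sub>R BL l (free.S h F) - BL l F - (BL 0 (free.S h F) - BL 0 F))
     \<le> l * h * L1_seminorm (lborel \<Otimes>\<^sub>M lborel) (near_kernel h f)"
proof -
  let ?N = "lborel \<Otimes>\<^sub>M lborel :: (real \<times> real) measure"
  let ?sh = "free.shift h f"
  note sh = free.shift_half_supported(1)[OF f h]
  note hl = history_half_supported(1)[OF sh l] history_half_supported(1)[OF f(2) l]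
    history_half_supported(1)[OF sh order_refl] history_half_supported(1)[OF f(2) order_refl]
  define E where "E = (\<lambda>s. exp (- l * h) *\<^sub>R history l ?sh s - history l f s - (history 0 ?sh s - history 0 f s))"
  have hE: "half_supported E"
    unfolding E_def using hl by (intro half_supported_diff half_supported_scaleR)
  have F: "exp (- l * h) *\<^sub>R BL l (free.S h F) - BL l F - (BL 0 (free.S h F) - BL 0 F) = abs_L1 E"
    unfolding F_def E_def free.S_abs[OF f h] BL_abs[OF sh l] BL_abs[OF f(2) l] BL_abs[OF sh order_refl] BL_abs[OF f(2) order_refl]
    using hl by (simp add: abs_L1_scaleR abs_L1_diff half_supported_scaleR half_supported_diff)
  define Q where "Q = (\<lambda>p. (if fst p - snd p < h then damped_kernel 0 f p else 0) - (if fst p - snd p < h then damped_kernel l f p else 0))"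
  have part: "strongly_integrable ?N (\<lambda>p. if fst p - snd p < h then damped_kernel l' f p else 0)" if "0 \<le> l'" for l'
  proof (rule strongly_integrable_dominated[OF _ damped_kernel_integrable(1)[OF f(2) that]])
    show "strongly_measurable ?N (\<lambda>p. if fst p - snd p < h then damped_kernel l' f p else 0)"
      by (intro near_kernel_measurable strongly_integrable_measurable damped_kernel_integrable f that)
  qed simp
  have Q: "strongly_integrable ?N Q"
    unfolding Q_def using l by (intro strongly_integrable_minus part) auto
  have trunc: "exp (- l' * h) *\<^sub>R history l' ?sh s - history l' f s = - strong_integral lborel (\<lambda>\<tau>. if s - \<tau> < h then damped_kernel l' f (s, \<tau>) else 0)"
    if i: "strongly_integrable lborel (\<lambda>\<tau>. damped_kernel l' f (s, \<tau>))" for l' s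
  proof -
    have 1: "strongly_integrable lborel (\<lambda>\<tau>. indicator {..s - h} \<tau> *\<^sub>R damped_kernel l' f (s, \<tau>))"
      by (intro strongly_integrable_indicator i) simp
    have "(\<lambda>\<tau>. if s - \<tau> < h then damped_kernel l' f (s, \<tau>) else 0) =
       (\<lambda>\<tau>. damped_kernel l' f (s, \<tau>) - indicator {..s - h} \<tau> *\<^sub>R damped_kernel l' f (s, \<tau>))"
      by (auto simp: fun_eq_iff split: split_indicator)
    then have "strong_integral lborel (\<lambda>\<tau>. if s - \<tau> < h then damped_kernel l' f (s, \<tau>) else 0) =
        history l' f s - exp (- l' * h) *\<^sub>R history l' ?sh s"
      using strong_integral_diff[OF i 1] history_shift[OF f h, of l' s] by (simp add: history_def)
    then show ?thesis by simp
  qed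
  have "AE s in lborel. E s = strong_integral lborel (\<lambda>\<tau>. Q (s, \<tau>))"
    using lborel_pair.strongly_integrable_iterated(1)[OF damped_kernel_integrable(1)[OF f(2) l]]
      lborel_pair.strongly_integrable_iterated(1)[OF damped_kernel_integrable(1)[OF f(2) order_refl]]
      lborel_pair.strongly_integrable_iterated(1)[OF part[OF l]]
      lborel_pair.strongly_integrable_iterated(1)[OF part[OF order_refl]]
  proof eventually_elim
    case (elim s)
    have "strong_integral lborel (\<lambda>\<tau>. Q (s, \<tau>)) =
        strong_integral lborel (\<lambda>\<tau>. if s - \<tau> < h then damped_kernel 0 f (s, \<tau>) else 0) -
        strong_integral lborel (\<lambda>\<tau>. if s - \<tau> < h then damped_kernel l f (s, \<tau>) else 0)"
      unfolding Q_def using elim(3,4) by (simp add: strong_integral_diff)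
    then show ?case using trunc[OF elim(1)] trunc[OF elim(2)] by (simp add: E_def)
  qed
  then have "L1_seminorm lborel E = L1_seminorm lborel (\<lambda>s. strong_integral lborel (\<lambda>\<tau>. Q (s, \<tau>)))"
    by (intro L1_seminorm_cong_AE) (auto elim!: eventually_mono)
  also have "\<dots> \<le> L1_seminorm ?N Q" by (rule lborel_pair.strongly_integrable_iterated(3)[OF Q])
  also have "\<dots> \<le> L1_seminorm ?N (\<lambda>p. (l * h) *\<^sub>R near_kernel h f p)"
  proof (rule L1_seminorm_mono_AE[OF strongly_integrable_scale[OF near_kernel_integrable[OF f(2)]]], rule AE_I2)
    fix p :: "real \<times> real"
    show "norm (Q p) \<le> norm ((l * h) *\<^sub>R near_kernel h f p)"
    proof (cases "0 \<le> snd p \<and> snd p \<le> fst p \<and> fst p - snd p < h")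
      case True
      let ?c = "l * (fst p - snd p)"
      have c: "0 \<le> ?c" "?c \<le> l * h" using True l by (auto intro: mult_left_mono)
      have "Q p = (1 - exp (- ?c)) *\<^sub>R BU_kernel f p" using True by (simp add: Q_def damped_kernel_def scaleR_diff_left)
      then have "norm (Q p) = \<bar>1 - exp (- ?c)\<bar> * norm (BU_kernel f p)" by simp
      also have "\<bar>1 - exp (- ?c)\<bar> \<le> l * h" using c exp_ge_add_one_self[of "- ?c"] by (simp add: abs_if)
      finally show ?thesis using True l h by (simp add: near_kernel_def mult_right_mono)
    next
      case False
      then have "Q p = 0" by (auto simp: Q_def damped_kernel_def BU_kernel_def case_prod_beta)
      then show ?thesis by simp
    qed
  qed
  also have "\<dots> = l * h * L1_seminorm ?N (near_kernel h f)"
    using l h by (simp add: L1_seminorm_scale near_kernel_integrable f)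
  finally show ?thesis unfolding F using norm_abs_L1[OF hE] by simp
qed

text \<open>
  The estimate is divided by \<open>h\<close>. On the domain of the generator the quotients for
  \<open>l\<close> and for \<open>0\<close> converge separately, to \<open>\<BB>\<^sub>l Zf - l
  \<BB>\<^sub>l f\<close> and to \<open>\<BB>\<^sub>0 Zf\<close>.
\<close>
theorem BL_on_domain:
  assumes F: "F \<in> generator_domain free.S" and l: "0 \<le> l"
  shows "l *\<^sub>R BL l F = BL l (generator free.S F) - BL 0 (generator free.S F)"
proof -
  let ?Z = "generator free.S F" and ?N = "lborel \<Otimes>\<^sub>M lborel :: (real \<times> real) measure"
  obtain f where f: "sep_measurable borel f" "half_supported f" "F = abs_L1 f" by (rule L1_cases)
  note gen = generator_tendsto[OF F]
  note lin = BL_bound(2)[OF l] BL_bound(2)[OF order_refl]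
  define E where "E = (\<lambda>h. (exp (- l * h) *\<^sub>R BL l (free.S h F) - BL l F - (BL 0 (free.S h F) - BL 0 F)) /\<^sub>R h)"
  have "(E \<longlongrightarrow> 0) (at_right 0)"
  proof (rule tendstoI)
    fix e :: real assume e: "0 < e"
    have "0 < e / (l + 1)" using e l by simp
    then obtain d where d: "0 < d" "\<And>d'. d' \<le> d \<Longrightarrow> L1_seminorm ?N (near_kernel d' f) < e / (l + 1)"
      by (rule near_kernel_small[OF f(2)]) blast
    have "dist (E h) 0 < e" if h: "0 < h" "h < d" for h
    proof -
      have hpos: "\<bar>inverse h\<bar> = inverse h" "0 \<le> inverse h" using h(1) by auto
      have "norm (E h) \<le> inverse h * (l * h * L1_seminorm ?N (near_kernel h f))"
        unfolding E_def norm_scaleR f(3) hpos(1)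
        by (rule mult_left_mono[OF BL_shift_estimate[OF l less_imp_le[OF h(1)] f(1,2)] hpos(2)])
      also have "\<dots> = l * L1_seminorm ?N (near_kernel h f)" using h by simp
      also have "\<dots> \<le> l * (e / (l + 1))" using d(2)[of h] h l by (intro mult_left_mono) auto
      also have "\<dots> < e" using e l by (simp add: field_simps)
      finally show ?thesis by simp
    qed
    then show "\<forall>\<^sub>F h in at_right 0. dist (E h) 0 < e" unfolding eventually_at_right_field using d(1) by blast
  qed
  moreover have "(E \<longlongrightarrow> exp (- l * 0) *\<^sub>R BL l ?Z + (- l) *\<^sub>R BL l F - BL 0 ?Z) (at_right 0)"
  proof -
    have "((\<lambda>h. exp (- l * h)) has_real_derivative - l) (at 0)" by (auto intro!: derivative_eq_intros)
    then have "((\<lambda>h. (exp (- l * h) - 1) / h) \<longlongrightarrow> - l) (at 0)" by (simp add: DERIV_def)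
    then have dexp: "((\<lambda>h. (exp (- l * h) - 1) / h) \<longlongrightarrow> - l) (at_right 0)"
      by (rule tendsto_within_subset) simp
    have "((\<lambda>h. exp (- l * h) *\<^sub>R BL l ((free.S h F - F) /\<^sub>R h) + ((exp (- l * h) - 1) / h) *\<^sub>R BL l F
        - BL 0 ((free.S h F - F) /\<^sub>R h)) \<longlongrightarrow> exp (- l * 0) *\<^sub>R BL l ?Z + (- l) *\<^sub>R BL l F - BL 0 ?Z) (at_right 0)"
      by (intro tendsto_intros bounded_linear.tendsto[OF lin(1)] bounded_linear.tendsto[OF lin(2)] gen dexp)
    moreover have "exp (- l * h) *\<^sub>R BL l ((free.S h F - F) /\<^sub>R h) + ((exp (- l * h) - 1) / h) *\<^sub>R BL l F
        - BL 0 ((free.S h F - F) /\<^sub>R h) = E h" for h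
      unfolding E_def linear_simps[OF lin(1)] linear_simps[OF lin(2)]
      by (simp add: scaleR_diff_right scaleR_diff_left divide_inverse mult.commute right_diff_distrib)
    ultimately show ?thesis by simp
  qed
  ultimately have "exp (- l * 0) *\<^sub>R BL l ?Z + (- l) *\<^sub>R BL l F - BL 0 ?Z = 0"
    using tendsto_unique[OF trivial_limit_at_right_real] by blast
  then show ?thesis by (simp add: algebra_simps)
qed

end

section \<open>Integrals of right derivatives\<close>

text \<open>
  The estimate with \<open>c + e\<close> in place of \<open>c\<close> holds from \<open>a\<close>
  up to some largest point \<open>s\<close>: continuity carries it into \<open>s\<close>, and the
  right derivative would carry it beyond any \<open>s < b\<close>.
\<close>
lemma right_derivative_bound:
  fixes g :: "real \<Rightarrow> 'b::real_normed_vector"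
  assumes ab: "a \<le> b" and cont: "continuous_on {a..b} g"
    and der: "\<And>x. a \<le> x \<Longrightarrow> x < b \<Longrightarrow> \<exists>D. ((\<lambda>h. (g (x + h) - g x) /\<^sub>R h) \<longlongrightarrow> D) (at_right 0) \<and> norm D \<le> c"
  shows "norm (g b - g a) \<le> c * (b - a)"
proof -
  have key: "norm (g b - g a) \<le> (c + e) * (b - a)" if e: "0 < e" for e
  proof -
    define P where "P = (\<lambda>x. norm (g x - g a) \<le> (c + e) * (x - a))"
    define E where "E = {x \<in> {a..b}. \<forall>y\<in>{a..x}. P y}"
    have aE: "a \<in> E" using ab by (auto simp: E_def P_def)
    have bdd: "bdd_above E" by (rule bdd_aboveI[of _ b]) (simp add: E_def)
    define s where "s = Sup E"
    have s: "a \<le> s" "s \<le> b"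
    proof -
      show "a \<le> s" unfolding s_def by (rule cSup_upper[OF aE bdd])
      show "s \<le> b" unfolding s_def by (rule cSup_least) (use aE in \<open>auto simp: E_def\<close>)
    qed
    have below: "P y" if y: "a \<le> y" "y < s" for y
    proof -
      have "E \<noteq> {}" using aE by blast
      then obtain x where "x \<in> E" "y < x" using less_cSup_iff[OF _ bdd, of y] y(2) unfolding s_def by blast
      then show ?thesis using y by (auto simp: E_def)
    qed
    have Ps: "P s"
    proof (cases "s = a")
      case False
      then have as: "a < s" using s by simp
      have "continuous_on {a..s} g" using cont by (rule continuous_on_subset) (use s in auto)
      then have "(g \<longlongrightarrow> g s) (at s within {a..s})" using s by (simp add: continuous_on_def)
      then have "((\<lambda>x. norm (g x - g a) - (c + e) * (x - a)) \<longlongrightarrow> norm (g s - g a) - (c + e) * (s - a)) (at s within {a..s})"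
        by (intro tendsto_intros)
      moreover have "\<forall>\<^sub>F x in at s within {a..s}. norm (g x - g a) - (c + e) * (x - a) \<le> 0"
        unfolding eventually_at_filter using below by (auto intro!: always_eventually simp: P_def)
      moreover have "at s within {a..s} \<noteq> bot"
        using as by (simp add: at_within_Icc_at_left)
      ultimately have "norm (g s - g a) - (c + e) * (s - a) \<le> 0" by (intro tendsto_upperbound)
      then show ?thesis by (simp add: P_def)
    qed (simp add: P_def)
    have "s = b"
    proof (rule ccontr)
      assume "s \<noteq> b"
      then have sb: "s < b" using s by simp
      obtain D where D: "((\<lambda>h. (g (s + h) - g s) /\<^sub>R h) \<longlongrightarrow> D) (at_right 0)" "norm D \<le> c"
        using der[OF s(1) sb] by blast
      have "((\<lambda>h. norm ((g (s + h) - g s) /\<^sub>R h)) \<longlongrightarrow> norm D) (at_right 0)" using D(1) by (rule tendsto_norm)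
      then have "\<forall>\<^sub>F h in at_right 0. norm ((g (s + h) - g s) /\<^sub>R h) < c + e"
        using D(2) e by (intro order_tendstoD(2)) auto
      then obtain d where d: "0 < d" "\<And>h. 0 < h \<Longrightarrow> h < d \<Longrightarrow> norm ((g (s + h) - g s) /\<^sub>R h) < c + e"
        unfolding eventually_at_right_field by auto
      define x where "x = s + min d (b - s) / 2"
      have x: "s < x" "x < s + d" "x \<le> b" using d(1) sb by (auto simp: x_def min_def field_simps)
      have "P y" if y: "s < y" "y \<le> x" for y
      proof -
        define h where "h = y - s"
        have h: "0 < h" "h < d" using y x by (auto simp: h_def)
        have i: "\<bar>inverse h\<bar> = inverse h" using h by simp
        have "inverse h * norm (g (s + h) - g s) < c + e"
          using d(2)[OF h] unfolding norm_scaleR i .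
        then have "norm (g (s + h) - g s) < (c + e) * h" using h by (simp add: field_simps)
        then have "norm (g y - g s) \<le> (c + e) * (y - s)" by (simp add: h_def)
        moreover have "norm (g y - g a) \<le> norm (g y - g s) + norm (g s - g a)"
          using norm_triangle_ineq[of "g y - g s" "g s - g a"] by simp
        moreover have "(c + e) * (y - s) + (c + e) * (s - a) = (c + e) * (y - a)" by (simp add: algebra_simps)
        ultimately show ?thesis using Ps unfolding P_def by linarith
      qed
      then have "P y" if "a \<le> y" "y \<le> x" for y
        using that below[of y] Ps by (cases "y < s"; cases "y = s") auto
      then have "x \<in> E" using x s by (auto simp: E_def)
      then show False using cSup_upper[OF _ bdd, of x] x(1) by (simp add: s_def)
    qed
    then show ?thesis using Ps by (simp add: P_def)
  qed
  show ?thesis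
  proof (cases "a = b")
    case False
    then have ba: "0 < b - a" using ab by simp
    show ?thesis
    proof (rule field_le_epsilon)
      fix e :: real assume "0 < e"
      then have "0 < e / (b - a)" using ba by simp
      from key[OF this] show "norm (g b - g a) \<le> c * (b - a) + e" using ba by (simp add: distrib_right)
    qed
  qed simp
qed

lemma simple_bochner_step:
  fixes c :: "'i \<Rightarrow> 'b::real_normed_vector"
  assumes "finite I" and "\<And>i. i \<in> I \<Longrightarrow> A i \<in> sets N" and "\<And>i. i \<in> I \<Longrightarrow> emeasure N (A i) < \<infinity>"
  shows "simple_bochner_integrable N (\<lambda>x. \<Sum>i\<in>I. indicator (A i) x *\<^sub>R c i) \<and>
    simple_bochner_integral N (\<lambda>x. \<Sum>i\<in>I. indicator (A i) x *\<^sub>R c i) = (\<Sum>i\<in>I. measure N (A i) *\<^sub>R c i)"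
  using assms
proof (induction I)
  case empty
  have "simple_bochner_integrable N (\<lambda>x. 0 :: 'b)" by (simp add: simple_bochner_integrable.simps)
  moreover have "simple_bochner_integral N (\<lambda>x. 0 :: 'b) = 0"
    by (auto simp: simple_bochner_integral_def intro!: sum.neutral)
  ultimately show ?case by simp
next
  case (insert i I)
  have A: "A i \<in> sets N" "emeasure N (A i) < \<infinity>" using insert.prems by auto
  have r: "simple_bochner_integrable N (indicat_real (A i))"
  proof (rule simple_bochner_integrable.intros)
    have "{y \<in> space N. indicat_real (A i) y \<noteq> 0} = A i"
      using sets.sets_into_space[OF A(1)] by (auto simp: indicator_def)
    then show "emeasure N {y \<in> space N. indicat_real (A i) y \<noteq> 0} \<noteq> \<infinity>" using A(2) by simp
  qed (use A(1) in auto)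
  have i1: "simple_bochner_integrable N (\<lambda>x. indicator (A i) x *\<^sub>R c i)"
    using simple_bochner_integrable_compose2[of "\<lambda>x y. x *\<^sub>R c i" N "indicat_real (A i)" "indicat_real (A i)"] r by simp
  have "linear (\<lambda>r. r *\<^sub>R c i)" by (rule bounded_linear.linear[OF bounded_linear_scaleR_left])
  from simple_bochner_integral_linear[OF this r]
  have i2: "simple_bochner_integral N (\<lambda>x. indicator (A i) x *\<^sub>R c i) = measure N (A i) *\<^sub>R c i"
    using A by (simp add: simple_bochner_integrable_eq_integral[OF r] Int_absorb2 sets.sets_into_space)
  have IH: "simple_bochner_integrable N (\<lambda>x. \<Sum>i\<in>I. indicator (A i) x *\<^sub>R c i)"
    "simple_bochner_integral N (\<lambda>x. \<Sum>i\<in>I. indicator (A i) x *\<^sub>R c i) = (\<Sum>i\<in>I. measure N (A i) *\<^sub>R c i)"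
    using insert by auto
  show ?case
    unfolding sum.insert[OF insert.hyps]
    using simple_bochner_integrable_compose2[of "(+)" N, OF add_0 i1 IH(1)] simple_bochner_integral_add[OF i1 IH(1)]
    by (simp only: i2 IH(2) simp_thms)
qed

text \<open>
  The values lie in a space that need not be complete, so the integral is found as the limit of
  Riemann sums. On each interval of the partition the mean value inequality is applied to \<open>g
  x - x *\<^sub>R F p\<close>, where \<open>p\<close> is the left end point; by uniform continuity
  its right derivative \<open>F x - F p\<close> is small.
\<close>
lemma has_strong_integral_right_derivative:
  fixes F g :: "real \<Rightarrow> 'b::real_normed_vector"
  assumes t: "0 \<le> t" and F: "continuous_on {0..t} F" and g: "continuous_on {0..t} g"
    and der: "\<And>x. 0 \<le> x \<Longrightarrow> x < t \<Longrightarrow> ((\<lambda>h. (g (x + h) - g x) /\<^sub>R h) \<longlongrightarrow> F x) (at_right 0)"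
  shows "has_strong_integral lborel (\<lambda>s. indicator {0..t} s *\<^sub>R F s) (g t - g 0)"
proof -
  let ?F = "\<lambda>s. indicator {0..t} s *\<^sub>R F s"
  have iT: "integrable lborel (indicat_real {0..t})" using t by (intro integrable_real_indicator) auto
  have "sep_measurable borel (\<lambda>s. if s \<in> {0..t} then F s else 0)"
    using F by (intro sep_measurable_continuous_on) auto
  also have "(\<lambda>s. if s \<in> {0..t} then F s else 0) = ?F" by (auto simp: fun_eq_iff)
  finally have m: "strongly_measurable lborel ?F" by (intro sep_imp_strongly_measurable) (simp add: sep_measurable_lborel)
  have "compact (F ` {0..t})" using F by (intro compact_continuous_image) auto
  then obtain K where K: "\<And>s. s \<in> {0..t} \<Longrightarrow> norm (F s) \<le> K"
    using compact_imp_bounded bounded_iff by (metis image_eqI)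
  have Fi: "strongly_integrable lborel ?F"
  proof (rule strongly_integrable_dominated[OF m integrable_real_strongly_integrable_scaleR(1)[OF iT, of K]], rule AE_I2)
    show "norm (?F s) \<le> norm (indicat_real {0..t} s *\<^sub>R K)" for s
      using K[of s] by (auto split: split_indicator intro: order_trans[OF _ abs_ge_self])
  qed
  have approx: "\<exists>\<phi>. simple_bochner_integrable lborel \<phi> \<and> L1_seminorm lborel (\<lambda>s. ?F s - \<phi> s) \<le> e * t \<and>
      norm (simple_bochner_integral lborel \<phi> - (g t - g 0)) \<le> e * t" if e: "0 < e" for e
  proof -
    have "uniformly_continuous_on {0..t} F" using F by (intro compact_uniformly_continuous) auto
    then obtain d where d: "0 < d" "\<And>x y. x \<in> {0..t} \<Longrightarrow> y \<in> {0..t} \<Longrightarrow> dist y x < d \<Longrightarrow> dist (F y) (F x) < e"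
      using e unfolding uniformly_continuous_on_def by metis
    obtain n :: nat where n: "t / d < real n" using reals_Archimedean2 by blast
    have n0: "0 < real n" using n t d(1) by (smt (verit) divide_nonneg_pos)
    define w where "w = t / real n"
    have w: "0 \<le> w" "w < d" "real n * w = t" using n t d(1) n0 by (auto simp: w_def field_simps)
    define p where "p = (\<lambda>i::nat. real i * w)"
    have p: "p (Suc i) = p i + w" "0 \<le> p i" for i using w(1) by (simp_all add: p_def algebra_simps)
    have pt: "p i \<le> t" if "i \<le> n" for i
      using that w by (metis mult_right_mono of_nat_le_iff p_def)
    define A where "A = (\<lambda>i. {p i..<p (Suc i)})"
    define \<phi> where "\<phi> = (\<lambda>s. \<Sum>i<n. indicator (A i) s *\<^sub>R F (p i))"
    have meas: "measure lborel (A i) = w" for i using w(1) by (simp add: A_def p)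
    have \<phi>: "simple_bochner_integrable lborel \<phi>" "simple_bochner_integral lborel \<phi> = (\<Sum>i<n. w *\<^sub>R F (p i))"
    proof -
      have "emeasure lborel (A i) < \<infinity>" for i using w(1) by (simp add: A_def p)
      then have "simple_bochner_integrable lborel \<phi> \<and>
          simple_bochner_integral lborel \<phi> = (\<Sum>i<n. measure lborel (A i) *\<^sub>R F (p i))"
        unfolding \<phi>_def by (intro simple_bochner_step) (auto simp: A_def)
      then show "simple_bochner_integrable lborel \<phi>" "simple_bochner_integral lborel \<phi> = (\<Sum>i<n. w *\<^sub>R F (p i))"
        by (simp_all only: meas)
    qed
    have close: "norm (F x - F (p i)) \<le> e" if "i < n" "p i \<le> x" "x \<le> p (Suc i)" for x i
    proof -
      have "p (Suc i) \<le> t" using that by (intro pt) simp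
      then have "x \<in> {0..t}" "p i \<in> {0..t}" using that p(2)[of i] by auto
      moreover have "dist x (p i) < d" using that p(1)[of i] w by (simp add: dist_real_def)
      ultimately show ?thesis using d(2) by (metis dist_norm less_imp_le)
    qed
    have "L1_seminorm lborel (\<lambda>s. ?F s - \<phi> s) \<le> L1_seminorm lborel (\<lambda>s. indicat_real {0..t} s *\<^sub>R e)"
    proof (rule L1_seminorm_mono_AE[OF integrable_real_strongly_integrable_scaleR(1)[OF iT]])
      have "AE s in lborel. s \<noteq> t" using AE_lborel_singleton[of t] by auto
      then show "AE s in lborel. norm (?F s - \<phi> s) \<le> norm (indicat_real {0..t} s *\<^sub>R e)"
      proof eventually_elim
        case (elim s)
        show ?case
        proof (cases "0 \<le> s \<and> s < t")
          case True
          then have w0: "0 < w" using w n0 by (cases "w = 0") auto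
          define i where "i = nat \<lfloor>s / w\<rfloor>"
          have "real i = of_int \<lfloor>s / w\<rfloor>" using True w0 by (simp add: i_def)
          then have "real i \<le> s / w" "s / w < real i + 1" by linarith+
          then have i: "p i \<le> s" "s < p (Suc i)" using w0 by (auto simp: p_def field_simps)
          have "p i < real n * w" using i(1) True w(3) by simp
          then have "i < n" using w0 by (simp add: p_def)
          have ind: "indicat_real (A j) s = (if j = i then 1 else 0)" for j
          proof (cases "j = i")
            case False
            then consider "Suc j \<le> i" | "Suc i \<le> j" by linarith
            then have "s \<notin> A j"
            proof cases
              case 1
              then have "real (Suc j) * w \<le> real i * w" using w(1) by (intro mult_right_mono) auto
              then show ?thesis using i by (auto simp: A_def p_def)
            next
              case 2
              then have "real (Suc i) * w \<le> real j * w" using w(1) by (intro mult_right_mono) auto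
              then show ?thesis using i by (auto simp: A_def p_def)
            qed
            then show ?thesis using False by simp
          qed (use i in \<open>simp add: A_def\<close>)
          have "\<phi> s = (\<Sum>j<n. if j = i then F (p j) else 0)"
            unfolding \<phi>_def ind by (intro sum.cong) auto
          also have "\<dots> = F (p i)" using \<open>i < n\<close> by simp
          finally show ?thesis using close[OF \<open>i < n\<close> i(1)] i(2) True e by simp
        next
          case False
          then have out: "s \<notin> {0..t}" using elim by auto
          have "s \<notin> A j" if "j < n" for j
            using out pt[of "Suc j"] p(2)[of j] that by (auto simp: A_def)
          then have "\<phi> s = 0" unfolding \<phi>_def by (intro sum.neutral) auto
          then show ?thesis using out by simp
        qed
      qed
    qed
    also have "\<dots> = e * t"
    proof -
      have "L1_seminorm lborel (\<lambda>s. indicat_real {0..t} s *\<^sub>R e)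
          = (LINT s|lborel. norm (indicat_real {0..t} s *\<^sub>R e))"
        by (intro L1_seminorm_sep sep_measurable_scaleR sep_measurable_const) simp
      then show ?thesis using e t by (simp add: mult.commute)
    qed
    finally have 1: "L1_seminorm lborel (\<lambda>s. ?F s - \<phi> s) \<le> e * t" .
    have step: "norm (w *\<^sub>R F (p i) - (g (p (Suc i)) - g (p i))) \<le> e * w" if i: "i < n" for i
    proof -
      define G where "G = (\<lambda>x. g x - x *\<^sub>R F (p i))"
      have sub: "{p i..p (Suc i)} \<subseteq> {0..t}" using pt[of "Suc i"] p(2)[of i] i by auto
      have "norm (G (p (Suc i)) - G (p i)) \<le> e * (p (Suc i) - p i)"
      proof (rule right_derivative_bound)
        show "p i \<le> p (Suc i)" using w(1) by (simp add: p)
        show "continuous_on {p i..p (Suc i)} G"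
          unfolding G_def by (intro continuous_intros continuous_on_subset[OF g sub])
        fix x assume x: "p i \<le> x" "x < p (Suc i)"
        have xt: "0 \<le> x" "x < t" using x sub p(2)[of i] pt[of "Suc i"] i by auto
        have "((\<lambda>h. (g (x + h) - g x) /\<^sub>R h - F (p i)) \<longlongrightarrow> F x - F (p i)) (at_right 0)"
          by (intro tendsto_intros der xt)
        moreover have "\<forall>\<^sub>F h in at_right 0. (g (x + h) - g x) /\<^sub>R h - F (p i) = (G (x + h) - G x) /\<^sub>R h"
          unfolding eventually_at_right_field
          by (intro exI[of _ 1]) (auto simp: G_def algebra_simps)
        ultimately have "((\<lambda>h. (G (x + h) - G x) /\<^sub>R h) \<longlongrightarrow> F x - F (p i)) (at_right 0)"
          by (rule Lim_transform_eventually)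
        then show "\<exists>D. ((\<lambda>h. (G (x + h) - G x) /\<^sub>R h) \<longlongrightarrow> D) (at_right 0) \<and> norm D \<le> e"
          using close[OF i x(1)] x(2) by (intro exI[of _ "F x - F (p i)"]) auto
      qed
      moreover have "G (p (Suc i)) - G (p i) = - (w *\<^sub>R F (p i) - (g (p (Suc i)) - g (p i)))"
        by (simp add: G_def p(1) algebra_simps)
      ultimately show ?thesis by (simp only: norm_minus_cancel p(1) add_diff_cancel_left')
    qed
    have "g t - g 0 = (\<Sum>i<n. g (p (Suc i)) - g (p i))"
      using w(3) sum_lessThan_telescope[of "\<lambda>i. g (p i)" n] by (simp add: p_def)
    then have "simple_bochner_integral lborel \<phi> - (g t - g 0) = (\<Sum>i<n. w *\<^sub>R F (p i) - (g (p (Suc i)) - g (p i)))"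
      by (simp only: \<phi>(2) sum_subtractf)
    then have "norm (simple_bochner_integral lborel \<phi> - (g t - g 0)) \<le> (\<Sum>i<n. e * w)"
      using sum_norm_le[of "{..<n}", OF step] by simp
    also have "\<dots> = e * t" using w(3) by (simp add: mult.left_commute)
    finally show ?thesis using 1 \<phi>(1) by blast
  qed
  have "\<forall>k::nat. \<exists>\<phi>. simple_bochner_integrable lborel \<phi> \<and> L1_seminorm lborel (\<lambda>s. ?F s - \<phi> s) \<le> inverse (real (Suc k)) * t \<and>
      norm (simple_bochner_integral lborel \<phi> - (g t - g 0)) \<le> inverse (real (Suc k)) * t"
    by (intro allI approx) simp
  from choice[OF this] obtain \<phi> where \<phi>: "\<And>k. simple_bochner_integrable lborel (\<phi> k)"
    "\<And>k. L1_seminorm lborel (\<lambda>s. ?F s - \<phi> k s) \<le> inverse (real (Suc k)) * t"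
    "\<And>k. norm (simple_bochner_integral lborel (\<phi> k) - (g t - g 0)) \<le> inverse (real (Suc k)) * t" by blast
  have z: "(\<lambda>k. inverse (real (Suc k)) * t) \<longlonglongrightarrow> 0"
    using tendsto_mult_right[OF LIMSEQ_inverse_real_of_nat, of t] by simp
  show ?thesis
  proof (rule has_strong_integralI[OF Fi \<phi>(1)])
    show "(\<lambda>k. L1_seminorm lborel (\<lambda>s. ?F s - \<phi> k s)) \<longlonglongrightarrow> 0"
      using \<phi>(2) L1_seminorm_nonneg
      by (intro tendsto_sandwich[OF _ _ tendsto_const z] always_eventually allI) blast+
    show "(\<lambda>k. simple_bochner_integral lborel (\<phi> k)) \<longlonglongrightarrow> g t - g 0"
      by (rule LIM_zero_cancel[OF Lim_null_comparison[OF always_eventually[OF allI[OF \<phi>(3)]] z]])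
  qed
qed

lemma tendsto_equibounded:
  fixes L :: "'x \<Rightarrow> 'b::real_normed_vector \<Rightarrow> 'c::real_normed_vector"
  assumes x: "(x \<longlongrightarrow> y) F" and L: "((\<lambda>p. L p y) \<longlongrightarrow> z) F"
    and lin: "\<forall>\<^sub>F p in F. bounded_linear (L p)" and bd: "\<forall>\<^sub>F p in F. \<forall>v. norm (L p v) \<le> C * norm v"
  shows "((\<lambda>p. L p (x p)) \<longlongrightarrow> z) F"
proof -
  have "((\<lambda>p. C * norm (x p - y)) \<longlongrightarrow> C * norm (y - y)) F" by (intro tendsto_intros x)
  then have z: "((\<lambda>p. C * norm (x p - y)) \<longlongrightarrow> 0) F" by simp
  have "\<forall>\<^sub>F p in F. norm (L p (x p) - L p y) \<le> C * norm (x p - y)"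
    using lin bd
  proof eventually_elim
    case (elim p)
    then show ?case using linear_simps(2)[OF elim(1), of "x p" y] by metis
  qed
  then have "((\<lambda>p. L p (x p) - L p y) \<longlongrightarrow> 0) F" using z by (rule Lim_null_comparison)
  from tendsto_add[OF this L] show ?thesis by simp
qed

context perturbed_evolution
begin

lemma free_S_domain:
  assumes F: "F \<in> generator_domain free.S" and s: "0 \<le> s"
  shows "free.S s F \<in> generator_domain free.S" "generator free.S (free.S s F) = free.S s (generator free.S F)"
proof -
  have "((\<lambda>h. free.S s ((free.S h F - F) /\<^sub>R h)) \<longlongrightarrow> free.S s (generator free.S F)) (at_right 0)"
    by (rule bounded_linear.tendsto[OF free.S_bounded_linear(1)[OF s] generator_tendsto[OF F]])
  moreover have "\<forall>\<^sub>F h in at_right 0. free.S s ((free.S h F - F) /\<^sub>R h) = (free.S h (free.S s F) - free.S s F) /\<^sub>R h"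
    unfolding eventually_at_right_field using s
    by (intro exI[of _ 1]) (auto simp: free.S_scaleR free.S_diff free.S_compose add.commute)
  ultimately have "((\<lambda>h. (free.S h (free.S s F) - free.S s F) /\<^sub>R h) \<longlongrightarrow> free.S s (generator free.S F)) (at_right 0)"
    by (rule Lim_transform_eventually)
  from generator_eqI[where T=free.S and x="free.S s F", OF this]
  show "free.S s F \<in> generator_domain free.S" "generator free.S (free.S s F) = free.S s (generator free.S F)" by auto
qed

text \<open>
  The function \<open>g s = - T(t - s) T\<^sub>0(s) f\<close> runs from \<open>- T(t) f\<close> to
  \<open>- T\<^sub>0(t) f\<close>. With \<open>w = T\<^sub>0(s) f\<close> its difference quotient
  is \<open>T(t - s - h)\<close> applied to the difference of the quotients \<open>(T(h) w - w) /
  h\<close> and \<open>(T\<^sub>0(h) w - w) / h\<close>, which converges to \<open>Gw - Zw\<close>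
  because \<open>w\<close> lies in both domains.
\<close>
theorem Duhamel:
  assumes F: "F \<in> generator_domain free.S" and t: "0 \<le> t"
  defines "\<Phi> \<equiv> \<lambda>s. pert.S (t - s) (- BL 0 (generator free.S (free.S s F)))"
  shows "has_strong_integral lborel (\<lambda>s. indicator {0..t} s *\<^sub>R \<Phi> s) (pert.S t F - free.S t F)"
proof -
  let ?Z = "generator free.S F"
  note lin0 = BL_bound(2)[OF order_refl]
  have cont: "continuous_on {0..t} (\<lambda>s. pert.S (t - s) (x s))" if x: "continuous_on {0..t} x" for x
    unfolding continuous_on_def
  proof
    fix s assume s: "s \<in> {0..t}"
    have "continuous_on {0..t} (\<lambda>r. pert.S (t - r) (x s))"
      by (rule continuous_on_compose2[OF pert.S_continuous_on]) (auto intro!: continuous_intros)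
    then have L: "((\<lambda>r. pert.S (t - r) (x s)) \<longlongrightarrow> pert.S (t - s) (x s)) (at s within {0..t})"
      using s by (simp add: continuous_on_def)
    have ev: "\<forall>\<^sub>F r in at s within {0..t}. r \<in> {0..t}" unfolding eventually_at_filter by (intro always_eventually) simp
    show "((\<lambda>s. pert.S (t - s) (x s)) \<longlongrightarrow> pert.S (t - s) (x s)) (at s within {0..t})"
    proof (rule tendsto_equibounded[where L="\<lambda>r. pert.S (t - r)" and x=x, OF _ L])
      show "(x \<longlongrightarrow> x s) (at s within {0..t})" using x s by (simp add: continuous_on_def)
      show "\<forall>\<^sub>F r in at s within {0..t}. bounded_linear (pert.S (t - r))"
        using ev by eventually_elim (simp add: pert.S_bounded_linear)
      show "\<forall>\<^sub>F r in at s within {0..t}. \<forall>v. norm (pert.S (t - r) v) \<le> M * norm v"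
        using ev by eventually_elim (simp add: pert.S_bounded_linear)
    qed
  qed
  have free_cont: "continuous_on {0..t} (\<lambda>s. free.S s G)" for G
    using free.S_continuous_on by (rule continuous_on_subset) auto
  have \<Phi>: "continuous_on {0..t} \<Phi>"
  proof -
    have "continuous_on {0..t} (\<lambda>s. - BL 0 (free.S s ?Z))"
      by (intro continuous_on_minus bounded_linear.continuous_on[OF lin0] free_cont)
    from cont[OF this] show ?thesis
      unfolding \<Phi>_def by (rule continuous_on_cong[THEN iffD1, rotated 2]) (auto simp: free_S_domain[OF F])
  qed
  define g where "g = (\<lambda>s. - pert.S (t - s) (free.S s F))"
  have g: "continuous_on {0..t} g" unfolding g_def by (intro continuous_on_minus cont free_cont)
  have "((\<lambda>h. (g (s + h) - g s) /\<^sub>R h) \<longlongrightarrow> \<Phi> s) (at_right 0)" if s: "0 \<le> s" "s < t" for s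
  proof -
    let ?G = "free.S s F"
    have G: "?G \<in> generator_domain free.S" by (rule free_S_domain[OF F s(1)])
    note pG = perturbed_generator[OF G]
    have q: "((\<lambda>h. (pert.S h ?G - ?G) /\<^sub>R h - (free.S h ?G - ?G) /\<^sub>R h) \<longlongrightarrow> - BL 0 (generator free.S ?G)) (at_right 0)"
      using tendsto_diff[OF generator_tendsto[OF pG(1)] generator_tendsto[OF G]] pG(2) by simp
    have ev: "\<forall>\<^sub>F h in at_right 0. 0 < h \<and> h < t - s"
      unfolding eventually_at_right_field using s by (intro exI[of _ "t - s"]) auto
    have L: "((\<lambda>h. pert.S (t - s - h) (- BL 0 (generator free.S ?G))) \<longlongrightarrow> pert.S (t - s - 0) (- BL 0 (generator free.S ?G))) (at_right 0)"
    proof -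
      have "continuous_on {0..t - s} (\<lambda>h. pert.S (t - s - h) (- BL 0 (generator free.S ?G)))"
        by (rule continuous_on_compose2[OF pert.S_continuous_on]) (auto intro!: continuous_intros)
      then have "((\<lambda>h. pert.S (t - s - h) (- BL 0 (generator free.S ?G))) \<longlongrightarrow> pert.S (t - s - 0) (- BL 0 (generator free.S ?G))) (at 0 within {0..t - s})"
        using s unfolding continuous_on_def by fastforce
      then show ?thesis using s by (simp add: at_within_Icc_at_right)
    qed
    have "((\<lambda>h. pert.S (t - s - h) ((pert.S h ?G - ?G) /\<^sub>R h - (free.S h ?G - ?G) /\<^sub>R h)) \<longlongrightarrow> \<Phi> s) (at_right 0)"
    proof (rule tendsto_equibounded[where L="\<lambda>h. pert.S (t - s - h)", OF q])
      show "((\<lambda>h. pert.S (t - s - h) (- BL 0 (generator free.S ?G))) \<longlongrightarrow> \<Phi> s) (at_right 0)"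
        using L by (simp add: \<Phi>_def)
      show "\<forall>\<^sub>F h in at_right 0. bounded_linear (pert.S (t - s - h))"
        using ev by eventually_elim (simp add: pert.S_bounded_linear)
      show "\<forall>\<^sub>F h in at_right 0. \<forall>v. norm (pert.S (t - s - h) v) \<le> M * norm v"
        using ev by eventually_elim (simp add: pert.S_bounded_linear)
    qed
    moreover have "\<forall>\<^sub>F h in at_right 0. pert.S (t - s - h) ((pert.S h ?G - ?G) /\<^sub>R h - (free.S h ?G - ?G) /\<^sub>R h) = (g (s + h) - g s) /\<^sub>R h"
      using ev
    proof eventually_elim
      case (elim h)
      then have h: "0 \<le> h" "0 \<le> t - s - h" by auto
      have split: "pert.S (t - s - h) ((pert.S h ?G - ?G) /\<^sub>R h - (free.S h ?G - ?G) /\<^sub>R h) =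
          (pert.S (t - s - h) (pert.S h ?G) - pert.S (t - s - h) (free.S h ?G)) /\<^sub>R h"
        using h by (simp add: pert.S_diff pert.S_scaleR scaleR_diff_right)
      have "pert.S (t - s - h) (pert.S h ?G) = pert.S (t - s) ?G" using h by (simp add: pert.S_compose)
      moreover have "free.S h ?G = free.S (s + h) F" using h s by (simp add: free.S_compose add.commute)
      ultimately show ?case unfolding split by (simp add: g_def diff_diff_eq)
    qed
    ultimately show ?thesis by (rule Lim_transform_eventually)
  qed
  from has_strong_integral_right_derivative[OF t \<Phi> g this]
  show ?thesis by (simp add: g_def pert.S_zero free.S_zero)
qed

section \<open>Positivity\<close>

lemma abs_L1_in_cone_iff:
  fixes g :: "real \<Rightarrow> 'a"
  assumes "half_supported g"
  shows "abs_L1 g \<in> L1_cone \<longleftrightarrow> (AE s in lborel. 0 \<le> s \<longrightarrow> 0 \<le> g s)"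
proof -
  have "AE s in half_line. rep_L1 (abs_L1 g) s = g s" by (rule rep_abs_L1[OF half_supported_half_line[OF assms]])
  then have "(AE s in half_line. 0 \<le> rep_L1 (abs_L1 g) s) \<longleftrightarrow> (AE s in half_line. 0 \<le> g s)"
    by (intro iffI; elim AE_mp) auto
  then show ?thesis by (simp add: L1_cone_def half_line_AE_iff)
qed

lemma L1_cone_cases:
  assumes "F \<in> (L1_cone :: 'a L1 set)"
  obtains g where "sep_measurable borel g" "half_supported g" "\<And>s. 0 \<le> g s" "F = abs_L1 g"
proof -
  obtain f where f: "sep_measurable borel f" "half_supported f" "F = abs_L1 f" by (rule L1_cases)
  have pos: "AE s in lborel. 0 \<le> s \<longrightarrow> 0 \<le> f s" using assms f(3) abs_L1_in_cone_iff[OF f(2)] by simp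
  define g where "g = (\<lambda>s. if 0 \<le> f s then f s else 0)"
  have "{u::'a. 0 \<le> u} \<in> sets borel" using cone_closed by (rule borel_closed)
  from measurable_sets[OF sep_measurable_borel[OF f(1)] this]
  have "Measurable.pred borel (\<lambda>s. 0 \<le> f s)" by (simp add: pred_def vimage_def)
  then have gm: "sep_measurable borel g" unfolding g_def by (rule sep_measurable_If[OF _ f(1)])
  have ae: "AE s in lborel. f s = g s"
    using pos
  proof eventually_elim
    case (elim s)
    then show ?case using f(2) by (cases "0 \<le> s") (auto simp: g_def half_supported_def)
  qed
  have g: "half_supported g"
    using f(2) strongly_integrable_cong_AE[OF ae] by (simp add: half_supported_def g_def)
  have "AE s in half_line. f s = g s" unfolding half_line_AE_iff using ae by eventually_elim simp
  then have "F = abs_L1 g" unfolding f(3) by (rule abs_L1_cong[OF _ half_supported_half_line[OF g]])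
  with gm g show ?thesis by (intro that[of g]) (auto simp: g_def)
qed

text \<open>
  The integral of the distance of \<open>f s\<close> to the cone is at most the distance of
  \<open>f\<close> to any element of the cone of \<open>L\<^sup>1\<close>.
\<close>
lemma closed_L1_cone: "closed (L1_cone :: 'a L1 set)"
  unfolding closed_sequential_limits
proof (intro allI impI, elim conjE)
  fix x :: "nat \<Rightarrow> 'a L1" and F assume x: "\<forall>n. x n \<in> L1_cone" "x \<longlonglongrightarrow> F"
  define P where "P = {u::'a. 0 \<le> u}"
  have P: "P \<noteq> {}" "closed P" using cone_closed by (auto simp: P_def)
  obtain f where f: "sep_measurable borel f" "half_supported f" "F = abs_L1 f" by (rule L1_cases)
  let ?d = "\<lambda>s. infdist (f s) P"
  have dle: "?d s \<le> norm (f s - u)" if "0 \<le> u" for s u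
    using infdist_le[of u P "f s"] that by (simp add: P_def dist_norm)
  have "sep_measurable borel ?d"
    by (intro sep_measurable_continuous_compose[OF f(1)] continuous_intros)
  then have dm: "strongly_measurable lborel ?d" by (intro sep_imp_strongly_measurable) (simp add: sep_measurable_lborel)
  have di: "strongly_integrable lborel ?d"
    by (rule strongly_integrable_dominated[OF dm half_supported_integrable[OF f(2)]], rule AE_I2)
      (use dle[of 0] in \<open>simp add: infdist_nonneg\<close>)
  have "L1_seminorm lborel ?d \<le> norm (F - x n)" for n
  proof -
    have "x n \<in> L1_cone" using x(1) by simp
    then obtain g where g: "sep_measurable borel g" "half_supported g" "\<And>s. 0 \<le> g s" "x n = abs_L1 g"
      by (rule L1_cone_cases) blast
    have d: "half_supported (\<lambda>s. f s - g s)" by (rule half_supported_diff[OF f(2) g(2)])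
    have "L1_seminorm lborel ?d \<le> L1_seminorm lborel (\<lambda>s. f s - g s)"
      by (rule L1_seminorm_mono_AE[OF half_supported_integrable[OF d]], rule AE_I2)
        (use dle[OF g(3)] in \<open>simp add: infdist_nonneg\<close>)
    also have "\<dots> = norm (F - x n)" using f g d by (simp add: abs_L1_diff norm_abs_L1)
    finally show ?thesis .
  qed
  moreover have "(\<lambda>n. norm (F - x n)) \<longlonglongrightarrow> norm (F - F)" by (intro tendsto_intros x(2))
  ultimately have "L1_seminorm lborel ?d \<le> norm (F - F)"
    by (intro LIMSEQ_le_const[of "\<lambda>n. norm (F - x n)"]) auto
  then have "L1_seminorm lborel ?d = 0" using L1_seminorm_nonneg[of lborel ?d] by simp
  from L1_seminorm_eq_0[OF di this] have "AE s in lborel. 0 \<le> s \<longrightarrow> 0 \<le> f s"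
  proof eventually_elim
    case (elim s)
    then have "f s \<in> P" using in_closed_iff_infdist_zero[OF P(2,1)] by blast
    then show ?case by (simp add: P_def)
  qed
  then show "F \<in> L1_cone" using f abs_L1_in_cone_iff[OF f(2)] by simp
qed

lemma BL_nonneg:
  assumes F: "F \<in> L1_cone" and l: "0 \<le> l"
  shows "BL l F \<in> L1_cone"
proof -
  obtain z where z: "sep_measurable borel z" "half_supported z" "\<And>s. 0 \<le> z s" "F = abs_L1 z"
    using F by (rule L1_cone_cases) blast
  have "AE p in lborel \<Otimes>\<^sub>M lborel. 0 \<le> damped_kernel l z p"
    using BU_kernel_domain[OF z(2)]
  proof eventually_elim
    case (elim p)
    then show ?case
      using z(3) U_pos B_pos by (auto simp: damped_kernel_def BU_kernel_def case_prod_beta intro!: scaleR_nonneg_nonneg)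
  qed
  from lborel_pair.AE_pair[OF this] lborel_pair.strongly_integrable_iterated(1)[OF damped_kernel_integrable(1)[OF z(2) l]]
  have "AE s in lborel. 0 \<le> s \<longrightarrow> 0 \<le> history l z s"
    unfolding history_def
  proof eventually_elim
    case (elim s)
    then show ?case using strong_integral_nonneg[OF cone_closed elim(2,1)] by simp
  qed
  then show ?thesis
    unfolding z(4) BL_abs[OF z(2) l] using abs_L1_in_cone_iff[OF history_half_supported(1)[OF z(2) l]] by simp
qed

lemma pert_S_cone:
  assumes F: "F \<in> L1_cone" and t: "0 \<le> t"
  shows "pert.S t F \<in> L1_cone" "norm (pert.S t F) \<le> norm F"
proof -
  obtain g where g: "sep_measurable borel g" "half_supported g" "\<And>s. 0 \<le> g s" "F = abs_L1 g"
    using F by (rule L1_cone_cases) blast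
  note sh = pert.shift_half_supported(1)[OF g(1,2) t]
  have "0 \<le> pert.shift t g s" for s using V_nonneg[of "s - t" s] g(3) t by (simp add: pert.shift_def)
  then show "pert.S t F \<in> L1_cone"
    unfolding g(4) pert.S_abs[OF g(1,2) t] using abs_L1_in_cone_iff[OF sh] by simp
  have "norm (pert.shift t g s) \<le> norm (g (s - t))" for s
    using V_contr[of "s - t" s] g(3) t by (simp add: pert.shift_def)
  then have "L1_seminorm lborel (pert.shift t g) \<le> L1_seminorm lborel (\<lambda>s. g (s - t))"
    by (intro L1_seminorm_mono_AE pert.shift_translate g AE_I2)
  then show "norm (pert.S t F) \<le> norm F"
    unfolding g(4) pert.S_abs[OF g(1,2) t]
    using sh g(2) by (simp add: norm_abs_L1 pert.shift_translate)
qed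

subsection \<open>The norm functional\<close>

definition norm_functional :: "'a \<Rightarrow> real" where
  "norm_functional w = (THE r. \<exists>u v. 0 \<le> u \<and> 0 \<le> v \<and> w = u - v \<and> r = norm u - norm v)"

text \<open>
  If \<open>u - v = u' - v'\<close> then \<open>u + v' = u' + v\<close>, and additivity of the
  norm on the cone shows that \<open>norm u - norm v\<close> does not depend on the decomposition.
\<close>
lemma norm_functional_diff:
  assumes "0 \<le> u" "0 \<le> v"
  shows "norm_functional (u - v) = norm u - norm v"
  unfolding norm_functional_def
proof (rule the_equality)
  show "\<exists>u' v'. 0 \<le> u' \<and> 0 \<le> v' \<and> u - v = u' - v' \<and> norm u - norm v = norm u' - norm v'" using assms by blast
  fix r assume "\<exists>u' v'. 0 \<le> u' \<and> 0 \<le> v' \<and> u - v = u' - v' \<and> r = norm u' - norm v'"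
  then obtain u' v' where uv: "0 \<le> u'" "0 \<le> v'" "u - v = u' - v'" "r = norm u' - norm v'" by blast
  then have "u + v' = u' + v" by (simp add: algebra_simps)
  then have "norm u + norm v' = norm u' + norm v" using norm_additive assms uv by metis
  then show "r = norm u - norm v" using uv(4) by simp
qed

lemma norm_functional_pos: "0 \<le> u \<Longrightarrow> norm_functional u = norm u"
  using norm_functional_diff[of u 0] by simp

lemma norm_functional_bounded_linear: "bounded_linear norm_functional" and norm_functional_le: "norm (norm_functional w) \<le> norm w"
proof -
  have le: "norm (norm_functional w) \<le> norm w" for w
  proof -
    obtain u v where uv: "0 \<le> u" "0 \<le> v" "w = u - v" by (rule cone_split)
    show ?thesis unfolding uv(3) norm_functional_diff[OF uv(1,2)] using norm_triangle_ineq3[of u v] by simp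
  qed
  then show "norm (norm_functional w) \<le> norm w" .
  have add: "norm_functional (w + w') = norm_functional w + norm_functional w'" for w w'
  proof -
    obtain u v where uv: "0 \<le> u" "0 \<le> v" "w = u - v" by (rule cone_split)
    obtain u' v' where uv': "0 \<le> u'" "0 \<le> v'" "w' = u' - v'" by (rule cone_split)
    have "norm_functional (w + w') = norm_functional ((u + u') - (v + v'))" by (simp add: uv(3) uv'(3) algebra_simps)
    also have "\<dots> = norm (u + u') - norm (v + v')" using uv uv' by (intro norm_functional_diff) auto
    also have "\<dots> = norm_functional w + norm_functional w'"
      using norm_additive uv(1,2) uv'(1,2) by (simp add: uv(3) uv'(3) norm_functional_diff)
    finally show ?thesis .
  qed
  have pos: "norm_functional (c *\<^sub>R w) = c * norm_functional w" if c: "0 \<le> c" for c w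
  proof -
    obtain u v where uv: "0 \<le> u" "0 \<le> v" "w = u - v" by (rule cone_split)
    have "norm_functional (c *\<^sub>R w) = norm_functional (c *\<^sub>R u - c *\<^sub>R v)" by (simp add: uv(3) scaleR_diff_right)
    also have "\<dots> = norm (c *\<^sub>R u) - norm (c *\<^sub>R v)" using uv c by (intro norm_functional_diff scaleR_nonneg_nonneg)
    also have "\<dots> = c * norm_functional w" using c by (simp add: uv(3) norm_functional_diff[OF uv(1,2)] right_diff_distrib)
    finally show ?thesis .
  qed
  have minus: "norm_functional (- w) = - norm_functional w" for w using add[of w "- w"] norm_functional_pos[of 0] by simp
  show "bounded_linear norm_functional"
  proof (rule bounded_linear_intro[of _ 1])
    show "norm_functional (c *\<^sub>R w) = c *\<^sub>R norm_functional w" for c w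
      using pos[of c w] pos[of "- c" w] minus[of "- c *\<^sub>R w"] by (cases "0 \<le> c") auto
  qed (use add le in auto)
qed

definition L1_norm_functional :: "'a L1 \<Rightarrow> real" where
  "L1_norm_functional F = strong_integral lborel (\<lambda>s. norm_functional (indicator {0..} s *\<^sub>R rep_L1 F s))"

lemma L1_norm_functional_abs:
  assumes g: "half_supported g"
  shows "L1_norm_functional (abs_L1 g) = strong_integral lborel (\<lambda>s. norm_functional (g s))"
proof -
  have "AE s in lborel. 0 \<le> s \<longrightarrow> rep_L1 (abs_L1 g) s = g s"
    using rep_abs_L1[OF half_supported_half_line[OF g]] by (simp add: half_line_AE_iff)
  then have "AE s in lborel. norm_functional (indicator {0..} s *\<^sub>R rep_L1 (abs_L1 g) s) = norm_functional (g s)"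
  proof eventually_elim
    case (elim s)
    then show ?case using g by (cases "0 \<le> s") (auto simp: half_supported_def)
  qed
  then show ?thesis unfolding L1_norm_functional_def by (rule strong_integral_cong_AE)
qed

lemma norm_functional_integrable: "half_supported g \<Longrightarrow> strongly_integrable lborel (\<lambda>s. norm_functional (g s))"
  by (intro strongly_integrable_bounded_linear[OF norm_functional_bounded_linear] half_supported_integrable)

lemma L1_norm_functional_bounded_linear: "bounded_linear L1_norm_functional"
proof (rule bounded_linear_intro[of _ 1])
  fix F G :: "'a L1" and c :: real
  obtain f where f: "half_supported f" "F = abs_L1 f" by (rule L1_cases)
  obtain g where g: "half_supported g" "G = abs_L1 g" by (rule L1_cases)
  show "L1_norm_functional (F + G) = L1_norm_functional F + L1_norm_functional G"
    using f g norm_functional_integrable half_supported_add[OF f(1) g(1)]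
    by (simp add: abs_L1_add L1_norm_functional_abs linear_simps(1)[OF norm_functional_bounded_linear] strong_integral_add)
  show "L1_norm_functional (c *\<^sub>R F) = c *\<^sub>R L1_norm_functional F"
    using f norm_functional_integrable[OF f(1)] half_supported_scaleR[OF f(1), of c] strong_integral_scaleR[of lborel "\<lambda>s. norm_functional (f s)" c]
    by (simp add: abs_L1_scaleR L1_norm_functional_abs linear_simps(5)[OF norm_functional_bounded_linear])
  have "norm (L1_norm_functional F) \<le> L1_seminorm lborel (\<lambda>s. norm_functional (f s))"
    unfolding f(2) L1_norm_functional_abs[OF f(1)] by (rule norm_strong_integral_le[OF norm_functional_integrable[OF f(1)]])
  also have "\<dots> \<le> L1_seminorm lborel f"
    by (rule L1_seminorm_mono_AE[OF half_supported_integrable[OF f(1)]], rule AE_I2, rule norm_functional_le)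
  finally show "norm (L1_norm_functional F) \<le> norm F * 1" using f by (simp add: norm_abs_L1)
qed

lemma L1_norm_functional_cone:
  assumes F: "F \<in> L1_cone"
  shows "L1_norm_functional F = norm F"
proof -
  obtain g where g: "sep_measurable borel g" "half_supported g" "\<And>s. 0 \<le> g s" "F = abs_L1 g"
    using F by (rule L1_cone_cases) blast
  have m: "sep_measurable lborel g" using g(1) by (simp add: sep_measurable_lborel)
  have i: "integrable lborel (\<lambda>s. norm (g s))"
    using half_supported_integrable[OF g(2)] sep_measurable_norm[OF m]
    by (simp add: integrable_iff_bounded strongly_integrable_def)
  have "L1_norm_functional F = strong_integral lborel (\<lambda>s. norm (g s))" unfolding g(4) L1_norm_functional_abs[OF g(2)] by (simp add: norm_functional_pos g(3))
  also have "\<dots> = (LINT s|lborel. norm (g s))" by (rule strong_integral_eq_lebesgue_integral[OF i])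
  also have "\<dots> = norm F" unfolding g(4) norm_abs_L1[OF g(2)] by (rule L1_seminorm_sep[OF m, symmetric])
  finally show ?thesis .
qed

text \<open>
  Two such functionals agree on the cone, hence on functions with one value, since that value
  splits along the cone; these span a dense subspace.
\<close>
lemma functional_unique:
  assumes P: "bounded_linear P" "\<forall>F\<in>L1_cone. P F = norm F" and Q: "bounded_linear Q" "\<forall>F\<in>L1_cone. Q F = norm F"
  shows "P F = Q (F :: 'a L1)"
proof -
  interpret D: bounded_linear "\<lambda>F. P F - Q F" by (rule bounded_linear_sub[OF P(1) Q(1)])
  obtain K where K: "0 < K" "\<And>x. norm (P x - Q x) \<le> norm x * K" using D.pos_bounded by blast
  have "P F - Q F = 0"
  proof (rule L1_dense_induct[of "\<lambda>F. P F - Q F = 0"])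
    fix A :: "real set" and x :: 'a
    assume A: "A \<in> sets borel" "A \<subseteq> {0..}" "emeasure lborel A < \<infinity>"
    obtain u v where uv: "0 \<le> u" "0 \<le> v" "x = u - v" by (rule cone_split)
    note hs = half_supported_indicator_scaleR[OF A]
    have cone: "abs_L1 (\<lambda>s. indicator A s *\<^sub>R y) \<in> L1_cone" if "0 \<le> y" for y :: 'a
      using abs_L1_in_cone_iff[OF hs[of y]] that by (simp add: indicator_def)
    have "abs_L1 (\<lambda>s. indicator A s *\<^sub>R x) = abs_L1 (\<lambda>s. indicator A s *\<^sub>R u) - abs_L1 (\<lambda>s. indicator A s *\<^sub>R v)"
      unfolding abs_L1_diff[OF hs hs] by (simp add: uv(3) scaleR_diff_right)
    then show "P (abs_L1 (\<lambda>s. indicator A s *\<^sub>R x)) - Q (abs_L1 (\<lambda>s. indicator A s *\<^sub>R x)) = 0"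
      using D.diff[of "abs_L1 (\<lambda>s. indicator A s *\<^sub>R u)" "abs_L1 (\<lambda>s. indicator A s *\<^sub>R v)"]
        cone[OF uv(1)] cone[OF uv(2)] P(2) Q(2) by simp
  next
    fix f g assume "P f - Q f = 0" "P g - Q g = 0"
    then show "P (f + g) - Q (f + g) = 0" using D.add[of f g] by simp
  next
    fix f assume *: "\<And>e. 0 < e \<Longrightarrow> \<exists>g. P g - Q g = 0 \<and> norm (f - g) < e"
    have "norm (P f - Q f) \<le> 0 + e" if e: "0 < e" for e
    proof -
      have "0 < e / K" using e K(1) by simp
      then obtain g where g: "P g - Q g = 0" "norm (f - g) < e / K" using * by blast
      have "norm (P f - Q f) = norm (P (f - g) - Q (f - g))" using D.diff[of f g] g(1) by simp
      also have "\<dots> \<le> norm (f - g) * K" by (rule K(2))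
      also have "\<dots> \<le> e" using g(2) K(1) by (simp add: field_simps)
      finally show ?thesis by simp
    qed
    then have "norm (P f - Q f) \<le> 0" by (rule field_le_epsilon)
    then show "P f - Q f = 0" by simp
  qed
  then show ?thesis by simp
qed

lemma L1_functional_eq: "(L1_functional :: 'a L1 \<Rightarrow> real) = L1_norm_functional"
  unfolding L1_functional_def
proof (rule the_equality)
  show "bounded_linear L1_norm_functional \<and> (\<forall>f\<in>L1_cone. L1_norm_functional f = norm f)" using L1_norm_functional_bounded_linear L1_norm_functional_cone by blast
  show "P = L1_norm_functional" if "bounded_linear P \<and> (\<forall>f\<in>L1_cone. P f = norm f)" for P
    using functional_unique[of P L1_norm_functional] that L1_norm_functional_bounded_linear L1_norm_functional_cone by blast
qed

text \<open>
  On the cone the functional is the norm, so it is at most \<open>0\<close> on the difference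
  quotients of the perturbed semigroup, which preserves the cone and is contractive on it.
\<close>
lemma functional_generator_le:
  assumes F: "F \<in> generator_domain pert.S" "F \<in> L1_cone"
  shows "L1_functional (generator pert.S F) \<le> 0"
proof -
  have lim: "((\<lambda>h. L1_norm_functional ((pert.S h F - F) /\<^sub>R h)) \<longlongrightarrow> L1_norm_functional (generator pert.S F)) (at_right 0)"
    by (rule bounded_linear.tendsto[OF L1_norm_functional_bounded_linear generator_tendsto[OF F(1)]])
  have "\<forall>\<^sub>F h in at_right 0. L1_norm_functional ((pert.S h F - F) /\<^sub>R h) \<le> 0"
    unfolding eventually_at_right_field
  proof (intro exI[of _ 1] conjI allI impI)
    fix h :: real assume h: "0 < h"
    have "L1_norm_functional (pert.S h F - F) = norm (pert.S h F) - norm F"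
      using h pert_S_cone(1)[OF F(2)] F(2) by (simp add: linear_simps(2)[OF L1_norm_functional_bounded_linear] L1_norm_functional_cone)
    then show "L1_norm_functional ((pert.S h F - F) /\<^sub>R h) \<le> 0"
      using h pert_S_cone(2)[OF F(2), of h] by (simp add: linear_simps(5)[OF L1_norm_functional_bounded_linear] mult_nonneg_nonpos)
  qed simp
  then show ?thesis unfolding L1_functional_eq using lim by (intro tendsto_upperbound) auto
qed

lemma large_lambda_limit:
  assumes F: "F \<in> generator_domain free.S"
  shows "((\<lambda>l. l *\<^sub>R BL l F) \<longlongrightarrow> - BL 0 (generator free.S F)) at_top"
proof -
  have "((\<lambda>l. BL l (generator free.S F) - BL 0 (generator free.S F)) \<longlongrightarrow> 0 - BL 0 (generator free.S F)) at_top"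
    by (intro tendsto_intros BL_tendsto_0)
  then have "((\<lambda>l. BL l (generator free.S F) - BL 0 (generator free.S F)) \<longlongrightarrow> - BL 0 (generator free.S F)) at_top" by simp
  moreover have "\<forall>\<^sub>F l in at_top. BL l (generator free.S F) - BL 0 (generator free.S F) = l *\<^sub>R BL l F"
    using eventually_ge_at_top[of 0] by eventually_elim (simp add: BL_on_domain[OF F])
  ultimately show ?thesis by (rule Lim_transform_eventually)
qed

lemma perturbation_nonneg:
  assumes F: "F \<in> generator_domain free.S" "F \<in> L1_cone"
  shows "- BL 0 (generator free.S F) \<in> L1_cone"
proof (rule Lim_in_closed_set[OF closed_L1_cone _ _ large_lambda_limit[OF F(1)]])
  show "\<forall>\<^sub>F l in at_top. l *\<^sub>R BL l F \<in> L1_cone"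
    using eventually_ge_at_top[of 0]
  proof eventually_elim
    case (elim l)
    have "BL l F \<in> L1_cone" by (rule BL_nonneg[OF F(2) elim])
    then obtain g where g: "sep_measurable borel g" "half_supported g" "\<And>s. 0 \<le> g s" "BL l F = abs_L1 g"
      by (rule L1_cone_cases) blast
    then show ?case
      using elim abs_L1_in_cone_iff[OF half_supported_scaleR[OF g(2), of l]]
      by (simp add: abs_L1_scaleR scaleR_nonneg_nonneg)
  qed
qed simp

end

theorem theorem3p5:
  fixes U :: "real \<Rightarrow> real \<Rightarrow> 'a \<Rightarrow> 'a::{banach, ordered_real_vector}"
    and D :: "real \<Rightarrow> 'a set"
    and B :: "real \<Rightarrow> 'a \<Rightarrow> 'a"
  assumes cone_closed: "closed {u::'a. 0 \<le> u}"
    and cone_generating: "\<forall>w::'a. \<exists>u v. 0 \<le> u \<and> 0 \<le> v \<and> w = u - v"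
    and norm_additive: "\<forall>u v::'a. 0 \<le> u \<longrightarrow> 0 \<le> v \<longrightarrow> norm (u + v) = norm u + norm v"
    and U_evolution: "evolution_family U"
    and B_linear: "\<forall>t\<ge>0. linear_operator (D t) (B t)"
    and U_pos: "\<forall>t s u. 0 \<le> s \<longrightarrow> s \<le> t \<longrightarrow> 0 \<le> u \<longrightarrow> 0 \<le> U t s u"
    and U_contr: "\<forall>t s u. 0 \<le> s \<longrightarrow> s \<le> t \<longrightarrow> 0 \<le> u \<longrightarrow> norm (U t s u) \<le> norm u"
    and B_pos: "\<forall>t\<ge>0. \<forall>u\<in>D t. 0 \<le> u \<longrightarrow> 0 \<le> B t u"
    and BU_defined: "\<forall>s\<ge>0. \<forall>u. AE t in lebesgue_on {s..}. U t s u \<in> D t"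
    and BU_measurable: "\<forall>s\<ge>0. \<forall>u. strongly_measurable (lebesgue_on {s..}) (\<lambda>t. B t (U t s u))"
    and BU_bound: "\<forall>t s u. 0 \<le> s \<longrightarrow> s \<le> t \<longrightarrow> 0 \<le> u \<longrightarrow>
       (\<integral>\<^sup>+\<tau>. ennreal (norm (B \<tau> (U \<tau> s u))) \<partial>(lebesgue_on {s..t}))
         \<le> ennreal (norm u - norm (U t s u))"
    and BUf_defined: "\<forall>f. strongly_integrable half_line f \<longrightarrow>
       (AE (t, s) in lebesgue_on {(t, s). 0 \<le> s \<and> s \<le> t}. U t s (f s) \<in> D t)"
    and BUf_measurable: "\<forall>f. strongly_integrable half_line f \<longrightarrow>
       strongly_measurable (lebesgue_on {(t, s). 0 \<le> s \<and> s \<le> t}) (\<lambda>(t, s). B t (U t s (f s)))"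
  shows
    "let T0 = evolution_semigroup U;
         T = evolution_semigroup (perturbed_family U B);
         Z = generator T0; DZ = generator_domain T0;
         G = generator T; DG = generator_domain T;
         Bhat = (\<lambda>f. G f - Z f)
     in DZ \<subseteq> DG \<and>
        relatively_bounded DZ Z Bhat \<and>
        (\<forall>f\<in>DZ. ((\<lambda>l. l *\<^sub>R B_lambda U B l f) \<longlongrightarrow> Bhat f) at_top) \<and>
        (\<forall>f\<in>DZ \<inter> L1_cone. Bhat f \<in> L1_cone) \<and>
        (\<forall>f\<in>DZ \<inter> L1_cone. L1_functional (Z f + Bhat f) \<le> 0) \<and>
        (\<forall>f\<in>DZ. \<forall>t\<ge>0.
           strongly_integrable (lebesgue_on {0..t}) (\<lambda>s. T (t - s) (Bhat (T0 s f))) \<and>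
           T t f = T0 t f + strong_integral (lebesgue_on {0..t}) (\<lambda>s. T (t - s) (Bhat (T0 s f))))"
proof -
  interpret perturbed_evolution U D B by (rule perturbed_evolution.intro) fact+
  let ?Z = "generator free.S" and ?G = "generator pert.S"
  have Bhat: "?G f - ?Z f = - BL 0 (?Z f)" if "f \<in> generator_domain free.S" for f
    using perturbed_generator(2)[OF that] by simp
  have 1: "generator_domain free.S \<subseteq> generator_domain pert.S" using perturbed_generator(1) by blast
  have 2: "relatively_bounded (generator_domain free.S) ?Z (\<lambda>f. ?G f - ?Z f)"
    unfolding relatively_bounded_def
    using BL_bound(1)[OF order_refl] M(1) by (intro exI[of _ 0] exI[of _ M] conjI ballI) (auto simp: Bhat)
  have 3: "((\<lambda>l. l *\<^sub>R BL l f) \<longlongrightarrow> ?G f - ?Z f) at_top" if "f \<in> generator_domain free.S" for f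
    using large_lambda_limit[OF that] Bhat[OF that] by simp
  have 4: "?G f - ?Z f \<in> L1_cone" if "f \<in> generator_domain free.S" "f \<in> L1_cone" for f
    using perturbation_nonneg[OF that] Bhat[OF that(1)] by simp
  have 5: "L1_functional (?Z f + (?G f - ?Z f)) \<le> 0" if "f \<in> generator_domain free.S" "f \<in> L1_cone" for f
    using functional_generator_le[of f] 1 that by auto
  have 6: "strongly_integrable (lebesgue_on {0..t}) (\<lambda>s. pert.S (t - s) (?G (free.S s f) - ?Z (free.S s f))) \<and>
      pert.S t f = free.S t f + strong_integral (lebesgue_on {0..t}) (\<lambda>s. pert.S (t - s) (?G (free.S s f) - ?Z (free.S s f)))"
    if f: "f \<in> generator_domain free.S" and t: "0 \<le> t" for f t
  proof -
    have eq: "indicator {0..t} s *\<^sub>R pert.S (t - s) (- BL 0 (?Z (free.S s f))) =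
        indicator {0..t} s *\<^sub>R pert.S (t - s) (?G (free.S s f) - ?Z (free.S s f))" for s
      using Bhat[OF free_S_domain(1)[OF f]] by (auto split: split_indicator)
    have "has_strong_integral (lebesgue_on {0..t}) (\<lambda>s. pert.S (t - s) (?G (free.S s f) - ?Z (free.S s f))) (pert.S t f - free.S t f)"
      using Duhamel[OF f t] unfolding eq by (intro has_strong_integral_lebesgue_on) simp
    then show ?thesis using strong_integral_eqI by (fastforce simp: has_strong_integral_def)
  qed
  show ?thesis unfolding Let_def using 1 2 3 4 5 6 by blast
qed

end
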